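(* Let $\alpha\ge\gamma$, $y\in\mathbb T^N$ and $\mathbf b=(b_1,\dots,b_M)\in\mathbb R^M$. Then $\mathbf b\in F_\alpha(y)$ if and only if $$\mathbb E_i\left[\int_0^\tau L_{\omega(s)}(y+\mathcal I(\Xi)(s),-\Xi(s))+\alpha\,ds-b_i+b_{\omega(\tau)}\right]\ge0$$ for every $i\in\{1,\dots,M\}$, every bounded stopping time $\tau$ and every $\tau$-cycle $\Xi$.
   Context: **System.** $\mathbb T^N=\mathbb R^N/\mathbb Z^N$ is the flat torus; $+,-$ also denote its group operations, and points of $\mathbb R^N$ are identified with their projections on $\mathbb T^N$ where needed. For $i\in\{1,\dots,M\}$, $H_i:\mathbb T^N\times\mathbb R^N\to\mathbb R$, $(x,p)\mapsto H_i(x,p)$, is continuous in both variables, convex in $p$ and superlinear in $p$. The Lagrangians are $L_i(x,q)=\max_{p\in\mathbb R^N}(p\cdot q-H_i(x,p))$. $\Lambda=(\Lambda_{ij})$ is an $M\times M$ real matrix with rows $\Lambda^1,\dots,\Lambda^M$ such that every non-diagonal entry is nonpositive, every row sums to $0$, and $\Lambda$ is irreducible (for every nonempty $I\subsetneq\{1,\dots,M\}$ there are $i\in I$, $j\notin I$ with $\Lambda_{ij}\neq0$). For $\alpha\in\mathbb R$, (HJ$\alpha$) is the system $H_i(x,Du_i)+\Lambda^i\cdot\mathbf u=\alpha$ on $\mathbb T^N$, $i=1,\dots,M$. A continuous $\mathbf u=(u_1,\dots,u_M):\mathbb T^N\to\mathbb R^M$ is a subsolution (resp. supersolution) of (HJ$\alpha$)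 if $H_i(x,D\psi(x))+\Lambda^i\cdot\mathbf u(x)\le\alpha$ (resp. $\ge\alpha$) for every $x\in\mathbb T^N$, $i$, and $\psi\in C^1(\mathbb T^N)$ such that $u_i-\psi$ attains a maximum (resp. minimum) at $x$; a solution is both. The critical value is $\gamma=\inf\{\alpha\in\mathbb R : \text{(HJ}\alpha)\text{ admits subsolutions}\}$. For $\alpha\ge\gamma$ and $x\in\mathbb T^N$, $F_\alpha(x)=\{\mathbf b\in\mathbb R^M : \text{there is a subsolution } \mathbf u \text{ of (HJ}\alpha)\text{ with }\mathbf u(x)=\mathbf b\}$. **Random setting.** $\mathcal D$ is the space of cadlag paths $\omega:[0,+\infty)\to\{1,\dots,M\}$; $\mathcal F$ is the $\sigma$-algebra generated by the evaluations $\omega\mapsto\omega(s)$, $s\ge0$, and $\mathcal F_t$ the one generated by those with $s\le t$. $\mathcal S\subset\mathbb R^M$ is the simplex of probability vectors (regarded as row vectors). For $\mathbf a\in\mathcal S$, $\mathbb P_{\mathbf a}$ is the unique probability measure on $(\mathcal D,\mathcal F)$ with $$\mathbb P_{\mathbf a}(\omega(t_1)=j_1,\dots,\omega(t_k)=j_k)=(\mathbf a e^{-t_1\Lambda})_{j_1}\prod_{l=2}^k\big(e^{-(t_l-t_{l-1})\Lambda}\big)_{j_{l-1}j_l}$$ for all $k\in\mathbb N$, $0\le t_1<\dots<t_k$ and indices $j_1,\dots,j_k$. $\mathbb E_{\mathbf a}$ is the expectation with respect to $\mathbb P_{\mathbf a}$, and $\mathbb E_i=\mathbb E_{\mathbf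 e_i}$ with $\mathbf e_i$ the $i$-th canonical basis vector. "Almost surely" (a.s.) means up to a set that is $\mathbb P_{\mathbf a}$-null for some, equivalently all, $\mathbf a\in\mathcal S$ with strictly positive components. A stopping time is a nonnegative random variable $\tau$ on $(\mathcal D,\mathcal F)$ with $\{\tau\le t\}\in\mathcal F_t$ for all $t\ge0$. **Controls.** $\mathcal D(0,+\infty;\mathbb R^N)$ is the space of cadlag paths $[0,+\infty)\to\mathbb R^N$ with the Skorohod metric and its Borel $\sigma$-algebra (generated by the evaluations). A control is a measurable map $\Xi:\mathcal D\to\mathcal D(0,+\infty;\mathbb R^N)$ such that (i) for every $t>0$ there is $R>0$ with $\sup_{[0,t]}|\Xi|<R$ a.s.; (ii) $\Xi$ is nonanticipating: for every $t>0$, $\omega_1=\omega_2$ in $[0,t]$ implies $\Xi(\omega_1)=\Xi(\omega_2)$ in $[0,t]$. For $\xi\in\mathcal D(0,+\infty;\mathbb R^N)$, $\mathcal I(\xi)(t)\in\mathbb T^N$ is the projection on $\mathbb T^N$ of $\int_0^t\xi\,ds$; $\mathcal I(\Xi)$ is defined $\omega$ by $\omega$. For a bounded stopping time $\tau$, a $\tau$-cycle is a control $\Xi$ with $\mathcal I(\Xi)(\tau)=0$ in $\mathbb T^N$ a.s. *)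

theory Defs
  imports "HOL-Probability.Probability"
begin

text \<open>
  The flat torus is rendered by its universal cover: a function on the torus is a
  function on \<open>real^'n\<close> that is periodic with respect to the integer lattice, a point of the
  torus is any of its representatives, and equality to \<open>0\<close> in the torus is membership in the
  lattice. The equations of the system are indexed by the finite type \<open>'m\<close>.
\<close>

definition int_lattice :: "(real^'n) set" where
  "int_lattice = {z. \<forall>k. z $ k \<in> \<int>}"

definition torus_periodic :: "(real^'n \<Rightarrow> 'b) \<Rightarrow> bool" where
  "torus_periodic f \<longleftrightarrow> (\<forall>x. \<forall>z\<in>int_lattice. f (x + z) = f x)"


subsection \<open>The weakly coupled system\<close>

definition hamiltonians :: "('m::finite \<Rightarrow> real^'n \<Rightarrow> real^'n \<Rightarrow> real) \<Rightarrow> bool" where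
  "hamiltonians H \<longleftrightarrow> (\<forall>i.
     (\<forall>p. torus_periodic (\<lambda>x. H i x p)) \<and>
     continuous_on UNIV (\<lambda>(x, p). H i x p) \<and>
     (\<forall>x. convex_on UNIV (H i x)) \<and>
     (\<forall>x. filterlim (\<lambda>p. H i x p / norm p) at_top at_infinity))"

text \<open>The supremum is attained, by continuity and superlinearity of \<open>H i x\<close>.\<close>

definition lagrangian ::
  "('m \<Rightarrow> real^'n \<Rightarrow> real^'n \<Rightarrow> real) \<Rightarrow> 'm \<Rightarrow> real^'n \<Rightarrow> real^'n \<Rightarrow> real" where
  "lagrangian H i x q = (SUP p. p \<bullet> q - H i x p)"

definition coupling_matrix :: "real^'m^'m \<Rightarrow> bool" where
  "coupling_matrix \<Lambda> \<longleftrightarrow>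
     (\<forall>i j. i \<noteq> j \<longrightarrow> \<Lambda> $ i $ j \<le> 0) \<and>
     (\<forall>i. (\<Sum>j\<in>UNIV. \<Lambda> $ i $ j) = 0) \<and>
     (\<forall>I. I \<noteq> {} \<and> I \<subset> UNIV \<longrightarrow> (\<exists>i\<in>I. \<exists>j. j \<notin> I \<and> \<Lambda> $ i $ j \<noteq> 0))"

definition torus_C1 :: "(real^'n \<Rightarrow> real) \<Rightarrow> (real^'n \<Rightarrow> real^'n) \<Rightarrow> bool" where
  "torus_C1 \<psi> D\<psi> \<longleftrightarrow>
     torus_periodic \<psi> \<and> (\<forall>x. GDERIV \<psi> x :> D\<psi> x) \<and> continuous_on UNIV D\<psi>"

definition hj_subsolution ::
  "('m::finite \<Rightarrow> real^'n \<Rightarrow> real^'n \<Rightarrow> real) \<Rightarrow> real^'m^'m \<Rightarrow> real \<Rightarrow> (real^'n \<Rightarrow> real^'m) \<Rightarrow> bool"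
  where
  "hj_subsolution H \<Lambda> \<alpha> u \<longleftrightarrow>
     torus_periodic u \<and> continuous_on UNIV u \<and>
     (\<forall>x i \<psi> D\<psi>. torus_C1 \<psi> D\<psi> \<and> (\<forall>z. u z $ i - \<psi> z \<le> u x $ i - \<psi> x)
        \<longrightarrow> H i x (D\<psi> x) + \<Lambda> $ i \<bullet> u x \<le> \<alpha>)"

definition critical_value ::
  "('m::finite \<Rightarrow> real^'n \<Rightarrow> real^'n \<Rightarrow> real) \<Rightarrow> real^'m^'m \<Rightarrow> real" where
  "critical_value H \<Lambda> = Inf {\<alpha>. \<exists>u. hj_subsolution H \<Lambda> \<alpha> u}"

definition admissible_values ::
  "('m::finite \<Rightarrow> real^'n \<Rightarrow> real^'n \<Rightarrow> real) \<Rightarrow> real^'m^'m \<Rightarrow> real \<Rightarrow> real^'n \<Rightarrow> (real^'m) set" where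
  "admissible_values H \<Lambda> \<alpha> x = {b. \<exists>u. hj_subsolution H \<Lambda> \<alpha> u \<and> u x = b}"


subsection \<open>Cadlag paths\<close>

text \<open>
  Paths live on \<open>[0, \<infinity>)\<close>; extensionality fixes the irrelevant values at negative times,
  so that distinct elements are distinct paths.
\<close>

definition cadlag_paths :: "'b topology \<Rightarrow> (real \<Rightarrow> 'b) set" where
  "cadlag_paths T = {f \<in> extensional {0..}.
     (\<forall>t\<ge>0. limitin T f (f t) (at_right t)) \<and> (\<forall>t>0. \<exists>l. limitin T f l (at_left t))}"

definition evaluation_algebra ::
  "'b topology \<Rightarrow> 'b measure \<Rightarrow> real set \<Rightarrow> (real \<Rightarrow> 'b) measure" where
  "evaluation_algebra T B I =
     sigma (cadlag_paths T) {{f \<in> cadlag_paths T. f s \<in> A} | s A. s \<in> I \<and> A \<in> sets B}"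

definition index_paths :: "(real \<Rightarrow> 'm) set" where
  "index_paths = cadlag_paths (discrete_topology UNIV)"

definition index_path_space :: "(real \<Rightarrow> 'm) measure" where
  "index_path_space = evaluation_algebra (discrete_topology UNIV) (count_space UNIV) {0..}"

definition index_filtration :: "real \<Rightarrow> (real \<Rightarrow> 'm) measure" where
  "index_filtration t = evaluation_algebra (discrete_topology UNIV) (count_space UNIV) {0..t}"

text \<open>The Borel \<open>\<sigma>\<close>-algebra of the Skorohod metric is the one generated by the evaluations.\<close>

definition velocity_path_space :: "(real \<Rightarrow> real^'n) measure" where
  "velocity_path_space = evaluation_algebra euclidean borel {0..}"


subsection \<open>The random index\<close>

definition mat_exp :: "real^'m^'m \<Rightarrow> real^'m^'m" where
  "mat_exp A = (\<Sum>k. (1 / fact k) *\<^sub>R (((**) A ^^ k) (mat 1)))"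

definition prob_vectors :: "(real^'m) set" where
  "prob_vectors = {a. (\<forall>i. 0 \<le> a $ i) \<and> (\<Sum>i\<in>UNIV. a $ i) = 1}"

text \<open>The times are \<open>t 0 < \<dots> < t k\<close> here, numbered from \<open>0\<close>.\<close>

definition is_index_law :: "real^'m^'m \<Rightarrow> real^'m \<Rightarrow> (real \<Rightarrow> 'm) measure \<Rightarrow> bool" where
  "is_index_law \<Lambda> a P \<longleftrightarrow>
     prob_space P \<and> space P = index_paths \<and> sets P = sets index_path_space \<and>
     (\<forall>(k::nat) (t :: nat \<Rightarrow> real) (j :: nat \<Rightarrow> 'm).
        0 \<le> t 0 \<and> (\<forall>l<k. t l < t (Suc l)) \<longrightarrow>
        measure P {\<omega> \<in> index_paths. \<forall>l\<le>k. \<omega> (t l) = j l} =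
          (a v* mat_exp (- t 0 *\<^sub>R \<Lambda>)) $ j 0 *
          (\<Prod>l<k. mat_exp (- (t (Suc l) - t l) *\<^sub>R \<Lambda>) $ j l $ j (Suc l)))"

definition index_law :: "real^'m^'m \<Rightarrow> real^'m \<Rightarrow> (real \<Rightarrow> 'm) measure" where
  "index_law \<Lambda> a = (THE P. is_index_law \<Lambda> a P)"

text \<open>
  The null sets are the same for all strictly positive initial distributions, so \<open>\<exists>\<close> could be
  replaced by \<open>\<forall>\<close>.
\<close>

definition almost_surely :: "real^'m^'m \<Rightarrow> ((real \<Rightarrow> 'm) \<Rightarrow> bool) \<Rightarrow> bool" where
  "almost_surely \<Lambda> Q \<longleftrightarrow>
     (\<exists>a\<in>prob_vectors. (\<forall>i. 0 < a $ i) \<and> (AE \<omega> in index_law \<Lambda> a. Q \<omega>))"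

text \<open>
  The library's \<open>stopping_time\<close> also quantifies over \<open>t < 0\<close>; this imposes nothing here,
  as \<open>\<tau>\<close> is nonnegative.
\<close>

definition bounded_stopping_time :: "((real \<Rightarrow> 'm) \<Rightarrow> real) \<Rightarrow> bool" where
  "bounded_stopping_time \<tau> \<longleftrightarrow>
     \<tau> \<in> borel_measurable index_path_space \<and>
     (\<forall>\<omega>\<in>index_paths. 0 \<le> \<tau> \<omega>) \<and>
     stopping_time index_filtration \<tau> \<and>
     (\<exists>K. \<forall>\<omega>\<in>index_paths. \<tau> \<omega> \<le> K)"


subsection \<open>Controls and cycles\<close>

definition control :: "real^'m^'m \<Rightarrow> ((real \<Rightarrow> 'm) \<Rightarrow> real \<Rightarrow> real^'n) \<Rightarrow> bool" where
  "control \<Lambda> \<Xi> \<longleftrightarrow>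
     \<Xi> \<in> index_path_space \<rightarrow>\<^sub>M velocity_path_space \<and>
     (\<forall>t>0. \<exists>R>0. almost_surely \<Lambda> (\<lambda>\<omega>. (SUP s\<in>{0..t}. norm (\<Xi> \<omega> s)) < R)) \<and>
     (\<forall>t>0. \<forall>\<omega>1\<in>index_paths. \<forall>\<omega>2\<in>index_paths.
        (\<forall>s\<in>{0..t}. \<omega>1 s = \<omega>2 s) \<longrightarrow> (\<forall>s\<in>{0..t}. \<Xi> \<omega>1 s = \<Xi> \<omega>2 s))"

definition displacement :: "(real \<Rightarrow> real^'n) \<Rightarrow> real \<Rightarrow> real^'n" where
  "displacement \<xi> t = (LINT s:{0..t}|lborel. \<xi> s)"

definition tau_cycle ::
  "real^'m^'m \<Rightarrow> ((real \<Rightarrow> 'm) \<Rightarrow> real) \<Rightarrow> ((real \<Rightarrow> 'm) \<Rightarrow> real \<Rightarrow> real^'n) \<Rightarrow> bool" where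
  "tau_cycle \<Lambda> \<tau> \<Xi> \<longleftrightarrow>
     control \<Lambda> \<Xi> \<and> almost_surely \<Lambda> (\<lambda>\<omega>. displacement (\<Xi> \<omega>) (\<tau> \<omega>) \<in> int_lattice)"

end

theory Submission
  imports Defs
begin

text \<open>
  If \<open>u\<close> is a subsolution with \<open>u(y) = b\<close>, then along any control the cost accumulated up to time \<open>t\<close>
  plus \<open>u\<^sub>\<omega>\<^sub>(\<^sub>t\<^sub>)(y + I(t))\<close> is a submartingale. Over a short time step, the motion is estimated with the
  index frozen at its final value, by the inequality that a viscosity subsolution satisfies along
  trajectories; this costs a coupling term, which is compensated to first order by the jumps of the
  index, because \<open>exp (- h \<Lambda>) = 1 - h \<Lambda> + o(h)\<close>. Stopping at \<open>\<tau>\<close> gives the inequality for cycles.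

  Conversely, let \<open>w\<^sub>i(x)\<close> be the infimum of the expected cost, with terminal cost \<open>b\<close>, over the finite
  feedback policies that steer \<open>x\<close> to \<open>y\<close> on the torus when the index starts at \<open>i\<close>. The policies from
  \<open>y\<close> to \<open>y\<close> are cycles, so the inequality gives \<open>w(y) = b\<close>; irreducibility makes \<open>w\<close> finite, and
  dynamic programming over short constant moves makes it a subsolution.

  The random index is realised by uniformisation: a Poisson clock of constant rate, at each tick of
  which the state moves according to a stochastic matrix, possibly to itself.
\<close>

subsection \<open>The transition semigroup\<close>

text \<open>The index is frozen at its final rather than its initial value because a control may
  react to jumps inside the step: the position at t + h is then correlated with the index at t + h,
  whereas the position at t depends on the past alone. With the final index frozen, what remains to
  be averaged is a function of the position at t and of the index at t + h, and the Markov property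
  between these two fixed times suffices. The time during which the index differs from its final
  value has expectation o(h). Feedback policies are finite trees whose legs have durations fixed on
  entering them. Their expected costs therefore obey a recursion over transition probabilities, and
  near-optimal continuations are chosen for finitely many indices only, so no measurable selection
  arises when policies are concatenated. Since \<open>index_law\<close> is a definite description,
  existence and uniqueness of the law have to come before any statement about expectations.
  Existence rests on a renewal equation, obtained by conditioning on the first tick of the clock,
  that both the jump process and the matrix exponential satisfy.\<close>

definition transition :: "real^'m^'m \<Rightarrow> real \<Rightarrow> 'm::finite \<Rightarrow> 'm \<Rightarrow> real" where
  "transition \<Lambda> t i j = mat_exp (- t *\<^sub>R \<Lambda>) $ i $ j"

definition matrix_power :: "real^'m^'m \<Rightarrow> nat \<Rightarrow> real^'m^'m" where
  "matrix_power A k = ((**) A ^^ k) (mat 1)"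

lemma matrix_power_0: "matrix_power A 0 = mat 1"
  by (simp add: matrix_power_def)

lemma matrix_power_Suc_nth:
  "matrix_power A (Suc k) $ i $ j = (\<Sum>l\<in>UNIV. A $ i $ l * matrix_power A k $ l $ j)"
  by (simp add: matrix_power_def matrix_matrix_mult_def)

lemma matrix_power_scaleR:
  "matrix_power (c *\<^sub>R A) k $ i $ j = c ^ k * matrix_power A k $ i $ j"
proof (induction k arbitrary: i)
  case 0
  then show ?case by (simp add: matrix_power_0)
next
  case (Suc k)
  then show ?case by (simp add: matrix_power_Suc_nth sum_distrib_left mult_ac)
qed

text \<open>The sum of all absolute entries dominates every absolute row sum, so each further factor
  multiplies the bound by at most this sum. It gives convergence of the exponential series entry by
  entry.\<close>

lemma matrix_power_bound:
  fixes A :: "real^'m^'m"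
  shows "\<bar>matrix_power A k $ i $ j\<bar> \<le> (\<Sum>i\<in>UNIV. \<Sum>j\<in>UNIV. \<bar>A $ i $ j\<bar>) ^ k"
proof (induction k arbitrary: i)
  case 0
  then show ?case by (simp add: matrix_power_0 mat_def)
next
  case (Suc k)
  let ?m = "\<Sum>i\<in>UNIV. \<Sum>j\<in>UNIV. \<bar>A $ i $ j\<bar>"
  have m: "0 \<le> ?m" by (intro sum_nonneg) auto
  have "\<bar>matrix_power A (Suc k) $ i $ j\<bar> \<le> (\<Sum>l\<in>UNIV. \<bar>A $ i $ l\<bar> * ?m ^ k)"
    unfolding matrix_power_Suc_nth
    by (rule order_trans[OF sum_abs]) (auto intro!: sum_mono mult_left_mono Suc simp: abs_mult)
  also have "\<dots> = (\<Sum>l\<in>UNIV. \<bar>A $ i $ l\<bar>) * ?m ^ k" by (simp add: sum_distrib_right)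
  also have "\<dots> \<le> ?m * ?m ^ k"
    using member_le_sum[of i UNIV "\<lambda>i. \<Sum>j\<in>UNIV. \<bar>A $ i $ j\<bar>"] m
    by (intro mult_right_mono) (auto intro: sum_nonneg)
  finally show ?case by simp
qed

text \<open>Taylor coefficients in t of an entry of exp (- t \<Lambda>). Working entrywise reduces
  the calculus of matrix exponentials to scalar power series.\<close>

definition transition_coeff :: "real^'m^'m \<Rightarrow> 'm \<Rightarrow> 'm \<Rightarrow> nat \<Rightarrow> real" where
  "transition_coeff \<Lambda> i j k = matrix_power (- \<Lambda>) k $ i $ j / fact k"

lemma summable_transition_coeff:
  fixes \<Lambda> :: "real^'m^'m"
  shows "summable (\<lambda>k. transition_coeff \<Lambda> i j k * t ^ k)"
proof (rule summable_comparison_test)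
  let ?m = "\<Sum>i\<in>UNIV. \<Sum>j\<in>UNIV. \<bar>(- \<Lambda>) $ i $ j\<bar>"
  show "\<exists>N. \<forall>n\<ge>N. norm (transition_coeff \<Lambda> i j n * t ^ n) \<le> inverse (fact n) * (?m * \<bar>t\<bar>) ^ n"
    by (intro exI[of _ 0])
       (auto simp: transition_coeff_def abs_mult power_abs power_mult_distrib divide_inverse mult_ac
          simp del: vector_uminus_component
          intro!: mult_left_mono matrix_power_bound)
qed (rule summable_exp)

lemma transition_eq: "transition \<Lambda> t i j = (\<Sum>k. transition_coeff \<Lambda> i j k * t ^ k)"
proof -
  have eq: "(1 / fact k) *\<^sub>R (((**) (- t *\<^sub>R \<Lambda>) ^^ k) (mat 1)) =
      (\<chi> i j. transition_coeff \<Lambda> i j k * t ^ k)" for k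
    using matrix_power_scaleR[of t "- \<Lambda>" k]
    by (simp add: vec_eq_iff matrix_power_def[symmetric] transition_coeff_def)
  have "(\<lambda>k. (\<chi> i j. transition_coeff \<Lambda> i j k * t ^ k)) sums
        (\<chi> i j. \<Sum>k. transition_coeff \<Lambda> i j k * t ^ k)"
    unfolding sums_def
    by (intro vec_tendstoI) (simp add: summable_LIMSEQ summable_transition_coeff)
  from sums_unique[OF this, symmetric] show ?thesis
    unfolding transition_def mat_exp_def eq by simp
qed

lemma transition_0: "transition \<Lambda> 0 i j = (if i = j then 1 else 0)"
proof -
  have "transition \<Lambda> 0 i j = (\<Sum>k. transition_coeff \<Lambda> i j k * 0 ^ k)" by (rule transition_eq)
  also have "\<dots> = transition_coeff \<Lambda> i j 0" by (rule powser_zero)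
  finally show ?thesis by (simp add: transition_coeff_def matrix_power_0 mat_def)
qed

text \<open>Kolmogorov's backward equation P' = - \<Lambda> P. The matrix stands on the left because
  the recursion for powers peels off the first factor.\<close>

lemma transition_deriv:
  "((\<lambda>t. transition \<Lambda> t i j) has_real_derivative
     (\<Sum>l\<in>UNIV. - \<Lambda> $ i $ l * transition \<Lambda> t l j)) (at t)"
proof -
  have d: "diffs (transition_coeff \<Lambda> i j) k * t ^ k =
      (\<Sum>l\<in>UNIV. - \<Lambda> $ i $ l * (transition_coeff \<Lambda> l j k * t ^ k))" for k
    unfolding diffs_def transition_coeff_def matrix_power_Suc_nth
    by (simp add: field_simps sum_distrib_left sum_divide_distrib del: of_nat_Suc)
  have "((\<lambda>t. \<Sum>k. transition_coeff \<Lambda> i j k * t ^ k) has_real_derivative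
     (\<Sum>k. diffs (transition_coeff \<Lambda> i j) k * t ^ k)) (at t)"
    by (rule termdiffs_strong_converges_everywhere) (rule summable_transition_coeff)
  also have "(\<Sum>k. diffs (transition_coeff \<Lambda> i j) k * t ^ k) =
     (\<Sum>l\<in>UNIV. - \<Lambda> $ i $ l * (\<Sum>k. transition_coeff \<Lambda> l j k * t ^ k))"
    unfolding d
    by (subst suminf_sum)
       (auto intro!: summable_mult summable_minus summable_transition_coeff sum.cong
             suminf_mult[symmetric] simp flip: suminf_mult simp: suminf_minus summable_mult summable_transition_coeff)
  finally show ?thesis by (simp add: transition_eq[abs_def])
qed

lemma continuous_on_transition: "continuous_on A (\<lambda>t. transition \<Lambda> t i j)"
  using transition_deriv DERIV_isCont by (blast intro: continuous_at_imp_continuous_on)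

subsection \<open>The random index as a uniformised jump process\<close>

lemma coupling_diag_nonneg:
  fixes \<Lambda> :: "real^'m^'m"
  assumes "coupling_matrix \<Lambda>"
  shows "0 \<le> \<Lambda> $ i $ i"
proof -
  have "(\<Sum>j\<in>UNIV. \<Lambda> $ i $ j) = \<Lambda> $ i $ i + (\<Sum>j\<in>UNIV - {i}. \<Lambda> $ i $ j)"
    by (simp add: sum.remove)
  moreover have "(\<Sum>j\<in>UNIV - {i}. \<Lambda> $ i $ j) \<le> 0"
    using assms by (intro sum_nonpos) (auto simp: coupling_matrix_def)
  ultimately show ?thesis using assms by (auto simp: coupling_matrix_def)
qed

text \<open>The trace dominates each diagonal entry, which makes all jump weights nonnegative; the
  summand 1 keeps the rate positive when the trace vanishes, as for a single state.\<close>

definition jump_rate :: "real^'m^'m \<Rightarrow> real" where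
  "jump_rate \<Lambda> = 1 + (\<Sum>i\<in>UNIV. \<Lambda> $ i $ i)"

text \<open>Entries of the stochastic matrix S = I - \<Lambda> / c, with c the jump rate, so that
  \<Lambda> = c (I - S). A positive diagonal entry stands for ticks that leave the state
  unchanged.\<close>

definition jump_weight :: "real^'m^'m \<Rightarrow> 'm \<Rightarrow> 'm \<Rightarrow> real" where
  "jump_weight \<Lambda> i j = of_bool (i = j) - \<Lambda> $ i $ j / jump_rate \<Lambda>"

definition jump_pmf :: "real^'m^'m \<Rightarrow> 'm::finite \<Rightarrow> 'm pmf" where
  "jump_pmf \<Lambda> i = embed_pmf (jump_weight \<Lambda> i)"

definition clock :: "real^'m^'m \<Rightarrow> real measure" where
  "clock \<Lambda> = density lborel (exponential_density (jump_rate \<Lambda>))"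

text \<open>Each mark is a waiting time together with a random map that moves every state at once.\<close>

definition mark_space :: "real^'m^'m \<Rightarrow> (real \<times> ('m::finite \<Rightarrow> 'm)) measure" where
  "mark_space \<Lambda> = clock \<Lambda> \<Otimes>\<^sub>M measure_pmf (Pi_pmf UNIV undefined (jump_pmf \<Lambda>))"

text \<open>The recursion consumes the first mark, in step with the decomposition of the stream
  measure, so that properties follow by conditioning on the first tick.\<close>

primrec jump_state :: "nat \<Rightarrow> 'm \<Rightarrow> (real \<times> ('m \<Rightarrow> 'm)) stream \<Rightarrow> 'm" where
  "jump_state 0 i w = i"
| "jump_state (Suc n) i w = jump_state n (snd (shd w) i) (stl w)"

primrec jump_time :: "nat \<Rightarrow> (real \<times> ('m \<Rightarrow> 'm)) stream \<Rightarrow> real" where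
  "jump_time 0 w = 0"
| "jump_time (Suc n) w = fst (shd w) + jump_time n (stl w)"

text \<open>Natural thresholds keep the condition a countable combination of measurable
  events.\<close>

definition nonexplosive :: "(real \<times> ('m \<Rightarrow> 'm)) stream \<Rightarrow> bool" where
  "nonexplosive w \<longleftrightarrow> (\<forall>n. 0 < fst (w !! n)) \<and> (\<forall>k::nat. \<exists>n. real k < jump_time n w)"

text \<open>On a nonexplosive stream, \<open>LEAST\<close> counts the ticks up to and including time
  t, which makes the path right-continuous at ticks. The constant default on explosive streams turns
  every stream into a cadlag path, with no exceptional null set.\<close>

definition jump_path :: "'m \<Rightarrow> (real \<times> ('m \<Rightarrow> 'm)) stream \<Rightarrow> real \<Rightarrow> 'm" where
  "jump_path i w t = (if nonexplosive w then jump_state (LEAST n. t < jump_time (Suc n) w) i w else i)"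

lemma nonexplosive_Stream: "nonexplosive (x ## w) \<longleftrightarrow> 0 < fst x \<and> nonexplosive w"
proof
  assume *: "nonexplosive (x ## w)"
  have "0 < fst ((x ## w) !! n)" for n using * by (simp add: nonexplosive_def)
  from this[of 0] this[of "Suc _"] have 1: "0 < fst x" and 2: "0 < fst (w !! n)" for n by auto
  have "\<exists>n. real k < jump_time n w" for k
  proof -
    obtain k' :: nat where k': "fst x + real k < real k'" using reals_Archimedean2 by blast
    then obtain n where n: "real k' < jump_time n (x ## w)" using * by (auto simp: nonexplosive_def)
    have "n \<noteq> 0" using n by (cases n) auto
    then obtain m where "n = Suc m" by (cases n) auto
    then show ?thesis using n k' by (intro exI[of _ m]) simp
  qed
  then show "0 < fst x \<and> nonexplosive w" using 1 2 by (simp add: nonexplosive_def)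
next
  assume *: "0 < fst x \<and> nonexplosive w"
  then have "0 < fst ((x ## w) !! n)" for n by (cases n) (auto simp: nonexplosive_def)
  moreover have "\<exists>n. real k < jump_time n (x ## w)" for k
  proof -
    obtain n where "real k < jump_time n w" using * by (auto simp: nonexplosive_def)
    then show ?thesis using * by (intro exI[of _ "Suc n"]) simp
  qed
  ultimately show "nonexplosive (x ## w)" by (simp add: nonexplosive_def)
qed

lemma nonexplosive_unbounded:
  assumes "nonexplosive w"
  obtains n where "t < jump_time n w"
proof -
  obtain k :: nat where "t < real k" using reals_Archimedean2 by blast
  moreover obtain n where "real k < jump_time n w" using assms by (auto simp: nonexplosive_def)
  ultimately show ?thesis using that[of n] by simp
qed

text \<open>Once the first tick has passed, the \<open>LEAST\<close> drops by exactly one on the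
  tail stream. This renewal identity drives the later inductions on paths.\<close>

lemma jump_path_Stream:
  assumes "nonexplosive (x ## w)" "0 \<le> t"
  shows "jump_path i (x ## w) t = (if t < fst x then i else jump_path (snd x i) w (t - fst x))"
proof (cases "t < fst x")
  case True
  then have "(LEAST n. t < jump_time (Suc n) (x ## w)) = 0"
    by (intro Least_eq_0) simp
  with True assms show ?thesis by (simp add: jump_path_def del: jump_time.simps)
next
  case False
  let ?P = "\<lambda>n. t < jump_time (Suc n) (x ## w)"
  obtain n where n: "t < jump_time n (x ## w)" using assms(1) by (rule nonexplosive_unbounded)
  with \<open>0 \<le> t\<close> obtain m where "n = Suc m" by (cases n) auto
  with n have "?P m" by simp
  moreover have "\<not> ?P 0" using False by simp
  ultimately have "(LEAST n. ?P n) = Suc (LEAST m. ?P (Suc m))" by (rule Least_Suc)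
  moreover have "?P (Suc m) \<longleftrightarrow> t - fst x < jump_time (Suc m) w" for m by auto
  ultimately show ?thesis using False assms
    by (simp add: jump_path_def nonexplosive_Stream del: jump_time.simps)
qed

text \<open>Induction on a number of ticks that exhausts the time t: before the first tick the path
  is constant, and after it the claim is that for the tail stream on a shifted time axis.\<close>

lemma jump_path_right:
  assumes "nonexplosive w" "0 \<le> t" "t < jump_time n w"
  shows "\<exists>e>0. \<forall>s. t \<le> s \<and> s < t + e \<longrightarrow> jump_path i w s = jump_path i w t"
  using assms
proof (induction n arbitrary: i w t)
  case 0
  then show ?case by simp
next
  case (Suc n)
  obtain x w' where w: "w = x ## w'" by (metis stream.collapse)
  note r = jump_path_Stream[OF Suc.prems(1)[unfolded w]]
  show ?case
  proof (cases "t < fst x")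
    case True
    with Suc.prems show ?thesis unfolding w
      by (intro exI[of _ "fst x - t"]) (auto simp: r)
  next
    case False
    with Suc.IH[of w' "t - fst x" "snd x i"] Suc.prems w
    obtain e where e: "e > 0"
      "\<And>s. t - fst x \<le> s \<and> s < t - fst x + e \<longrightarrow> jump_path (snd x i) w' s = jump_path (snd x i) w' (t - fst x)"
      by (auto simp: nonexplosive_Stream)
    show ?thesis unfolding w
    proof (intro exI[of _ e] conjI allI impI e(1))
      fix s assume "t \<le> s \<and> s < t + e"
      with e(2)[of "s - fst x"] False Suc.prems(2)
      show "jump_path i (x ## w') s = jump_path i (x ## w') t" by (auto simp: r)
    qed
  qed
qed

text \<open>The bound \<open>e \<le> t\<close> keeps the left neighbourhood at nonnegative times,
  where the renewal identity and the restriction of paths apply.\<close>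

lemma jump_path_left:
  assumes "nonexplosive w" "0 < t" "t < jump_time n w"
  shows "\<exists>e>0. \<exists>l. e \<le> t \<and> (\<forall>s. t - e < s \<and> s < t \<longrightarrow> jump_path i w s = l)"
  using assms
proof (induction n arbitrary: i w t)
  case 0
  then show ?case by simp
next
  case (Suc n)
  obtain x w' where w: "w = x ## w'" by (metis stream.collapse)
  note r = jump_path_Stream[OF Suc.prems(1)[unfolded w]]
  show ?case
  proof (cases "t \<le> fst x")
    case True
    with Suc.prems show ?thesis unfolding w
      by (intro exI[of _ t] exI[of _ i] conjI) (auto simp: r)
  next
    case False
    with Suc.IH[of w' "t - fst x" "snd x i"] Suc.prems w
    obtain e l where e: "e > 0" "e \<le> t - fst x"
      "\<And>s. t - fst x - e < s \<and> s < t - fst x \<longrightarrow> jump_path (snd x i) w' s = l"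
      by (auto simp: nonexplosive_Stream)
    have x: "0 < fst x" using Suc.prems w by (simp add: nonexplosive_Stream)
    show ?thesis unfolding w
    proof (intro exI[of _ e] exI[of _ l] conjI allI impI e(1))
      show "e \<le> t" using e x by simp
      fix s assume "t - e < s \<and> s < t"
      with e(2) e(3)[of "s - fst x"] x
      show "jump_path i (x ## w') s = l" by (auto simp: r)
    qed
  qed
qed

lemma limitin_discrete_UNIV:
  "limitin (discrete_topology UNIV) f l F \<longleftrightarrow> eventually (\<lambda>x. f x = l) F"
proof
  assume "limitin (discrete_topology UNIV) f l F"
  then show "eventually (\<lambda>x. f x = l) F" by (auto simp: limitin_def dest: spec[of _ "{l}"])
next
  assume "eventually (\<lambda>x. f x = l) F"
  then show "limitin (discrete_topology UNIV) f l F"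
    by (auto simp: limitin_def elim: eventually_mono)
qed

lemma restrict_jump_path: "restrict (jump_path i w) {0..} \<in> index_paths"
proof (cases "nonexplosive w")
  case True
  have "eventually (\<lambda>s. restrict (jump_path i w) {0..} s = jump_path i w t) (at_right t)"
    if t: "0 \<le> t" for t
  proof -
    obtain n where n: "t < jump_time n w" using True by (rule nonexplosive_unbounded)
    obtain e where e: "e > 0" "\<forall>s. t \<le> s \<and> s < t + e \<longrightarrow> jump_path i w s = jump_path i w t"
      using jump_path_right[OF True t n, of i] by (elim exE conjE)
    have "restrict (jump_path i w) {0..} s = jump_path i w t" if "t < s" "s < t + e" for s
      using e(2)[rule_format, of s] that t by (simp add: restrict_def)
    then show ?thesis unfolding eventually_at_right_field using e(1)
      by (intro exI[of _ "t + e"]) auto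
  qed
  moreover have "\<exists>l. eventually (\<lambda>s. restrict (jump_path i w) {0..} s = l) (at_left t)"
    if t: "0 < t" for t
  proof -
    obtain n where n: "t < jump_time n w" using True by (rule nonexplosive_unbounded)
    obtain e l where e: "e > 0" "e \<le> t" "\<forall>s. t - e < s \<and> s < t \<longrightarrow> jump_path i w s = l"
      using jump_path_left[OF True t n, of i] by (elim exE conjE)
    have "restrict (jump_path i w) {0..} s = l" if "t - e < s" "s < t" for s
      using e(2) e(3)[rule_format, of s] that by (simp add: restrict_def)
    then show ?thesis unfolding eventually_at_left_field using e(1)
      by (intro exI[of _ l] exI[of _ "t - e"]) auto
  qed
  ultimately show ?thesis
    by (auto simp: index_paths_def cadlag_paths_def limitin_discrete_UNIV)
next
  case False
  then have const: "jump_path i w = (\<lambda>_. i)" by (simp add: jump_path_def fun_eq_iff)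
  have "eventually (\<lambda>s. restrict (jump_path i w) {0..} s = jump_path i w t) (at_right t)" if "0 \<le> t" for t
    unfolding eventually_at_right_field const using that by (intro exI[of _ "t + 1"]) auto
  moreover have "\<exists>l. eventually (\<lambda>s. restrict (jump_path i w) {0..} s = l) (at_left t)" if "0 < t" for t
    unfolding eventually_at_left_field const using that by (intro exI[of _ i] exI[of _ 0]) auto
  ultimately show ?thesis
    by (auto simp: index_paths_def cadlag_paths_def limitin_discrete_UNIV)
qed

lemma sets_clock [measurable_cong, simp]: "sets (clock \<Lambda>) = sets borel"
  by (simp add: clock_def)

lemma space_clock [simp]: "space (clock \<Lambda>) = UNIV"
  by (simp add: clock_def)

lemma measurable_fst_mark [measurable]: "fst \<in> mark_space \<Lambda> \<rightarrow>\<^sub>M borel"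
  unfolding mark_space_def by measurable

lemma measurable_snd_mark [measurable]: "snd \<in> mark_space \<Lambda> \<rightarrow>\<^sub>M count_space UNIV"
  unfolding mark_space_def by measurable

lemma measurable_snd_mark_apply [measurable]: "(\<lambda>x. snd x i) \<in> mark_space \<Lambda> \<rightarrow>\<^sub>M count_space UNIV"
  by (rule measurable_compose[OF measurable_snd_mark]) simp

lemma space_mark_space [simp]: "space (mark_space \<Lambda>) = UNIV"
  by (simp add: mark_space_def space_pair_measure)

lemma measurable_jump_state [measurable]:
  fixes \<Lambda> :: "real^'m^'m"
  shows "(\<lambda>w. jump_state n i w) \<in> stream_space (mark_space \<Lambda>) \<rightarrow>\<^sub>M count_space UNIV"
proof (induction n arbitrary: i)
  case 0
  then show ?case by simp
next
  case (Suc n)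
  note [measurable] = Suc
  have "(\<lambda>w. jump_state n (snd (shd w) i) (stl w)) \<in> stream_space (mark_space \<Lambda>) \<rightarrow>\<^sub>M count_space UNIV"
    by (rule measurable_compose_countable) measurable
  then show ?case by simp
qed

lemma measurable_jump_time [measurable]:
  "(\<lambda>w. jump_time n w) \<in> stream_space (mark_space \<Lambda>) \<rightarrow>\<^sub>M borel"
proof (induction n)
  case (Suc n)
  note [measurable] = Suc
  show ?case unfolding jump_time.simps by measurable
qed simp

lemma measurable_nonexplosive [measurable]:
  "Measurable.pred (stream_space (mark_space \<Lambda>)) nonexplosive"
  unfolding nonexplosive_def by measurable

lemma measurable_jump_path [measurable]:
  fixes \<Lambda> :: "real^'m^'m"
  assumes [measurable]: "f \<in> borel_measurable M" "g \<in> M \<rightarrow>\<^sub>M stream_space (mark_space \<Lambda>)"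
  shows "(\<lambda>x. jump_path i (g x) (f x)) \<in> M \<rightarrow>\<^sub>M count_space UNIV"
proof -
  have [measurable]: "(\<lambda>x. jump_state (LEAST n. f x < jump_time (Suc n) (g x)) i (g x)) \<in> M \<rightarrow>\<^sub>M count_space UNIV"
    by (rule measurable_compose_countable) measurable
  show ?thesis unfolding jump_path_def by measurable
qed

section \<open>Exponential waiting times and the law of a mark\<close>

context
  fixes \<Lambda> :: "real^'m::finite^'m"
  assumes coupling: "coupling_matrix \<Lambda>"
begin

lemma jump_rate_pos: "0 < jump_rate \<Lambda>"
  using coupling_diag_nonneg[OF coupling] by (simp add: jump_rate_def add_pos_nonneg sum_nonneg)

lemma jump_weight_nonneg: "0 \<le> jump_weight \<Lambda> i j"
proof (cases "i = j")
  case True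
  have "\<Lambda> $ i $ i \<le> (\<Sum>i\<in>UNIV. \<Lambda> $ i $ i)"
    using coupling_diag_nonneg[OF coupling] by (intro member_le_sum) auto
  then show ?thesis using True jump_rate_pos by (simp add: jump_weight_def jump_rate_def)
next
  case False
  then show ?thesis using coupling jump_rate_pos
    by (simp add: jump_weight_def coupling_matrix_def divide_nonpos_pos)
qed

lemma jump_weight_sum: "(\<Sum>j\<in>UNIV. jump_weight \<Lambda> i j) = 1"
  using coupling
  by (simp add: jump_weight_def sum_subtractf coupling_matrix_def flip: sum_divide_distrib)

lemma pmf_jump: "pmf (jump_pmf \<Lambda> i) j = jump_weight \<Lambda> i j"
  unfolding jump_pmf_def
proof (rule pmf_embed_pmf)
  show "(\<integral>\<^sup>+x. ennreal (jump_weight \<Lambda> i x) \<partial>count_space UNIV) = 1"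
    by (simp add: nn_integral_count_space_finite jump_weight_nonneg sum_ennreal jump_weight_sum)
qed (rule jump_weight_nonneg)

lemma prob_space_clock: "prob_space (clock \<Lambda>)"
  unfolding clock_def using jump_rate_pos by (rule prob_space_exponential_density)

lemma prob_space_mark_space: "prob_space (mark_space \<Lambda>)"
  unfolding mark_space_def
  by (intro prob_space_pair prob_space_clock prob_space_measure_pmf)

lemma integral_clock:
  assumes [measurable]: "f \<in> borel_measurable borel"
  shows "(\<integral>x. f x \<partial>clock \<Lambda>) = (\<integral>x. exponential_density (jump_rate \<Lambda>) x * f x \<partial>lborel)"
  unfolding clock_def using exponential_density_nonneg[OF jump_rate_pos]
  by (subst integral_density) auto

text \<open>An expectation over waiting times up to t becomes a difference of values of an
  antiderivative, so integral equations for the clock reduce to differentiation.\<close>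

lemma clock_interval:
  assumes "continuous_on UNIV f" "0 \<le> t" "\<And>x. (F has_real_derivative (jump_rate \<Lambda> * exp (- jump_rate \<Lambda> * x) * f x)) (at x)"
  shows "(\<integral>x. indicator {..t} x * f x \<partial>clock \<Lambda>) = F t - F 0"
proof -
  have [measurable]: "f \<in> borel_measurable borel"
    using assms(1) by (rule borel_measurable_continuous_onI)
  have "(\<integral>x. indicator {..t} x * f x \<partial>clock \<Lambda>) =
      (\<integral>x. (jump_rate \<Lambda> * exp (- jump_rate \<Lambda> * x) * f x) * indicator {0..t} x \<partial>lborel)"
    by (subst integral_clock, measurable, rule Bochner_Integration.integral_cong)
       (auto simp: exponential_density_def mult_ac split: split_indicator)
  also have "\<dots> = F t - F 0"
    using assms by (intro integral_FTC_Icc_real) (auto intro!: continuous_intros simp: continuous_on_eq_continuous_at)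
  finally show ?thesis .
qed

lemma clock_cdf: "0 \<le> t \<Longrightarrow> (\<integral>x. indicator {..t} x \<partial>clock \<Lambda>) = 1 - exp (- jump_rate \<Lambda> * t)"
proof -
  assume t: "0 \<le> t"
  have "((\<lambda>x. - exp (- jump_rate \<Lambda> * x)) has_real_derivative
     jump_rate \<Lambda> * exp (- jump_rate \<Lambda> * x) * 1) (at x)" for x
    by (auto intro!: derivative_eq_intros)
  from clock_interval[OF _ t this] show ?thesis by simp
qed

text \<open>The exponential density satisfies d(t + x) = exp (- c t) d(x) for x > 0, so the residual
  waiting time beyond t is again exponential.\<close>

lemma clock_memoryless:
  assumes [measurable]: "f \<in> borel_measurable borel" and "0 \<le> t"
  shows "(\<integral>x. indicator {t<..} x * f (x - t) \<partial>clock \<Lambda>) = exp (- jump_rate \<Lambda> * t) * (\<integral>x. f x \<partial>clock \<Lambda>)"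
proof -
  let ?d = "exponential_density (jump_rate \<Lambda>)"
  have "(\<integral>x. indicator {t<..} x * f (x - t) \<partial>clock \<Lambda>) =
      (\<integral>x. ?d x * (indicator {t<..} x * f (x - t)) \<partial>lborel)"
    by (rule integral_clock) measurable
  also have "\<dots> = (\<integral>x. ?d (t + x) * (indicator {t<..} (t + x) * f x) \<partial>lborel)"
    by (subst lborel_integral_real_affine[where c=1 and t=t]) auto
  also have "\<dots> = (\<integral>x. exp (- jump_rate \<Lambda> * t) * (?d x * f x) \<partial>lborel)"
  proof (rule integral_cong_AE)
    show "AE x in lborel. ?d (t + x) * (indicator {t<..} (t + x) * f x) = exp (- jump_rate \<Lambda> * t) * (?d x * f x)"
      \<comment> \<open>At x = 0 the strict indicator removes a point where the density is positive;
        that point is Lebesgue null.\<close>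
      using AE_lborel_singleton[of 0]
      by eventually_elim
        (use \<open>0 \<le> t\<close> in \<open>auto simp: exponential_density_def algebra_simps exp_add exp_diff exp_minus field_simps split: split_indicator\<close>)
  qed measurable
  also have "\<dots> = exp (- jump_rate \<Lambda> * t) * (\<integral>x. f x \<partial>clock \<Lambda>)"
    by (simp add: integral_clock)
  finally show ?thesis .
qed

lemma AE_clock_pos: "AE x in clock \<Lambda>. 0 < x"
proof -
  have "AE x in lborel. 0 < exponential_density (jump_rate \<Lambda>) x \<longrightarrow> 0 < x"
    using AE_lborel_singleton[of 0] by eventually_elim (auto simp: exponential_density_def)
  then show ?thesis unfolding clock_def by (subst AE_density) (auto simp: ennreal_less_zero_iff)
qed

lemma AE_mark_pos: "AE x in mark_space \<Lambda>. 0 < fst x"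
proof -
  interpret C: prob_space "clock \<Lambda>" by (rule prob_space_clock)
  interpret P: pair_prob_space "clock \<Lambda>" "measure_pmf (Pi_pmf UNIV undefined (jump_pmf \<Lambda>))" ..
  show ?thesis unfolding mark_space_def
    by (rule P.AE_pair_measure) (use AE_clock_pos in auto)
qed

lemma integral_mark_space:
  fixes f :: "real \<times> ('m \<Rightarrow> 'm) \<Rightarrow> real"
  assumes [measurable]: "f \<in> borel_measurable (mark_space \<Lambda>)" and "\<And>x. \<bar>f x\<bar> \<le> B"
  shows "(\<integral>x. f x \<partial>mark_space \<Lambda>) =
    (\<integral>T. (\<integral>U. f (T, U) \<partial>measure_pmf (Pi_pmf UNIV undefined (jump_pmf \<Lambda>))) \<partial>clock \<Lambda>)"
proof -
  interpret M: prob_space "mark_space \<Lambda>" by (rule prob_space_mark_space)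
  interpret C: prob_space "clock \<Lambda>" by (rule prob_space_clock)
  interpret P: pair_prob_space "clock \<Lambda>" "measure_pmf (Pi_pmf UNIV undefined (jump_pmf \<Lambda>))" ..
  have "integrable (mark_space \<Lambda>) f"
    by (rule M.integrable_const_bound[of _ B]) (auto simp: assms(2))
  then show ?thesis unfolding mark_space_def by (simp add: P.integral_fst')
qed

lemma integral_Pi_jump:
  fixes f :: "'m \<Rightarrow> real"
  shows "(\<integral>U. f (U i) \<partial>measure_pmf (Pi_pmf UNIV undefined (jump_pmf \<Lambda>))) = (\<Sum>l\<in>UNIV. jump_weight \<Lambda> i l * f l)"
proof -
  have "(\<integral>U. f (U i) \<partial>measure_pmf (Pi_pmf UNIV undefined (jump_pmf \<Lambda>))) =
     (\<integral>l. f l \<partial>measure_pmf (map_pmf (\<lambda>U. U i) (Pi_pmf UNIV undefined (jump_pmf \<Lambda>))))"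
    by simp
  also have "map_pmf (\<lambda>U. U i) (Pi_pmf UNIV undefined (jump_pmf \<Lambda>)) = jump_pmf \<Lambda> i"
    by (subst Pi_pmf_component) auto
  also have "(\<integral>l. f l \<partial>measure_pmf (jump_pmf \<Lambda> i)) = (\<Sum>l\<in>UNIV. jump_weight \<Lambda> i l * f l)"
    by (subst integral_measure_pmf[of UNIV]) (auto simp: pmf_jump)
  finally show ?thesis .
qed

text \<open>Conditioning on the first mark. Values in [0, 1] keep every integral finite on the way
  through the nonnegative integral.\<close>

lemma integral_mark_stream:
  fixes f :: "(real \<times> ('m \<Rightarrow> 'm)) stream \<Rightarrow> real"
  assumes [measurable]: "f \<in> borel_measurable (stream_space (mark_space \<Lambda>))"
    and f: "\<And>w. 0 \<le> f w" "\<And>w. f w \<le> 1"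
  shows "(\<integral>w. f w \<partial>stream_space (mark_space \<Lambda>)) =
    (\<integral>x. (\<integral>w. f (x ## w) \<partial>stream_space (mark_space \<Lambda>)) \<partial>mark_space \<Lambda>)"
proof -
  interpret M: prob_space "mark_space \<Lambda>" by (rule prob_space_mark_space)
  interpret S: prob_space "stream_space (mark_space \<Lambda>)" by (rule M.prob_space_stream_space)
  have "(\<integral>w. f w \<partial>stream_space (mark_space \<Lambda>)) = enn2real (\<integral>\<^sup>+w. f w \<partial>stream_space (mark_space \<Lambda>))"
    by (rule integral_eq_nn_integral) (auto simp: f)
  also have "(\<integral>\<^sup>+w. f w \<partial>stream_space (mark_space \<Lambda>)) =
     (\<integral>\<^sup>+x. (\<integral>\<^sup>+w. f (x ## w) \<partial>stream_space (mark_space \<Lambda>)) \<partial>mark_space \<Lambda>)"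
    by (rule M.nn_integral_stream_space) measurable
  also have "\<dots> = (\<integral>\<^sup>+x. ennreal (\<integral>w. f (x ## w) \<partial>stream_space (mark_space \<Lambda>)) \<partial>mark_space \<Lambda>)"
    by (intro nn_integral_cong nn_integral_eq_integral S.integrable_const_bound[of _ 1]) (auto simp: f)
  also have "enn2real \<dots> = (\<integral>x. (\<integral>w. f (x ## w) \<partial>stream_space (mark_space \<Lambda>)) \<partial>mark_space \<Lambda>)"
    by (rule integral_eq_nn_integral[symmetric]) (auto simp: f intro!: integral_nonneg_AE)
  finally show ?thesis .
qed

end

section \<open>Renewal equations and non-explosion\<close>

context
  fixes \<Lambda> :: "real^'m::finite^'m"
  assumes coupling: "coupling_matrix \<Lambda>"
begin

text \<open>With c the jump rate and P the transition matrix, - exp (- c T) P(t - T) is an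
  antiderivative in T: by the backward equation its derivative is c exp (- c T) (I - \<Lambda> / c)
  P(t - T), and I - \<Lambda> / c holds the jump weights.\<close>

lemma transition_renewal:
  assumes "0 \<le> t"
  shows "transition \<Lambda> t i j = exp (- jump_rate \<Lambda> * t) * of_bool (i = j) +
    (\<integral>T. indicator {..t} T * (\<Sum>l\<in>UNIV. jump_weight \<Lambda> i l * transition \<Lambda> (t - T) l j) \<partial>clock \<Lambda>)"
proof -
  let ?c = "jump_rate \<Lambda>"
  have c: "?c \<noteq> 0" using jump_rate_pos[OF coupling] by simp
  have "((\<lambda>T. - exp (- ?c * T) * transition \<Lambda> (t - T) i j) has_real_derivative
      ?c * exp (- ?c * T) * (\<Sum>l\<in>UNIV. jump_weight \<Lambda> i l * transition \<Lambda> (t - T) l j)) (at T)" for T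
  proof -
    have "((\<lambda>T. transition \<Lambda> (t - T) i j) has_real_derivative
       (\<Sum>l\<in>UNIV. - \<Lambda> $ i $ l * transition \<Lambda> (t - T) l j) * (- 1)) (at T)"
      by (rule DERIV_chain2[OF transition_deriv]) (auto intro!: derivative_eq_intros)
    moreover have "((\<lambda>T. - exp (- ?c * T)) has_real_derivative ?c * exp (- ?c * T)) (at T)"
      by (auto intro!: derivative_eq_intros)
    ultimately have "((\<lambda>T. - exp (- ?c * T) * transition \<Lambda> (t - T) i j) has_real_derivative
       ?c * exp (- ?c * T) * transition \<Lambda> (t - T) i j
       + (\<Sum>l\<in>UNIV. - \<Lambda> $ i $ l * transition \<Lambda> (t - T) l j) * (- 1) * (- exp (- ?c * T))) (at T)"
      by (intro DERIV_mult)
    also have "?c * exp (- ?c * T) * transition \<Lambda> (t - T) i j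
       + (\<Sum>l\<in>UNIV. - \<Lambda> $ i $ l * transition \<Lambda> (t - T) l j) * (- 1) * (- exp (- ?c * T))
       = ?c * exp (- ?c * T) * (\<Sum>l\<in>UNIV. jump_weight \<Lambda> i l * transition \<Lambda> (t - T) l j)"
    proof -
      have "(\<Sum>l\<in>UNIV. jump_weight \<Lambda> i l * transition \<Lambda> (t - T) l j) =
        transition \<Lambda> (t - T) i j - (\<Sum>l\<in>UNIV. \<Lambda> $ i $ l * transition \<Lambda> (t - T) l j) / ?c"
        by (simp add: jump_weight_def left_diff_distrib sum_subtractf sum_divide_distrib of_bool_def if_distrib[of "\<lambda>x. x * _"] cong: if_cong)
      then have "?c * (\<Sum>l\<in>UNIV. jump_weight \<Lambda> i l * transition \<Lambda> (t - T) l j) =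
        ?c * transition \<Lambda> (t - T) i j - (\<Sum>l\<in>UNIV. \<Lambda> $ i $ l * transition \<Lambda> (t - T) l j)"
        using c by (simp add: right_diff_distrib)
      then have "exp (- ?c * T) * (?c * (\<Sum>l\<in>UNIV. jump_weight \<Lambda> i l * transition \<Lambda> (t - T) l j)) =
        exp (- ?c * T) * (?c * transition \<Lambda> (t - T) i j - (\<Sum>l\<in>UNIV. \<Lambda> $ i $ l * transition \<Lambda> (t - T) l j))"
        by (rule arg_cong)
      then show ?thesis by (simp add: sum_negf algebra_simps)
    qed
    finally show ?thesis .
  qed
  from clock_interval[OF coupling _ assms this]
  show ?thesis
    using assms by (simp add: continuous_intros continuous_on_compose2[OF continuous_on_transition[of UNIV]] transition_0)
qed

text \<open>A contraction argument: the weights of a row add up to 1 and the clock rings before t0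
  with probability q < 1, so each application of the equation improves a uniform bound by the factor
  q.\<close>

lemma renewal_unique:
  assumes [measurable]: "\<And>i. D i \<in> borel_measurable borel"
    and B: "\<And>i t. 0 \<le> t \<Longrightarrow> t \<le> t0 \<Longrightarrow> \<bar>D i t\<bar> \<le> B"
    and eq: "\<And>i t. 0 \<le> t \<Longrightarrow> t \<le> t0 \<Longrightarrow>
      D i t = (\<integral>T. indicator {..t} T * (\<Sum>l\<in>UNIV. jump_weight \<Lambda> i l * D l (t - T)) \<partial>clock \<Lambda>)"
    and t: "0 \<le> t" "t \<le> t0"
  shows "D i t = 0"
proof -
  interpret C: prob_space "clock \<Lambda>" by (rule prob_space_clock[OF coupling])
  define q where "q = 1 - exp (- jump_rate \<Lambda> * t0)"
  have t0: "0 \<le> t0" using t by simp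
  have q: "0 \<le> q" "q < 1" using jump_rate_pos[OF coupling] t0 by (auto simp: q_def)
  have B0: "0 \<le> B" using B[of 0 i] t0 by auto
  have bound: "\<bar>D i t\<bar> \<le> B * q ^ n" if "0 \<le> t" "t \<le> t0" for n i t
    using that
  proof (induction n arbitrary: i t)
    case 0
    then show ?case using B by simp
  next
    case (Suc n)
    let ?f = "\<lambda>T. indicator {..t} T * (\<Sum>l\<in>UNIV. jump_weight \<Lambda> i l * D l (t - T)) :: real"
    let ?g = "\<lambda>T. indicator {..t0} T * (B * q ^ n) :: real"
    \<comment> \<open>For negative T the time t - T could leave the range in which D is bounded; the
      clock is almost surely positive.\<close>
    have bd: "0 < T \<Longrightarrow> \<bar>?f T\<bar> \<le> ?g T" for T
    proof -
      assume "0 < T"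
      have "\<bar>\<Sum>l\<in>UNIV. jump_weight \<Lambda> i l * D l (t - T)\<bar> \<le> B * q ^ n" if "T \<le> t"
      proof -
        have "\<bar>\<Sum>l\<in>UNIV. jump_weight \<Lambda> i l * D l (t - T)\<bar> \<le> (\<Sum>l\<in>UNIV. jump_weight \<Lambda> i l * (B * q ^ n))"
          using \<open>0 < T\<close> that Suc.prems
          by (intro order_trans[OF sum_abs] sum_mono)
             (auto simp: abs_mult jump_weight_nonneg[OF coupling] intro!: mult_left_mono Suc.IH)
        also have "\<dots> = B * q ^ n" by (simp add: jump_weight_sum[OF coupling] flip: sum_distrib_right)
        finally show ?thesis .
      qed
      then show ?thesis using B0 q Suc.prems by (auto split: split_indicator)
    qed
    have int_g: "integrable (clock \<Lambda>) ?g"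
      by (rule C.integrable_const_bound[of _ "B * q ^ n"]) (use B0 q in \<open>auto split: split_indicator\<close>)
    have "\<bar>D i t\<bar> = \<bar>\<integral>T. ?f T \<partial>clock \<Lambda>\<bar>" using eq[OF Suc.prems, of i] by simp
    also have "\<dots> \<le> (\<integral>T. \<bar>?f T\<bar> \<partial>clock \<Lambda>)" by (rule integral_abs_bound)
    also have "\<dots> \<le> (\<integral>T. ?g T \<partial>clock \<Lambda>)"
    proof (rule integral_mono_AE[OF _ int_g])
      show ae: "AE T in clock \<Lambda>. \<bar>?f T\<bar> \<le> ?g T"
        using AE_clock_pos[OF coupling] by eventually_elim (rule bd)
      show "integrable (clock \<Lambda>) (\<lambda>T. \<bar>?f T\<bar>)"
        by (rule Bochner_Integration.integrable_bound[OF int_g]) (use ae in auto)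
    qed
    also have "\<dots> = q * (B * q ^ n)"
      using clock_cdf[OF coupling t0] by (simp add: q_def)
    finally show ?case by (simp add: mult_ac)
  qed
  have "(\<lambda>n. B * q ^ n) \<longlonglongrightarrow> B * 0"
    using q by (intro tendsto_mult tendsto_const LIMSEQ_realpow_zero) auto
  then have "\<bar>D i t\<bar> \<le> B * 0"
    by (rule tendsto_lowerbound) (use bound[OF t] in auto)
  then show ?thesis by simp
qed

text \<open>Almost surely, beyond every position of the stream there is a waiting time above 1, and
  each of these pushes the elapsed time past a further natural number.\<close>

lemma AE_nonexplosive: "AE w in stream_space (mark_space \<Lambda>). nonexplosive w"
proof -
  interpret M: prob_space "mark_space \<Lambda>" by (rule prob_space_mark_space[OF coupling])
  interpret S: prob_space "stream_space (mark_space \<Lambda>)" by (rule M.prob_space_stream_space)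
  let ?S = "stream_space (mark_space \<Lambda>)"
  \<comment> \<open>The law of the stream is invariant under dropping marks, so an almost sure event
    holds almost surely along each tail.\<close>
  have shift: "AE w in ?S. P (sdrop m w)" if [measurable]: "Measurable.pred ?S P" and P: "AE w in ?S. P w" for P m
  proof (induction m)
    case (Suc m)
    have "AE w in ?S. P (sdrop m (stl w))"
      by (subst M.AE_stream_space) (use Suc in auto)
    then show ?case by simp
  qed (use P in simp)
  have pos: "AE w in ?S. 0 < fst (w !! n)" for n
  proof -
    have "AE w in ?S. 0 < fst (shd w)"
      by (subst M.AE_stream_space) (use AE_mark_pos[OF coupling] in auto)
    from shift[OF _ this, of n] show ?thesis by simp
  qed
  \<comment> \<open>Let a be the probability that no waiting time exceeds 1. Conditioning on the
    first mark gives a = (1 - exp (- c)) a with c the jump rate, hence a = 0.\<close>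
  have late: "AE w in ?S. \<exists>n. 1 < fst (w !! n)"
  proof -
    let ?f = "\<lambda>w. of_bool (\<forall>n. fst (w !! n) \<le> 1) :: real"
    define a where "a = (\<integral>w. ?f w \<partial>?S)"
    have split: "?f (x ## w) = indicator {..1} (fst x) * ?f w" for x :: "real \<times> ('m \<Rightarrow> 'm)" and w
    proof -
      have "(\<forall>n. fst ((x ## w) !! n) \<le> 1) \<longleftrightarrow> fst x \<le> 1 \<and> (\<forall>n. fst (w !! n) \<le> 1)"
      proof safe
        assume *: "\<forall>n. fst ((x ## w) !! n) \<le> 1"
        show "fst x \<le> 1" using *[rule_format, of 0] by simp
        show "fst (w !! n) \<le> 1" for n using *[rule_format, of "Suc n"] by simp
      next
        fix n assume "fst x \<le> 1" "\<forall>n. fst (w !! n) \<le> 1"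
        then show "fst ((x ## w) !! n) \<le> 1" by (cases n) auto
      qed
      then show ?thesis by (auto split: split_indicator)
    qed
    have "a = (\<integral>x. (\<integral>w. ?f (x ## w) \<partial>?S) \<partial>mark_space \<Lambda>)"
      unfolding a_def by (rule integral_mark_stream[OF coupling]) auto
    also have "\<dots> = (\<integral>x. indicator {..1} (fst x) * a \<partial>mark_space \<Lambda>)"
      unfolding split a_def by simp
    also have "\<dots> = (\<integral>x. indicator {..1} (fst x) \<partial>mark_space \<Lambda>) * a" by simp
    also have "(\<integral>x. indicator {..1} (fst x) \<partial>mark_space \<Lambda>) = (\<integral>T. indicator {..1} T \<partial>clock \<Lambda> :: real)"
      by (subst integral_mark_space[OF coupling, of _ 1]) (auto split: split_indicator)
    also have "\<dots> = 1 - exp (- jump_rate \<Lambda>)" using clock_cdf[OF coupling, of 1] by simp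
    finally have "a = 0" by (simp add: algebra_simps)
    then have "AE w in ?S. ?f w = 0" unfolding a_def
      by (subst (asm) integral_nonneg_eq_0_iff_AE) (auto intro!: S.integrable_const_bound[of _ 1])
    then show ?thesis by eventually_elim (auto simp: not_le)
  qed
  have late': "AE w in ?S. \<forall>m. \<exists>n. 1 < fst (sdrop m w !! n)"
    unfolding AE_all_countable using shift[OF _ late] by auto
  have "AE w in ?S. \<forall>n. 0 < fst (w !! n)"
    unfolding AE_all_countable using pos by auto
  then show ?thesis using late'
  proof eventually_elim
    case (elim w)
    have split: "jump_time (m + n) w = jump_time m w + jump_time n (sdrop m w)" for m n and w :: "(real \<times> ('m \<Rightarrow> 'm)) stream"
      by (induction m arbitrary: w) auto
    have nonneg: "0 \<le> jump_time n w" if "\<forall>n. 0 < fst (w !! n)" for n and w :: "(real \<times> ('m \<Rightarrow> 'm)) stream"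
      using that
    proof (induction n arbitrary: w)
      case (Suc n)
      have "0 < fst (shd w)" using Suc.prems[rule_format, of 0] by simp
      moreover have "\<forall>n. 0 < fst (stl w !! n)" using Suc.prems by (metis snth.simps(2))
      ultimately show ?case using Suc.IH[of "stl w"] by simp
    qed simp
    have "\<exists>n. real k < jump_time n w" for k
    proof (induction k)
      case 0
      show ?case using elim(1)[rule_format, of 0] by (intro exI[of _ "Suc 0"]) simp
    next
      case (Suc k)
      then obtain m where m: "real k < jump_time m w" by blast
      obtain n where n: "1 < fst (sdrop m w !! n)" using elim(2) by blast
      have "fst (sdrop m w !! n) = jump_time (Suc 0) (sdrop n (sdrop m w))"
        by (simp add: sdrop_snth add.commute)
      then have "1 < jump_time (Suc n) (sdrop m w)"
        using split[of n "Suc 0" "sdrop m w"] nonneg[of "sdrop m w" n] elim(1) n by (simp add: sdrop_snth add.commute)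
      then show ?case using split[of m "Suc n" w] m by (intro exI[of _ "m + Suc n"]) simp
    qed
    then show ?case using elim(1) by (simp add: nonexplosive_def)
  qed
qed

end

section \<open>Markov property of the jump path and its finite-dimensional distributions\<close>

context
  fixes \<Lambda> :: "real^'m::finite^'m"
  assumes coupling: "coupling_matrix \<Lambda>"
begin

text \<open>As functions of i and t, both sides solve the same renewal equation: if the first tick
  comes after t, memorylessness restarts the clock at t; otherwise the path restarts at the tick.
  Bounded solutions are unique.\<close>

lemma jump_path_markov:
  fixes s :: "nat \<Rightarrow> real" and z :: "nat \<Rightarrow> 'm"
  assumes t: "0 \<le> t" and s: "\<And>l. l < n \<Longrightarrow> 0 \<le> s l"
  shows "(\<integral>w. of_bool (jump_path i w t = j \<and> (\<forall>l<n. jump_path i w (t + s l) = z l)) \<partial>stream_space (mark_space \<Lambda>)) =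
    transition \<Lambda> t i j * (\<integral>w. of_bool (\<forall>l<n. jump_path j w (s l) = z l) \<partial>stream_space (mark_space \<Lambda>))"
proof -
  let ?S = "stream_space (mark_space \<Lambda>)"
  interpret M: prob_space "mark_space \<Lambda>" by (rule prob_space_mark_space[OF coupling])
  interpret S: prob_space ?S by (rule M.prob_space_stream_space)
  interpret C: prob_space "clock \<Lambda>" by (rule prob_space_clock[OF coupling])
  \<comment> \<open>\<open>G\<close> is the left side, \<open>g\<close> at j is the second factor on
    the right, and \<open>h\<close> is \<open>g\<close> conditioned on the first mark.\<close>
  define G where "G i t = (\<integral>w. of_bool (jump_path i w t = j \<and> (\<forall>l<n. jump_path i w (t + s l) = z l)) \<partial>?S :: real)" for i t
  define g where "g i = (\<integral>w. of_bool (\<forall>l<n. jump_path i w (s l) = z l) \<partial>?S :: real)" for i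
  define h where "h i x = (\<integral>w. of_bool (\<forall>l<n. jump_path i (x ## w) (s l) = z l) \<partial>?S :: real)" for i x
  have jp1 [measurable]: "(\<lambda>x. jump_path i (snd x) (f (fst x))) \<in> borel \<Otimes>\<^sub>M ?S \<rightarrow>\<^sub>M count_space UNIV"
    if [measurable]: "f \<in> borel_measurable borel" for i and f :: "real \<Rightarrow> real"
    by (rule measurable_jump_path) measurable
  have jp2 [measurable]: "(\<lambda>x. jump_path i (fst x ## snd x) t) \<in> mark_space \<Lambda> \<Otimes>\<^sub>M ?S \<rightarrow>\<^sub>M count_space UNIV" for i t
    by (rule measurable_jump_path) measurable
  have jp3 [measurable]: "(\<lambda>w. jump_path i (x ## w) t) \<in> ?S \<rightarrow>\<^sub>M count_space UNIV" for i x t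
    by (rule measurable_jump_path[where \<Lambda> = \<Lambda>]) measurable
  have jp4 [measurable]: "(\<lambda>w. jump_path i w t) \<in> ?S \<rightarrow>\<^sub>M count_space UNIV" for i t
    by (rule measurable_jump_path) measurable
  have G_meas [measurable]: "G i \<in> borel_measurable borel" for i
    unfolding G_def by (rule S.borel_measurable_lebesgue_integral) (unfold case_prod_beta', measurable)
  have h_meas [measurable]: "h i \<in> borel_measurable (mark_space \<Lambda>)" for i
    unfolding h_def by (rule S.borel_measurable_lebesgue_integral) (unfold case_prod_beta', measurable)
  have h_meas' [measurable]: "(\<lambda>p. h i (fst p - t, snd p)) \<in> borel_measurable (mark_space \<Lambda>)" for i t
    by (rule measurable_compose[OF _ h_meas]) (unfold mark_space_def, measurable)
  have of_bool_int: "\<bar>\<integral>w. of_bool (P w) \<partial>?S :: real\<bar> \<le> 1" for P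
  proof -
    have "(\<integral>w. of_bool (P w) \<partial>?S :: real) \<le> (\<integral>w. 1 \<partial>?S)"
      by (rule integral_mono') auto
    moreover have "0 \<le> (\<integral>w. of_bool (P w) \<partial>?S :: real)" by (intro integral_nonneg_AE) auto
    ultimately show ?thesis using S.prob_space by simp
  qed
  have G1: "\<bar>G i t\<bar> \<le> 1" for i t unfolding G_def by (rule of_bool_int)
  have h1: "\<bar>h i x\<bar> \<le> 1" for i x unfolding h_def by (rule of_bool_int)
  have g_eq: "g i = (\<integral>T. (\<integral>U. h i (T, U) \<partial>measure_pmf (Pi_pmf UNIV undefined (jump_pmf \<Lambda>))) \<partial>clock \<Lambda>)" for i
  proof -
    have "g i = (\<integral>x. h i x \<partial>mark_space \<Lambda>)"
      unfolding g_def h_def by (rule integral_mark_stream[OF coupling]) (measurable, auto)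
    also have "\<dots> = (\<integral>T. (\<integral>U. h i (T, U) \<partial>measure_pmf (Pi_pmf UNIV undefined (jump_pmf \<Lambda>))) \<partial>clock \<Lambda>)"
      by (rule integral_mark_space[OF coupling h_meas h1])
    finally show ?thesis .
  qed
  have hU_meas [measurable]: "(\<lambda>T. \<integral>U. h i (T, U) \<partial>measure_pmf (Pi_pmf UNIV undefined (jump_pmf \<Lambda>))) \<in> borel_measurable borel" for i
  proof -
    have "h i \<in> borel_measurable (borel \<Otimes>\<^sub>M measure_pmf (Pi_pmf UNIV undefined (jump_pmf \<Lambda>)))"
      using h_meas[of i] unfolding mark_space_def
      by (subst measurable_cong_sets[OF sets_pair_measure_cong[OF sets_clock[symmetric] refl] refl])
    then show ?thesis by measurable
  qed
  have renewal: "G i t = exp (- jump_rate \<Lambda> * t) * of_bool (i = j) * g j +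
     (\<integral>T. indicator {..t} T * (\<Sum>l\<in>UNIV. jump_weight \<Lambda> i l * G l (t - T)) \<partial>clock \<Lambda>)" if t: "0 \<le> t" for i t
  proof -
    let ?k = "\<lambda>x. (if t < fst x then of_bool (i = j) * h i (fst x - t, snd x) else G (snd x i) (t - fst x))"
    have k_meas: "?k \<in> borel_measurable (mark_space \<Lambda>)"
    proof -
      have [measurable]: "(\<lambda>x. G (snd x i) (t - fst x)) \<in> borel_measurable (mark_space \<Lambda>)"
        by (rule measurable_compose_countable[where g = "\<lambda>x. snd x i"]) measurable
      show ?thesis by measurable
    qed
    have "G i t = (\<integral>x. (\<integral>w. of_bool (jump_path i (x ## w) t = j \<and> (\<forall>l<n. jump_path i (x ## w) (t + s l) = z l)) \<partial>?S) \<partial>mark_space \<Lambda> :: real)"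
      unfolding G_def by (rule integral_mark_stream[OF coupling]) (measurable, auto)
    also have "\<dots> = (\<integral>x. ?k x \<partial>mark_space \<Lambda>)"
    proof (rule integral_cong_AE)
      show "AE x in mark_space \<Lambda>. (\<integral>w. of_bool (jump_path i (x ## w) t = j \<and> (\<forall>l<n. jump_path i (x ## w) (t + s l) = z l)) \<partial>?S :: real) = ?k x"
        using AE_mark_pos[OF coupling]
      proof eventually_elim
        case (elim x)
        show ?case
        proof (cases "t < fst x")
          \<comment> \<open>Shortening the first waiting time by t yields the path as seen from time
            t.\<close>
          case True
          have "(\<integral>w. of_bool (jump_path i (x ## w) t = j \<and> (\<forall>l<n. jump_path i (x ## w) (t + s l) = z l)) \<partial>?S :: real) =
             (\<integral>w. of_bool (i = j) * of_bool (\<forall>l<n. jump_path i ((fst x - t, snd x) ## w) (s l) = z l) \<partial>?S)"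
          proof (rule integral_cong_AE)
            show "AE w in ?S. of_bool (jump_path i (x ## w) t = j \<and> (\<forall>l<n. jump_path i (x ## w) (t + s l) = z l)) =
               (of_bool (i = j) * of_bool (\<forall>l<n. jump_path i ((fst x - t, snd x) ## w) (s l) = z l) :: real)"
              using AE_nonexplosive[OF coupling]
            proof eventually_elim
              case (elim w)
              have 1: "nonexplosive (x ## w)" "nonexplosive ((fst x - t, snd x) ## w)"
                using elim \<open>0 < fst x\<close> True by (auto simp: nonexplosive_Stream)
              have "jump_path i (x ## w) (t + s l) = jump_path i ((fst x - t, snd x) ## w) (s l)" if "l < n" for l
                using s[OF that] t True by (auto simp: jump_path_Stream[OF 1(1)] jump_path_Stream[OF 1(2)] algebra_simps)
              moreover have "jump_path i (x ## w) t = i" using t True by (simp add: jump_path_Stream[OF 1(1)])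
              ultimately show ?case by auto
            qed
          qed measurable
          then show ?thesis using True by (simp add: h_def)
        next
          case False
          have "(\<integral>w. of_bool (jump_path i (x ## w) t = j \<and> (\<forall>l<n. jump_path i (x ## w) (t + s l) = z l)) \<partial>?S :: real) =
             G (snd x i) (t - fst x)"
            unfolding G_def
          proof (rule integral_cong_AE)
            show "AE w in ?S. of_bool (jump_path i (x ## w) t = j \<and> (\<forall>l<n. jump_path i (x ## w) (t + s l) = z l)) =
               (of_bool (jump_path (snd x i) w (t - fst x) = j \<and> (\<forall>l<n. jump_path (snd x i) w (t - fst x + s l) = z l)) :: real)"
              using AE_nonexplosive[OF coupling]
            proof eventually_elim
              case (elim w)
              have 1: "nonexplosive (x ## w)"
                using elim \<open>0 < fst x\<close> by (auto simp: nonexplosive_Stream)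
              have "jump_path i (x ## w) (t + s l) = jump_path (snd x i) w (t - fst x + s l)" if "l < n" for l
                using s[OF that] t False by (auto simp: jump_path_Stream[OF 1(1)] algebra_simps)
              moreover have "jump_path i (x ## w) t = jump_path (snd x i) w (t - fst x)"
                using t False by (simp add: jump_path_Stream[OF 1(1)])
              ultimately show ?case by auto
            qed
          qed measurable
          then show ?thesis using False by simp
        qed
      qed
      show "(\<lambda>x. \<integral>w. of_bool (jump_path i (x ## w) t = j \<and> (\<forall>l<n. jump_path i (x ## w) (t + s l) = z l)) \<partial>?S :: real)
          \<in> borel_measurable (mark_space \<Lambda>)"
        by (rule S.borel_measurable_lebesgue_integral) (unfold case_prod_beta', measurable)
    qed (rule k_meas)
    also have "\<dots> = (\<integral>T. (\<integral>U. ?k (T, U) \<partial>measure_pmf (Pi_pmf UNIV undefined (jump_pmf \<Lambda>))) \<partial>clock \<Lambda>)"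
      by (rule integral_mark_space[OF coupling k_meas, of 1]) (auto simp: G1 h1)
    also have "\<dots> = (\<integral>T. of_bool (i = j) * (indicator {t<..} T * (\<integral>U. h i (T - t, U) \<partial>measure_pmf (Pi_pmf UNIV undefined (jump_pmf \<Lambda>))))
        + indicator {..t} T * (\<Sum>l\<in>UNIV. jump_weight \<Lambda> i l * G l (t - T)) \<partial>clock \<Lambda>)"
    proof (rule Bochner_Integration.integral_cong[OF refl])
      fix T
      show "(\<integral>U. ?k (T, U) \<partial>measure_pmf (Pi_pmf UNIV undefined (jump_pmf \<Lambda>))) =
        of_bool (i = j) * (indicator {t<..} T * (\<integral>U. h i (T - t, U) \<partial>measure_pmf (Pi_pmf UNIV undefined (jump_pmf \<Lambda>))))
        + indicator {..t} T * (\<Sum>l\<in>UNIV. jump_weight \<Lambda> i l * G l (t - T))"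
        by (cases "t < T") (auto simp: integral_Pi_jump[OF coupling, of "\<lambda>l. G l (t - T)" i])
    qed
    also have "\<dots> = (\<integral>T. of_bool (i = j) * (indicator {t<..} T * (\<integral>U. h i (T - t, U) \<partial>measure_pmf (Pi_pmf UNIV undefined (jump_pmf \<Lambda>)))) \<partial>clock \<Lambda>)
        + (\<integral>T. indicator {..t} T * (\<Sum>l\<in>UNIV. jump_weight \<Lambda> i l * G l (t - T)) \<partial>clock \<Lambda>)"
    proof (rule Bochner_Integration.integral_add)
      have bU: "\<bar>\<integral>U. h i (T - t, U) \<partial>measure_pmf (Pi_pmf UNIV undefined (jump_pmf \<Lambda>))\<bar> \<le> 1" for T
        using h1 by (intro order_trans[OF integral_abs_bound] measure_pmf.integral_le_const measure_pmf.integrable_const_bound[of _ 1]) auto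
      show "integrable (clock \<Lambda>) (\<lambda>T. of_bool (i = j) * (indicator {t<..} T * (\<integral>U. h i (T - t, U) \<partial>measure_pmf (Pi_pmf UNIV undefined (jump_pmf \<Lambda>)))))"
        by (rule C.integrable_const_bound[of _ 1]) (use bU in \<open>auto split: split_indicator\<close>)
      have bS: "\<bar>\<Sum>l\<in>UNIV. jump_weight \<Lambda> i l * G l (t - T)\<bar> \<le> 1" for T
      proof -
        have "\<bar>\<Sum>l\<in>UNIV. jump_weight \<Lambda> i l * G l (t - T)\<bar> \<le> (\<Sum>l\<in>UNIV. jump_weight \<Lambda> i l * 1)"
          by (rule order_trans[OF sum_abs], rule sum_mono)
             (auto simp: abs_mult jump_weight_nonneg[OF coupling] G1 intro!: mult_left_le)
        then show ?thesis by (simp add: jump_weight_sum[OF coupling])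
      qed
      show "integrable (clock \<Lambda>) (\<lambda>T. indicator {..t} T * (\<Sum>l\<in>UNIV. jump_weight \<Lambda> i l * G l (t - T)))"
        by (rule C.integrable_const_bound[of _ 1]) (use bS in \<open>auto split: split_indicator\<close>)
    qed
    also have "(\<integral>T. of_bool (i = j) * (indicator {t<..} T * (\<integral>U. h i (T - t, U) \<partial>measure_pmf (Pi_pmf UNIV undefined (jump_pmf \<Lambda>)))) \<partial>clock \<Lambda>)
        = of_bool (i = j) * (exp (- jump_rate \<Lambda> * t) * g i)"
      using clock_memoryless[OF coupling hU_meas t, of i] by (simp add: g_eq)
    finally show ?thesis by (cases "i = j") auto
  qed
  \<comment> \<open>The equation for \<open>G\<close> and \<open>g j\<close> times the equation for
    the transition probabilities have the same inhomogeneous term, so the difference solves the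
    homogeneous equation.\<close>
  define D where "D i t = G i t - transition \<Lambda> t i j * g j" for i t
  have g1: "\<bar>g i\<bar> \<le> 1" for i unfolding g_def by (rule of_bool_int)
  have trans_meas [measurable]: "(\<lambda>t. transition \<Lambda> t i j) \<in> borel_measurable borel" for i
    by (intro borel_measurable_continuous_onI continuous_on_transition)
  have D_meas: "D i \<in> borel_measurable borel" for i unfolding D_def by measurable
  have "\<exists>B. \<forall>t'\<in>{0..t}. \<bar>transition \<Lambda> t' i j\<bar> \<le> B" for i
    using compact_imp_bounded[OF compact_continuous_image[OF continuous_on_transition[of _ \<Lambda> i j] compact_Icc[of 0 t]]]
    unfolding bounded_iff by auto
  then obtain B where B: "\<And>i t'. t' \<in> {0..t} \<Longrightarrow> \<bar>transition \<Lambda> t' i j\<bar> \<le> B i" by metis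
  have tb: "\<bar>transition \<Lambda> t' i j\<bar> \<le> (\<Sum>i\<in>UNIV. \<bar>B i\<bar>)" if "t' \<in> {0..t}" for i t'
    using B[OF that, of i] member_le_sum[of i UNIV "\<lambda>i. \<bar>B i\<bar>"] by auto
  have "D i t = 0"
  proof (rule renewal_unique[OF coupling, of D t "1 + (\<Sum>i\<in>UNIV. \<bar>B i\<bar>)", OF D_meas])
    show "\<bar>D i t'\<bar> \<le> 1 + (\<Sum>i\<in>UNIV. \<bar>B i\<bar>)" if "0 \<le> t'" "t' \<le> t" for i t'
    proof -
      have "\<bar>transition \<Lambda> t' i j * g j\<bar> \<le> (\<Sum>i\<in>UNIV. \<bar>B i\<bar>) * 1"
        unfolding abs_mult using that g1 tb[of t' i] by (intro mult_mono) (auto intro: sum_nonneg)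
      then show ?thesis using G1[of i t'] by (auto simp: D_def)
    qed
    show "D i t' = (\<integral>T. indicator {..t'} T * (\<Sum>l\<in>UNIV. jump_weight \<Lambda> i l * D l (t' - T)) \<partial>clock \<Lambda>)"
      if t': "0 \<le> t'" "t' \<le> t" for i t'
    proof -
      let ?A = "\<lambda>T. indicator {..t'} T * (\<Sum>l\<in>UNIV. jump_weight \<Lambda> i l * G l (t' - T)) :: real"
      let ?B = "\<lambda>T. indicator {..t'} T * (\<Sum>l\<in>UNIV. jump_weight \<Lambda> i l * transition \<Lambda> (t' - T) l j) :: real"
      have iA: "integrable (clock \<Lambda>) ?A"
      proof (rule C.integrable_const_bound)
        have "\<bar>\<Sum>l\<in>UNIV. jump_weight \<Lambda> i l * G l (t' - T)\<bar> \<le> (\<Sum>l\<in>UNIV. jump_weight \<Lambda> i l * 1)" for T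
          by (rule order_trans[OF sum_abs], rule sum_mono)
             (auto simp: abs_mult jump_weight_nonneg[OF coupling] G1 intro!: mult_left_le)
        then show "AE T in clock \<Lambda>. norm (?A T) \<le> 1"
          by (auto simp: jump_weight_sum[OF coupling] split: split_indicator)
      qed measurable
      have iB: "integrable (clock \<Lambda>) ?B"
      proof (rule C.integrable_const_bound)
        have "\<bar>\<Sum>l\<in>UNIV. jump_weight \<Lambda> i l * transition \<Lambda> (t' - T) l j\<bar> \<le> (\<Sum>l\<in>UNIV. jump_weight \<Lambda> i l * (\<Sum>i\<in>UNIV. \<bar>B i\<bar>))"
          if "0 < T" "T \<le> t'" for T
          using that t' by (intro order_trans[OF sum_abs] sum_mono)
             (auto simp: abs_mult jump_weight_nonneg[OF coupling] intro!: mult_left_mono tb)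
        then have "norm (?B T) \<le> (\<Sum>i\<in>UNIV. \<bar>B i\<bar>)" if "0 < T" for T
          using that by (auto simp: jump_weight_sum[OF coupling] sum_nonneg simp flip: sum_distrib_right split: split_indicator)
        then show "AE T in clock \<Lambda>. norm (?B T) \<le> (\<Sum>i\<in>UNIV. \<bar>B i\<bar>)"
          using AE_clock_pos[OF coupling] by auto
      qed measurable
      have "D i t' = (\<integral>T. ?A T \<partial>clock \<Lambda>) - g j * (\<integral>T. ?B T \<partial>clock \<Lambda>)"
        unfolding D_def by (subst renewal[OF t'(1)], subst transition_renewal[OF coupling t'(1)]) (simp add: algebra_simps)
      also have "\<dots> = (\<integral>T. ?A T - g j * ?B T \<partial>clock \<Lambda>)"
        using iA iB by simp
      also have "\<dots> = (\<integral>T. indicator {..t'} T * (\<Sum>l\<in>UNIV. jump_weight \<Lambda> i l * D l (t' - T)) \<partial>clock \<Lambda>)"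
        by (rule Bochner_Integration.integral_cong[OF refl])
           (simp add: D_def sum_distrib_left sum_subtractf algebra_simps)
      finally show ?thesis .
    qed
  qed (use t in auto)
  then show ?thesis by (simp add: D_def G_def g_def)
qed

text \<open>The Markov property at the first time leaves the differences to it, which again increase
  from a nonnegative start and are one fewer.\<close>

lemma jump_path_fdd:
  fixes t :: "nat \<Rightarrow> real" and j :: "nat \<Rightarrow> 'm"
  assumes "0 \<le> t 0" "\<And>l. l < k \<Longrightarrow> t l < t (Suc l)"
  shows "(\<integral>w. of_bool (\<forall>l\<le>k. jump_path i w (t l) = j l) \<partial>stream_space (mark_space \<Lambda>)) =
    transition \<Lambda> (t 0) i (j 0) * (\<Prod>l<k. transition \<Lambda> (t (Suc l) - t l) (j l) (j (Suc l)))"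
  using assms
proof (induction k arbitrary: i t j)
  case 0
  interpret M: prob_space "mark_space \<Lambda>" by (rule prob_space_mark_space[OF coupling])
  interpret S: prob_space "stream_space (mark_space \<Lambda>)" by (rule M.prob_space_stream_space)
  show ?case using jump_path_markov[OF 0(1), of 0 "\<lambda>_. 0" i "j 0"] S.prob_space by simp
next
  case (Suc k)
  have mono: "t 0 \<le> t l" if "l \<le> Suc k" for l
    using that
  proof (induction l)
    case (Suc l)
    then show ?case using Suc.IH Suc.prems assms \<open>\<And>l. l < Suc k \<Longrightarrow> t l < t (Suc l)\<close>[of l] by simp
  qed simp
  have "(\<forall>l\<le>Suc k. P l) \<longleftrightarrow> P 0 \<and> (\<forall>l<Suc k. P (Suc l))" for P
    by (metis Suc_le_mono less_Suc_eq_le not0_implies_Suc zero_le)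
  then have "(\<integral>w. of_bool (\<forall>l\<le>Suc k. jump_path i w (t l) = j l) \<partial>stream_space (mark_space \<Lambda>)) =
    (\<integral>w. of_bool (jump_path i w (t 0) = j 0 \<and> (\<forall>l<Suc k. jump_path i w (t 0 + (t (Suc l) - t 0)) = j (Suc l))) \<partial>stream_space (mark_space \<Lambda>))"
    by simp
  also have "\<dots> = transition \<Lambda> (t 0) i (j 0) *
      (\<integral>w. of_bool (\<forall>l<Suc k. jump_path (j 0) w (t (Suc l) - t 0) = j (Suc l)) \<partial>stream_space (mark_space \<Lambda>))"
    by (rule jump_path_markov) (use Suc.prems(1) mono in auto)
  also have "(\<integral>w. of_bool (\<forall>l<Suc k. jump_path (j 0) w (t (Suc l) - t 0) = j (Suc l)) \<partial>stream_space (mark_space \<Lambda>)) =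
     transition \<Lambda> (t (Suc 0) - t 0) (j 0) (j (Suc 0)) * (\<Prod>l<k. transition \<Lambda> (t (Suc (Suc l)) - t (Suc l)) (j (Suc l)) (j (Suc (Suc l))))"
    using Suc.IH[of "\<lambda>l. t (Suc l) - t 0" "j 0" "\<lambda>l. j (Suc l)"] Suc.prems(2) mono[of "Suc 0"]
    by (simp add: less_Suc_eq_le)
  finally show ?case by (simp only: prod.lessThan_Suc_shift)
qed

end

subsection \<open>Hamiltonians and Lagrangians on the torus\<close>

text \<open>The closed cube, because compactness is what is exploited; distinct points on opposite
  faces may represent the same point of the torus.\<close>

definition unit_cube :: "(real^'n) set" where
  "unit_cube = cbox 0 (\<chi> k. 1)"

lemma compact_unit_cube: "compact (unit_cube :: (real^'n) set)"
  by (simp add: unit_cube_def)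

lemma unit_cube_nonempty: "(0 :: real^'n) \<in> unit_cube"
  by (simp add: unit_cube_def mem_box_cart)

lemma int_lattice_translate_to_unit_cube:
  fixes x :: "real^'n"
  obtains z where "z \<in> int_lattice" "x + z \<in> unit_cube"
proof
  let ?z = "\<chi> k. - of_int \<lfloor>x $ k\<rfloor> :: real^'n"
  show "?z \<in> int_lattice" by (simp add: int_lattice_def)
  show "x + ?z \<in> unit_cube"
    by (simp add: unit_cube_def mem_box_cart) (metis frac_def frac_ge_0 frac_lt_1 less_eq_real_def)
qed

lemma int_lattice_uminus: "z \<in> int_lattice \<Longrightarrow> - z \<in> int_lattice"
  by (simp add: int_lattice_def)

lemma int_lattice_add: "z \<in> int_lattice \<Longrightarrow> z' \<in> int_lattice \<Longrightarrow> z + z' \<in> int_lattice"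
  by (simp add: int_lattice_def)

lemma zero_in_int_lattice: "0 \<in> int_lattice"
  by (simp add: int_lattice_def)

lemma torus_periodicD: "torus_periodic f \<Longrightarrow> z \<in> int_lattice \<Longrightarrow> f (x + z) = f x"
  by (simp add: torus_periodic_def)

lemma torus_periodic_range:
  assumes "torus_periodic f"
  shows "range f = f ` unit_cube"
proof -
  have "f x \<in> f ` unit_cube" for x
  proof -
    obtain z where "z \<in> int_lattice" "x + z \<in> unit_cube" by (rule int_lattice_translate_to_unit_cube)
    with torus_periodicD[OF assms, of z x] show ?thesis by (metis image_eqI)
  qed
  then show ?thesis by auto
qed

lemma torus_periodic_bounded:
  fixes f :: "real^'n \<Rightarrow> 'b::real_normed_vector"
  assumes "torus_periodic f" "continuous_on UNIV f"
  shows "\<exists>B>0. \<forall>x. norm (f x) \<le> B"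
proof -
  have "compact (range f)"
    unfolding torus_periodic_range[OF assms(1)]
    using assms(2) compact_unit_cube by (intro compact_continuous_image) (auto intro: continuous_on_subset)
  then have "bounded (range f)" by (rule compact_imp_bounded)
  then show ?thesis by (auto simp: bounded_pos)
qed

context
  fixes H :: "'m::finite \<Rightarrow> real^'n \<Rightarrow> real^'n \<Rightarrow> real"
  assumes H: "hamiltonians H"
begin

lemma hamiltonian_periodic: "z \<in> int_lattice \<Longrightarrow> H i (x + z) p = H i x p"
  using H by (simp add: hamiltonians_def torus_periodic_def)

lemma hamiltonian_continuous: "continuous_on UNIV (\<lambda>(x, p). H i x p)"
  using H by (simp add: hamiltonians_def)

lemma hamiltonian_tendsto:
  assumes "(f \<longlongrightarrow> x) F" "(g \<longlongrightarrow> p) F"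
  shows "((\<lambda>n. H i (f n) (g n)) \<longlongrightarrow> H i x p) F"
proof -
  have "isCont (\<lambda>(x, p). H i x p) (x, p)"
    using hamiltonian_continuous by (simp add: continuous_on_eq_continuous_at)
  from isCont_tendsto_compose[OF this tendsto_Pair[OF assms]] show ?thesis by simp
qed

lemma hamiltonian_convex: "convex_on UNIV (H i x)"
  using H by (simp add: hamiltonians_def)

lemma hamiltonian_superlinear: "filterlim (\<lambda>p. H i x p / norm p) at_top at_infinity"
  using H by (simp add: hamiltonians_def)

text \<open>Convexity along the ray from 0: if H stays below linear growth of slope K at p, it does
  so at every shorter multiple of p. A failure of growth far away thus becomes visible at any fixed
  radius.\<close>

lemma hamiltonian_radial:
  assumes "H i x p < H i x 0 + K * norm p" "0 \<le> r" "r \<le> norm p" "p \<noteq> 0"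
  shows "H i x ((r / norm p) *\<^sub>R p) \<le> H i x 0 + K * r"
proof -
  define s where "s = r / norm p"
  have s: "0 \<le> s" "s \<le> 1" using assms by (auto simp: s_def)
  have "H i x ((1 - s) *\<^sub>R 0 + s *\<^sub>R p) \<le> (1 - s) * H i x 0 + s * H i x p"
    using hamiltonian_convex s by (intro convex_onD) auto
  also have "s * H i x p \<le> s * (H i x 0 + K * norm p)"
    using s assms(1) by (intro mult_left_mono) auto
  also have "(1 - s) * H i x 0 + s * (H i x 0 + K * norm p) = H i x 0 + K * (s * norm p)"
    by (simp add: algebra_simps)
  also have "s * norm p = r" using assms by (simp add: s_def)
  finally show ?thesis by (simp add: s_def)
qed

text \<open>Superlinearity is assumed for each x separately. If uniformity failed, base points and
  directions of failures at radii tending to infinity would have limits, and by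
  \<open>hamiltonian_radial\<close> the Hamiltonian would grow at most linearly along the limiting
  ray.\<close>

lemma hamiltonian_uniformly_superlinear:
  "\<exists>R>0. \<forall>x p. R \<le> norm p \<longrightarrow> H i x 0 + K * norm p \<le> H i x p"
proof (rule ccontr)
  assume *: "\<not> ?thesis"
  have "\<exists>x p. x \<in> unit_cube \<and> real (Suc n) \<le> norm p \<and> H i x p < H i x 0 + K * norm p" for n
  proof -
    obtain x p where xp: "real (Suc n) \<le> norm p" "H i x p < H i x 0 + K * norm p"
      using * of_nat_0_less_iff[where n = "Suc n"] zero_less_Suc unfolding not_less[symmetric] by blast
    obtain z where "z \<in> int_lattice" "x + z \<in> unit_cube" by (rule int_lattice_translate_to_unit_cube)
    with xp show ?thesis by (intro exI[of _ "x + z"] exI[of _ p]) (simp add: hamiltonian_periodic)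
  qed
  then obtain x p where xp: "\<And>n. x n \<in> unit_cube" "\<And>n. real (Suc n) \<le> norm (p n)"
    "\<And>n. H i (x n) (p n) < H i (x n) 0 + K * norm (p n)"
    by metis
  define e where "e n = (1 / norm (p n)) *\<^sub>R p n" for n
  have p0: "p n \<noteq> 0" for n using xp(2)[of n] by auto
  then have "(x n, e n) \<in> unit_cube \<times> sphere 0 1" for n using xp(1) by (simp add: e_def)
  moreover have "compact (unit_cube \<times> sphere (0::real^'n) 1 :: ((real^'n) \<times> (real^'n)) set)"
    by (intro compact_Times compact_unit_cube compact_sphere)
  ultimately obtain l s where l: "l \<in> unit_cube \<times> sphere 0 1" and s: "strict_mono (s :: nat \<Rightarrow> nat)"
    and lim: "((\<lambda>n. (x n, e n)) \<circ> s) \<longlonglongrightarrow> l"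
    unfolding compact_def by (metis (no_types, lifting))
  obtain x0 e0 where l0: "l = (x0, e0)" by (cases l)
  have limx: "(\<lambda>n. x (s n)) \<longlonglongrightarrow> x0" and lime: "(\<lambda>n. e (s n)) \<longlonglongrightarrow> e0"
    using tendsto_fst[OF lim] tendsto_snd[OF lim] by (simp_all add: l0 o_def)
  have e0: "norm e0 = 1" using l l0 by simp
  have bound: "H i x0 (r *\<^sub>R e0) \<le> H i x0 0 + K * r" if r: "0 \<le> r" for r
  proof (rule tendsto_le[OF sequentially_bot])
    show "(\<lambda>n. H i (x (s n)) (r *\<^sub>R e (s n))) \<longlonglongrightarrow> H i x0 (r *\<^sub>R e0)"
      by (intro hamiltonian_tendsto limx tendsto_intros lime)
    show "(\<lambda>n. H i (x (s n)) 0 + K * r) \<longlonglongrightarrow> H i x0 0 + K * r"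
      by (intro hamiltonian_tendsto limx tendsto_intros)
    show "\<forall>\<^sub>F n in sequentially. H i (x (s n)) (r *\<^sub>R e (s n)) \<le> H i (x (s n)) 0 + K * r"
    proof (rule eventually_sequentiallyI[of "nat \<lceil>r\<rceil>"])
      fix n assume "nat \<lceil>r\<rceil> \<le> n"
      then have "r \<le> real n" by linarith
      also have "n \<le> s n" using s by (rule seq_suble)
      then have "real n \<le> norm (p (s n))" using xp(2)[of "s n"] by simp
      finally show "H i (x (s n)) (r *\<^sub>R e (s n)) \<le> H i (x (s n)) 0 + K * r"
        using hamiltonian_radial[OF xp(3) r _ p0] by (simp add: e_def)
    qed
  qed
  \<comment> \<open>For r at least 1 the ray bound H(x0, 0) / r + K stays below this threshold,
    which is the contradiction sought.\<close>
  obtain N where N: "\<And>p. N \<le> norm p \<Longrightarrow> \<bar>H i x0 0\<bar> + K + 1 \<le> H i x0 p / norm p"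
    using hamiltonian_superlinear[of i x0] unfolding filterlim_at_top eventually_at_infinity by meson
  define r where "r = max N 1"
  have "\<bar>H i x0 0\<bar> + K + 1 \<le> H i x0 (r *\<^sub>R e0) / r"
    using N[of "r *\<^sub>R e0"] e0 by (simp add: r_def)
  also have "\<dots> \<le> (H i x0 0 + K * r) / r"
    using bound[of r] by (intro divide_right_mono) (auto simp: r_def)
  also have "\<dots> = H i x0 0 / r + K" by (simp add: r_def field_simps)
  also have "H i x0 0 / r \<le> \<bar>H i x0 0\<bar>"
  proof -
    have "1 \<le> r" by (simp add: r_def)
    then have "\<bar>H i x0 0\<bar> * 1 \<le> \<bar>H i x0 0\<bar> * r" by (intro mult_left_mono) auto
    then show ?thesis using \<open>1 \<le> r\<close> by (simp add: pos_divide_le_eq)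
  qed
  finally show False by simp
qed

text \<open>When K bounds the norm of q, growth of slope K makes every p outside a fixed ball no
  better than p = 0. A ball that does not depend on x is what makes the Lagrangian continuous and
  locally bounded.\<close>

lemma lagrangian_attained:
  "\<exists>R>0. \<forall>x q. norm q \<le> K \<longrightarrow>
    (\<exists>p. norm p \<le> R \<and> lagrangian H i x q = p \<bullet> q - H i x p \<and> (\<forall>p'. p' \<bullet> q - H i x p' \<le> p \<bullet> q - H i x p))"
proof -
  obtain R where R: "0 < R" "\<And>x p. R \<le> norm p \<Longrightarrow> H i x 0 + K * norm p \<le> H i x p"
    using hamiltonian_uniformly_superlinear[of i K] by blast
  have "\<exists>p. norm p \<le> R \<and> lagrangian H i x q = p \<bullet> q - H i x p \<and> (\<forall>p'. p' \<bullet> q - H i x p' \<le> p \<bullet> q - H i x p)"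
    if q: "norm q \<le> K" for x q
  proof -
    have "continuous_on UNIV (\<lambda>p. (x, p))" by (intro continuous_intros)
    then have "continuous_on UNIV (\<lambda>p. H i x p)"
      using continuous_on_compose2[OF hamiltonian_continuous] by fastforce
    then have "continuous_on (cball 0 R) (\<lambda>p. p \<bullet> q - H i x p)"
      by (intro continuous_intros) (auto intro: continuous_on_subset)
    then obtain p where p: "p \<in> cball 0 R" "\<And>p'. p' \<in> cball 0 R \<Longrightarrow> p' \<bullet> q - H i x p' \<le> p \<bullet> q - H i x p"
      using continuous_attains_sup[OF compact_cball, of 0 R] R(1) by fastforce
    have all: "p' \<bullet> q - H i x p' \<le> p \<bullet> q - H i x p" for p'
    proof (cases "norm p' \<le> R")
      case False
      have "p' \<bullet> q \<le> norm p' * K"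
        using norm_cauchy_schwarz[of p' q] mult_left_mono[OF q norm_ge_zero[of p']] by simp
      with R(2)[of p' x] False have "p' \<bullet> q - H i x p' \<le> 0 \<bullet> q - H i x 0" by (simp add: mult.commute)
      also have "\<dots> \<le> p \<bullet> q - H i x p" using R(1) by (intro p(2)) simp
      finally show ?thesis .
    qed (simp add: p)
    then have "lagrangian H i x q = p \<bullet> q - H i x p"
      unfolding lagrangian_def by (intro cSup_eq_maximum) auto
    with p(1) all show ?thesis by auto
  qed
  with R(1) show ?thesis by blast
qed

lemma fenchel_inequality: "p \<bullet> q - H i x p \<le> lagrangian H i x q"
proof -
  obtain p' where "lagrangian H i x q = p' \<bullet> q - H i x p'" "p \<bullet> q - H i x p \<le> p' \<bullet> q - H i x p'"
    using lagrangian_attained[of "norm q" i] by blast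
  then show ?thesis by simp
qed

lemma lagrangian_periodic: "z \<in> int_lattice \<Longrightarrow> lagrangian H i (x + z) q = lagrangian H i x q"
  by (simp add: lagrangian_def hamiltonian_periodic)

text \<open>Near (x0, q0) the supremum runs over one compact ball, on which p \<bullet> q - H is
  uniformly continuous; using each maximiser as a competitor at the other point gives the two
  inequalities.\<close>

lemma lagrangian_continuous: "continuous_on UNIV (\<lambda>(x, q). lagrangian H i x q)"
proof -
  have "isCont (\<lambda>(x, q). lagrangian H i x q) (x0, q0)" for x0 q0
  proof -
    obtain R where R: "0 < R" "\<And>x q. norm q \<le> norm q0 + 1 \<Longrightarrow>
       \<exists>p. norm p \<le> R \<and> lagrangian H i x q = p \<bullet> q - H i x p \<and> (\<forall>p'. p' \<bullet> q - H i x p' \<le> p \<bullet> q - H i x p)"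
      using lagrangian_attained[of "norm q0 + 1" i] by blast
    define \<phi> where "\<phi> = (\<lambda>((x, q), p). p \<bullet> q - H i x p)"
    define C where "C = (cball x0 1 \<times> cball q0 1) \<times> cball (0::real^'n) R"
    have "continuous_on UNIV (\<lambda>((x, q), p). H i x p)"
      using continuous_on_compose2[OF hamiltonian_continuous, of UNIV "\<lambda>((x, q), p). (x, p)" i]
      by (simp add: case_prod_beta' continuous_on_fst continuous_on_snd continuous_on_Pair continuous_on_id)
    then have "continuous_on C \<phi>"
      unfolding \<phi>_def case_prod_beta' by (intro continuous_intros) (auto intro: continuous_on_subset)
    moreover have "compact C" unfolding C_def by (intro compact_Times compact_cball)
    ultimately have uc: "uniformly_continuous_on C \<phi>" by (rule compact_uniformly_continuous)
    show ?thesis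
      unfolding continuous_at_eps_delta
    proof (intro allI impI)
      fix e :: real assume "0 < e"
      then obtain d where d: "d > 0"
        "\<And>a b. a \<in> C \<Longrightarrow> b \<in> C \<Longrightarrow> dist b a < d \<Longrightarrow> dist (\<phi> b) (\<phi> a) < e"
        using uc unfolding uniformly_continuous_on_def by metis
      show "\<exists>d>0. \<forall>x'. dist x' (x0, q0) < d \<longrightarrow>
          dist (case x' of (x, q) \<Rightarrow> lagrangian H i x q) (case (x0, q0) of (x, q) \<Rightarrow> lagrangian H i x q) < e"
      proof (intro exI[of _ "min d 1"] conjI allI impI)
        fix a :: "(real^'n) \<times> (real^'n)" assume a: "dist a (x0, q0) < min d 1"
        obtain x q where xq: "a = (x, q)" by (cases a)
        have xq1: "dist x x0 < 1" "dist q q0 < 1"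
          using a dist_fst_le[of a "(x0, q0)"] dist_snd_le[of a "(x0, q0)"] by (auto simp: xq)
        then have nq: "norm q \<le> norm q0 + 1" using norm_triangle_sub[of q q0] by (simp add: dist_norm)
        have close: "\<bar>\<phi> ((x, q), p) - \<phi> ((x0, q0), p)\<bar> < e" if "norm p \<le> R" for p
          using d(2)[of "((x0, q0), p)" "((x, q), p)"] xq1 a that
          by (auto simp: C_def xq dist_Pair_Pair dist_real_def dist_commute)
        obtain p where p: "norm p \<le> R" "lagrangian H i x q = p \<bullet> q - H i x p" using R(2)[OF nq] by blast
        obtain p0 where p0: "norm p0 \<le> R" "lagrangian H i x0 q0 = p0 \<bullet> q0 - H i x0 p0"
          using R(2)[of q0 x0] by auto
        have "lagrangian H i x q < lagrangian H i x0 q0 + e"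
          using close[OF p(1)] fenchel_inequality[of p q0 i x0] p(2) by (auto simp: \<phi>_def)
        moreover have "lagrangian H i x0 q0 < lagrangian H i x q + e"
          using close[OF p0(1)] fenchel_inequality[of p0 q i x] p0(2) by (auto simp: \<phi>_def)
        ultimately show "dist (case a of (x, q) \<Rightarrow> lagrangian H i x q)
            (case (x0, q0) of (x, q) \<Rightarrow> lagrangian H i x q) < e"
          by (simp add: xq dist_real_def)
      qed (use d(1) in auto)
    qed
  qed
  then show ?thesis by (auto simp: continuous_on_eq_continuous_at)
qed

lemma lagrangian_tendsto:
  assumes "(f \<longlongrightarrow> x) F" "(g \<longlongrightarrow> p) F"
  shows "((\<lambda>n. lagrangian H i (f n) (g n)) \<longlongrightarrow> lagrangian H i x p) F"
proof -
  have "isCont (\<lambda>(x, p). lagrangian H i x p) (x, p)"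
    using lagrangian_continuous by (simp add: continuous_on_eq_continuous_at)
  from isCont_tendsto_compose[OF this tendsto_Pair[OF assms]] show ?thesis by simp
qed

lemma continuous_on_lagrangian [continuous_intros]:
  assumes "continuous_on A f" "continuous_on A g"
  shows "continuous_on A (\<lambda>x. lagrangian H i (f x) (g x))"
  using continuous_on_compose2[OF lagrangian_continuous continuous_on_Pair[OF assms]] by simp

lemma lagrangian_bounded:
  "\<exists>B>0. \<forall>i x q. norm q \<le> K \<longrightarrow> \<bar>lagrangian H i x q\<bar> \<le> B"
proof -
  define C where "C = (unit_cube \<times> cball (0::real^'n) K :: ((real^'n) \<times> (real^'n)) set)"
  have "\<exists>B. \<forall>x q. norm q \<le> K \<longrightarrow> \<bar>lagrangian H i x q\<bar> \<le> B" for i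
  proof -
    have "compact C" unfolding C_def by (intro compact_Times compact_unit_cube compact_cball)
    then have "compact ((\<lambda>(x, q). lagrangian H i x q) ` C)"
      by (intro compact_continuous_image continuous_on_subset[OF lagrangian_continuous]) auto
    then obtain B where B: "\<And>a. a \<in> C \<Longrightarrow> \<bar>(\<lambda>(x, q). lagrangian H i x q) a\<bar> \<le> B"
      using bounded_iff[THEN iffD1, OF compact_imp_bounded] by fastforce
    have "\<bar>lagrangian H i x q\<bar> \<le> B" if "norm q \<le> K" for x q
    proof -
      obtain z where "z \<in> int_lattice" "x + z \<in> unit_cube" by (rule int_lattice_translate_to_unit_cube)
      with B[of "(x + z, q)"] that show ?thesis by (simp add: C_def lagrangian_periodic)
    qed
    then show ?thesis by blast
  qed
  then obtain B where B: "\<And>i x q. norm q \<le> K \<Longrightarrow> \<bar>lagrangian H i x q\<bar> \<le> B i" by metis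
  show ?thesis
  proof (intro exI[of _ "1 + (\<Sum>i\<in>UNIV. \<bar>B i\<bar>)"] conjI allI impI)
    fix i x q assume "norm (q::real^'n) \<le> K"
    then have "\<bar>lagrangian H i x q\<bar> \<le> \<bar>B i\<bar>" using B[of q i x] by linarith
    also have "\<dots> \<le> (\<Sum>i\<in>UNIV. \<bar>B i\<bar>)" by (rule member_le_sum) auto
    finally show "\<bar>lagrangian H i x q\<bar> \<le> 1 + (\<Sum>i\<in>UNIV. \<bar>B i\<bar>)" by simp
  qed (simp add: add_pos_nonneg sum_nonneg)
qed

text \<open>A hyperplane separates the point (p0, H(x, p0)) from the strict epigraph, which is
  convex and does not contain it.\<close>

lemma hamiltonian_subgradient:
  "\<exists>q. \<forall>p. H i x p0 + q \<bullet> (p - p0) \<le> H i x p"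
proof -
  let ?S = "{(p, r). H i x p < r}"
  have "convex ?S"
    unfolding convex_alt
  proof (clarsimp)
    fix p r p' r' u assume *: "H i x p < r" "H i x p' < r'" "0 \<le> u" "u \<le> (1::real)"
    have "H i x ((1 - u) *\<^sub>R p + u *\<^sub>R p') \<le> (1 - u) * H i x p + u * H i x p'"
      using hamiltonian_convex * by (intro convex_onD) auto
    also have "\<dots> < (1 - u) * r + u * r'"
    proof (cases "u = 0")
      case False
      then show ?thesis using * by (intro add_le_less_mono mult_left_mono mult_strict_left_mono) auto
    qed (use * in simp)
    finally show "H i x ((1 - u) *\<^sub>R p + u *\<^sub>R p') < (1 - u) * r + u * r'" .
  qed
  moreover have "?S \<noteq> {}" by (auto intro: exI[of _ 0] gt_ex)
  moreover have "?S \<inter> {(p0, H i x p0)} = {}" by auto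
  ultimately obtain a b where ab: "a \<noteq> 0" "\<And>w. w \<in> ?S \<Longrightarrow> a \<bullet> w \<le> b" "b \<le> a \<bullet> (p0, H i x p0)"
    using separating_hyperplane_sets[of ?S "{(p0, H i x p0)}"] by (simp del: split_paired_All split_paired_Ex) blast
  obtain a1 a2 where a: "a = (a1, a2)" by (cases a)
  have sep: "a1 \<bullet> p + a2 * r \<le> a1 \<bullet> p0 + a2 * H i x p0" if "H i x p < r" for p r
    using ab(2)[of "(p, r)"] ab(3) that by (simp add: a inner_Pair)
  have sep': "a1 \<bullet> p + a2 * H i x p \<le> a1 \<bullet> p0 + a2 * H i x p0" for p
  proof (rule tendsto_upperbound)
    show "((\<lambda>r. a1 \<bullet> p + a2 * r) \<longlongrightarrow> a1 \<bullet> p + a2 * H i x p) (at_right (H i x p))"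
      by (intro tendsto_intros)
    show "\<forall>\<^sub>F r in at_right (H i x p). a1 \<bullet> p + a2 * r \<le> a1 \<bullet> p0 + a2 * H i x p0"
      by (auto simp: eventually_at_right_field intro!: exI[of _ "H i x p + 1"] sep)
  qed simp
  have "a2 \<le> 0" using sep[of p0 "H i x p0 + 1"] by (simp add: algebra_simps)
  \<comment> \<open>A vertical hyperplane would bound a1 \<bullet> p over all p, which forces a1 =
    0.\<close>
  moreover have "a2 \<noteq> 0"
  proof
    assume "a2 = 0"
    with sep'[of "p0 + a1"] have "a1 \<bullet> a1 \<le> 0" by (simp add: inner_add_right)
    then have "a1 = 0" by (metis inner_eq_zero_iff inner_ge_zero order_antisym)
    with \<open>a2 = 0\<close> ab(1) a show False by (simp add: zero_prod_def)
  qed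
  ultimately have a2: "a2 < 0" by simp
  show ?thesis
  proof (intro exI[of _ "(1 / (- a2)) *\<^sub>R a1"] allI)
    fix p
    have "(- a2) * (H i x p0 + ((1 / (- a2)) *\<^sub>R a1) \<bullet> (p - p0)) \<le> (- a2) * H i x p"
      using sep'[of p] a2 by (simp add: inner_diff_right algebra_simps)
    then show "H i x p0 + ((1 / (- a2)) *\<^sub>R a1) \<bullet> (p - p0) \<le> H i x p"
      using a2 by (simp only: mult_le_cancel_left)
  qed
qed

text \<open>For a subgradient q at p, the supremum defining the Lagrangian at q is attained at p.
  This q later supplies the velocity with which the value function is tested.\<close>

lemma fenchel_equality:
  "\<exists>q. H i x p = p \<bullet> q - lagrangian H i x q"
proof -
  obtain q where q: "\<And>p'. H i x p + q \<bullet> (p' - p) \<le> H i x p'"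
    using hamiltonian_subgradient[of i x p] by blast
  have "lagrangian H i x q = p \<bullet> q - H i x p"
    unfolding lagrangian_def
    by (rule cSup_eq_maximum) (use q in \<open>auto simp: inner_diff_right inner_commute algebra_simps\<close>)
  then show ?thesis by (intro exI[of _ q]) simp
qed

end

subsection \<open>Viscosity subsolutions along trajectories\<close>

text \<open>Test functions have to be periodic, so this smooth function, zero exactly on the
  lattice, replaces the squared distance.\<close>

definition lattice_penalty :: "real^'n \<Rightarrow> real" where
  "lattice_penalty w = (\<Sum>k\<in>UNIV. 1 - cos (2 * pi * w $ k))"

definition lattice_penalty_grad :: "real^'n \<Rightarrow> real^'n" where
  "lattice_penalty_grad w = (\<chi> k. 2 * pi * sin (2 * pi * w $ k))"

lemma lattice_penalty_nonneg: "0 \<le> lattice_penalty w"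
  by (auto simp: lattice_penalty_def intro!: sum_nonneg)

lemma lattice_penalty_0: "lattice_penalty 0 = 0"
  by (simp add: lattice_penalty_def)

lemma lattice_penalty_eq_0_iff: "lattice_penalty w = 0 \<longleftrightarrow> w \<in> int_lattice"
proof -
  have "lattice_penalty w = 0 \<longleftrightarrow> (\<forall>k. cos (2 * pi * w $ k) = 1)"
    unfolding lattice_penalty_def by (subst sum_nonneg_eq_0_iff) auto
  also have "\<dots> \<longleftrightarrow> (\<forall>k. w $ k \<in> \<int>)"
    by (intro all_cong1) (auto simp: cos_one_2pi_int Ints_def)
  finally show ?thesis by (simp add: int_lattice_def)
qed

lemma lattice_penalty_periodic:
  assumes "z \<in> int_lattice"
  shows "lattice_penalty (w + z) = lattice_penalty w"
proof -
  have "cos (2 * pi * (w $ k + z $ k)) = cos (2 * pi * w $ k)" for k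
  proof -
    have "z $ k \<in> \<int>" using assms by (simp add: int_lattice_def)
    then obtain m :: int where "z $ k = of_int m" by (auto elim: Ints_cases)
    then have eq: "2 * pi * (w $ k + z $ k) = 2 * pi * w $ k + 2 * pi * of_int m" by (simp add: distrib_left)
    show ?thesis unfolding eq cos_add by simp
  qed
  then show ?thesis by (simp add: lattice_penalty_def)
qed

lemma lattice_penalty_gderiv: "GDERIV lattice_penalty w :> lattice_penalty_grad w"
  unfolding gderiv_def lattice_penalty_def lattice_penalty_grad_def inner_vec_def
  by (auto intro!: derivative_eq_intros bounded_linear.has_derivative[OF bounded_linear_vec_nth] simp: mult_ac)

lemma continuous_on_lattice_penalty: "continuous_on A lattice_penalty"
  unfolding lattice_penalty_def[abs_def] by (intro continuous_intros)

lemma continuous_on_lattice_penalty_grad: "continuous_on A lattice_penalty_grad"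
  unfolding lattice_penalty_grad_def[abs_def] by (intro continuous_intros)

lemma torus_C1_penalty: "torus_C1 (\<lambda>z. c * lattice_penalty (z - a)) (\<lambda>z. c *\<^sub>R lattice_penalty_grad (z - a))"
proof -
  have "torus_periodic (\<lambda>z. c * lattice_penalty (z - a))"
  proof -
    have "lattice_penalty (x + z - a) = lattice_penalty (x - a)" if "z \<in> int_lattice" for x z
      using lattice_penalty_periodic[OF that, of "x - a"] by (simp add: algebra_simps)
    then show ?thesis by (simp add: torus_periodic_def)
  qed
  moreover have "GDERIV (\<lambda>z. c * lattice_penalty (z - a)) x :> c *\<^sub>R lattice_penalty_grad (x - a)" for x
  proof -
    have d: "(lattice_penalty has_derivative (\<lambda>h. h \<bullet> lattice_penalty_grad (x - a))) (at (x - a))"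
      using lattice_penalty_gderiv by (simp add: gderiv_def)
    have "((\<lambda>z. lattice_penalty (z - a)) has_derivative (\<lambda>h. h \<bullet> lattice_penalty_grad (x - a))) (at x)"
      by (rule has_derivative_compose[where g = lattice_penalty and f = "\<lambda>z. z - a", OF _ d])
       (auto intro!: derivative_eq_intros)
    then show ?thesis
      unfolding gderiv_def by (auto intro!: derivative_eq_intros)
  qed
  moreover have "continuous_on UNIV (\<lambda>z. c *\<^sub>R lattice_penalty_grad (z - a))"
    by (intro continuous_intros continuous_on_compose2[OF continuous_on_lattice_penalty_grad[of UNIV]]) auto
  ultimately show ?thesis by (simp add: torus_C1_def)
qed

lemma lattice_penalty_line_deriv:
  "((\<lambda>r. lattice_penalty (z - (x0 + r *\<^sub>R q))) has_real_derivative
     - (lattice_penalty_grad (z - (x0 + r *\<^sub>R q)) \<bullet> q)) (at r)"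
proof -
  have d: "(lattice_penalty has_derivative (\<lambda>h. h \<bullet> lattice_penalty_grad (z - (x0 + r *\<^sub>R q)))) (at (z - (x0 + r *\<^sub>R q)))"
    using lattice_penalty_gderiv by (simp add: gderiv_def)
  have "((\<lambda>r. lattice_penalty (z - (x0 + r *\<^sub>R q))) has_derivative
     (\<lambda>h. (- (h *\<^sub>R q)) \<bullet> lattice_penalty_grad (z - (x0 + r *\<^sub>R q)))) (at r)"
    by (rule has_derivative_compose[where g = lattice_penalty and f = "\<lambda>r. z - (x0 + r *\<^sub>R q)", OF _ d])
       (auto intro!: derivative_eq_intros)
  then show ?thesis
    unfolding has_field_derivative_def by (rule has_derivative_eq_rhs) (auto simp: inner_commute)
qed

text \<open>
  Doubling of variables: \<open>z\<close> is tied to the point \<open>x0 + r q\<close> of the segment by the penalty, so that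
  optimality in \<open>z\<close> tests the equation while optimality in \<open>r\<close> identifies the slope of the
  test function in direction \<open>q\<close>. The barrier \<open>\<kappa> / r\<close> keeps \<open>r\<close> away from the initial end.
\<close>

lemma viscosity_segment:
  fixes v m :: "real^'n \<Rightarrow> real"
  assumes v: "torus_periodic v" "continuous_on UNIV v"
    and m: "torus_periodic m" "continuous_on UNIV m"
    and visc: "\<And>z \<psi> D\<psi>. torus_C1 \<psi> D\<psi> \<Longrightarrow> (\<And>z'. v z' - \<psi> z' \<le> v z - \<psi> z) \<Longrightarrow> - (D\<psi> z \<bullet> q) \<le> m z"
    and h: "0 \<le> h"
  shows "v x0 \<le> v (x0 + h *\<^sub>R q) + integral {0..h} (\<lambda>r. m (x0 + r *\<^sub>R q))"
proof (rule ccontr)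
  assume neg: "\<not> ?thesis"
  with h have h0: "0 < h" by (cases "h = 0") auto
  define x where "x r = x0 + r *\<^sub>R q" for r
  have x_cont: "continuous_on A x" for A unfolding x_def by (intro continuous_intros)
  have vx: "continuous_on A (\<lambda>r. v (x r))" for A
    by (rule continuous_on_compose2[OF v(2) x_cont]) auto
  have mx: "continuous_on A (\<lambda>r. m (x r))" for A
    by (rule continuous_on_compose2[OF m(2) x_cont]) auto
  define G where "G r = integral {0..r} (\<lambda>r. m (x r))" for r
  have G_deriv: "(G has_real_derivative m (x r)) (at r within {0..h})" if "r \<in> {0..h}" for r
    unfolding G_def using integral_has_real_derivative[OF mx that] .
  have G_cont: "continuous_on {0..h} G"
    unfolding continuous_on_eq_continuous_within using DERIV_continuous[OF G_deriv] by blast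
  \<comment> \<open>Half of the deficit per unit time, so that the strict inequality survives the
    added term \<delta> r: F h < F 0.\<close>
  define \<delta> where "\<delta> = (v x0 - v (x h) - G h) / (2 * h)"
  have \<delta>: "0 < \<delta>" using neg h0 by (simp add: \<delta>_def G_def x_def)
  define F where "F r = v (x r) + G r + \<delta> * r" for r
  have F_cont: "continuous_on {0..h} F" unfolding F_def by (intro continuous_intros vx G_cont)
  have F0h: "F h < F 0"
  proof -
    have "\<delta> * h = (v x0 - v (x h) - G h) / 2" using h0 by (simp add: \<delta>_def)
    moreover have "v (x h) + G h < v x0" using neg by (simp add: G_def x_def)
    moreover have "x 0 = x0" "G 0 = 0" by (simp_all add: x_def G_def)
    ultimately show ?thesis by (simp add: F_def)
  qed
  have "\<exists>r1. 0 < r1 \<and> r1 < h \<and> F h < F r1"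
  proof -
    have "(F \<longlongrightarrow> F 0) (at 0 within {0..h})" using F_cont h0 by (auto simp: continuous_on)
    then have "\<forall>\<^sub>F r in at 0 within {0..h}. F h < F r" using F0h by (rule order_tendstoD)
    then obtain d where d: "d > 0" "\<And>r. r \<in> {0..h} \<Longrightarrow> r \<noteq> 0 \<Longrightarrow> dist r 0 < d \<Longrightarrow> F h < F r"
      unfolding eventually_at by blast
    show ?thesis
      by (rule exI[of _ "min d h / 2"]) (use d h0 in \<open>auto simp: min_def dist_real_def\<close>)
  qed
  then obtain r1 where r1: "0 < r1" "r1 < h" "F h < F r1" by blast
  \<comment> \<open>At r1 the barrier costs half of the gap F r1 - F h, so \<Phi> still prefers r1
    to the endpoint h.\<close>
  define \<kappa> where "\<kappa> = r1 * (F r1 - F h) / 2"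
  have \<kappa>: "0 < \<kappa>" using r1 by (simp add: \<kappa>_def)
  define \<theta> where "\<theta> r = - G r - \<delta> * r + \<kappa> / r" for r
  define \<Phi> where "\<Phi> r = v (x r) - \<theta> r" for r
  have \<Phi>_F: "\<Phi> r = F r - \<kappa> / r" for r by (simp add: \<Phi>_def \<theta>_def F_def)
  have \<Phi>h: "\<Phi> h < \<Phi> r1"
  proof -
    have "\<kappa> / r1 < F r1 - F h" using r1 by (simp add: \<kappa>_def)
    moreover have "0 < \<kappa> / h" using \<kappa> h0 by simp
    ultimately show ?thesis by (simp add: \<Phi>_F)
  qed
  have "\<exists>BF. \<forall>r\<in>{0..h}. \<bar>F r\<bar> \<le> BF"
    using compact_imp_bounded[OF compact_continuous_image[OF F_cont compact_Icc]]
    unfolding bounded_iff by auto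
  then obtain BF where BF: "\<And>r. r \<in> {0..h} \<Longrightarrow> \<bar>F r\<bar> \<le> BF" by blast
  \<comment> \<open>Small enough for the barrier to outweigh every value of F, so that \<Phi>
    prefers r1 to r2 as well. A limit of maximisers over [r2, h] then lies strictly inside.\<close>
  define r2 where "r2 = min (r1 / 2) (\<kappa> / (1 + \<bar>BF - \<Phi> r1\<bar>))"
  have r2: "0 < r2" "r2 < r1" using r1 \<kappa> by (auto simp: r2_def)
  have \<Phi>2: "\<Phi> r2 < \<Phi> r1"
  proof -
    have "r2 * (1 + \<bar>BF - \<Phi> r1\<bar>) \<le> \<kappa>"
      using min.cobounded2[of "r1 / 2" "\<kappa> / (1 + \<bar>BF - \<Phi> r1\<bar>)"] unfolding r2_def[symmetric]
      by (simp add: pos_le_divide_eq add_pos_nonneg)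
    then have "1 + \<bar>BF - \<Phi> r1\<bar> \<le> \<kappa> / r2" using r2 by (simp add: pos_le_divide_eq mult.commute)
    moreover have "F r2 \<le> BF" using BF[of r2] r1 r2 by auto
    ultimately show ?thesis by (simp add: \<Phi>_F)
  qed
  have \<theta>_cont: "continuous_on {r2..h} \<theta>"
    unfolding \<theta>_def using r2 by (intro continuous_intros continuous_on_subset[OF G_cont]) auto
  define \<Psi> where "\<Psi> n rz = v (snd rz) - \<theta> (fst rz) - real n * lattice_penalty (snd rz - x (fst rz))" for n rz
  define C where "C = ({r2..h} \<times> unit_cube :: (real \<times> (real^'n)) set)"
  have C: "compact C" unfolding C_def by (intro compact_Times compact_Icc compact_unit_cube)
  have \<Psi>_cont: "continuous_on C (\<Psi> n)" for n
    unfolding \<Psi>_def C_def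
    by (intro continuous_intros continuous_on_compose2[OF v(2)] continuous_on_compose2[OF \<theta>_cont]
        continuous_on_compose2[OF continuous_on_lattice_penalty[of UNIV]] continuous_on_compose2[OF x_cont[of UNIV]]) auto
  have "\<exists>rz\<in>C. \<forall>rz'\<in>C. \<Psi> n rz' \<le> \<Psi> n rz" for n
  proof -
    have "(r1, 0) \<in> C" using r1 r2 unit_cube_nonempty by (simp add: C_def)
    then show ?thesis using continuous_attains_sup[OF C _ \<Psi>_cont] by blast
  qed
  then obtain rz where rz: "\<And>n. rz n \<in> C" "\<And>n rz'. rz' \<in> C \<Longrightarrow> \<Psi> n rz' \<le> \<Psi> n (rz n)" by metis
  define r where "r n = fst (rz n)" for n
  define z where "z n = snd (rz n)" for n
  have rn: "r n \<in> {r2..h}" for n using rz(1)[of n] by (auto simp: C_def r_def)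
  \<comment> \<open>Periodicity extends maximality from the cube to all z', as a global test
    function requires.\<close>
  have max: "\<Psi> n (r', z') \<le> \<Psi> n (r n, z n)" if r': "r' \<in> {r2..h}" for n r' z'
  proof -
    obtain w where w: "w \<in> int_lattice" "z' + w \<in> unit_cube" by (rule int_lattice_translate_to_unit_cube)
    have "\<Psi> n (r', z') = \<Psi> n (r', z' + w)"
      using torus_periodicD[OF v(1) w(1), of z'] lattice_penalty_periodic[OF w(1), of "z' - x r'"]
      by (simp add: \<Psi>_def algebra_simps)
    also have "\<dots> \<le> \<Psi> n (rz n)" using r' w by (intro rz(2)) (simp add: C_def)
    finally show ?thesis by (simp add: r_def z_def)
  qed
  have low: "\<Phi> r1 \<le> \<Psi> n (r n, z n)" for n
    using max[of r1 n "x r1"] r1 r2 by (simp add: \<Psi>_def \<Phi>_def lattice_penalty_0)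
  have low': "\<Phi> r1 \<le> v (z n) - \<theta> (r n)" for n
    using low[of n] mult_nonneg_nonneg[OF of_nat_0_le_iff[of n] lattice_penalty_nonneg[of "z n - x (r n)"]]
    by (simp add: \<Psi>_def)
  obtain Bv where Bv: "\<And>x. norm (v x) \<le> Bv" using torus_periodic_bounded[OF v] by blast
  have "\<exists>B\<theta>. \<forall>r\<in>{r2..h}. \<bar>\<theta> r\<bar> \<le> B\<theta>"
    using compact_imp_bounded[OF compact_continuous_image[OF \<theta>_cont compact_Icc]]
    unfolding bounded_iff by auto
  then obtain B\<theta> where B\<theta>: "\<And>r. r \<in> {r2..h} \<Longrightarrow> \<bar>\<theta> r\<bar> \<le> B\<theta>" by blast
  have pen: "real n * lattice_penalty (z n - x (r n)) \<le> Bv + B\<theta> - \<Phi> r1" for n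
    using low[of n] Bv[of "z n"] B\<theta>[OF rn[of n]] by (auto simp: \<Psi>_def)
  obtain l s where l: "l \<in> C" and s: "strict_mono (s :: nat \<Rightarrow> nat)" and lim: "(rz \<circ> s) \<longlonglongrightarrow> l"
    using spec[OF C[unfolded compact_def], of rz] rz(1) by blast
  define r0 z0 where "r0 = fst l" and "z0 = snd l"
  have limr: "(\<lambda>n. r (s n)) \<longlonglongrightarrow> r0" and limz: "(\<lambda>n. z (s n)) \<longlonglongrightarrow> z0"
    using tendsto_fst[OF lim] tendsto_snd[OF lim] by (simp_all add: r_def z_def r0_def z0_def o_def)
  have r0: "r0 \<in> {r2..h}" using l by (auto simp: C_def r0_def)
  have limx: "(\<lambda>n. x (r (s n))) \<longlonglongrightarrow> x r0" unfolding x_def by (intro tendsto_intros limr)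
  have tend: "(\<lambda>n. f (g n)) \<longlonglongrightarrow> f a" if "continuous_on UNIV f" "g \<longlonglongrightarrow> a"
    for f :: "real^'n \<Rightarrow> real" and g a
    using that by (metis UNIV_I continuous_on_eq_continuous_at isCont_tendsto_compose open_UNIV)
  have lim_pen: "(\<lambda>n. lattice_penalty (z (s n) - x (r (s n)))) \<longlonglongrightarrow> lattice_penalty (z0 - x r0)"
    by (intro tend continuous_on_lattice_penalty tendsto_intros limz limx)
  have "(\<lambda>n. lattice_penalty (z (s n) - x (r (s n)))) \<longlonglongrightarrow> 0"
  proof (rule tendsto_sandwich[OF _ _ tendsto_const])
    show "\<forall>\<^sub>F n in sequentially. lattice_penalty (z (s n) - x (r (s n))) \<le> (Bv + B\<theta> - \<Phi> r1) / real n"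
    proof (rule eventually_sequentiallyI[of 1])
      fix n :: nat assume n: "1 \<le> n"
      have "n \<le> s n" using s by (rule seq_suble)
      then have "real n * lattice_penalty (z (s n) - x (r (s n))) \<le> real (s n) * lattice_penalty (z (s n) - x (r (s n)))"
        by (intro mult_right_mono lattice_penalty_nonneg) simp
      also note pen[of "s n"]
      finally show "lattice_penalty (z (s n) - x (r (s n))) \<le> (Bv + B\<theta> - \<Phi> r1) / real n"
        using n by (simp add: pos_le_divide_eq mult.commute)
    qed
    show "(\<lambda>n. (Bv + B\<theta> - \<Phi> r1) / real n) \<longlonglongrightarrow> 0" by (rule lim_const_over_n)
  qed (simp add: lattice_penalty_nonneg)
  then have "lattice_penalty (z0 - x r0) = 0" using lim_pen LIMSEQ_unique by blast
  \<comment> \<open>The penalty ties z0 to the segment only modulo the lattice; periodicity of v and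
    m absorbs the difference.\<close>
  then have lat: "z0 - x r0 \<in> int_lattice" by (simp add: lattice_penalty_eq_0_iff)
  have vz0: "v z0 = v (x r0)" and mz0: "m z0 = m (x r0)"
    using torus_periodicD[OF v(1) lat, of "x r0"] torus_periodicD[OF m(1) lat, of "x r0"] by simp_all
  have "(\<lambda>n. v (z (s n)) - \<theta> (r (s n))) \<longlonglongrightarrow> v z0 - \<theta> r0"
    by (intro tendsto_intros tend v(2) limz continuous_on_tendsto_compose[OF \<theta>_cont limr r0] always_eventually allI rn)
  then have "\<Phi> r1 \<le> v z0 - \<theta> r0"
    by (rule tendsto_lowerbound) (auto intro!: always_eventually low')
  then have "\<Phi> r1 \<le> \<Phi> r0" by (simp add: \<Phi>_def vz0)
  then have r0': "r2 < r0" "r0 < h" using r0 \<Phi>h \<Phi>2 by (auto simp: less_le)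
  have ev: "\<forall>\<^sub>F n in sequentially. r2 < r (s n) \<and> r (s n) < h"
    using order_tendstoD(1)[OF limr r0'(1)] order_tendstoD(2)[OF limr r0'(2)] by eventually_elim auto
  \<comment> \<open>With p the gradient of the penalty term, the equation at z n gives - p \<bullet>
    q \<le> m (z n), and the vanishing derivative in r gives p \<bullet> q = - m (x (r n)) -
    \<delta> - \<kappa> / (r n)^2. The surplus \<delta> survives the limit and contradicts
    continuity and periodicity of m.\<close>
  have key: "m (x (r n)) + \<delta> \<le> m (z n)" if n: "r2 < r n" "r n < h" for n
  proof -
    define p where "p = real n *\<^sub>R lattice_penalty_grad (z n - x (r n))"
    have "- (p \<bullet> q) \<le> m (z n)"
      unfolding p_def
    proof (rule visc[OF torus_C1_penalty])
      fix z' show "v z' - real n * lattice_penalty (z' - x (r n)) \<le> v (z n) - real n * lattice_penalty (z n - x (r n))"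
        using max[OF rn, of n n z'] by (simp add: \<Psi>_def)
    qed
    moreover have "p \<bullet> q = - m (x (r n)) - \<delta> - \<kappa> / (r n)\<^sup>2"
    proof -
      have rpos: "0 < r n" using n r2 by simp
      have "(G has_real_derivative m (x (r n))) (at (r n) within {0..h})"
        using n rpos by (intro G_deriv) auto
      then have "(G has_real_derivative m (x (r n))) (at (r n))"
        using n rpos by (subst (asm) at_within_interior) (auto simp: interior_atLeastAtMost_real)
      moreover have "((\<lambda>r. lattice_penalty (z n - x r)) has_real_derivative
           - (lattice_penalty_grad (z n - x (r n)) \<bullet> q)) (at (r n))"
        unfolding x_def by (rule lattice_penalty_line_deriv)
      ultimately have "((\<lambda>r'. \<Psi> n (r', z n)) has_real_derivative
          (m (x (r n)) + \<delta> + \<kappa> / (r n)\<^sup>2 + real n * (lattice_penalty_grad (z n - x (r n)) \<bullet> q))) (at (r n))"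
        unfolding \<Psi>_def \<theta>_def fst_conv snd_conv using rpos
        by (auto intro!: derivative_eq_intros simp: power2_eq_square)
      moreover have "0 < min (r n - r2) (h - r n)" using n by simp
      moreover have "\<forall>y. \<bar>r n - y\<bar> < min (r n - r2) (h - r n) \<longrightarrow> \<Psi> n (y, z n) \<le> \<Psi> n (r n, z n)"
        by (auto intro!: max)
      ultimately have "m (x (r n)) + \<delta> + \<kappa> / (r n)\<^sup>2 + real n * (lattice_penalty_grad (z n - x (r n)) \<bullet> q) = 0"
        by (rule DERIV_local_max)
      then show ?thesis by (simp add: p_def)
    qed
    moreover have "0 \<le> \<kappa> / (r n)\<^sup>2" using \<kappa> by simp
    ultimately show ?thesis by simp
  qed
  have "m (x r0) + \<delta> \<le> m z0"
  proof (rule tendsto_le[OF sequentially_bot])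
    show "(\<lambda>n. m (z (s n))) \<longlonglongrightarrow> m z0" by (intro tend m(2) limz)
    show "(\<lambda>n. m (x (r (s n))) + \<delta>) \<longlonglongrightarrow> m (x r0) + \<delta>" by (intro tendsto_intros tend m(2) limx)
    show "\<forall>\<^sub>F n in sequentially. m (x (r (s n))) + \<delta> \<le> m (z (s n))"
      using ev by eventually_elim (auto intro: key)
  qed
  then show False using \<delta> mz0 by simp
qed

text \<open>The hypothesis is implied by a nonnegative upper right Dini derivative. For each slope
  e, the set where \<phi> has dropped by at most e (r - a) is closed, and from its supremum a
  further step would be possible before b.\<close>

lemma dini_nondecreasing:
  fixes \<phi> :: "real \<Rightarrow> real"
  assumes "a \<le> b" "continuous_on {a..b} \<phi>"
    and dini: "\<And>r e. a \<le> r \<Longrightarrow> r < b \<Longrightarrow> 0 < e \<Longrightarrow> \<exists>h>0. r + h \<le> b \<and> \<phi> r - e * h \<le> \<phi> (r + h)"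
  shows "\<phi> a \<le> \<phi> b"
proof -
  have "\<phi> a - e * (b - a) \<le> \<phi> b" if e: "0 < e" for e
  proof -
    define A where "A = {r \<in> {a..b}. \<phi> a - e * (r - a) \<le> \<phi> r}"
    have "closed A" unfolding A_def
      by (intro continuous_on_closed_Collect_le continuous_intros assms(2))
    moreover have aA: "a \<in> A" using assms(1) by (simp add: A_def)
    moreover have bdd: "bdd_above A" by (auto simp: A_def intro!: bdd_aboveI[of _ b])
    ultimately have c: "Sup A \<in> A" by (intro closed_contains_Sup) auto
    define c where "c = Sup A"
    have "c = b"
    proof (rule ccontr)
      assume "c \<noteq> b"
      then have "a \<le> c" "c < b" using c by (auto simp: A_def c_def)
      from dini[OF this e] obtain h where h: "h > 0" "c + h \<le> b" "\<phi> c - e * h \<le> \<phi> (c + h)" by blast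
      moreover have "\<phi> a - e * (c - a) \<le> \<phi> c" using c by (simp add: A_def c_def)
      ultimately have "c + h \<in> A" using \<open>a \<le> c\<close> by (simp add: A_def algebra_simps)
      then have "c + h \<le> c" unfolding c_def by (rule cSup_upper[OF _ bdd])
      then show False using h by simp
    qed
    then show ?thesis using c by (simp add: A_def c_def)
  qed
  note * = this
  show ?thesis
  proof (rule field_le_epsilon)
    fix e :: real assume e: "0 < e"
    have "e / (b - a + 1) * (b - a) \<le> e" using e assms(1) by (simp add: field_simps)
    then show "\<phi> a \<le> \<phi> b + e" using *[of "e / (b - a + 1)"] e assms(1) by simp
  qed
qed

text \<open>On a short interval the trajectory is replaced by the segment with the same endpoints,
  for which \<open>seg\<close> holds. Right continuity of the velocity keeps the integrands of both
  close to their common value at the left end, and a Dini inequality results.\<close>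

lemma trajectory_inequality:
  fixes v :: "real^'n \<Rightarrow> real" and \<L> :: "real^'n \<Rightarrow> real^'n \<Rightarrow> real" and \<xi> :: "real \<Rightarrow> real^'n"
  assumes v: "continuous_on UNIV v"
    and \<L>: "continuous_on UNIV (\<lambda>(x, q). \<L> x q)"
    and seg: "\<And>x0 q h. 0 \<le> h \<Longrightarrow> v x0 \<le> v (x0 + h *\<^sub>R q) + integral {0..h} (\<lambda>r. \<L> (x0 + r *\<^sub>R q) q)"
    and ab: "a \<le> b"
    and right: "\<And>r. a \<le> r \<Longrightarrow> r < b \<Longrightarrow> (\<xi> \<longlongrightarrow> \<xi> r) (at_right r)"
    and \<xi>: "\<xi> integrable_on {a..b}"
    and x: "\<And>r. a \<le> r \<Longrightarrow> r \<le> b \<Longrightarrow> x r = x a + integral {a..r} \<xi>"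
    and int: "(\<lambda>r. \<L> (x r) (\<xi> r)) integrable_on {a..b}"
  shows "v (x a) \<le> v (x b) + integral {a..b} (\<lambda>r. \<L> (x r) (\<xi> r))"
proof -
  define \<phi> where "\<phi> r = v (x r) + integral {a..r} (\<lambda>r. \<L> (x r) (\<xi> r))" for r
  have x_cont: "continuous_on {a..b} x"
  proof -
    have "continuous_on {a..b} (\<lambda>r. x a + integral {a..r} \<xi>)"
      by (intro continuous_intros indefinite_integral_continuous_1 \<xi>)
    moreover have "continuous_on {a..b} x \<longleftrightarrow> continuous_on {a..b} (\<lambda>r. x a + integral {a..r} \<xi>)"
      by (rule continuous_on_cong[OF refl], rule x) simp_all
    ultimately show ?thesis by simp
  qed
  have "\<phi> a \<le> \<phi> b"
  proof (rule dini_nondecreasing[OF ab])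
    show "continuous_on {a..b} \<phi>"
      unfolding \<phi>_def
      by (intro continuous_intros indefinite_integral_continuous_1 int continuous_on_compose2[OF v x_cont]) auto
    fix r e :: real assume r: "a \<le> r" "r < b" and e: "0 < e"
    define q where "q = \<xi> r"
    have "isCont (\<lambda>(x, q). \<L> x q) (x r, q)"
      using \<L> by (simp add: continuous_on_eq_continuous_at)
    then obtain d where d: "d > 0" "\<And>x' q'. dist (x', q') (x r, q) < d \<Longrightarrow> \<bar>\<L> x' q' - \<L> (x r) q\<bar> < e / 2"
      unfolding continuous_at_eps_delta using e half_gt_zero[OF e]
      by (fastforce simp: dist_real_def)
    have d': "\<bar>\<L> x' q' - \<L> (x r) q\<bar> < e / 2" if "norm (x' - x r) < d / 2" "norm (q' - q) < d / 2" for x' q'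
    proof (rule d(2))
      have "dist (x', q') (x r, q) \<le> dist x' (x r) + dist q' q"
        using sqrt_sum_squares_le_sum[of "dist x' (x r)" "dist q' q"] by (simp add: dist_Pair_Pair)
      then show "dist (x', q') (x r, q) < d" using that by (simp add: dist_norm)
    qed
    have "\<forall>\<^sub>F \<rho> in at_right r. norm (\<xi> \<rho> - q) < d / 4"
      using tendstoD[OF right[OF r], of "d / 4"] d(1) by (simp add: q_def dist_norm)
    then obtain c where c: "c > r" "\<And>\<rho>. r < \<rho> \<Longrightarrow> \<rho> < c \<Longrightarrow> norm (\<xi> \<rho> - q) < d / 4"
      unfolding eventually_at_right_field by blast
    have \<xi>_near: "norm (\<xi> \<rho> - q) < d / 4" if "r \<le> \<rho>" "\<rho> < c" for \<rho>
      using c(2)[of \<rho>] that d(1) by (cases "\<rho> = r") (auto simp: q_def)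
    \<comment> \<open>Short enough that the velocity stays within d / 4 of q and that neither the
      trajectory nor the segment moves by d / 2.\<close>
    define h where "h = min (min (b - r) ((c - r) / 2)) (d / (4 * (norm q + d + 1)))"
    have den: "0 < 4 * (norm q + d + 1)" using d(1) by (intro mult_pos_pos add_pos_pos add_nonneg_pos) auto
    have h: "0 < h" "r + h \<le> b" "r + h < c"
    proof -
      show "0 < h" using r c(1) d(1) den by (simp add: h_def)
      have "h \<le> b - r" "h \<le> (c - r) / 2"
        unfolding h_def by (meson min.cobounded1 min.cobounded2 order_trans)+
      then show "r + h \<le> b" "r + h < c" using c(1) by auto
    qed
    have h_d: "h * (norm q + d) \<le> d / 4"
    proof -
      have "h * (4 * (norm q + d + 1)) \<le> d"
        using den min.cobounded2[of "min (b - r) ((c - r) / 2)" "d / (4 * (norm q + d + 1))"]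
        unfolding h_def[symmetric] by (simp add: pos_le_divide_eq)
      then show ?thesis using h(1) by (simp add: algebra_simps)
    qed
    have int_sub: "\<xi> integrable_on {c1..c2}" if "a \<le> c1" "c2 \<le> b" for c1 c2
      by (rule integrable_on_subinterval[OF \<xi>]) (use that in auto)
    have xr: "x \<rho> = x r + integral {r..\<rho>} \<xi>" if "r \<le> \<rho>" "\<rho> \<le> b" for \<rho>
      using x[of \<rho>] x[of r] Henstock_Kurzweil_Integration.integral_combine[of a r \<rho> \<xi>] int_sub[of a \<rho>] that r by simp
    have avg: "norm (integral {r..\<rho>} \<xi> - (\<rho> - r) *\<^sub>R q) \<le> d / 4 * (\<rho> - r)" if "r \<le> \<rho>" "\<rho> \<le> r + h" for \<rho>
    proof -
      have "integral {r..\<rho>} \<xi> - (\<rho> - r) *\<^sub>R q = integral {r..\<rho>} (\<lambda>s. \<xi> s - q)"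
      proof -
        have "integral {r..\<rho>} (\<lambda>s. \<xi> s - q) = integral {r..\<rho>} \<xi> - integral {r..\<rho>} (\<lambda>s. q)"
          using that r h by (intro Henstock_Kurzweil_Integration.integral_diff int_sub integrable_const_ivl) auto
        then show ?thesis using that by simp
      qed
      also have "norm \<dots> \<le> d / 4 * measure lborel (cbox r \<rho>)"
        unfolding cbox_interval[symmetric]
      proof (rule integrable_bound)
        show "(\<lambda>s. \<xi> s - q) integrable_on cbox r \<rho>"
          unfolding cbox_interval using int_sub[of r \<rho>] that r h
          by (intro Henstock_Kurzweil_Integration.integrable_diff integrable_const_ivl) auto
        fix s assume "s \<in> cbox r \<rho>"
        then show "norm (\<xi> s - q) \<le> d / 4" using \<xi>_near[of s] that h by auto
      qed (use d in simp)
      also have "\<dots> = d / 4 * (\<rho> - r)" using that by simp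
      finally show ?thesis .
    qed
    have x_near: "norm (x \<rho> - x r) < d / 2" if "r \<le> \<rho>" "\<rho> \<le> r + h" for \<rho>
    proof -
      have "norm (x \<rho> - x r) \<le> norm (integral {r..\<rho>} \<xi> - (\<rho> - r) *\<^sub>R q) + norm ((\<rho> - r) *\<^sub>R q)"
        using xr[of \<rho>] that h norm_triangle_ineq[of "integral {r..\<rho>} \<xi> - (\<rho> - r) *\<^sub>R q" "(\<rho> - r) *\<^sub>R q"] by simp
      also have "\<dots> \<le> d / 4 * (\<rho> - r) + (\<rho> - r) * norm q" using avg[OF that] that by simp
      also have "\<dots> = (\<rho> - r) * (norm q + d / 4)" by (simp add: algebra_simps)
      also have "\<dots> \<le> h * (norm q + d)" using that d(1) h by (intro mult_mono) auto
      also have "\<dots> < d / 2" using h_d d(1) by simp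
      finally show ?thesis .
    qed
    \<comment> \<open>The mean velocity, so that the segment ends exactly where the trajectory is at
      time r + h.\<close>
    define qh where "qh = (1 / h) *\<^sub>R (x (r + h) - x r)"
    have qh: "x (r + h) = x r + h *\<^sub>R qh" using h by (simp add: qh_def)
    have qh_near: "norm (qh - q) < d / 2"
    proof -
      have "h *\<^sub>R (qh - q) = integral {r..r + h} \<xi> - (r + h - r) *\<^sub>R q"
        using xr[of "r + h"] h qh by (simp add: scaleR_diff_right)
      then have "h * norm (qh - q) \<le> d / 4 * h" using avg[of "r + h"] h
        by (metis abs_of_pos add_diff_cancel_left' le_add_same_cancel1 less_eq_real_def norm_scaleR order_refl)
      then have "norm (qh - q) \<le> d / 4" using h by (simp add: mult.commute)
      then show ?thesis using d(1) by simp
    qed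
    have seg_near: "norm (x r + \<rho> *\<^sub>R qh - x r) < d / 2" if "0 \<le> \<rho>" "\<rho> \<le> h" for \<rho>
    proof -
      have "norm qh \<le> norm q + d" using qh_near norm_triangle_sub[of qh q] d(1) by simp
      then have "\<rho> * norm qh \<le> h * (norm q + d)" using that h by (intro mult_mono) auto
      then show ?thesis using h_d d(1) that by simp
    qed
    have cont_seg: "continuous_on {0..h} (\<lambda>\<rho>. \<L> (x r + \<rho> *\<^sub>R qh) qh)"
    proof -
      have "continuous_on {0..h} (\<lambda>\<rho>. (\<lambda>(x, q). \<L> x q) (x r + \<rho> *\<^sub>R qh, qh))"
        by (rule continuous_on_compose2[OF \<L>]) (auto intro!: continuous_intros)
      then show ?thesis by simp
    qed
    have "integral {0..h} (\<lambda>\<rho>. \<L> (x r + \<rho> *\<^sub>R qh) qh) \<le> integral {0..h} (\<lambda>\<rho>. \<L> (x r) q + e / 2)"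
    proof (rule integral_le)
      show "(\<lambda>\<rho>. \<L> (x r + \<rho> *\<^sub>R qh) qh) integrable_on {0..h}" by (rule integrable_continuous_interval[OF cont_seg])
      fix \<rho> assume "\<rho> \<in> {0..h}"
      then show "\<L> (x r + \<rho> *\<^sub>R qh) qh \<le> \<L> (x r) q + e / 2"
        using le_less_trans[OF abs_ge_self d'[OF seg_near qh_near, of \<rho>]]
        by (auto simp: diff_less_eq add.commute intro: less_imp_le)
    qed (rule integrable_const_ivl)
    then have 1: "v (x r) \<le> v (x (r + h)) + h * (\<L> (x r) q + e / 2)"
      using seg[of h "x r" qh] h by (simp add: qh)
    have int_sub': "(\<lambda>r. \<L> (x r) (\<xi> r)) integrable_on {c1..c2}" if "a \<le> c1" "c2 \<le> b" for c1 c2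
      by (rule integrable_on_subinterval[OF int]) (use that in auto)
    have "integral {r..r + h} (\<lambda>\<rho>. \<L> (x r) q - e / 2) \<le> integral {r..r + h} (\<lambda>r. \<L> (x r) (\<xi> r))"
    proof (rule integral_le)
      fix \<rho> assume \<rho>: "\<rho> \<in> {r..r + h}"
      have "norm (\<xi> \<rho> - q) < d / 2" using \<xi>_near[of \<rho>] \<rho> h d(1) by auto
      then have "\<bar>\<L> (x \<rho>) (\<xi> \<rho>) - \<L> (x r) q\<bar> < e / 2" using \<rho> by (intro d' x_near) auto
      from le_less_trans[OF abs_ge_minus_self this]
      show "\<L> (x r) q - e / 2 \<le> \<L> (x \<rho>) (\<xi> \<rho>)"
        by (auto simp: diff_less_eq diff_le_eq add.commute intro: less_imp_le)
    qed (use int_sub' r h in \<open>auto intro!: integrable_const_ivl\<close>)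
    then have 2: "h * (\<L> (x r) q - e / 2) \<le> integral {r..r + h} (\<lambda>r. \<L> (x r) (\<xi> r))" using h by simp
    have "\<phi> (r + h) = v (x (r + h)) + integral {a..r} (\<lambda>r. \<L> (x r) (\<xi> r)) + integral {r..r + h} (\<lambda>r. \<L> (x r) (\<xi> r))"
      unfolding \<phi>_def using Henstock_Kurzweil_Integration.integral_combine[of a r "r + h", OF _ _ int_sub'] r h by simp
    then have "\<phi> r - e * h \<le> \<phi> (r + h)" using 1 2 by (simp add: \<phi>_def algebra_simps)
    then show "\<exists>h>0. r + h \<le> b \<and> \<phi> r - e * h \<le> \<phi> (r + h)" using h by blast
  qed
  then show ?thesis by (simp add: \<phi>_def)
qed

lemma coupling_offdiag: "coupling_matrix \<Lambda> \<Longrightarrow> i \<noteq> j \<Longrightarrow> \<Lambda> $ i $ j \<le> 0"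
  unfolding coupling_matrix_def by (elim conjE allE[of _ i] allE[of _ j] impE)

lemma coupling_irreducible:
  assumes "coupling_matrix \<Lambda>" "I \<noteq> {}" "I \<noteq> UNIV"
  shows "\<exists>i j. i \<in> I \<and> j \<notin> I \<and> \<Lambda> $ i $ j \<noteq> 0"
proof -
  have "I \<noteq> {} \<and> I \<subset> UNIV \<longrightarrow> (\<exists>i\<in>I. \<exists>j. j \<notin> I \<and> \<Lambda> $ i $ j \<noteq> 0)"
    using assms(1) unfolding coupling_matrix_def by (elim conjE) (rule spec)
  with assms(2,3) show ?thesis by blast
qed

subsection \<open>Path spaces\<close>

lemma space_evaluation_algebra [simp]: "space (evaluation_algebra T B I) = cadlag_paths T"
  unfolding evaluation_algebra_def by (rule space_measure_of) auto

lemma sets_evaluation_algebra: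
  "sets (evaluation_algebra T B I) =
     sigma_sets (cadlag_paths T) {{f \<in> cadlag_paths T. f s \<in> A} | s A. s \<in> I \<and> A \<in> sets B}"
  unfolding evaluation_algebra_def by (rule sets_measure_of) auto

lemma measurable_evaluation:
  assumes "s \<in> I" "\<And>f. f \<in> cadlag_paths T \<Longrightarrow> f s \<in> space B"
  shows "(\<lambda>f. f s) \<in> evaluation_algebra T B I \<rightarrow>\<^sub>M B"
proof (rule measurableI)
  fix A assume "A \<in> sets B"
  with assms(1) have "{f \<in> cadlag_paths T. f s \<in> A} \<in> sets (evaluation_algebra T B I)"
    unfolding sets_evaluation_algebra by (intro sigma_sets.Basic) auto
  moreover have "(\<lambda>f. f s) -` A \<inter> space (evaluation_algebra T B I) = {f \<in> cadlag_paths T. f s \<in> A}" by auto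
  ultimately show "(\<lambda>f. f s) -` A \<inter> space (evaluation_algebra T B I) \<in> sets (evaluation_algebra T B I)" by simp
qed (use assms(2) in simp)

lemma measurable_into_evaluation_algebra:
  assumes "\<And>x. x \<in> space M \<Longrightarrow> g x \<in> cadlag_paths T"
    and "\<And>s. s \<in> I \<Longrightarrow> (\<lambda>x. g x s) \<in> M \<rightarrow>\<^sub>M B"
  shows "g \<in> M \<rightarrow>\<^sub>M evaluation_algebra T B I"
  unfolding evaluation_algebra_def
proof (rule measurable_measure_of)
  fix y assume "y \<in> {{f \<in> cadlag_paths T. f s \<in> A} | s A. s \<in> I \<and> A \<in> sets B}"
  then obtain s A where y: "y = {f \<in> cadlag_paths T. f s \<in> A}" "s \<in> I" "A \<in> sets B" by auto
  have "g -` y \<inter> space M = (\<lambda>x. g x s) -` A \<inter> space M" using assms(1) y by auto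
  then show "g -` y \<inter> space M \<in> sets M" using measurable_sets[OF assms(2)] y by simp
qed (use assms(1) in auto)

lemma space_index_path_space [simp]: "space index_path_space = index_paths"
  by (simp add: index_path_space_def index_paths_def)

lemma space_index_filtration [simp]: "space (index_filtration t) = index_paths"
  by (simp add: index_filtration_def index_paths_def)

lemma space_velocity_path_space [simp]: "space velocity_path_space = cadlag_paths euclidean"
  by (simp add: velocity_path_space_def)

lemma measurable_index_eval:
  "0 \<le> s \<Longrightarrow> (\<lambda>\<omega>. \<omega> s) \<in> index_path_space \<rightarrow>\<^sub>M count_space UNIV"
  unfolding index_path_space_def by (rule measurable_evaluation) auto

lemma measurable_index_eval_filtration:
  "0 \<le> s \<Longrightarrow> s \<le> t \<Longrightarrow> (\<lambda>\<omega>. \<omega> s) \<in> index_filtration t \<rightarrow>\<^sub>M count_space UNIV"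
  unfolding index_filtration_def by (rule measurable_evaluation) auto

lemma measurable_velocity_eval:
  "0 \<le> s \<Longrightarrow> (\<lambda>\<xi>. \<xi> s) \<in> velocity_path_space \<rightarrow>\<^sub>M borel"
  unfolding velocity_path_space_def by (rule measurable_evaluation) auto

lemma evaluation_algebra_mono:
  "I \<subseteq> J \<Longrightarrow> sets (evaluation_algebra T B I) \<subseteq> sets (evaluation_algebra T B J)"
  unfolding sets_evaluation_algebra by (intro sigma_sets_mono') auto

lemma sets_index_filtration_subset: "sets (index_filtration t) \<subseteq> sets index_path_space"
  unfolding index_filtration_def index_path_space_def by (intro evaluation_algebra_mono) auto

lemma sets_index_filtration_mono: "s \<le> t \<Longrightarrow> sets (index_filtration s) \<subseteq> sets (index_filtration t)"
  unfolding index_filtration_def by (intro evaluation_algebra_mono) auto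

lemma index_pathsD:
  assumes "\<omega> \<in> index_paths"
  shows "0 \<le> t \<Longrightarrow> eventually (\<lambda>s. \<omega> s = \<omega> t) (at_right t)"
    and "0 < t \<Longrightarrow> \<exists>l. eventually (\<lambda>s. \<omega> s = l) (at_left t)"
    and "\<omega> \<in> extensional {0..}"
  using assms by (auto simp: index_paths_def cadlag_paths_def limitin_discrete_UNIV)

lemma index_pathsI:
  assumes "\<omega> \<in> extensional {0..}"
    and "\<And>t. 0 \<le> t \<Longrightarrow> eventually (\<lambda>s. \<omega> s = \<omega> t) (at_right t)"
    and "\<And>t. 0 < t \<Longrightarrow> \<exists>l. eventually (\<lambda>s. \<omega> s = l) (at_left t)"
  shows "\<omega> \<in> index_paths"
  using assms by (auto simp: index_paths_def cadlag_paths_def limitin_discrete_UNIV)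

text \<open>Freezing a path at t realises the past of t by a map into the full path space.\<close>

definition stopped_path :: "real \<Rightarrow> (real \<Rightarrow> 'm) \<Rightarrow> real \<Rightarrow> 'm" where
  "stopped_path t \<omega> = (\<lambda>s\<in>{0..}. \<omega> (min s t))"

lemma stopped_path_in_index_paths:
  assumes "\<omega> \<in> index_paths" "0 \<le> t"
  shows "stopped_path t \<omega> \<in> index_paths"
proof (rule index_pathsI)
  fix r :: real assume r: "0 \<le> r"
  show "eventually (\<lambda>s. stopped_path t \<omega> s = stopped_path t \<omega> r) (at_right r)"
  proof (cases "r < t")
    case True
    have "eventually (\<lambda>s. s < t) (at_right r)"
      unfolding eventually_at_right_field using True by (intro exI[of _ t]) auto
    with index_pathsD(1)[OF assms(1) r] eventually_at_right_less[of r] show ?thesis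
      by eventually_elim (use r True in \<open>auto simp: stopped_path_def\<close>)
  next
    case False
    show ?thesis
      using eventually_at_right_less[of r]
      by eventually_elim (use r False in \<open>auto simp: stopped_path_def min_def\<close>)
  qed
next
  fix r :: real assume r: "0 < r"
  have pos: "eventually (\<lambda>s. 0 < s) (at_left r)"
    unfolding eventually_at_left_field using r by (intro exI[of _ 0]) auto
  have less: "eventually (\<lambda>s. s < r) (at_left r)"
    unfolding eventually_at_left_field using r by (intro exI[of _ 0]) auto
  show "\<exists>l. eventually (\<lambda>s. stopped_path t \<omega> s = l) (at_left r)"
  proof (cases "r \<le> t")
    case True
    obtain l where "eventually (\<lambda>s. \<omega> s = l) (at_left r)" using index_pathsD(2)[OF assms(1) r] by blast
    then have "eventually (\<lambda>s. stopped_path t \<omega> s = l) (at_left r)" using pos less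
      by eventually_elim (use True in \<open>auto simp: stopped_path_def\<close>)
    then show ?thesis by blast
  next
    case False
    then have "eventually (\<lambda>s. t < s) (at_left r)"
      unfolding eventually_at_left_field by (intro exI[of _ t]) auto
    with pos have "eventually (\<lambda>s. stopped_path t \<omega> s = \<omega> t) (at_left r)"
      by eventually_elim (auto simp: stopped_path_def)
    then show ?thesis by blast
  qed
qed (simp add: stopped_path_def)

text \<open>Galmarino's test: a functional determined by the path up to t factors through
  \<open>stopped_path t\<close>, which is measurable from the past of t into the full path
  space.\<close>

lemma measurable_index_filtrationI:
  assumes X: "X \<in> index_path_space \<rightarrow>\<^sub>M N" and "0 \<le> t"
    and past: "\<And>\<omega>1 \<omega>2. \<omega>1 \<in> index_paths \<Longrightarrow> \<omega>2 \<in> index_paths \<Longrightarrow> (\<And>s. 0 \<le> s \<Longrightarrow> s \<le> t \<Longrightarrow> \<omega>1 s = \<omega>2 s) \<Longrightarrow> X \<omega>1 = X \<omega>2"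
  shows "X \<in> index_filtration t \<rightarrow>\<^sub>M N"
proof -
  have "stopped_path t \<in> index_filtration t \<rightarrow>\<^sub>M index_path_space"
    unfolding index_path_space_def
  proof (rule measurable_into_evaluation_algebra)
    show "stopped_path t \<omega> \<in> cadlag_paths (discrete_topology UNIV)" if "\<omega> \<in> space (index_filtration t)" for \<omega>
      using stopped_path_in_index_paths[of \<omega> t] that assms(2) by (simp add: index_paths_def)
    show "(\<lambda>\<omega>. stopped_path t \<omega> s) \<in> index_filtration t \<rightarrow>\<^sub>M count_space UNIV" if "s \<in> {0..}" for s
      using measurable_index_eval_filtration[of "min s t" t] that assms(2) by (simp add: stopped_path_def)
  qed
  from measurable_compose[OF this X] have "(\<lambda>\<omega>. X (stopped_path t \<omega>)) \<in> index_filtration t \<rightarrow>\<^sub>M N" .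
  moreover have "X (stopped_path t \<omega>) = X \<omega>" if "\<omega> \<in> space (index_filtration t)" for \<omega>
    using that stopped_path_in_index_paths[of \<omega> t] assms(2) by (intro past) (auto simp: stopped_path_def)
  ultimately show ?thesis using measurable_cong[of "index_filtration t" "\<lambda>\<omega>. X (stopped_path t \<omega>)" X] by blast
qed


section \<open>Cylinder sets as an intersection-stable generator\<close>

definition path_cylinder :: "real set \<Rightarrow> (real \<Rightarrow> 'm) \<Rightarrow> (real \<Rightarrow> 'm) set" where
  "path_cylinder J x = {\<omega> \<in> index_paths. \<forall>t\<in>J. \<omega> t = x t}"

text \<open>The empty set is included because two cylinders with conflicting values have an empty
  intersection.\<close>

definition path_cylinders :: "real set \<Rightarrow> (real \<Rightarrow> 'm) set set" where
  "path_cylinders I = {path_cylinder J x | J x. finite J \<and> J \<subseteq> I} \<union> {{}}"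

lemma Int_stable_path_cylinders: "Int_stable (path_cylinders I)"
proof (rule Int_stableI)
  fix A B :: "(real \<Rightarrow> 'm) set"
  assume AB: "A \<in> path_cylinders I" "B \<in> path_cylinders I"
  show "A \<inter> B \<in> path_cylinders I"
  proof (cases "A = {} \<or> B = {}")
    case False
    then obtain J x K y where J: "A = path_cylinder J x" "finite J" "J \<subseteq> I"
      and K: "B = path_cylinder K y" "finite K" "K \<subseteq> I"
      using AB by (auto simp: path_cylinders_def)
    show ?thesis
    proof (cases "\<forall>t\<in>J \<inter> K. x t = y t")
      case True
      then have "A \<inter> B = path_cylinder (J \<union> K) (\<lambda>t. if t \<in> J then x t else y t)"
        using J K by (auto simp: path_cylinder_def)
      with J K show ?thesis unfolding path_cylinders_def by blast
    next
      case False
      then have "A \<inter> B = {}" using J K by (auto simp: path_cylinder_def)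
      then show ?thesis by (simp add: path_cylinders_def)
    qed
  qed (auto simp: path_cylinders_def)
qed

text \<open>Over a finite index type, the event that the value at a time lies in A is a finite union
  of cylinders.\<close>

lemma sets_index_algebra:
  fixes I :: "real set"
  shows "sets (evaluation_algebra (discrete_topology UNIV) (count_space (UNIV :: 'm::finite set)) I) =
    sigma_sets index_paths (path_cylinders I)"
proof -
  let ?M = "evaluation_algebra (discrete_topology UNIV) (count_space (UNIV :: 'm set)) I"
  have "sigma_sets index_paths {{f \<in> index_paths. f s \<in> A} | s A. s \<in> I \<and> A \<in> sets (count_space (UNIV :: 'm set))}
     \<subseteq> sigma_sets index_paths (path_cylinders I)"
  proof (rule sigma_sets_mono, clarify)
    fix s and A :: "'m set" assume s: "s \<in> I"
    have eq: "{f \<in> index_paths. f s \<in> A} = (\<Union>a\<in>A. path_cylinder {s} (\<lambda>_. a))"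
      by (auto simp: path_cylinder_def)
    have "path_cylinder {s} (\<lambda>_. a) \<in> path_cylinders I" for a :: 'm
      using s unfolding path_cylinders_def by blast
    then show "{f \<in> index_paths. f s \<in> A} \<in> sigma_sets index_paths (path_cylinders I)"
      unfolding eq by (intro sigma_sets_UNION countable_finite finite_imageI) auto
  qed
  moreover have "sigma_sets index_paths (path_cylinders I) \<subseteq> sets ?M"
  proof (rule sets.sigma_sets_subset')
    have "path_cylinder J x \<in> sets ?M" if "finite J" "J \<subseteq> I" for J and x :: "real \<Rightarrow> 'm"
    proof -
      have "{\<omega> \<in> space ?M. \<forall>t\<in>J. \<omega> t = x t} \<in> sets ?M"
      proof (rule sets.sets_Collect_finite_All[OF _ \<open>finite J\<close>])
        fix t assume "t \<in> J"
        then have "(\<lambda>f. f t) \<in> ?M \<rightarrow>\<^sub>M count_space UNIV" using that by (intro measurable_evaluation) auto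
        from measurable_sets[OF this, of "{x t}"] show "{\<omega> \<in> space ?M. \<omega> t = x t} \<in> sets ?M"
          by (simp add: vimage_def Int_def conj_commute)
      qed
      then show ?thesis by (simp add: path_cylinder_def index_paths_def)
    qed
    then show "path_cylinders I \<subseteq> sets ?M" by (auto simp: path_cylinders_def)
    show "index_paths \<in> sets ?M" using sets.top[of ?M] by (simp add: index_paths_def)
  qed
  ultimately show ?thesis unfolding sets_evaluation_algebra by (simp add: index_paths_def)
qed

text \<open>Cylinders are indexed by finite sets of times, the index law by increasing sequences of
  times. The last clause identifies the latest time, as needed to append one more.\<close>

lemma increasing_enumeration:
  fixes J :: "real set"
  assumes "finite J" "J \<noteq> {}" "J \<subseteq> {0..}"
  shows "\<exists>(k::nat) t. 0 \<le> t 0 \<and> (\<forall>l<k. t l < t (Suc l)) \<and> J = t ` {..k} \<and> (\<forall>s\<in>J. s \<le> t k)"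
proof -
  define L where "L = sorted_list_of_set J"
  define k where "k = card J - 1"
  have len: "length L = Suc k" using assms by (simp add: L_def k_def card_gt_0_iff)
  have set: "set L = J" using assms by (simp add: L_def)
  have "sorted_wrt (<) L" unfolding L_def by (rule strict_sorted_list_of_set)
  then have mono: "L ! i < L ! j" if "i < j" "j < Suc k" for i j
    using that len by (simp add: sorted_wrt_nth_less)
  have J: "J = (\<lambda>n. L ! n) ` {..k}"
    using set len by (auto simp: set_conv_nth less_Suc_eq_le image_iff)
  moreover have "0 \<le> L ! 0"
  proof -
    have "L ! 0 \<in> J" unfolding J by auto
    then show ?thesis using assms(3) by auto
  qed
  moreover have "s \<le> L ! k" if s: "s \<in> J" for s
  proof -
    obtain i where "i \<le> k" "s = L ! i" using s unfolding J by auto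
    then show ?thesis using mono[of i k] by (cases "i = k") auto
  qed
  ultimately show ?thesis using mono by (intro exI[of _ k] exI[of _ "\<lambda>n. L ! n"]) auto
qed

subsection \<open>Existence and uniqueness of the index law\<close>

lemma is_index_law_cylinder:
  assumes "is_index_law \<Lambda> a P" "0 \<le> t 0" "\<And>l. l < k \<Longrightarrow> t l < t (Suc l)"
  shows "measure P (path_cylinder (t ` {..k}) x) =
    (\<Sum>i\<in>UNIV. a $ i * transition \<Lambda> (t 0) i (x (t 0))) *
    (\<Prod>l<k. transition \<Lambda> (t (Suc l) - t l) (x (t l)) (x (t (Suc l))))"
proof -
  have "path_cylinder (t ` {..k}) x = {\<omega> \<in> index_paths. \<forall>l\<le>k. \<omega> (t l) = x (t l)}"
    by (auto simp: path_cylinder_def)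
  then show ?thesis using assms
    by (simp add: is_index_law_def transition_def vector_matrix_mult_def mult.commute)
qed

text \<open>The prescribed probabilities fix the measure on all cylinders, which are stable under
  intersections and generate the \<sigma>-algebra.\<close>

lemma is_index_law_unique:
  fixes \<Lambda> :: "real^'m::finite^'m"
  assumes P: "is_index_law \<Lambda> a P" and Q: "is_index_law \<Lambda> a Q"
  shows "P = Q"
proof (rule measure_eqI_generator_eq[OF Int_stable_path_cylinders[of "{0..}"], of index_paths])
  show "path_cylinders {0..} \<subseteq> Pow index_paths"
    by (auto simp: path_cylinders_def path_cylinder_def)
  show "sets P = sigma_sets index_paths (path_cylinders {0..})" "sets Q = sigma_sets index_paths (path_cylinders {0..})"
    using P Q by (auto simp: is_index_law_def index_path_space_def sets_index_algebra)
  interpret P: prob_space P using P by (simp add: is_index_law_def)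
  interpret Q: prob_space Q using Q by (simp add: is_index_law_def)
  have PQ: "space P = index_paths" "space Q = index_paths" using P Q by (auto simp: is_index_law_def)
  fix A :: "(real \<Rightarrow> 'm) set" assume "A \<in> path_cylinders {0..}"
  then consider "A = {}" | J x where "A = path_cylinder J x" "finite J" "J \<subseteq> {0..}"
    by (auto simp: path_cylinders_def)
  then have "measure P A = measure Q A"
  proof cases
    case 2
    show ?thesis
    proof (cases "J = {}")
      case True
      then have "A = space P" "A = space Q" using 2 PQ by (auto simp: path_cylinder_def)
      then show ?thesis using P.prob_space Q.prob_space by simp
    next
      case False
      then obtain k :: nat and t where "0 \<le> t 0" "\<forall>l<k. t l < t (Suc l)" "J = t ` {..k}"
        using increasing_enumeration[of J] 2 by blast
      then show ?thesis using 2 is_index_law_cylinder[OF P, of t k x] is_index_law_cylinder[OF Q, of t k x] by simp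
    qed
  qed simp
  then show "emeasure P A = emeasure Q A" by (simp add: P.emeasure_eq_measure Q.emeasure_eq_measure)
next
  show "range (\<lambda>_::nat. index_paths :: (real \<Rightarrow> 'm) set) \<subseteq> path_cylinders {0..}"
    by (auto simp: path_cylinders_def path_cylinder_def intro!: exI[of _ "{}"])
  show "emeasure P index_paths \<noteq> \<infinity>" for i :: nat
    using prob_space.emeasure_space_1[of P] P by (auto simp: is_index_law_def)
qed simp

lemma axis_prob_vector: "axis i 1 \<in> (prob_vectors :: (real^'m::finite) set)"
  by (simp add: prob_vectors_def axis_def)

context
  fixes \<Lambda> :: "real^'m::finite^'m"
  assumes coupling: "coupling_matrix \<Lambda>"
begin

definition jump_law :: "real^'m \<Rightarrow> (real \<Rightarrow> 'm) measure" where
  "jump_law a = distr (measure_pmf (embed_pmf (($) a)) \<Otimes>\<^sub>M stream_space (mark_space \<Lambda>)) index_path_space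
     (\<lambda>x. restrict (jump_path (fst x) (snd x)) {0..})"

lemma measurable_restrict_jump_path:
  "(\<lambda>x. restrict (jump_path (fst x) (snd x)) {0..}) \<in>
     measure_pmf p \<Otimes>\<^sub>M stream_space (mark_space \<Lambda>) \<rightarrow>\<^sub>M index_path_space"
  unfolding index_path_space_def
proof (rule measurable_into_evaluation_algebra)
  show "restrict (jump_path (fst x) (snd x)) {0..} \<in> cadlag_paths (discrete_topology UNIV)"
    for x :: "'m \<times> (real \<times> ('m \<Rightarrow> 'm)) stream"
    using restrict_jump_path[of "fst x" "snd x"] by (simp add: index_paths_def)
  fix s :: real assume s: "s \<in> {0..}"
  have "(\<lambda>x. jump_path i (snd x) s) \<in> measure_pmf p \<Otimes>\<^sub>M stream_space (mark_space \<Lambda>) \<rightarrow>\<^sub>M count_space UNIV" for i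
    by (rule measurable_jump_path) measurable
  then have "(\<lambda>x. jump_path (fst x) (snd x) s) \<in> measure_pmf p \<Otimes>\<^sub>M stream_space (mark_space \<Lambda>) \<rightarrow>\<^sub>M count_space UNIV"
    by (rule measurable_compose_countable[where f = "\<lambda>i x. jump_path i (snd x) s" and g = fst]) measurable
  then show "(\<lambda>x. restrict (jump_path (fst x) (snd x)) {0..} s) \<in>
      measure_pmf p \<Otimes>\<^sub>M stream_space (mark_space \<Lambda>) \<rightarrow>\<^sub>M count_space UNIV"
    using s by simp
qed

lemma measure_jump_law:
  assumes a: "a \<in> prob_vectors" and A: "A \<in> sets index_path_space"
  shows "measure (jump_law a) A =
    (\<Sum>i\<in>UNIV. a $ i * (\<integral>w. indicator A (restrict (jump_path i w) {0..}) \<partial>stream_space (mark_space \<Lambda>)))"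
proof -
  let ?p = "embed_pmf (($) a)" and ?S = "stream_space (mark_space \<Lambda>)"
  interpret M: prob_space "mark_space \<Lambda>" by (rule prob_space_mark_space[OF coupling])
  interpret S: prob_space ?S by (rule M.prob_space_stream_space)
  interpret PS: pair_prob_space "measure_pmf ?p" ?S ..
  have pmf: "pmf ?p i = a $ i" for i
  proof (rule pmf_embed_pmf)
    show "(\<integral>\<^sup>+x. ennreal (a $ x) \<partial>count_space UNIV) = 1"
      using a by (simp add: nn_integral_count_space_finite sum_ennreal prob_vectors_def)
  qed (use a in \<open>simp add: prob_vectors_def\<close>)
  have [measurable]: "(\<lambda>x. restrict (jump_path (fst x) (snd x)) {0..}) \<in> measure_pmf ?p \<Otimes>\<^sub>M ?S \<rightarrow>\<^sub>M index_path_space"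
    by (rule measurable_restrict_jump_path)
  have [measurable]: "indicator A \<in> borel_measurable index_path_space" using A by simp
  have meas: "(\<lambda>x. indicator A (restrict (jump_path (fst x) (snd x)) {0..}) :: real) \<in> borel_measurable (measure_pmf ?p \<Otimes>\<^sub>M ?S)"
    by measurable
  have "A \<subseteq> index_paths" using sets.sets_into_space[OF A] by simp
  then have "measure (jump_law a) A = (\<integral>\<omega>. indicator A \<omega> \<partial>jump_law a)"
    by (simp add: jump_law_def Int_absorb2)
  also have "\<dots> = (\<integral>x. indicator A (restrict (jump_path (fst x) (snd x)) {0..}) \<partial>(measure_pmf ?p \<Otimes>\<^sub>M ?S))"
    unfolding jump_law_def by (rule integral_distr) measurable
  also have "\<dots> = (\<integral>i. (\<integral>w. indicator A (restrict (jump_path i w) {0..}) \<partial>?S) \<partial>measure_pmf ?p)"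
    using PS.integral_fst'[OF PS.P.integrable_const_bound[OF _ meas, of 1]] by simp
  also have "\<dots> = (\<Sum>i\<in>UNIV. a $ i * (\<integral>w. indicator A (restrict (jump_path i w) {0..}) \<partial>?S))"
    by (subst integral_measure_pmf[of UNIV]) (auto simp: pmf)
  finally show ?thesis .
qed

lemma is_index_law_jump_law:
  assumes a: "a \<in> prob_vectors"
  shows "is_index_law \<Lambda> a (jump_law a)"
  unfolding is_index_law_def
proof (intro conjI allI impI)
  interpret M: prob_space "mark_space \<Lambda>" by (rule prob_space_mark_space[OF coupling])
  interpret S: prob_space "stream_space (mark_space \<Lambda>)" by (rule M.prob_space_stream_space)
  interpret PS: pair_prob_space "measure_pmf (embed_pmf (($) a))" "stream_space (mark_space \<Lambda>)" ..
  show "prob_space (jump_law a)"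
    unfolding jump_law_def by (intro PS.P.prob_space_distr measurable_restrict_jump_path)
  show "space (jump_law a) = index_paths" "sets (jump_law a) = sets index_path_space"
    by (simp_all add: jump_law_def)
  fix k :: nat and t :: "nat \<Rightarrow> real" and j :: "nat \<Rightarrow> 'm"
  assume t: "0 \<le> t 0 \<and> (\<forall>l<k. t l < t (Suc l))"
  have tl: "0 \<le> t l" if "l \<le> k" for l
    using that
  proof (induction l)
    case (Suc l)
    then have "t l < t (Suc l)" using t by simp
    with Suc show ?case by simp
  qed (use t in simp)
  let ?A = "{\<omega> \<in> index_paths. \<forall>l\<le>k. \<omega> (t l) = j l}"
  have "{\<omega> \<in> space index_path_space. \<forall>l\<in>{..k}. \<omega> (t l) = j l} \<in> sets index_path_space"
  proof (rule sets.sets_Collect_finite_All)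
    fix l assume "l \<in> {..k}"
    then show "{\<omega> \<in> space index_path_space. \<omega> (t l) = j l} \<in> sets index_path_space"
      using measurable_sets[OF measurable_index_eval[OF tl], of l "{j l}"]
      by (simp add: vimage_def Int_def conj_commute)
  qed simp
  then have A: "?A \<in> sets index_path_space"
    by (simp only: space_index_path_space Ball_def atMost_iff)
  have ind: "indicator ?A (restrict (jump_path i w) {0..}) = (of_bool (\<forall>l\<le>k. jump_path i w (t l) = j l) :: real)"
    for i and w :: "(real \<times> ('m \<Rightarrow> 'm)) stream"
  proof -
    have "restrict (jump_path i w) {0..} (t l) = jump_path i w (t l)" if "l \<le> k" for l
      using tl[OF that] by simp
    then have "(\<forall>l\<le>k. restrict (jump_path i w) {0..} (t l) = j l) \<longleftrightarrow> (\<forall>l\<le>k. jump_path i w (t l) = j l)"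
      by (intro iff_allI imp_cong refl) simp
    then have "restrict (jump_path i w) {0..} \<in> ?A \<longleftrightarrow> (\<forall>l\<le>k. jump_path i w (t l) = j l)"
      using restrict_jump_path[of i w] by (simp only: mem_Collect_eq simp_thms)
    then show ?thesis by (simp only: indicator_def of_bool_def)
  qed
  have "measure (jump_law a) ?A =
     (\<Sum>i\<in>UNIV. a $ i * (\<integral>w. of_bool (\<forall>l\<le>k. jump_path i w (t l) = j l) \<partial>stream_space (mark_space \<Lambda>)))"
    unfolding measure_jump_law[OF a A] ind ..
  also have "\<dots> = (\<Sum>i\<in>UNIV. a $ i * (transition \<Lambda> (t 0) i (j 0) * (\<Prod>l<k. transition \<Lambda> (t (Suc l) - t l) (j l) (j (Suc l)))))"
    using t by (simp add: jump_path_fdd[OF coupling])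
  also have "\<dots> = (\<Sum>i\<in>UNIV. a $ i * transition \<Lambda> (t 0) i (j 0)) * (\<Prod>l<k. transition \<Lambda> (t (Suc l) - t l) (j l) (j (Suc l)))"
    by (simp add: sum_distrib_right mult.assoc)
  finally show "measure (jump_law a) ?A =
          (a v* mat_exp (- t 0 *\<^sub>R \<Lambda>)) $ j 0 *
          (\<Prod>l<k. mat_exp (- (t (Suc l) - t l) *\<^sub>R \<Lambda>) $ j l $ j (Suc l))"
    by (simp add: transition_def vector_matrix_mult_def mult.commute)
qed

lemma index_law_eq: "a \<in> prob_vectors \<Longrightarrow> index_law \<Lambda> a = jump_law a"
  unfolding index_law_def using is_index_law_jump_law is_index_law_unique by (blast intro: the_equality)

lemma is_index_law_index_law: "a \<in> prob_vectors \<Longrightarrow> is_index_law \<Lambda> a (index_law \<Lambda> a)"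
  by (simp add: index_law_eq is_index_law_jump_law)

lemma measure_index_law:
  assumes a: "a \<in> prob_vectors" and A: "A \<in> sets index_path_space"
  shows "measure (index_law \<Lambda> a) A = (\<Sum>i\<in>UNIV. a $ i * measure (index_law \<Lambda> (axis i 1)) A)"
proof -
  have "measure (index_law \<Lambda> (axis i 1)) A =
     (\<integral>w. indicator A (restrict (jump_path i w) {0..}) \<partial>stream_space (mark_space \<Lambda>))" for i
    unfolding index_law_eq[OF axis_prob_vector] measure_jump_law[OF axis_prob_vector A]
    by (simp add: axis_def if_distrib[of "\<lambda>x. x * _"] cong: if_cong)
  then show ?thesis by (simp add: index_law_eq[OF a] measure_jump_law[OF a A])
qed

lemma
  assumes "a \<in> prob_vectors"
  shows prob_space_index_law: "prob_space (index_law \<Lambda> a)"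
    and sets_index_law: "sets (index_law \<Lambda> a) = sets index_path_space"
    and space_index_law: "space (index_law \<Lambda> a) = index_paths"
  using is_index_law_index_law[OF assms] by (auto simp: is_index_law_def)

text \<open>The law started from a is the combination of the laws started from single indices with
  weights a; when these are positive, its null sets are null for each of them.\<close>

lemma almost_surely_axis:
  assumes "almost_surely \<Lambda> Q"
  shows "AE \<omega> in index_law \<Lambda> (axis i 1). Q \<omega>"
proof -
  obtain a where a: "a \<in> prob_vectors" "\<And>i. 0 < a $ i" "AE \<omega> in index_law \<Lambda> a. Q \<omega>"
    using assms by (auto simp: almost_surely_def)
  interpret A: prob_space "index_law \<Lambda> a" by (rule prob_space_index_law[OF a(1)])
  interpret I: prob_space "index_law \<Lambda> (axis i 1)" by (rule prob_space_index_law[OF axis_prob_vector])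
  obtain N where N: "{\<omega> \<in> space (index_law \<Lambda> a). \<not> Q \<omega>} \<subseteq> N" "emeasure (index_law \<Lambda> a) N = 0" "N \<in> sets (index_law \<Lambda> a)"
    using AE_E[OF a(3)] by blast
  then have N': "N \<in> sets index_path_space" by (simp add: sets_index_law[OF a(1)])
  have "a $ i * measure (index_law \<Lambda> (axis i 1)) N \<le> (\<Sum>i\<in>UNIV. a $ i * measure (index_law \<Lambda> (axis i 1)) N)"
    by (rule member_le_sum[where f = "\<lambda>i. a $ i * measure (index_law \<Lambda> (axis i 1)) N"])
       (auto intro!: mult_nonneg_nonneg less_imp_le[OF a(2)])
  also have "\<dots> = 0"
    using N(2) measure_index_law[OF a(1) N'] by (simp add: measure_def)
  finally have "measure (index_law \<Lambda> (axis i 1)) N = 0"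
    using a(2)[of i] measure_nonneg[of "index_law \<Lambda> (axis i 1)" N] by (simp add: mult_le_0_iff)
  then have "N \<in> null_sets (index_law \<Lambda> (axis i 1))"
    using N' by (auto simp: null_sets_def I.emeasure_eq_measure sets_index_law[OF axis_prob_vector])
  then show ?thesis
    by (rule AE_I') (use N(1) in \<open>auto simp: space_index_law[OF a(1)] space_index_law[OF axis_prob_vector]\<close>)
qed

lemma almost_surelyI:
  assumes "\<And>\<omega>. \<omega> \<in> index_paths \<Longrightarrow> Q \<omega>"
  shows "almost_surely \<Lambda> Q"
proof -
  define a :: "real^'m" where "a = (\<chi> i. 1 / real CARD('m))"
  have "a \<in> prob_vectors" by (simp add: a_def prob_vectors_def)
  moreover have "AE \<omega> in index_law \<Lambda> a. Q \<omega>"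
    by (rule AE_I2) (use assms space_index_law[OF \<open>a \<in> prob_vectors\<close>] in auto)
  ultimately show ?thesis unfolding almost_surely_def by (intro bexI[of _ a]) (auto simp: a_def)
qed

subsection \<open>Properties of the transition probabilities\<close>

text \<open>This representation yields nonnegativity and unit row sums of the matrix
  exponential.\<close>

lemma transition_eq_prob:
  assumes "0 \<le> t"
  shows "transition \<Lambda> t i j = (\<integral>w. of_bool (jump_path i w t = j) \<partial>stream_space (mark_space \<Lambda>))"
  using jump_path_fdd[OF coupling, of "\<lambda>_. t" 0 i "\<lambda>_. j"] assms by simp

lemma transition_nonneg: "0 \<le> t \<Longrightarrow> 0 \<le> transition \<Lambda> t i j"
  unfolding transition_eq_prob by (intro integral_nonneg_AE) auto

lemma transition_sum:
  assumes t: "0 \<le> t"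
  shows "(\<Sum>j\<in>UNIV. transition \<Lambda> t i j) = 1"
proof -
  interpret M: prob_space "mark_space \<Lambda>" by (rule prob_space_mark_space[OF coupling])
  interpret S: prob_space "stream_space (mark_space \<Lambda>)" by (rule M.prob_space_stream_space)
  have m: "(\<lambda>w. of_bool (jump_path i w t = j) :: real) \<in> borel_measurable (stream_space (mark_space \<Lambda>))" for j
  proof -
    have [measurable]: "(\<lambda>w. jump_path i w t) \<in> stream_space (mark_space \<Lambda>) \<rightarrow>\<^sub>M count_space UNIV"
      by (rule measurable_jump_path) measurable
    show ?thesis by measurable
  qed
  have "(\<Sum>j\<in>UNIV. transition \<Lambda> t i j) = (\<integral>w. (\<Sum>j\<in>UNIV. of_bool (jump_path i w t = j)) \<partial>stream_space (mark_space \<Lambda>))"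
    unfolding transition_eq_prob[OF t]
    by (subst Bochner_Integration.integral_sum) (auto intro!: S.integrable_const_bound[of _ 1] m)
  also have "(\<lambda>w. (\<Sum>j\<in>UNIV. of_bool (jump_path i w t = j)) :: real) = (\<lambda>w. 1)"
    by (auto simp: of_bool_def)
  finally show ?thesis using S.prob_space by simp
qed

lemma transition_le_1: "0 \<le> t \<Longrightarrow> transition \<Lambda> t i j \<le> 1"
  using member_le_sum[of j UNIV "transition \<Lambda> t i"] transition_nonneg transition_sum by fastforce

text \<open>\<open>exp (t \<Lambda>\<^sub>i\<^sub>i) P\<^sub>i\<^sub>j(t)\<close> is nondecreasing, so once an entry is positive it stays so. If some entries of a
  column vanished at time \<open>1\<close>, they would vanish on \<open>[0, 1]\<close>, and the backward equation would
  contradict irreducibility.\<close>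

lemma transition_pos: "0 < transition \<Lambda> 1 i j"
proof (rule ccontr)
  assume "\<not> 0 < transition \<Lambda> 1 i j"
  then have i: "transition \<Lambda> 1 i j = 0" using transition_nonneg[of 1 i j] by simp
  define f where "f i t = exp (\<Lambda> $ i $ i * t) * transition \<Lambda> t i j" for i t
  have f_deriv: "(f i has_real_derivative exp (\<Lambda> $ i $ i * t) * (\<Sum>l\<in>UNIV - {i}. - \<Lambda> $ i $ l * transition \<Lambda> t l j)) (at t)" for i t
  proof -
    have cancel: "x * e * T + (- x * T + S) * e = e * S" for x e T S :: real by (simp add: algebra_simps)
    have "(f i has_real_derivative \<Lambda> $ i $ i * exp (\<Lambda> $ i $ i * t) * transition \<Lambda> t i j
       + (\<Sum>l\<in>UNIV. - \<Lambda> $ i $ l * transition \<Lambda> t l j) * exp (\<Lambda> $ i $ i * t)) (at t)"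
      unfolding f_def by (rule DERIV_mult[OF _ transition_deriv]) (auto intro!: derivative_eq_intros)
    also have "(\<Sum>l\<in>UNIV. - \<Lambda> $ i $ l * transition \<Lambda> t l j) =
       - \<Lambda> $ i $ i * transition \<Lambda> t i j + (\<Sum>l\<in>UNIV - {i}. - \<Lambda> $ i $ l * transition \<Lambda> t l j)"
      by (rule sum.remove) auto
    also have "\<Lambda> $ i $ i * exp (\<Lambda> $ i $ i * t) * transition \<Lambda> t i j
        + (- \<Lambda> $ i $ i * transition \<Lambda> t i j + (\<Sum>l\<in>UNIV - {i}. - \<Lambda> $ i $ l * transition \<Lambda> t l j)) * exp (\<Lambda> $ i $ i * t)
        = exp (\<Lambda> $ i $ i * t) * (\<Sum>l\<in>UNIV - {i}. - \<Lambda> $ i $ l * transition \<Lambda> t l j)"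
      by (rule cancel)
    finally show ?thesis .
  qed
  have f_mono: "f i s \<le> f i t" if "0 \<le> s" "s \<le> t" for i s t
  proof (rule DERIV_nonneg_imp_nondecreasing[OF that(2)])
    fix x assume "s \<le> x" "x \<le> t"
    then have "0 \<le> x" using that by simp
    then have nn: "0 \<le> - \<Lambda> $ i $ l * transition \<Lambda> x l j" if "l \<in> UNIV - {i}" for l
      using coupling_offdiag[OF coupling, of i l] that transition_nonneg[of x l j] by (auto simp: mult_nonpos_nonneg)
    have "0 \<le> exp (\<Lambda> $ i $ i * x) * (\<Sum>l\<in>UNIV - {i}. - \<Lambda> $ i $ l * transition \<Lambda> x l j)"
      by (rule mult_nonneg_nonneg[OF exp_ge_zero sum_nonneg[OF nn]])
    with f_deriv show "\<exists>y. (f i has_real_derivative y) (at x) \<and> 0 \<le> y" by blast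
  qed
  define I where "I = {i. transition \<Lambda> 1 i j = 0}"
  have "j \<notin> I"
  proof
    assume "j \<in> I"
    then have "f j 1 = 0" by (simp add: I_def f_def)
    moreover have "f j 0 = 1" by (simp add: f_def transition_0)
    ultimately show False using f_mono[of 0 1 j] by simp
  qed
  moreover have "i \<in> I" using i by (simp add: I_def)
  ultimately have "I \<noteq> {}" "I \<noteq> UNIV" by auto
  then obtain k l where k: "k \<in> I" and l: "l \<notin> I" and kl: "\<Lambda> $ k $ l \<noteq> 0"
    using coupling_irreducible[OF coupling, of I] by blast
  have zero: "transition \<Lambda> t k j = 0" if "0 \<le> t" "t \<le> 1" for t
  proof -
    have "f k t \<le> 0" using f_mono[OF that, of k] k by (simp add: f_def I_def)
    then show ?thesis using transition_nonneg[OF that(1), of k j] by (simp add: f_def mult_le_0_iff)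
  qed
  have "transition \<Lambda> t l j = 0" if t: "0 < t" "t < 1" for t
  proof -
    have "((\<lambda>t. 0) has_real_derivative (\<Sum>m\<in>UNIV. - \<Lambda> $ k $ m * transition \<Lambda> t m j)) (at t)"
    proof (rule has_field_derivative_transform_within_open[OF transition_deriv[of \<Lambda> k j t], of "{0<..<1}"])
      show "\<And>x. x \<in> {0<..<1} \<Longrightarrow> transition \<Lambda> x k j = 0" using zero by auto
    qed (use t in auto)
    then have "(\<Sum>m\<in>UNIV. - \<Lambda> $ k $ m * transition \<Lambda> t m j) = 0"
      using DERIV_const_ratio_const DERIV_unique DERIV_const by blast
    then have "(\<Sum>m\<in>UNIV - {k}. - \<Lambda> $ k $ m * transition \<Lambda> t m j) = 0"
      using zero[of t] t by (simp add: sum.remove[of UNIV k])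
    moreover have "0 \<le> - \<Lambda> $ k $ m * transition \<Lambda> t m j" if "m \<in> UNIV - {k}" for m
      using coupling_offdiag[OF coupling, of k m] that t transition_nonneg[of t m j] by (auto simp: mult_nonpos_nonneg)
    ultimately have "- \<Lambda> $ k $ l * transition \<Lambda> t l j = 0"
      using k l by (subst (asm) sum_nonneg_eq_0_iff) auto
    then show ?thesis using kl by simp
  qed
  \<comment> \<open>The backward equation gave zero on the open interval; continuity from the left
    carries it to time 1.\<close>
  moreover have "((\<lambda>t. transition \<Lambda> t l j) \<longlongrightarrow> transition \<Lambda> 1 l j) (at_left 1)"
    using DERIV_isCont[OF transition_deriv[of \<Lambda> l j 1]] by (simp add: isCont_def filterlim_at_split)
  ultimately have "((\<lambda>t. 0) \<longlongrightarrow> transition \<Lambda> 1 l j) (at_left (1::real))"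
    by (elim Lim_transform_eventually) (auto simp: eventually_at_left_field intro!: exI[of _ 0])
  from tendsto_unique[OF _ this tendsto_const] have "transition \<Lambda> 1 l j = 0" by simp
  then show False using l by (simp add: I_def)
qed

subsection \<open>The Markov property\<close>

text \<open>Each side integrates Y against a measure on the past of t: the law weighted by the event
  of index k at t and l at t + h, or the law weighted by index k at t, times the transition
  probability. The two measures agree on cylinders, hence everywhere, so the identity holds for
  every past-measurable Y.\<close>

lemma markov_property:
  fixes Y :: "(real \<Rightarrow> 'm) \<Rightarrow> real"
  assumes a: "a \<in> prob_vectors" and t: "0 \<le> t" and h: "0 \<le> h" and Y: "Y \<in> borel_measurable (index_filtration t)"
  shows "(\<integral>\<omega>. of_bool (\<omega> t = k \<and> \<omega> (t + h) = l) * Y \<omega> \<partial>index_law \<Lambda> a) =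
    transition \<Lambda> h k l * (\<integral>\<omega>. of_bool (\<omega> t = k) * Y \<omega> \<partial>index_law \<Lambda> a)"
\<comment> \<open>Finite-dimensional distributions are given along strictly increasing times, so h =
  0 is treated apart.\<close>
proof (cases "h = 0")
  case True
  show ?thesis
  proof (cases "k = l")
    case False
    then have "(\<lambda>\<omega>. of_bool (\<omega> t = k \<and> \<omega> (t + h) = l) * Y \<omega>) = (\<lambda>\<omega>. 0)" using True by (auto simp: fun_eq_iff)
    then show ?thesis using False True by (simp only: transition_0) simp
  qed (use True in \<open>simp add: transition_0\<close>)
next
  case False
  then have h: "0 < h" using h by simp
  let ?P = "index_law \<Lambda> a" and ?F = "index_filtration t :: (real \<Rightarrow> 'm) measure"
  let ?B = "\<lambda>\<omega>. of_bool (\<omega> t = k \<and> \<omega> (t + h) = l) :: real"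
  let ?C = "\<lambda>\<omega>. transition \<Lambda> h k l * of_bool (\<omega> t = k) :: real"
  interpret P: prob_space ?P by (rule prob_space_index_law[OF a])
  note law = is_index_law_index_law[OF a]
  have sets_P [measurable_cong]: "sets ?P = sets index_path_space" by (rule sets_index_law[OF a])
  have space_P: "space ?P = index_paths" by (rule space_index_law[OF a])
  have c: "0 \<le> transition \<Lambda> h k l" using h by (intro transition_nonneg) simp
  have m1 [measurable]: "(\<lambda>\<omega>. \<omega> t) \<in> ?P \<rightarrow>\<^sub>M count_space UNIV"
    and m2 [measurable]: "(\<lambda>\<omega>. \<omega> (t + h)) \<in> ?P \<rightarrow>\<^sub>M count_space UNIV"
    using measurable_index_eval[of t] measurable_index_eval[of "t + h"] t h
    by (auto simp: measurable_cong_sets[OF sets_P refl])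
  have id_meas [measurable]: "(\<lambda>\<omega>. \<omega>) \<in> density ?P f \<rightarrow>\<^sub>M ?F" for f
    using sets_index_filtration_subset[of t] by (intro measurableI) (auto simp: space_P sets_P)
  have id_meas' [measurable]: "(\<lambda>\<omega>. \<omega>) \<in> ?P \<rightarrow>\<^sub>M ?F"
    using sets_index_filtration_subset[of t] by (intro measurableI) (auto simp: space_P sets_P)
  have S1: "{\<omega> \<in> A. \<omega> t = k} \<in> sets ?P" if A: "A \<in> sets ?P" for A
  proof -
    have "{\<omega> \<in> A. \<omega> t = k} = A \<inter> ((\<lambda>\<omega>. \<omega> t) -` {k} \<inter> space ?P)"
      using sets.sets_into_space[OF A] by auto
    then show ?thesis using A measurable_sets[OF m1, of "{k}"] by auto
  qed
  have S2: "{\<omega> \<in> A. \<omega> t = k \<and> \<omega> (t + h) = l} \<in> sets ?P" if A: "A \<in> sets ?P" for A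
  proof -
    have "{\<omega> \<in> A. \<omega> t = k \<and> \<omega> (t + h) = l} = {\<omega> \<in> A. \<omega> t = k} \<inter> ((\<lambda>\<omega>. \<omega> (t + h)) -` {l} \<inter> space ?P)"
      using sets.sets_into_space[OF A] by auto
    then show ?thesis using S1[OF A] measurable_sets[OF m2, of "{l}"] by auto
  qed
  have Bm: "?B \<in> borel_measurable ?P" and Cm: "?C \<in> borel_measurable ?P" by measurable
  define \<mu> where "\<mu> = distr (density ?P ?B) ?F (\<lambda>\<omega>. \<omega>)"
  define \<nu> where "\<nu> = distr (density ?P ?C) ?F (\<lambda>\<omega>. \<omega>)"
  have E\<mu>: "emeasure \<mu> A = ennreal (measure P {\<omega> \<in> A. \<omega> t = k \<and> \<omega> (t + h) = l})" 
    if "A \<in> sets ?F" "P = ?P" for A P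
  proof -
    have A: "A \<in> sets ?P" using that sets_index_filtration_subset[of t] sets_P by auto
    have "emeasure \<mu> A = (\<integral>\<^sup>+\<omega>. ennreal (?B \<omega>) * indicator A \<omega> \<partial>?P)"
      unfolding \<mu>_def using that A
      by (subst emeasure_distr) (auto simp: emeasure_density space_P sets.Int_space_eq2 Int_absorb2 sets.sets_into_space[of A ?F, simplified])
    also have "\<dots> = (\<integral>\<^sup>+\<omega>. indicator {\<omega> \<in> A. \<omega> t = k \<and> \<omega> (t + h) = l} \<omega> \<partial>?P)"
      by (intro nn_integral_cong) (auto simp: indicator_def)
    also have "\<dots> = emeasure ?P {\<omega> \<in> A. \<omega> t = k \<and> \<omega> (t + h) = l}"
      by (intro nn_integral_indicator S2 A)
    finally show ?thesis using that by (simp add: P.emeasure_eq_measure)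
  qed
  have E\<nu>: "emeasure \<nu> A = ennreal (transition \<Lambda> h k l * measure P {\<omega> \<in> A. \<omega> t = k})" 
    if "A \<in> sets ?F" "P = ?P" for A P
  proof -
    have A: "A \<in> sets ?P" using that sets_index_filtration_subset[of t] sets_P by auto
    have "emeasure \<nu> A = (\<integral>\<^sup>+\<omega>. ennreal (?C \<omega>) * indicator A \<omega> \<partial>?P)"
      unfolding \<nu>_def using that A
      by (subst emeasure_distr) (auto simp: emeasure_density space_P sets.Int_space_eq2 Int_absorb2 sets.sets_into_space[of A ?F, simplified])
    also have "\<dots> = (\<integral>\<^sup>+\<omega>. ennreal (transition \<Lambda> h k l) * indicator {\<omega> \<in> A. \<omega> t = k} \<omega> \<partial>?P)"
      by (intro nn_integral_cong) (auto simp: indicator_def)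
    also have "\<dots> = ennreal (transition \<Lambda> h k l) * emeasure ?P {\<omega> \<in> A. \<omega> t = k}"
      by (intro nn_integral_cmult_indicator S1 A)
    finally show ?thesis using that c by (simp add: P.emeasure_eq_measure ennreal_mult)
  qed
  have "\<mu> = \<nu>"
  proof (rule measure_eqI_generator_eq[OF Int_stable_path_cylinders[of "{0..t}"], of index_paths])
    show "path_cylinders {0..t} \<subseteq> Pow index_paths"
      by (auto simp: path_cylinders_def path_cylinder_def)
    show "sets \<mu> = sigma_sets index_paths (path_cylinders {0..t})" "sets \<nu> = sigma_sets index_paths (path_cylinders {0..t})"
      by (auto simp: \<mu>_def \<nu>_def index_filtration_def sets_index_algebra)
    have sets_F: "sets ?F = sigma_sets index_paths (path_cylinders {0..t})"
      by (simp add: index_filtration_def sets_index_algebra)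
    show "range (\<lambda>_::nat. index_paths :: (real \<Rightarrow> 'm) set) \<subseteq> path_cylinders {0..t}"
      by (auto simp: path_cylinders_def path_cylinder_def intro!: exI[of _ "{}"])
    show "emeasure \<mu> index_paths \<noteq> \<infinity>" for i :: nat
      using E\<mu>[of index_paths ?P] sets.top[of ?F] by simp
    fix A :: "(real \<Rightarrow> 'm) set" assume A: "A \<in> path_cylinders {0..t}"
    then have AF: "A \<in> sets ?F" unfolding sets_F by (rule sigma_sets.Basic)
    from A consider "A = {}" | J x where "A = path_cylinder J x" "finite J" "J \<subseteq> {0..t}"
      by (auto simp: path_cylinders_def)
    then have "measure ?P {\<omega> \<in> A. \<omega> t = k \<and> \<omega> (t + h) = l} = transition \<Lambda> h k l * measure ?P {\<omega> \<in> A. \<omega> t = k}"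
    proof cases
      case 2
      show ?thesis
      \<comment> \<open>A cylinder that prescribes another index at t makes both events empty.
        Otherwise t is adjoined to its times, where it becomes the latest, and t + h is
        appended.\<close>
      proof (cases "t \<in> J \<and> x t \<noteq> k")
        case True
        then have "{\<omega> \<in> A. \<omega> t = k \<and> \<omega> (t + h) = l} = {}" "{\<omega> \<in> A. \<omega> t = k} = {}"
          using 2 by (auto simp: path_cylinder_def)
        then show ?thesis by (simp only: measure_empty mult_zero_right)
      next
        case False
        define x' where "x' = x(t := k, t + h := l)"
        have x't: "x' t = k" and x'h: "x' (t + h) = l" using h by (auto simp: x'_def)
        have x'J: "x' r = x r" if "r \<in> J" for r
          using that 2(3) False h by (cases "r = t") (auto simp: x'_def)
        have "\<exists>(n::nat) s. 0 \<le> s 0 \<and> (\<forall>l<n. s l < s (Suc l)) \<and> insert t J = s ` {..n} \<and> (\<forall>r\<in>insert t J. r \<le> s n)"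
          by (rule increasing_enumeration) (use 2 t in auto)
        then obtain n :: nat and s where s: "0 \<le> s 0" "\<forall>l<n. s l < s (Suc l)" "insert t J = s ` {..n}" "\<forall>r\<in>insert t J. r \<le> s n"
          by blast
        have "s n \<in> insert t J" unfolding s(3) by simp
        then have sn: "s n = t" using s(4) 2 by force
        define s' where "s' m = (if m \<le> n then s m else t + h)" for m
        have le: "s m \<le> t" if "m \<le> n" for m using s(3) 2 that by force
        have eqC: "{\<omega> \<in> A. \<omega> t = k} = path_cylinder (s ` {..n}) x'"
          unfolding s(3)[symmetric] 2(1) path_cylinder_def using x't x'J by auto
        have s'_im: "s' ` {..Suc n} = insert (t + h) (insert t J)"
          unfolding s(3) by (auto simp: s'_def atMost_Suc)
        have eqB: "{\<omega> \<in> A. \<omega> t = k \<and> \<omega> (t + h) = l} = path_cylinder (s' ` {..Suc n}) x'"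
          unfolding s'_im 2(1) path_cylinder_def using x't x'h x'J by auto
        have "measure ?P (path_cylinder (s' ` {..Suc n}) x') =
          (\<Sum>i\<in>UNIV. a $ i * transition \<Lambda> (s' 0) i (x' (s' 0))) *
          (\<Prod>l<Suc n. transition \<Lambda> (s' (Suc l) - s' l) (x' (s' l)) (x' (s' (Suc l))))"
        proof (rule is_index_law_cylinder[OF law])
          show "0 \<le> s' 0" using s by (simp add: s'_def)
          show "s' l < s' (Suc l)" if "l < Suc n" for l
            using s(2) that sn h by (cases "l = n") (auto simp: s'_def)
        qed
        also have "\<dots> = (\<Sum>i\<in>UNIV. a $ i * transition \<Lambda> (s 0) i (x' (s 0))) *
          (\<Prod>l<n. transition \<Lambda> (s (Suc l) - s l) (x' (s l)) (x' (s (Suc l)))) * transition \<Lambda> h k l"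
          using sn h x't x'h by (simp add: s'_def)
        also have "\<dots> = measure ?P (path_cylinder (s ` {..n}) x') * transition \<Lambda> h k l"
          by (subst is_index_law_cylinder[OF law]) (use s in auto)
        finally show ?thesis unfolding eqB eqC by (simp only: mult.commute)
      qed
    qed simp
    then show "emeasure \<mu> A = emeasure \<nu> A" using E\<mu>[OF AF refl] E\<nu>[OF AF refl] by simp
  qed simp
  have Ym: "Y \<in> borel_measurable ?P" using measurable_compose[OF id_meas' Y] by simp
  have "(\<integral>\<omega>. ?B \<omega> * Y \<omega> \<partial>?P) = integral\<^sup>L \<mu> Y"
    unfolding \<mu>_def by (subst integral_distr[OF id_meas Y], subst integral_density[OF Ym Bm]) auto
  also have "\<dots> = (\<integral>\<omega>. ?C \<omega> * Y \<omega> \<partial>?P)"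
    unfolding \<open>\<mu> = \<nu>\<close> \<nu>_def by (subst integral_distr[OF id_meas Y], subst integral_density[OF Ym Cm]) (auto simp: c)
  also have "\<dots> = transition \<Lambda> h k l * (\<integral>\<omega>. of_bool (\<omega> t = k) * Y \<omega> \<partial>?P)"
    by (simp add: mult.assoc)
  finally show ?thesis .
qed

end

abbreviation (input) axis_law :: "real^'m^'m \<Rightarrow> 'm::finite \<Rightarrow> (real \<Rightarrow> 'm) measure" where
  "axis_law \<Lambda> i \<equiv> index_law \<Lambda> (axis i 1)"

lemma
  assumes "coupling_matrix \<Lambda>"
  shows prob_space_axis_law: "prob_space (axis_law \<Lambda> i)"
    and sets_axis_law: "sets (axis_law \<Lambda> i) = sets index_path_space"
    and space_axis_law: "space (axis_law \<Lambda> i) = index_paths"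
  using assms by (simp_all add: prob_space_index_law sets_index_law space_index_law axis_prob_vector)

subsection \<open>Right-continuous processes\<close>

text \<open>The next grid point strictly to the right of s, so that values along refining grids
  converge by right continuity.\<close>

definition grid_above :: "nat \<Rightarrow> real \<Rightarrow> real" where
  "grid_above n s = (of_int \<lfloor>real (Suc n) * s\<rfloor> + 1) / real (Suc n)"

lemma grid_above_bounds: "s < grid_above n s" "grid_above n s \<le> s + 1 / real (Suc n)"
proof -
  have "real (Suc n) * s < of_int \<lfloor>real (Suc n) * s\<rfloor> + 1" by linarith
  then show "s < grid_above n s"
    by (simp add: grid_above_def pos_less_divide_eq mult.commute del: of_nat_Suc)
  have "of_int \<lfloor>real (Suc n) * s\<rfloor> + 1 \<le> real (Suc n) * s + 1" by linarith
  then show "grid_above n s \<le> s + 1 / real (Suc n)"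
    by (simp add: grid_above_def pos_divide_le_eq algebra_simps del: of_nat_Suc)
qed

lemma filterlim_grid_above: "filterlim (\<lambda>n. grid_above n s) (at_right s) sequentially"
  unfolding filterlim_at
proof
  show "\<forall>\<^sub>F n in sequentially. grid_above n s \<in> {s<..} \<and> grid_above n s \<noteq> s"
    using grid_above_bounds(1)[of s] by (intro always_eventually allI) (auto simp: less_imp_neq[symmetric])
  show "(\<lambda>n. grid_above n s) \<longlonglongrightarrow> s"
  proof (rule tendsto_sandwich[where f = "\<lambda>_. s" and h = "\<lambda>n. s + 1 / real (Suc n)"])
    show "(\<lambda>n. s + 1 / real (Suc n)) \<longlonglongrightarrow> s"
      using tendsto_add[OF tendsto_const LIMSEQ_inverse_real_of_nat, of s] by (simp add: inverse_eq_divide)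
    show "\<forall>\<^sub>F n in sequentially. s \<le> grid_above n s"
      using grid_above_bounds(1)[of s] by (intro always_eventually allI) (auto intro: less_imp_le)
    show "\<forall>\<^sub>F n in sequentially. grid_above n s \<le> s + 1 / real (Suc n)"
      using grid_above_bounds(2)[of _ s] by (intro always_eventually allI)
  qed simp
qed

text \<open>A limit of processes that are constant in time between grid points. The
  \<open>max 0\<close> extends the time axis to all reals, where the Borel algebra and Lebesgue
  measure live.\<close>

lemma joint_measurable_right_continuous:
  fixes X :: "'a \<Rightarrow> real \<Rightarrow> 'b::metric_space"
  assumes m: "\<And>s. 0 \<le> s \<Longrightarrow> (\<lambda>\<omega>. X \<omega> s) \<in> borel_measurable M"
    and rc: "\<And>\<omega> s. \<omega> \<in> space M \<Longrightarrow> 0 \<le> s \<Longrightarrow> (X \<omega> \<longlongrightarrow> X \<omega> s) (at_right s)"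
  shows "(\<lambda>p. X (fst p) (max 0 (snd p))) \<in> borel_measurable (M \<Otimes>\<^sub>M borel)"
proof (rule borel_measurable_LIMSEQ_metric)
  fix n
  have "(\<lambda>p. X (fst p) (max 0 ((of_int i + 1) / real (Suc n)))) \<in> borel_measurable (M \<Otimes>\<^sub>M borel)" for i :: int
    by (rule measurable_compose[OF measurable_fst m]) simp
  then have "(\<lambda>p. X (fst p) (max 0 ((of_int \<lfloor>real (Suc n) * max 0 (snd p)\<rfloor> + 1) / real (Suc n)))) \<in> borel_measurable (M \<Otimes>\<^sub>M borel)"
    by (rule measurable_compose_countable[where g = "\<lambda>p. \<lfloor>real (Suc n) * max 0 (snd p)\<rfloor>"]) measurable
  moreover have "max 0 (grid_above n (max 0 s)) = grid_above n (max 0 s)" for s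
    using grid_above_bounds(1)[of "max 0 s" n] by simp
  ultimately show "(\<lambda>p. X (fst p) (grid_above n (max 0 (snd p)))) \<in> borel_measurable (M \<Otimes>\<^sub>M borel)"
    unfolding grid_above_def by simp
next
  fix p assume "p \<in> space (M \<Otimes>\<^sub>M (borel :: real measure))"
  then have "fst p \<in> space M" by (auto simp: space_pair_measure)
  from filterlim_compose[OF rc[OF this] filterlim_grid_above]
  show "(\<lambda>n. X (fst p) (grid_above n (max 0 (snd p)))) \<longlonglongrightarrow> X (fst p) (max 0 (snd p))" by simp
qed

lemma measurable_at_random_time:
  fixes X :: "'a \<Rightarrow> real \<Rightarrow> 'b::metric_space"
  assumes "\<And>s. 0 \<le> s \<Longrightarrow> (\<lambda>\<omega>. X \<omega> s) \<in> borel_measurable M"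
    and "\<And>\<omega> s. \<omega> \<in> space M \<Longrightarrow> 0 \<le> s \<Longrightarrow> (X \<omega> \<longlongrightarrow> X \<omega> s) (at_right s)"
    and [measurable]: "\<tau> \<in> borel_measurable M" and "\<And>\<omega>. \<omega> \<in> space M \<Longrightarrow> 0 \<le> \<tau> \<omega>"
  shows "(\<lambda>\<omega>. X \<omega> (\<tau> \<omega>)) \<in> borel_measurable M"
proof -
  have "(\<lambda>\<omega>. (\<omega>, \<tau> \<omega>)) \<in> M \<rightarrow>\<^sub>M M \<Otimes>\<^sub>M borel" by measurable
  from measurable_compose[OF this joint_measurable_right_continuous[OF assms(1,2)]]
  have "(\<lambda>\<omega>. X \<omega> (max 0 (\<tau> \<omega>))) \<in> borel_measurable M" by simp
  also have "?this \<longleftrightarrow> ?thesis"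
    by (rule measurable_cong) (simp add: assms(4))
  finally show ?thesis .
qed

lemma measurable_right_continuous:
  fixes f :: "real \<Rightarrow> 'b::metric_space"
  assumes "\<And>s. 0 \<le> s \<Longrightarrow> (f \<longlongrightarrow> f s) (at_right s)"
  shows "(\<lambda>s. f (max 0 s)) \<in> borel_measurable borel"
proof -
  have "(\<lambda>s. ((), s)) \<in> borel \<rightarrow>\<^sub>M count_space UNIV \<Otimes>\<^sub>M borel" by measurable
  from measurable_compose[OF this joint_measurable_right_continuous[of "\<lambda>_. f" "count_space UNIV"]]
  show ?thesis using assms by simp
qed

lemma measurable_set_lebesgue_integral_param:
  fixes f :: "'a \<Rightarrow> real \<Rightarrow> 'b::{banach, second_countable_topology}"
  assumes f: "(\<lambda>p. f (fst p) (max 0 (snd p))) \<in> borel_measurable (M \<Otimes>\<^sub>M borel)" and "0 \<le> a"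
  shows "(\<lambda>\<omega>. LINT s:{a..b}|lborel. f \<omega> s) \<in> borel_measurable M"
proof -
  have [measurable]: "(\<lambda>p. f (fst p) (max 0 (snd p))) \<in> borel_measurable (M \<Otimes>\<^sub>M lborel)"
    using f by (simp cong: measurable_cong_sets sets_pair_measure_cong)
  have "(\<lambda>\<omega>. \<integral>s. indicator {a..b} s *\<^sub>R f \<omega> (max 0 s) \<partial>lborel) \<in> borel_measurable M"
    by (rule lborel.borel_measurable_lebesgue_integral) (unfold case_prod_beta', measurable)
  moreover have "indicator {a..b} s *\<^sub>R f \<omega> (max 0 s) = indicator {a..b} s *\<^sub>R f \<omega> s" for s \<omega>
    using \<open>0 \<le> a\<close> by (auto simp: indicator_def max_def)
  ultimately show ?thesis by (simp add: set_lebesgue_integral_def)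
qed

subsection \<open>Cadlag velocities and their trajectories\<close>

lemma cadlag_right:
  fixes \<xi> :: "real \<Rightarrow> 'b::real_normed_vector"
  shows "\<xi> \<in> cadlag_paths euclidean \<Longrightarrow> 0 \<le> s \<Longrightarrow> (\<xi> \<longlongrightarrow> \<xi> s) (at_right s)"
  by (simp add: cadlag_paths_def)

text \<open>Bisection: near each point the one-sided limits bound the path. The guard
  \<open>0 \<le> s\<close> discards negative times from the neighbourhoods of 0.\<close>

lemma cadlag_bounded:
  fixes \<xi> :: "real \<Rightarrow> 'b::real_normed_vector"
  assumes \<xi>: "\<xi> \<in> cadlag_paths euclidean"
  shows "\<exists>B. \<forall>s\<in>{0..T}. norm (\<xi> s) \<le> B"
proof (cases "0 \<le> T")
  case True
  then have "\<exists>B. \<forall>s\<in>{0..T}. 0 \<le> s \<longrightarrow> norm (\<xi> s) \<le> B"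
  proof (rule Bolzano[where P = "\<lambda>a b. \<exists>B. \<forall>s\<in>{a..b}. 0 \<le> s \<longrightarrow> norm (\<xi> s) \<le> B"])
    fix a b c
    assume "\<exists>B. \<forall>s\<in>{a..b}. 0 \<le> s \<longrightarrow> norm (\<xi> s) \<le> B" "\<exists>B. \<forall>s\<in>{b..c}. 0 \<le> s \<longrightarrow> norm (\<xi> s) \<le> B"
    then obtain B1 B2 where B: "\<forall>s\<in>{a..b}. 0 \<le> s \<longrightarrow> norm (\<xi> s) \<le> B1" "\<forall>s\<in>{b..c}. 0 \<le> s \<longrightarrow> norm (\<xi> s) \<le> B2" by blast
    show "\<exists>B. \<forall>s\<in>{a..c}. 0 \<le> s \<longrightarrow> norm (\<xi> s) \<le> B"
    proof (intro exI[of _ "max B1 B2"] ballI impI)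
      fix s assume "s \<in> {a..c}" "0 \<le> s"
      then show "norm (\<xi> s) \<le> max B1 B2" using B by (cases "s \<le> b") (auto simp: le_max_iff_disj)
    qed
  next
    fix x assume local: "0 \<le> x" "x \<le> T"
    have right: "(\<xi> \<longlongrightarrow> \<xi> x) (at_right x)" using \<xi> local by (intro cadlag_right)
    have "\<forall>\<^sub>F s in at_right x. dist (\<xi> s) (\<xi> x) < 1" using tendstoD[OF right] by simp
    then obtain r where r: "r > x" "\<And>s. x < s \<Longrightarrow> s < r \<Longrightarrow> dist (\<xi> s) (\<xi> x) < 1"
      unfolding eventually_at_right_field by blast
    have "\<exists>l r'. r' < x \<and> (\<forall>s. 0 \<le> s \<and> r' < s \<and> s < x \<longrightarrow> dist (\<xi> s) l < 1)"
    proof (cases "x = 0")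
      case True
      then show ?thesis by (intro exI[of _ 0] exI[of _ "-1"]) auto
    next
      case False
      then have "0 < x" using local by simp
      then obtain l where "(\<xi> \<longlongrightarrow> l) (at_left x)" using \<xi> by (auto simp: cadlag_paths_def)
      then have "\<forall>\<^sub>F s in at_left x. dist (\<xi> s) l < 1" using tendstoD by fastforce
      then obtain r' where "r' < x" "\<forall>s>r'. s < x \<longrightarrow> dist (\<xi> s) l < 1"
        unfolding eventually_at_left_field by blast
      then show ?thesis by blast
    qed
    then obtain l r' where r': "r' < x" "\<And>s. 0 \<le> s \<Longrightarrow> r' < s \<Longrightarrow> s < x \<Longrightarrow> dist (\<xi> s) l < 1" by blast
    show "\<exists>d>0. \<forall>a b. a \<le> x \<and> x \<le> b \<and> b - a < d \<longrightarrow> (\<exists>B. \<forall>s\<in>{a..b}. 0 \<le> s \<longrightarrow> norm (\<xi> s) \<le> B)"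
    proof (rule exI[of _ "min (r - x) (x - r')"], intro conjI allI impI)
      fix a b assume ab: "a \<le> x \<and> x \<le> b \<and> b - a < min (r - x) (x - r')"
      show "\<exists>B. \<forall>s\<in>{a..b}. 0 \<le> s \<longrightarrow> norm (\<xi> s) \<le> B"
      proof (intro exI[of _ "1 + norm (\<xi> x) + norm l"] ballI impI)
        fix s assume s: "s \<in> {a..b}" "0 \<le> s"
        consider "s < x" | "s = x" | "x < s" by linarith
        then show "norm (\<xi> s) \<le> 1 + norm (\<xi> x) + norm l"
        proof cases
          case 1
          then have "norm (\<xi> s - l) < 1" using r'(2)[of s] s ab by (simp add: dist_norm)
          then show ?thesis using norm_triangle_sub[of "\<xi> s" l] norm_ge_zero[of "\<xi> x"] by linarith
        next
          case 3
          then have "norm (\<xi> s - \<xi> x) < 1" using r(2)[of s] s ab by (simp add: dist_norm)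
          then show ?thesis using norm_triangle_sub[of "\<xi> s" "\<xi> x"] norm_ge_zero[of l] by linarith
        qed simp
      qed
    qed (use r r' in simp)
  qed
  then show ?thesis by auto
qed simp

lemma set_integrable_right_continuous:
  fixes f :: "real \<Rightarrow> 'b::{banach, second_countable_topology}"
  assumes "\<And>s. 0 \<le> s \<Longrightarrow> (f \<longlongrightarrow> f s) (at_right s)" and "\<And>s. s \<in> {a..b} \<Longrightarrow> norm (f s) \<le> B" and "0 \<le> a"
  shows "set_integrable lborel {a..b} f"
proof -
  have [measurable]: "(\<lambda>s. f (max 0 s)) \<in> borel_measurable borel"
    by (rule measurable_right_continuous) (rule assms(1))
  have "AE s in lborel. s \<in> {a..b} \<longrightarrow> norm (indicator {a..b} s *\<^sub>R f (max 0 s)) \<le> B"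
    using assms(2,3) by (auto simp: max_def)
  moreover have "(\<lambda>s. indicator {a..b} s *\<^sub>R f (max 0 s)) \<in> borel_measurable lborel" by measurable
  ultimately have "integrable lborel (\<lambda>s. indicator {a..b} s *\<^sub>R f (max 0 s))"
    by (intro integrableI_bounded_set[where A = "{a..b}" and B = B]) (auto simp: emeasure_lborel_Icc_eq)
  moreover have "indicator {a..b} s *\<^sub>R f (max 0 s) = indicator {a..b} s *\<^sub>R f s" for s
    using \<open>0 \<le> a\<close> by (auto simp: indicator_def max_def)
  ultimately show ?thesis by (simp add: set_integrable_def)
qed

lemma cadlag_set_integrable:
  fixes \<xi> :: "real \<Rightarrow> 'b::{banach, second_countable_topology}"
  assumes \<xi>: "\<xi> \<in> cadlag_paths euclidean" and "0 \<le> a"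
  shows "set_integrable lborel {a..b} \<xi>"
proof -
  obtain B where "\<forall>s\<in>{0..b}. norm (\<xi> s) \<le> B" using cadlag_bounded[OF \<xi>] by blast
  then show ?thesis
    by (intro set_integrable_right_continuous[where B = B] cadlag_right \<xi>) (use \<open>0 \<le> a\<close> in auto)
qed

lemma displacement_integral:
  fixes \<xi> :: "real \<Rightarrow> real^'n"
  assumes \<xi>: "\<xi> \<in> cadlag_paths euclidean"
  shows "displacement \<xi> t = integral {0..t} \<xi>"
  unfolding displacement_def by (rule set_borel_integral_eq_integral(2)[OF cadlag_set_integrable[OF \<xi>]]) simp

lemma cadlag_integrable_on:
  fixes \<xi> :: "real \<Rightarrow> real^'n"
  assumes \<xi>: "\<xi> \<in> cadlag_paths euclidean" and "0 \<le> a"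
  shows "\<xi> integrable_on {a..b}"
  by (rule set_borel_integral_eq_integral(1)[OF cadlag_set_integrable[OF assms]])

lemma displacement_0: "displacement (\<xi> :: real \<Rightarrow> real^'n) 0 = 0"
proof -
  have "displacement \<xi> 0 = (\<integral>s. 0 \<partial>lborel)"
    unfolding displacement_def set_lebesgue_integral_def
    by (rule integral_eq_zero_AE[THEN trans[OF _ sym[OF Bochner_Integration.integral_zero]]])
       (use AE_lborel_singleton[of "0::real"] in \<open>auto elim!: eventually_mono\<close>)
  then show ?thesis by simp
qed

lemma displacement_split:
  fixes \<xi> :: "real \<Rightarrow> real^'n"
  assumes \<xi>: "\<xi> \<in> cadlag_paths euclidean" and "0 \<le> s" "s \<le> t"
  shows "displacement \<xi> t = displacement \<xi> s + integral {s..t} \<xi>"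
  unfolding displacement_integral[OF \<xi>]
  using Henstock_Kurzweil_Integration.integral_combine[of 0 s t \<xi>] assms cadlag_integrable_on[OF \<xi>, of 0 t] by simp

lemma displacement_lipschitz:
  fixes \<xi> :: "real \<Rightarrow> real^'n"
  assumes \<xi>: "\<xi> \<in> cadlag_paths euclidean" and "0 \<le> s" "s \<le> t"
    and B: "\<And>r. r \<in> {s..t} \<Longrightarrow> norm (\<xi> r) \<le> B"
  shows "norm (displacement \<xi> t - displacement \<xi> s) \<le> B * (t - s)"
proof -
  have "0 \<le> B" using order_trans[OF norm_ge_zero B[of s]] assms(3) by simp
  have "norm (integral (cbox s t) \<xi>) \<le> B * measure lborel (cbox s t)"
    using cadlag_integrable_on[OF \<xi> assms(2), of t] B \<open>0 \<le> B\<close>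
    by (intro integrable_bound) auto
  then show ?thesis using displacement_split[OF assms(1-3)] assms(3) by simp
qed

lemma displacement_continuous:
  fixes \<xi> :: "real \<Rightarrow> real^'n"
  assumes \<xi>: "\<xi> \<in> cadlag_paths euclidean"
  shows "continuous_on {0..} (displacement \<xi>)"
proof -
  have "continuous_on {0..<T} (displacement \<xi>)" for T
  proof -
    have "continuous_on {0..T} (\<lambda>t. integral {0..t} \<xi>)"
      by (intro indefinite_integral_continuous_1 cadlag_integrable_on \<xi>) simp
    then show ?thesis using displacement_integral[OF \<xi>]
      by (simp cong: continuous_on_cong) (auto intro: continuous_on_subset)
  qed
  note c = this
  show ?thesis
    unfolding continuous_on_def
  proof
    fix t :: real assume t: "t \<in> {0..}"
    have "(displacement \<xi> \<longlongrightarrow> displacement \<xi> t) (at t within {0..<t + 1})"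
      using c[of "t + 1"] t by (auto simp: continuous_on_def)
    moreover have "at t within {0..<t + 1} = at t within {0..}"
      by (rule at_within_nhd[where S = "{..<t + 1}"]) auto
    ultimately show "(displacement \<xi> \<longlongrightarrow> displacement \<xi> t) (at t within {0..})" by simp
  qed
qed

lemma displacement_right:
  fixes \<xi> :: "real \<Rightarrow> real^'n"
  assumes \<xi>: "\<xi> \<in> cadlag_paths euclidean" and "0 \<le> t"
  shows "(displacement \<xi> \<longlongrightarrow> displacement \<xi> t) (at_right t)"
proof -
  have "(displacement \<xi> \<longlongrightarrow> displacement \<xi> t) (at t within {0..})"
    using displacement_continuous[OF \<xi>] assms(2) by (auto simp: continuous_on_def)
  then show ?thesis by (rule tendsto_within_subset) (use assms(2) in auto)
qed

section \<open>Measurability of controls and of their displacements\<close>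

context
  fixes \<Lambda> :: "real^'m::finite^'m" and \<Xi> :: "(real \<Rightarrow> 'm) \<Rightarrow> real \<Rightarrow> real^'n"
  assumes control: "control \<Lambda> \<Xi>"
begin

lemma control_cadlag: "\<omega> \<in> index_paths \<Longrightarrow> \<Xi> \<omega> \<in> cadlag_paths euclidean"
  using control measurable_space[of \<Xi> index_path_space velocity_path_space] by (simp add: control_def)

lemma control_measurable: "0 \<le> s \<Longrightarrow> (\<lambda>\<omega>. \<Xi> \<omega> s) \<in> borel_measurable index_path_space"
  using control measurable_compose[OF _ measurable_velocity_eval] by (auto simp: control_def)

lemma displacement_measurable: "(\<lambda>\<omega>. displacement (\<Xi> \<omega>) t) \<in> borel_measurable index_path_space"
  unfolding displacement_def
  by (rule measurable_set_lebesgue_integral_param)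
     (auto intro!: joint_measurable_right_continuous control_measurable cadlag_right control_cadlag)

text \<open>Nonanticipation makes the position at t a functional of the path up to t; this is what
  allows the Markov property at t to be applied to it.\<close>

lemma displacement_past:
  assumes "0 \<le> t"
  shows "(\<lambda>\<omega>. displacement (\<Xi> \<omega>) t) \<in> borel_measurable (index_filtration t)"
proof (rule measurable_index_filtrationI[OF displacement_measurable assms])
  fix \<omega>1 \<omega>2 :: "real \<Rightarrow> 'm"
  assume \<omega>: "\<omega>1 \<in> index_paths" "\<omega>2 \<in> index_paths" "\<And>s. 0 \<le> s \<Longrightarrow> s \<le> t \<Longrightarrow> \<omega>1 s = \<omega>2 s"
  show "displacement (\<Xi> \<omega>1) t = displacement (\<Xi> \<omega>2) t"
  \<comment> \<open>Nonanticipation is stated for positive times; at time 0 the displacement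
    vanishes.\<close>
  proof (cases "t = 0")
    case False
    then have "0 < t" using assms by simp
    then have "\<forall>s\<in>{0..t}. \<Xi> \<omega>1 s = \<Xi> \<omega>2 s"
      using control[unfolded control_def, THEN conjunct2, THEN conjunct2, rule_format, of t \<omega>1 \<omega>2] \<omega> by simp
    then show ?thesis unfolding displacement_def by (intro set_lebesgue_integral_cong) auto
  qed (simp add: displacement_0)
qed

end

section \<open>Running and accumulated cost along a controlled path\<close>

definition running_cost ::
  "('m \<Rightarrow> real^'n \<Rightarrow> real^'n \<Rightarrow> real) \<Rightarrow> real \<Rightarrow> real^'n \<Rightarrow> (real \<Rightarrow> real^'n) \<Rightarrow> (real \<Rightarrow> 'm) \<Rightarrow> real \<Rightarrow> real"
  where "running_cost H \<alpha> y \<xi> \<omega> s = lagrangian H (\<omega> s) (y + displacement \<xi> s) (- \<xi> s) + \<alpha>"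

context
  fixes H :: "'m::finite \<Rightarrow> real^'n \<Rightarrow> real^'n \<Rightarrow> real"
  assumes H: "hamiltonians H"
begin

lemma fixed_index_cost_right:
  assumes \<xi>: "\<xi> \<in> cadlag_paths euclidean" and "0 \<le> s"
  shows "((\<lambda>s. lagrangian H j (y + displacement \<xi> s) (- \<xi> s)) \<longlongrightarrow> lagrangian H j (y + displacement \<xi> s) (- \<xi> s)) (at_right s)"
  by (intro lagrangian_tendsto[OF H] tendsto_intros displacement_right cadlag_right assms)

lemma running_cost_right:
  assumes \<omega>: "\<omega> \<in> index_paths" and \<xi>: "\<xi> \<in> cadlag_paths euclidean" and "0 \<le> s"
  shows "(running_cost H \<alpha> y \<xi> \<omega> \<longlongrightarrow> running_cost H \<alpha> y \<xi> \<omega> s) (at_right s)"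
proof -
  have "((\<lambda>r. lagrangian H (\<omega> s) (y + displacement \<xi> r) (- \<xi> r) + \<alpha>) \<longlongrightarrow> running_cost H \<alpha> y \<xi> \<omega> s) (at_right s)"
    unfolding running_cost_def by (intro tendsto_intros fixed_index_cost_right assms)
  moreover have "\<forall>\<^sub>F r in at_right s. lagrangian H (\<omega> s) (y + displacement \<xi> r) (- \<xi> r) + \<alpha> = running_cost H \<alpha> y \<xi> \<omega> r"
    using index_pathsD(1)[OF \<omega> \<open>0 \<le> s\<close>] by eventually_elim (simp add: running_cost_def)
  ultimately show ?thesis by (rule Lim_transform_eventually)
qed

lemma running_cost_bounded:
  "\<exists>B>0. \<forall>\<xi> \<omega> s y. norm (\<xi> s) \<le> R \<longrightarrow> \<bar>running_cost H \<alpha> y \<xi> \<omega> s\<bar> \<le> B"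
proof -
  obtain B where B: "B > 0" "\<And>i x q. norm q \<le> R \<Longrightarrow> \<bar>lagrangian H i x q\<bar> \<le> B"
    using lagrangian_bounded[OF H, of R] by blast
  have "\<bar>running_cost H \<alpha> y \<xi> \<omega> s\<bar> \<le> B + \<bar>\<alpha>\<bar>" if "norm (\<xi> s) \<le> R" for \<xi> \<omega> s y
    using B(2)[of "- \<xi> s" "\<omega> s" "y + displacement \<xi> s"] that by (simp add: running_cost_def)
  then show ?thesis using B(1) by (intro exI[of _ "B + \<bar>\<alpha>\<bar>"]) auto
qed

lemma running_cost_set_integrable:
  assumes \<omega>: "\<omega> \<in> index_paths" and \<xi>: "\<xi> \<in> cadlag_paths euclidean" and "0 \<le> a"
  shows "set_integrable lborel {a..b} (running_cost H \<alpha> y \<xi> \<omega>)"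
proof -
  obtain R where R: "\<forall>s\<in>{0..b}. norm (\<xi> s) \<le> R" using cadlag_bounded[OF \<xi>] by blast
  obtain B where "\<forall>\<xi> \<omega> s y. norm (\<xi> s) \<le> R \<longrightarrow> \<bar>running_cost H \<alpha> y \<xi> \<omega> s\<bar> \<le> B"
    using running_cost_bounded[of R] by blast
  then show ?thesis using R \<open>0 \<le> a\<close>
    by (intro set_integrable_right_continuous[where B = B] running_cost_right \<omega> \<xi>) auto
qed

lemma fixed_index_cost_set_integrable:
  assumes \<xi>: "\<xi> \<in> cadlag_paths euclidean" and "0 \<le> a"
  shows "set_integrable lborel {a..b} (\<lambda>s. lagrangian H j (y + displacement \<xi> s) (- \<xi> s))"
proof -
  obtain R where R: "\<forall>s\<in>{0..b}. norm (\<xi> s) \<le> R" using cadlag_bounded[OF \<xi>] by blast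
  obtain B where "\<forall>i x q. norm q \<le> R \<longrightarrow> \<bar>lagrangian H i x q\<bar> \<le> B"
    using lagrangian_bounded[OF H, of R] by blast
  then show ?thesis using R \<open>0 \<le> a\<close>
    by (intro set_integrable_right_continuous[where B = B] fixed_index_cost_right \<xi>) auto
qed

context
  fixes \<Lambda> :: "real^'m^'m" and \<Xi> :: "(real \<Rightarrow> 'm) \<Rightarrow> real \<Rightarrow> real^'n"
  assumes control: "control \<Lambda> \<Xi>"
begin

lemma running_cost_measurable:
  assumes "0 \<le> s"
  shows "(\<lambda>\<omega>. running_cost H \<alpha> y (\<Xi> \<omega>) \<omega> s) \<in> borel_measurable index_path_space"
proof -
  have [measurable]: "(\<lambda>\<omega>. \<Xi> \<omega> s) \<in> borel_measurable index_path_space"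
    "(\<lambda>\<omega>. displacement (\<Xi> \<omega>) s) \<in> borel_measurable index_path_space"
    using control_measurable[OF control assms] displacement_measurable[OF control] by auto
  have "(\<lambda>\<omega>. lagrangian H j (y + displacement (\<Xi> \<omega>) s) (- \<Xi> \<omega> s) + \<alpha>) \<in> borel_measurable index_path_space" for j
  proof -
    have "(\<lambda>\<omega>. (y + displacement (\<Xi> \<omega>) s, - \<Xi> \<omega> s)) \<in> borel_measurable index_path_space" by measurable
    from measurable_compose[OF this borel_measurable_continuous_onI[OF lagrangian_continuous[OF H, of j]]]
    show ?thesis by simp
  qed
  then show ?thesis unfolding running_cost_def
    by (rule measurable_compose_countable[where g = "\<lambda>\<omega>. \<omega> s"]) (rule measurable_index_eval[OF assms])
qed

lemma running_cost_joint_measurable: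
  "(\<lambda>p. running_cost H \<alpha> y (\<Xi> (fst p)) (fst p) (max 0 (snd p))) \<in> borel_measurable (index_path_space \<Otimes>\<^sub>M borel)"
  by (rule joint_measurable_right_continuous[where X = "\<lambda>\<omega>. running_cost H \<alpha> y (\<Xi> \<omega>) \<omega>"])
     (auto intro!: running_cost_measurable running_cost_right control_cadlag[OF control])

definition accumulated_cost :: "real \<Rightarrow> real^'n \<Rightarrow> (real \<Rightarrow> 'm) \<Rightarrow> real \<Rightarrow> real" where
  "accumulated_cost \<alpha> y \<omega> t = (LINT s:{0..t}|lborel. running_cost H \<alpha> y (\<Xi> \<omega>) \<omega> s)"

lemma accumulated_cost_measurable: "(\<lambda>\<omega>. accumulated_cost \<alpha> y \<omega> t) \<in> borel_measurable index_path_space"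
  unfolding accumulated_cost_def
  by (rule measurable_set_lebesgue_integral_param[OF running_cost_joint_measurable]) simp

lemma running_cost_integrable_on:
  "\<omega> \<in> index_paths \<Longrightarrow> 0 \<le> s \<Longrightarrow> running_cost H \<alpha> y (\<Xi> \<omega>) \<omega> integrable_on {s..t}"
  by (rule set_borel_integral_eq_integral(1)[OF running_cost_set_integrable[OF _ control_cadlag[OF control]]])

lemma accumulated_cost_integral:
  "\<omega> \<in> index_paths \<Longrightarrow> accumulated_cost \<alpha> y \<omega> t = integral {0..t} (running_cost H \<alpha> y (\<Xi> \<omega>) \<omega>)"
  unfolding accumulated_cost_def
  by (rule set_borel_integral_eq_integral(2)[OF running_cost_set_integrable[OF _ control_cadlag[OF control]]]) auto

lemma accumulated_cost_right:
  assumes \<omega>: "\<omega> \<in> index_paths" and "0 \<le> t"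
  shows "(accumulated_cost \<alpha> y \<omega> \<longlongrightarrow> accumulated_cost \<alpha> y \<omega> t) (at_right t)"
proof -
  have "continuous_on {0..t + 1} (\<lambda>t. integral {0..t} (running_cost H \<alpha> y (\<Xi> \<omega>) \<omega>))"
    by (intro indefinite_integral_continuous_1 running_cost_integrable_on \<omega>) simp
  then have c: "continuous_on {0..t + 1} (accumulated_cost \<alpha> y \<omega>)"
    by (simp add: accumulated_cost_integral[OF \<omega>] cong: continuous_on_cong)
  then have "(accumulated_cost \<alpha> y \<omega> \<longlongrightarrow> accumulated_cost \<alpha> y \<omega> t) (at t within {0..t + 1})"
    using assms(2) by (auto simp: continuous_on_def)
  then have "(accumulated_cost \<alpha> y \<omega> \<longlongrightarrow> accumulated_cost \<alpha> y \<omega> t) (at t within {t<..<t + 1})"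
    by (rule tendsto_within_subset) (use assms(2) in auto)
  moreover have "at t within {t<..<t + 1} = at_right t"
    by (rule at_within_nhd[where S = "{..<t + 1}"]) auto
  ultimately show ?thesis by simp
qed

end

end

subsection \<open>Subsolutions satisfy the cycle inequality\<close>

text \<open>The compensation exp (- h \<Lambda>) (I + h \<Lambda>) = I + o(h). The transition matrix
  stands to the left of the coupling because the coupling term carries the index at the end of the
  step.\<close>

lemma transition_first_order:
  fixes \<Lambda> :: "real^'m::finite^'m"
  assumes "0 < \<epsilon>"
  shows "\<exists>h0>0. \<forall>h. 0 < h \<and> h \<le> h0 \<longrightarrow>
    (\<Sum>k\<in>UNIV. \<Sum>m\<in>UNIV. \<bar>transition \<Lambda> h k m + h * (\<Sum>l\<in>UNIV. transition \<Lambda> h k l * \<Lambda> $ l $ m) - of_bool (k = m)\<bar>) \<le> \<epsilon> * h"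
proof -
  let ?e = "\<lambda>h k m. (transition \<Lambda> h k m - of_bool (k = m)) / h + (\<Sum>l\<in>UNIV. transition \<Lambda> h k l * \<Lambda> $ l $ m)"
  have "(\<lambda>h. ?e h k m) \<midarrow>0\<rightarrow> - \<Lambda> $ k $ m + \<Lambda> $ k $ m" for k m
  proof (rule tendsto_add)
    have "(\<lambda>h. (transition \<Lambda> (0 + h) k m - transition \<Lambda> 0 k m) / h) \<midarrow>0\<rightarrow> (\<Sum>l\<in>UNIV. - \<Lambda> $ k $ l * transition \<Lambda> 0 l m)"
      using transition_deriv[of \<Lambda> k m 0] unfolding DERIV_def .
    moreover have "(\<Sum>l\<in>UNIV. - \<Lambda> $ k $ l * transition \<Lambda> 0 l m) = - \<Lambda> $ k $ m"
      by (simp add: transition_0 if_distrib[of "\<lambda>x. _ * x"] cong: if_cong)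
    ultimately show "(\<lambda>h. (transition \<Lambda> h k m - of_bool (k = m)) / h) \<midarrow>0\<rightarrow> - \<Lambda> $ k $ m"
      by (simp add: transition_0 of_bool_def)
    have "(\<lambda>h. transition \<Lambda> h k l) \<midarrow>0\<rightarrow> transition \<Lambda> 0 k l" for l
      using DERIV_isCont[OF transition_deriv[of \<Lambda> k l 0]] by (simp add: isCont_def)
    then have "(\<lambda>h. (\<Sum>l\<in>UNIV. transition \<Lambda> h k l * \<Lambda> $ l $ m)) \<midarrow>0\<rightarrow> (\<Sum>l\<in>UNIV. transition \<Lambda> 0 k l * \<Lambda> $ l $ m)"
      by (intro tendsto_intros)
    then show "(\<lambda>h. (\<Sum>l\<in>UNIV. transition \<Lambda> h k l * \<Lambda> $ l $ m)) \<midarrow>0\<rightarrow> \<Lambda> $ k $ m"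
      by (simp add: transition_0 if_distrib[of "\<lambda>x. x * _"] cong: if_cong)
  qed
  then have e0: "(\<lambda>h. ?e h k m) \<midarrow>0\<rightarrow> 0" for k m by simp
  have "(\<lambda>h. \<Sum>k\<in>UNIV. \<Sum>m\<in>UNIV. \<bar>?e h k m\<bar>) \<midarrow>0\<rightarrow> (\<Sum>k\<in>(UNIV::'m set). \<Sum>m\<in>(UNIV::'m set). \<bar>0\<bar>)"
    by (intro tendsto_sum tendsto_rabs e0)
  then have "(\<lambda>h. \<Sum>k\<in>UNIV. \<Sum>m\<in>UNIV. \<bar>?e h k m\<bar>) \<midarrow>0\<rightarrow> 0" by simp
  from order_tendstoD(2)[OF this assms] obtain d where d: "d > 0"
    "\<And>h. h \<noteq> 0 \<Longrightarrow> \<bar>h\<bar> < d \<Longrightarrow> (\<Sum>k\<in>UNIV. \<Sum>m\<in>UNIV. \<bar>?e h k m\<bar>) < \<epsilon>"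
    unfolding eventually_at by (auto simp: dist_real_def)
  show ?thesis
  proof (intro exI[of _ "d / 2"] conjI allI impI)
    fix h assume h: "0 < h \<and> h \<le> d / 2"
    have "(\<Sum>k\<in>UNIV. \<Sum>m\<in>UNIV. \<bar>transition \<Lambda> h k m + h * (\<Sum>l\<in>UNIV. transition \<Lambda> h k l * \<Lambda> $ l $ m) - of_bool (k = m)\<bar>)
        = (\<Sum>k\<in>UNIV. \<Sum>m\<in>UNIV. h * \<bar>?e h k m\<bar>)"
    proof (intro sum.cong refl)
      fix k m
      have "transition \<Lambda> h k m + h * (\<Sum>l\<in>UNIV. transition \<Lambda> h k l * \<Lambda> $ l $ m) - of_bool (k = m) = h * ?e h k m"
        using h by (simp add: distrib_left)
      then show "\<bar>transition \<Lambda> h k m + h * (\<Sum>l\<in>UNIV. transition \<Lambda> h k l * \<Lambda> $ l $ m) - of_bool (k = m)\<bar> = h * \<bar>?e h k m\<bar>"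
        using h by (simp only: abs_mult) simp
    qed
    also have "\<dots> = h * (\<Sum>k\<in>UNIV. \<Sum>m\<in>UNIV. \<bar>?e h k m\<bar>)" by (simp only: sum_distrib_left)
    also have "\<dots> \<le> h * \<epsilon>" using d(2)[of h] h d(1) by (intro mult_left_mono) auto
    finally show "(\<Sum>k\<in>UNIV. \<Sum>m\<in>UNIV. \<bar>transition \<Lambda> h k m + h * (\<Sum>l\<in>UNIV. transition \<Lambda> h k l * \<Lambda> $ l $ m) - of_bool (k = m)\<bar>) \<le> \<epsilon> * h"
      by (simp add: mult.commute)
  qed (use d in simp)
qed

lemma transition_near_identity:
  fixes \<Lambda> :: "real^'m::finite^'m"
  assumes "0 < \<epsilon>"
  shows "\<exists>h0>0. \<forall>h k l. 0 \<le> h \<and> h \<le> h0 \<longrightarrow> \<bar>transition \<Lambda> h k l - of_bool (k = l)\<bar> \<le> \<epsilon>"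
proof -
  have "((\<lambda>h. transition \<Lambda> h k l - of_bool (k = l)) \<longlongrightarrow> transition \<Lambda> 0 k l - of_bool (k = l)) (at 0)" for k l
    using DERIV_isCont[OF transition_deriv[of \<Lambda> k l 0]] by (intro tendsto_intros) (simp add: isCont_def)
  then have "((\<lambda>h. transition \<Lambda> h k l - of_bool (k = l)) \<longlongrightarrow> 0) (at 0)" for k l
    by (simp add: transition_0 of_bool_def)
  then have "\<forall>\<^sub>F h in at 0. \<bar>transition \<Lambda> h k l - of_bool (k = l)\<bar> < \<epsilon>" for k l
    using tendstoD[OF _ assms] by (fastforce simp: dist_real_def)
  then have "\<forall>\<^sub>F h in at 0. \<forall>k l. \<bar>transition \<Lambda> h k l - of_bool (k = l)\<bar> < \<epsilon>"
    by (intro eventually_all_finite)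
  then obtain d where d: "d > 0" "\<And>h k l. h \<noteq> 0 \<Longrightarrow> \<bar>h\<bar> < d \<Longrightarrow> \<bar>transition \<Lambda> h k l - of_bool (k = l)\<bar> < \<epsilon>"
    unfolding eventually_at by (auto simp: dist_real_def)
  show ?thesis
  proof (intro exI[of _ "d / 2"] conjI allI impI)
    fix h k l assume h: "0 \<le> h \<and> h \<le> d / 2"
    show "\<bar>transition \<Lambda> h k l - of_bool (k = l)\<bar> \<le> \<epsilon>"
    proof (cases "h = 0")
      case False
      then show ?thesis using d(2)[of h k l] h d(1) by (simp add: less_imp_le)
    qed (use assms in \<open>simp add: transition_0 of_bool_def\<close>)
  qed (use d in simp)
qed

context
  fixes H :: "'m::finite \<Rightarrow> real^'n \<Rightarrow> real^'n \<Rightarrow> real" and \<Lambda> :: "real^'m^'m" and \<alpha> :: real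
    and u :: "real^'n \<Rightarrow> real^'m"
  assumes H: "hamiltonians H" and coupling: "coupling_matrix \<Lambda>" and sub: "hj_subsolution H \<Lambda> \<alpha> u"
begin

lemma u_periodic: "z \<in> int_lattice \<Longrightarrow> u (x + z) = u x"
  using sub by (simp add: hj_subsolution_def torus_periodic_def)

lemma u_continuous: "continuous_on A u"
  using sub by (auto simp: hj_subsolution_def intro: continuous_on_subset)

lemma value_bounded: "\<exists>B>0. \<forall>x j. \<bar>u x $ j\<bar> \<le> B"
proof -
  obtain B where "B > 0" "\<forall>x. norm (u x) \<le> B"
    using torus_periodic_bounded[of u] sub unfolding hj_subsolution_def by blast
  then show ?thesis using component_le_norm_cart order_trans by (metis (no_types))
qed

text \<open>Fenchel's inequality at - q turns the viscosity test into the hypothesis of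
  \<open>viscosity_segment\<close>, the rate m at x being the Lagrangian at - q plus \<alpha> minus
  the coupling term.\<close>

lemma subsolution_trajectory:
  assumes \<xi>: "\<xi> \<in> cadlag_paths euclidean" and ab: "0 \<le> a" "a \<le> b"
  shows "u (y + displacement \<xi> a) $ j \<le> u (y + displacement \<xi> b) $ j +
    integral {a..b} (\<lambda>s. lagrangian H j (y + displacement \<xi> s) (- \<xi> s) + \<alpha> - \<Lambda> $ j \<bullet> u (y + displacement \<xi> s))"
proof (rule trajectory_inequality[where v = "\<lambda>x. u x $ j" and x = "\<lambda>s. y + displacement \<xi> s" and \<xi> = \<xi>
      and \<L> = "\<lambda>x q. lagrangian H j x (- q) + \<alpha> - \<Lambda> $ j \<bullet> u x"])
  show "continuous_on UNIV (\<lambda>x. u x $ j)" by (intro continuous_intros u_continuous)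
  show "continuous_on UNIV (\<lambda>(x, q). lagrangian H j x (- q) + \<alpha> - \<Lambda> $ j \<bullet> u x)"
    unfolding case_prod_beta'
    by (intro continuous_intros continuous_on_lagrangian[OF H] continuous_on_compose2[OF u_continuous[of UNIV]]) auto
  fix x0 q :: "real^'n" and h :: real assume h: "0 \<le> h"
  show "u x0 $ j \<le> u (x0 + h *\<^sub>R q) $ j +
      integral {0..h} (\<lambda>r. lagrangian H j (x0 + r *\<^sub>R q) (- q) + \<alpha> - \<Lambda> $ j \<bullet> u (x0 + r *\<^sub>R q))"
  proof (rule viscosity_segment[OF _ _ _ _ _ h, where v = "\<lambda>x. u x $ j" and m = "\<lambda>x. lagrangian H j x (- q) + \<alpha> - \<Lambda> $ j \<bullet> u x"])
    show "torus_periodic (\<lambda>x. u x $ j)" "torus_periodic (\<lambda>x. lagrangian H j x (- q) + \<alpha> - \<Lambda> $ j \<bullet> u x)"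
      by (simp_all add: torus_periodic_def u_periodic lagrangian_periodic[OF H])
    show "continuous_on UNIV (\<lambda>x. u x $ j)" by (intro continuous_intros u_continuous)
    show "continuous_on UNIV (\<lambda>x. lagrangian H j x (- q) + \<alpha> - \<Lambda> $ j \<bullet> u x)"
      by (intro continuous_intros continuous_on_lagrangian[OF H] u_continuous)
    fix z \<psi> D\<psi> assume "torus_C1 \<psi> D\<psi>" "\<And>z'. u z' $ j - \<psi> z' \<le> u z $ j - \<psi> z"
    then have "H j z (D\<psi> z) + \<Lambda> $ j \<bullet> u z \<le> \<alpha>"
      using sub unfolding hj_subsolution_def by blast
    then show "- (D\<psi> z \<bullet> q) \<le> lagrangian H j z (- q) + \<alpha> - \<Lambda> $ j \<bullet> u z"
      using fenchel_inequality[OF H, of "D\<psi> z" "- q" j z] by simp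
  qed
next
  show "(\<xi> \<longlongrightarrow> \<xi> r) (at_right r)" if "a \<le> r" "r < b" for r
    using ab that by (intro cadlag_right[OF \<xi>]) simp
  show "\<xi> integrable_on {a..b}" by (rule cadlag_integrable_on[OF \<xi> ab(1)])
  show "y + displacement \<xi> r = y + displacement \<xi> a + integral {a..r} \<xi>" if "a \<le> r" "r \<le> b" for r
    using displacement_split[OF \<xi> ab(1) that(1)] by simp
  have 1: "(\<lambda>s. lagrangian H j (y + displacement \<xi> s) (- \<xi> s)) integrable_on {a..b}"
    by (rule set_borel_integral_eq_integral(1)[OF fixed_index_cost_set_integrable[OF H \<xi> ab(1)]])
  have "continuous_on {a..b} (displacement \<xi>)"
    by (rule continuous_on_subset[OF displacement_continuous[OF \<xi>]]) (use ab in auto)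
  then have "continuous_on {a..b} (\<lambda>s. y + displacement \<xi> s)" by (intro continuous_intros)
  from continuous_on_compose2[OF u_continuous[of UNIV] this]
  have 2: "(\<lambda>s. \<Lambda> $ j \<bullet> u (y + displacement \<xi> s)) integrable_on {a..b}"
    by (intro integrable_continuous_interval continuous_intros) auto
  show "(\<lambda>r. lagrangian H j (y + displacement \<xi> r) (- \<xi> r) + \<alpha> - \<Lambda> $ j \<bullet> u (y + displacement \<xi> r)) integrable_on {a..b}"
    by (intro Henstock_Kurzweil_Integration.integrable_diff Henstock_Kurzweil_Integration.integrable_add 1 2 integrable_const_ivl)
qed (use ab in simp)

lemma index_change_right:
  assumes "\<omega> \<in> index_paths" "0 \<le> s"
  shows "((\<lambda>s. of_bool (\<omega> s \<noteq> j)) \<longlongrightarrow> (of_bool (\<omega> s \<noteq> j) :: real)) (at_right s)"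
  by (rule tendsto_eventually) (use index_pathsD(1)[OF assms] in \<open>auto elim: eventually_mono\<close>)

text \<open>The Markov property summed over the pairs (k, k) gives the probability that both indices
  agree, and each diagonal transition probability is at least 1 - e.\<close>

lemma probability_index_change:
  assumes s: "0 \<le> s" and r: "0 \<le> r" and e: "\<And>k. 1 - e \<le> transition \<Lambda> r k k"
  shows "(\<integral>\<omega>. of_bool (\<omega> s \<noteq> \<omega> (s + r)) \<partial>index_law \<Lambda> (axis i 1)) \<le> e"
proof -
  let ?P = "index_law \<Lambda> (axis i 1)"
  interpret P: prob_space ?P by (rule prob_space_index_law[OF coupling axis_prob_vector])
  have sets_P [measurable_cong]: "sets ?P = sets index_path_space" by (rule sets_index_law[OF coupling axis_prob_vector])
  have [measurable]: "(\<lambda>\<omega>. \<omega> s) \<in> index_path_space \<rightarrow>\<^sub>M count_space UNIV" "(\<lambda>\<omega>. \<omega> (s + r)) \<in> index_path_space \<rightarrow>\<^sub>M count_space UNIV"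
    using s r by (auto intro!: measurable_index_eval)
  have i1: "integrable ?P (\<lambda>\<omega>. of_bool (\<omega> s = k \<and> \<omega> (s + r) = l) :: real)"
    "integrable ?P (\<lambda>\<omega>. of_bool (\<omega> s = k) :: real)" for k l
    by (rule P.integrable_const_bound[of _ 1]; auto)+
  have "(\<integral>\<omega>. of_bool (\<omega> s \<noteq> \<omega> (s + r)) \<partial>?P) = (\<integral>\<omega>. 1 - (\<Sum>k\<in>UNIV. of_bool (\<omega> s = k \<and> \<omega> (s + r) = k)) \<partial>?P :: real)"
  proof (rule Bochner_Integration.integral_cong[OF refl])
    fix \<omega> :: "real \<Rightarrow> 'm"
    have "(\<Sum>k\<in>UNIV. of_bool (\<omega> s = k \<and> \<omega> (s + r) = k)) = (\<Sum>k\<in>UNIV. if k = \<omega> s then of_bool (\<omega> (s + r) = \<omega> s) else 0 :: real)"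
      by (intro sum.cong) auto
    also have "\<dots> = of_bool (\<omega> (s + r) = \<omega> s)" by simp
    finally show "(of_bool (\<omega> s \<noteq> \<omega> (s + r)) :: real) = 1 - (\<Sum>k\<in>UNIV. of_bool (\<omega> s = k \<and> \<omega> (s + r) = k))"
      by (cases "\<omega> (s + r) = \<omega> s") auto
  qed
  also have "\<dots> = (\<integral>\<omega>. 1 \<partial>?P) - (\<integral>\<omega>. (\<Sum>k\<in>UNIV. of_bool (\<omega> s = k \<and> \<omega> (s + r) = k)) \<partial>?P)"
    by (intro Bochner_Integration.integral_diff Bochner_Integration.integrable_sum i1) simp
  also have "(\<integral>\<omega>. (\<Sum>k\<in>UNIV. of_bool (\<omega> s = k \<and> \<omega> (s + r) = k)) \<partial>?P) =
      (\<Sum>k\<in>UNIV. \<integral>\<omega>. of_bool (\<omega> s = k \<and> \<omega> (s + r) = k) \<partial>?P :: real)"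
    by (intro Bochner_Integration.integral_sum i1)
  also have "(\<Sum>k\<in>UNIV. \<integral>\<omega>. of_bool (\<omega> s = k \<and> \<omega> (s + r) = k) \<partial>?P) =
     (\<Sum>k\<in>UNIV. transition \<Lambda> r k k * (\<integral>\<omega>. of_bool (\<omega> s = k) \<partial>?P))"
    using markov_property[OF coupling axis_prob_vector s r, of "\<lambda>_. 1"] by simp
  also have "(\<integral>\<omega>. 1 \<partial>?P) - \<dots> \<le> 1 - (\<Sum>k\<in>UNIV. (1 - e) * (\<integral>\<omega>. of_bool (\<omega> s = k) \<partial>?P))"
    using P.prob_space by (simp, intro sum_mono mult_right_mono e integral_nonneg_AE) auto
  also have "(\<Sum>k\<in>UNIV. (1 - e) * (\<integral>\<omega>. of_bool (\<omega> s = k) \<partial>?P)) = (1 - e) * (\<integral>\<omega>. (\<Sum>k\<in>UNIV. of_bool (\<omega> s = k)) \<partial>?P)"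
    by (subst Bochner_Integration.integral_sum[OF i1(2)]) (simp only: sum_distrib_left)
  also have "(\<lambda>\<omega>::real \<Rightarrow> 'm. (\<Sum>k\<in>UNIV. of_bool (\<omega> s = k)) :: real) = (\<lambda>\<omega>. 1)"
  proof
    fix \<omega> :: "real \<Rightarrow> 'm"
    have "(\<Sum>k\<in>UNIV. of_bool (\<omega> s = k)) = (\<Sum>k\<in>UNIV. if k = \<omega> s then 1 else 0 :: real)"
      by (intro sum.cong) auto
    then show "(\<Sum>k\<in>UNIV. of_bool (\<omega> s = k)) = (1 :: real)" by simp
  qed
  finally show ?thesis using P.prob_space by simp
qed

text \<open>The price of freezing the index at its final value: the expected time within the step
  during which the index differs from it. By Fubini it is at most h e, and
  \<open>transition_near_identity\<close> makes e small for short steps.\<close>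

lemma expected_index_change:
  assumes t: "0 \<le> t" and h: "0 \<le> h" and e: "\<And>k r. 0 \<le> r \<Longrightarrow> r \<le> h \<Longrightarrow> 1 - e \<le> transition \<Lambda> r k k"
  shows "(\<integral>\<omega>. (LINT s:{t..t + h}|lborel. of_bool (\<omega> s \<noteq> \<omega> (t + h))) \<partial>index_law \<Lambda> (axis i 1)) \<le> h * e"
    and "(\<lambda>\<omega>::real \<Rightarrow> 'm. LINT s:{t..t + h}|lborel. of_bool (\<omega> s \<noteq> \<omega> (t + h)) :: real) \<in> borel_measurable index_path_space"
proof -
  let ?P = "index_law \<Lambda> (axis i 1)"
  interpret P: prob_space ?P by (rule prob_space_index_law[OF coupling axis_prob_vector])
  interpret PS: pair_sigma_finite ?P lborel ..
  have sets_P [measurable_cong]: "sets ?P = sets index_path_space" by (rule sets_index_law[OF coupling axis_prob_vector])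
  have space_P: "space ?P = index_paths" by (rule space_index_law[OF coupling axis_prob_vector])
  have joint: "(\<lambda>p. of_bool (fst p (max 0 (snd p)) \<noteq> (fst p (t + h) :: 'm)) :: real) \<in> borel_measurable (index_path_space \<Otimes>\<^sub>M borel)"
  proof (rule joint_measurable_right_continuous[where X = "\<lambda>\<omega> s. of_bool (\<omega> s \<noteq> \<omega> (t + h)) :: real"])
    fix s :: real assume s: "0 \<le> s"
    have [measurable]: "(\<lambda>\<omega>. \<omega> s) \<in> index_path_space \<rightarrow>\<^sub>M count_space UNIV" "(\<lambda>\<omega>. \<omega> (t + h)) \<in> index_path_space \<rightarrow>\<^sub>M count_space UNIV"
      using s t h by (auto intro!: measurable_index_eval)
    show "(\<lambda>\<omega>::real \<Rightarrow> 'm. of_bool (\<omega> s \<noteq> \<omega> (t + h)) :: real) \<in> borel_measurable index_path_space"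
      by (rule measurable_compose_countable[where f = "\<lambda>(k::'m) (\<omega>::real \<Rightarrow> 'm). of_bool (\<omega> s \<noteq> k) :: real"
            and g = "\<lambda>\<omega>::real \<Rightarrow> 'm. \<omega> (t + h)"])
         measurable
  qed (rule index_change_right; simp)
  from measurable_set_lebesgue_integral_param[OF joint t]
  show "(\<lambda>\<omega>::real \<Rightarrow> 'm. LINT s:{t..t + h}|lborel. of_bool (\<omega> s \<noteq> \<omega> (t + h)) :: real) \<in> borel_measurable index_path_space" .
  define f where "f \<omega> s = indicator {t..t + h} s * (of_bool (\<omega> (max 0 s) \<noteq> \<omega> (t + h)) :: real)" for \<omega> :: "real \<Rightarrow> 'm" and s
  have f_eq: "f \<omega> s = indicator {t..t + h} s *\<^sub>R of_bool (\<omega> s \<noteq> \<omega> (t + h))" for \<omega> s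
    using t by (auto simp: f_def indicator_def max_def)
  have [measurable]: "(\<lambda>p. of_bool (fst p (max 0 (snd p)) \<noteq> fst p (t + h)) :: real) \<in> borel_measurable (?P \<Otimes>\<^sub>M lborel)"
    using joint by (simp cong: measurable_cong_sets sets_pair_measure_cong add: sets_P)
  have f_int: "integrable (?P \<Otimes>\<^sub>M lborel) (\<lambda>(\<omega>, s). f \<omega> s)"
  proof (rule integrableI_bounded_set[where A = "space ?P \<times> {t..t + h}" and B = 1])
    show "(\<lambda>(\<omega>, s). f \<omega> s) \<in> borel_measurable (?P \<Otimes>\<^sub>M lborel)"
      unfolding f_def case_prod_beta' by measurable
    show "emeasure (?P \<Otimes>\<^sub>M lborel) (space ?P \<times> {t..t + h}) < \<infinity>"
      using h by (subst lborel.emeasure_pair_measure_Times) (auto simp: P.emeasure_space_1 emeasure_lborel_Icc_eq)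
  qed (auto simp: f_def indicator_def space_pair_measure)
  have "(\<integral>\<omega>. (LINT s:{t..t + h}|lborel. of_bool (\<omega> s \<noteq> \<omega> (t + h))) \<partial>?P) = (\<integral>\<omega>. (\<integral>s. f \<omega> s \<partial>lborel) \<partial>?P)"
    unfolding set_lebesgue_integral_def f_eq ..
  also have "\<dots> = (\<integral>s. (\<integral>\<omega>. f \<omega> s \<partial>?P) \<partial>lborel)"
    by (rule PS.Fubini_integral[symmetric, OF f_int])
  also have "\<dots> \<le> (\<integral>s. indicator {t..t + h} s * e \<partial>lborel)"
  proof (rule integral_mono_AE)
    show "integrable lborel (\<lambda>s. \<integral>\<omega>. f \<omega> s \<partial>?P)"
      using PS.integrable_snd[OF f_int] by simp
    show "integrable lborel (\<lambda>s. indicator {t..t + h} s * e)"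
      by (rule integrable_mult_left) (simp add: h)
    show "AE s in lborel. (\<integral>\<omega>. f \<omega> s \<partial>?P) \<le> indicator {t..t + h} s * e"
    proof (rule AE_I2)
      fix s :: real
      show "(\<integral>\<omega>. f \<omega> s \<partial>?P) \<le> indicator {t..t + h} s * e"
      proof (cases "s \<in> {t..t + h}")
        case True
        then show ?thesis
          using probability_index_change[of s "t + h - s" e i] e t by (simp add: f_eq)
      qed (simp add: f_eq)
    qed
  qed
  also have "\<dots> = h * e" using h by simp
  finally show "(\<integral>\<omega>. (LINT s:{t..t + h}|lborel. of_bool (\<omega> s \<noteq> \<omega> (t + h))) \<partial>?P) \<le> h * e" .
qed

section \<open>Cost plus value along a control, path by path\<close>

context
  fixes \<Xi> :: "(real \<Rightarrow> 'm) \<Rightarrow> real \<Rightarrow> real^'n" and y :: "real^'n" and i :: 'm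
  assumes control: "control \<Lambda> \<Xi>"
begin

abbreviation (input) position :: "(real \<Rightarrow> 'm) \<Rightarrow> real \<Rightarrow> real^'n" where
  "position \<omega> t \<equiv> y + displacement (\<Xi> \<omega>) t"

text \<open>Up to the initial value, the quantity whose expectation the theorem bounds from below: it is a
  submartingale.\<close>

definition cost_plus_value :: "(real \<Rightarrow> 'm) \<Rightarrow> real \<Rightarrow> real" where
  "cost_plus_value \<omega> t = accumulated_cost H \<Xi> \<alpha> y \<omega> t + u (position \<omega> t) $ \<omega> t"

lemma control_AE_bounded:
  "\<exists>R>0. AE \<omega> in axis_law \<Lambda> i. \<forall>s\<in>{0..T}. norm (\<Xi> \<omega> s) \<le> R"
proof -
  \<comment> \<open>Bounds on a control are available on intervals of positive length;
    \<open>max T 1\<close> covers every T.\<close>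
  have "0 < max T 1" by simp
  then obtain R where R: "R > 0" "almost_surely \<Lambda> (\<lambda>\<omega>. (SUP s\<in>{0..max T 1}. norm (\<Xi> \<omega> s)) < R)"
    using control unfolding control_def by blast
  have "AE \<omega> in axis_law \<Lambda> i. \<forall>s\<in>{0..T}. norm (\<Xi> \<omega> s) \<le> R"
    using almost_surely_axis[OF coupling R(2), of i] AE_space
  proof eventually_elim
    case (elim \<omega>)
    \<comment> \<open>A \<open>SUP\<close> dominates its members only when they are bounded above,
      which cadlag paths guarantee.\<close>
    obtain B where "\<forall>s\<in>{0..max T 1}. norm (\<Xi> \<omega> s) \<le> B"
      using cadlag_bounded[OF control_cadlag[OF control], of \<omega> "max T 1"] elim(2) by (auto simp: space_axis_law[OF coupling])
    then have bdd: "bdd_above ((\<lambda>s. norm (\<Xi> \<omega> s)) ` {0..max T 1})" by (auto intro!: bdd_aboveI[of _ B])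
    show ?case
    proof
      fix s assume "s \<in> {0..T}"
      then have "norm (\<Xi> \<omega> s) \<le> (SUP s\<in>{0..max T 1}. norm (\<Xi> \<omega> s))"
        by (intro cSUP_upper bdd) auto
      then show "norm (\<Xi> \<omega> s) \<le> R" using elim(1) by simp
    qed
  qed
  with R(1) show ?thesis by blast
qed

lemma value_measurable:
  assumes f: "continuous_on UNIV f" and "0 \<le> s" "0 \<le> t"
  shows "(\<lambda>\<omega>. f (position \<omega> t) $ \<omega> s :: real) \<in> borel_measurable index_path_space"
proof (rule measurable_compose_countable[where f = "\<lambda>j \<omega>. f (position \<omega> t) $ j" and g = "\<lambda>\<omega>. \<omega> s"])
  show "(\<lambda>\<omega>. \<omega> s) \<in> index_path_space \<rightarrow>\<^sub>M count_space UNIV" by (rule measurable_index_eval) fact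
  fix j :: 'm
  have [measurable]: "(\<lambda>\<omega>. displacement (\<Xi> \<omega>) t) \<in> borel_measurable index_path_space"
    by (rule displacement_measurable[OF control])
  have "(\<lambda>\<omega>. position \<omega> t) \<in> borel_measurable index_path_space" by measurable
  moreover have "(\<lambda>x. f x $ j) \<in> borel_measurable borel"
    by (intro borel_measurable_continuous_onI continuous_intros f)
  ultimately show "(\<lambda>\<omega>. f (position \<omega> t) $ j) \<in> borel_measurable index_path_space"
    by (rule measurable_compose)
qed

lemma value_past_measurable:
  assumes f: "continuous_on UNIV f" and "0 \<le> t"
  shows "(\<lambda>\<omega>. f (position \<omega> t) :: real) \<in> borel_measurable (index_filtration t)"
proof -
  have [measurable]: "(\<lambda>\<omega>. displacement (\<Xi> \<omega>) t) \<in> borel_measurable (index_filtration t)"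
    by (rule displacement_past[OF control]) fact
  have "(\<lambda>\<omega>. position \<omega> t) \<in> borel_measurable (index_filtration t)" by measurable
  from measurable_compose[OF this borel_measurable_continuous_onI[OF f]] show ?thesis .
qed

lemma cost_plus_value_measurable:
  assumes "0 \<le> t"
  shows "(\<lambda>\<omega>. cost_plus_value \<omega> t) \<in> borel_measurable index_path_space"
  unfolding cost_plus_value_def
  by (intro borel_measurable_add accumulated_cost_measurable[OF H control] value_measurable u_continuous assms)

lemma cost_plus_value_right:
  assumes "\<omega> \<in> index_paths" "0 \<le> t"
  shows "(cost_plus_value \<omega> \<longlongrightarrow> cost_plus_value \<omega> t) (at_right t)"
proof -
  have "isCont u (y + displacement (\<Xi> \<omega>) t)" using u_continuous[of UNIV] by (simp add: continuous_on_eq_continuous_at)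
  then have "((\<lambda>s. u (position \<omega> s)) \<longlongrightarrow> u (position \<omega> t)) (at_right t)"
    by (rule isCont_tendsto_compose)
       (intro tendsto_intros displacement_right control_cadlag[OF control] assms)
  then have "((\<lambda>s. accumulated_cost H \<Xi> \<alpha> y \<omega> s + u (position \<omega> s) $ \<omega> t) \<longlongrightarrow> cost_plus_value \<omega> t) (at_right t)"
    unfolding cost_plus_value_def by (intro tendsto_intros accumulated_cost_right[OF H control] assms)
  moreover have "\<forall>\<^sub>F s in at_right t. accumulated_cost H \<Xi> \<alpha> y \<omega> s + u (position \<omega> s) $ \<omega> t = cost_plus_value \<omega> s"
    using index_pathsD(1)[OF assms] by eventually_elim (simp add: cost_plus_value_def)
  ultimately show ?thesis by (rule Lim_transform_eventually)
qed

lemma cost_plus_value_bounded: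
  "\<exists>B. AE \<omega> in axis_law \<Lambda> i. \<forall>t\<in>{0..T}. \<bar>cost_plus_value \<omega> t\<bar> \<le> B"
proof -
  obtain R where R: "AE \<omega> in axis_law \<Lambda> i. \<forall>s\<in>{0..T}. norm (\<Xi> \<omega> s) \<le> R" using control_AE_bounded by blast
  obtain B where B: "B > 0" "\<And>\<xi> \<omega> s y. norm (\<xi> s) \<le> R \<Longrightarrow> \<bar>running_cost H \<alpha> y \<xi> \<omega> s\<bar> \<le> B"
    using running_cost_bounded[OF H, of R \<alpha>] by blast
  obtain Bu where Bu: "\<And>x j. \<bar>u x $ j\<bar> \<le> Bu" using value_bounded by blast
  have "AE \<omega> in axis_law \<Lambda> i. \<forall>t\<in>{0..T}. \<bar>cost_plus_value \<omega> t\<bar> \<le> B * T + Bu"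
    using R AE_space
  proof eventually_elim
    case (elim \<omega>)
    then have \<omega>: "\<omega> \<in> index_paths" by (simp add: space_axis_law[OF coupling])
    show ?case
    proof
      fix t assume t: "t \<in> {0..T}"
      have "norm (integral (cbox 0 t) (running_cost H \<alpha> y (\<Xi> \<omega>) \<omega>)) \<le> B * measure lborel (cbox 0 t)"
        using running_cost_integrable_on[OF H control \<omega>, of 0 \<alpha> y t] B elim(1) t
        by (intro integrable_bound) (auto simp: less_imp_le)
      then have "\<bar>accumulated_cost H \<Xi> \<alpha> y \<omega> t\<bar> \<le> B * t"
        using t by (simp add: accumulated_cost_integral[OF H control \<omega>])
      also have "\<dots> \<le> B * T" using B(1) t by simp
      finally show "\<bar>cost_plus_value \<omega> t\<bar> \<le> B * T + Bu"
        using Bu[of "position \<omega> t" "\<omega> t"] unfolding cost_plus_value_def by linarith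
    qed
  qed
  then show ?thesis by blast
qed

text \<open>The change of index is evaluated at the old position; the coupling term is frozen at
  that position, at a cost of at most h e; and while the index is not yet the final one, using the
  wrong Lagrangian costs at most 2 BL per unit of time.\<close>

lemma cost_plus_value_step:
  assumes bound: "\<forall>s\<in>{0..t + h}. norm (\<Xi> \<omega> s) \<le> R" and \<omega>: "\<omega> \<in> index_paths" and t: "0 \<le> t" and h: "0 \<le> h"
    and BL: "\<And>j x q. norm q \<le> R \<Longrightarrow> \<bar>lagrangian H j x q\<bar> \<le> BL"
    and G: "\<And>s. s \<in> {t..t + h} \<Longrightarrow> \<bar>\<Lambda> $ \<omega> (t + h) \<bullet> u (position \<omega> s) - \<Lambda> $ \<omega> (t + h) \<bullet> u (position \<omega> t)\<bar> \<le> e"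
  shows "u (position \<omega> t) $ \<omega> (t + h) + h * (\<Lambda> $ \<omega> (t + h) \<bullet> u (position \<omega> t)) - u (position \<omega> t) $ \<omega> t
      - h * e - 2 * BL * (LINT s:{t..t + h}|lborel. of_bool (\<omega> s \<noteq> \<omega> (t + h)))
    \<le> cost_plus_value \<omega> (t + h) - cost_plus_value \<omega> t"
proof -
  define j where "j = \<omega> (t + h)"
  define g where "g = \<Lambda> $ j \<bullet> u (position \<omega> t)"
  note \<xi> = control_cadlag[OF control \<omega>]
  let ?rc = "running_cost H \<alpha> y (\<Xi> \<omega>) \<omega>"
  let ?J = "LINT s:{t..t + h}|lborel. of_bool (\<omega> s \<noteq> j) :: real"
  have J: "set_integrable lborel {t..t + h} (\<lambda>s. of_bool (\<omega> s \<noteq> j) :: real)"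
    by (rule set_integrable_right_continuous[where B = 1], rule index_change_right[OF \<omega>]) (auto simp: t)
  note J' = set_borel_integral_eq_integral[OF J]
  have rc: "?rc integrable_on {t..t + h}" by (rule running_cost_integrable_on[OF H control \<omega> t])
  have 1: "(\<lambda>s. lagrangian H j (position \<omega> s) (- \<Xi> \<omega> s)) integrable_on {t..t + h}"
    by (rule set_borel_integral_eq_integral(1)[OF fixed_index_cost_set_integrable[OF H \<xi> t]])
  have "continuous_on {t..t + h} (displacement (\<Xi> \<omega>))"
    by (rule continuous_on_subset[OF displacement_continuous[OF \<xi>]]) (use t in auto)
  then have "continuous_on {t..t + h} (\<lambda>s. position \<omega> s)" by (intro continuous_intros)
  from continuous_on_compose2[OF u_continuous[of UNIV] this]
  have 2: "(\<lambda>s. \<Lambda> $ j \<bullet> u (position \<omega> s)) integrable_on {t..t + h}"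
    by (intro integrable_continuous_interval continuous_intros) auto
  have int_rhs: "(\<lambda>s. ?rc s + (2 * BL * of_bool (\<omega> s \<noteq> j) + (e - g))) integrable_on {t..t + h}"
    using J'(1) by (intro Henstock_Kurzweil_Integration.integrable_add rc integrable_const_ivl integrable_on_mult_right) auto
  have "u (position \<omega> t) $ j \<le> u (position \<omega> (t + h)) $ j +
    integral {t..t + h} (\<lambda>s. lagrangian H j (position \<omega> s) (- \<Xi> \<omega> s) + \<alpha> - \<Lambda> $ j \<bullet> u (position \<omega> s))"
    by (rule subsolution_trajectory[OF \<xi> t]) (use h in simp)
  also have "integral {t..t + h} (\<lambda>s. lagrangian H j (position \<omega> s) (- \<Xi> \<omega> s) + \<alpha> - \<Lambda> $ j \<bullet> u (position \<omega> s))
     \<le> integral {t..t + h} (\<lambda>s. ?rc s + (2 * BL * of_bool (\<omega> s \<noteq> j) + (e - g)))"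
  proof (rule integral_le[OF _ int_rhs])
    show "(\<lambda>s. lagrangian H j (position \<omega> s) (- \<Xi> \<omega> s) + \<alpha> - \<Lambda> $ j \<bullet> u (position \<omega> s)) integrable_on {t..t + h}"
      by (intro Henstock_Kurzweil_Integration.integrable_diff Henstock_Kurzweil_Integration.integrable_add 1 2 integrable_const_ivl)
    fix s assume s: "s \<in> {t..t + h}"
    have n: "norm (- \<Xi> \<omega> s) \<le> R" using bound s t by simp
    have "lagrangian H j (position \<omega> s) (- \<Xi> \<omega> s) \<le> lagrangian H (\<omega> s) (position \<omega> s) (- \<Xi> \<omega> s) + 2 * BL * of_bool (\<omega> s \<noteq> j)"
      using BL[OF n, of j "position \<omega> s"] BL[OF n, of "\<omega> s" "position \<omega> s"] by (cases "\<omega> s = j") auto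
    moreover have "g - e \<le> \<Lambda> $ j \<bullet> u (position \<omega> s)" using G[OF s] by (auto simp: g_def j_def abs_le_iff)
    ultimately show "lagrangian H j (position \<omega> s) (- \<Xi> \<omega> s) + \<alpha> - \<Lambda> $ j \<bullet> u (position \<omega> s) \<le> ?rc s + (2 * BL * of_bool (\<omega> s \<noteq> j) + (e - g))"
      by (simp add: running_cost_def)
  qed
  also have "integral {t..t + h} (\<lambda>s. ?rc s + (2 * BL * of_bool (\<omega> s \<noteq> j) + (e - g))) =
     integral {t..t + h} ?rc + (2 * BL * ?J + h * (e - g))"
  proof -
    have i2: "(\<lambda>s. 2 * BL * of_bool (\<omega> s \<noteq> j) + (e - g)) integrable_on {t..t + h}"
      using J'(1) by (intro Henstock_Kurzweil_Integration.integrable_add integrable_const_ivl integrable_on_mult_right) auto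
    have i3: "(\<lambda>s. 2 * BL * of_bool (\<omega> s \<noteq> j)) integrable_on {t..t + h}"
      using J'(1) by (intro integrable_on_mult_right) auto
    show ?thesis
      using h by (simp only: Henstock_Kurzweil_Integration.integral_add[OF rc i2]
        Henstock_Kurzweil_Integration.integral_add[OF i3 integrable_const_ivl]
        Henstock_Kurzweil_Integration.integral_mult_right J'(2)) simp
  qed
  also have "integral {t..t + h} ?rc = accumulated_cost H \<Xi> \<alpha> y \<omega> (t + h) - accumulated_cost H \<Xi> \<alpha> y \<omega> t"
    using Henstock_Kurzweil_Integration.integral_combine[of 0 t "t + h" ?rc] t h running_cost_integrable_on[OF H control \<omega>, of 0 \<alpha> y "t + h"]
    by (simp add: accumulated_cost_integral[OF H control \<omega>])
  finally show ?thesis unfolding cost_plus_value_def j_def[symmetric] g_def[symmetric] by (simp add: algebra_simps)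
qed

end

end

section \<open>The submartingale inequality and optional stopping\<close>

context
  fixes H :: "'m::finite \<Rightarrow> real^'n \<Rightarrow> real^'n \<Rightarrow> real" and \<Lambda> :: "real^'m^'m" and \<alpha> :: real
    and u :: "real^'n \<Rightarrow> real^'m" and \<Xi> :: "(real \<Rightarrow> 'm) \<Rightarrow> real \<Rightarrow> real^'n" and y :: "real^'n" and i :: 'm
  assumes H: "hamiltonians H" and coupling: "coupling_matrix \<Lambda>" and sub: "hj_subsolution H \<Lambda> \<alpha> u"
    and control: "control \<Lambda> \<Xi>"
begin

abbreviation (input) "W \<equiv> cost_plus_value H \<alpha> u \<Xi> y"
abbreviation (input) "X \<omega> t \<equiv> y + displacement (\<Xi> \<omega>) t"

lemma W_integrable:
  assumes A: "A \<in> sets index_path_space" and t: "0 \<le> t"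
  shows "integrable (axis_law \<Lambda> i) (\<lambda>\<omega>. indicator A \<omega> * W \<omega> t)"
proof -
  interpret P: prob_space "axis_law \<Lambda> i" by (rule prob_space_axis_law[OF coupling])
  obtain B where B: "AE \<omega> in axis_law \<Lambda> i. \<forall>t'\<in>{0..t}. \<bar>W \<omega> t'\<bar> \<le> B"
    using cost_plus_value_bounded[OF H coupling sub control, of t y i] by blast
  have "AE \<omega> in axis_law \<Lambda> i. norm (indicator A \<omega> * W \<omega> t) \<le> \<bar>B\<bar>"
    using B by eventually_elim (use t in \<open>auto simp: indicator_def intro: order_trans[OF _ abs_ge_self]\<close>)
  moreover have "(\<lambda>\<omega>. indicator A \<omega> * W \<omega> t) \<in> borel_measurable (axis_law \<Lambda> i)"
    using cost_plus_value_measurable[OF H coupling sub control t] A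
    by (simp cong: measurable_cong_sets add: sets_axis_law[OF coupling, of i])
  ultimately show ?thesis by (rule P.integrable_const_bound)
qed

text \<open>Given the index k at time t, averaging over the index at t + h leaves the sum over m of
  c k m times the component m of u at the old position, where c is the deviation of exp (- h
  \<Lambda>) (I + h \<Lambda>) from the identity.\<close>

lemma markov_step_expectation:
  assumes A: "A \<in> sets (index_filtration t)" and t: "0 \<le> t" and h: "0 \<le> h" and e: "0 \<le> e"
    and Bu: "\<And>x j. \<bar>u x $ j\<bar> \<le> Bu"
    and first_order: "(\<Sum>k\<in>UNIV. \<Sum>m\<in>UNIV. \<bar>transition \<Lambda> h k m + h * (\<Sum>l\<in>UNIV. transition \<Lambda> h k l * \<Lambda> $ l $ m) - of_bool (k = m)\<bar>) \<le> e"
  defines "M \<equiv> \<lambda>\<omega>. u (X \<omega> t) $ \<omega> (t + h) + h * (\<Lambda> $ \<omega> (t + h) \<bullet> u (X \<omega> t)) - u (X \<omega> t) $ \<omega> t"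
  shows "- (e * Bu) \<le> (\<integral>\<omega>. indicator A \<omega> * M \<omega> \<partial>(axis_law \<Lambda> i))" and "integrable (axis_law \<Lambda> i) (\<lambda>\<omega>. indicator A \<omega> * M \<omega>)"
proof -
  interpret P: prob_space "axis_law \<Lambda> i" by (rule prob_space_axis_law[OF coupling])
  note [measurable_cong] = sets_axis_law[OF coupling, of i]
  have A': "A \<in> sets index_path_space" using A sets_index_filtration_subset by blast
  have Bu0: "0 \<le> Bu" using Bu[of 0 undefined] by (rule order_trans[OF abs_ge_zero])
  \<comment> \<open>With the index values held fixed as l and k, \<open>f\<close> and
    \<open>g\<close> are functionals of the past of t, the form in which the Markov property
    applies.\<close>
  define f where "f l \<omega> = indicator A \<omega> * (u (X \<omega> t) $ l + h * (\<Lambda> $ l \<bullet> u (X \<omega> t)))" for l \<omega>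
  define g where "g k \<omega> = indicator A \<omega> * u (X \<omega> t) $ k" for k \<omega>
  have u_cont: "continuous_on UNIV u" by (rule u_continuous[OF H coupling sub])
  have f_past [measurable]: "f l \<in> borel_measurable (index_filtration t)" for l
  proof -
    have "(\<lambda>\<omega>. u (X \<omega> t) $ l + h * (\<Lambda> $ l \<bullet> u (X \<omega> t))) \<in> borel_measurable (index_filtration t)"
      by (rule value_past_measurable[OF H coupling sub control _ t, of "\<lambda>x. u x $ l + h * (\<Lambda> $ l \<bullet> u x)"])
         (intro continuous_intros u_cont)
    with A show ?thesis unfolding f_def by (intro borel_measurable_times borel_measurable_indicator)
  qed
  have g_past [measurable]: "g k \<in> borel_measurable (index_filtration t)" for k
  proof -
    have "(\<lambda>\<omega>. u (X \<omega> t) $ k) \<in> borel_measurable (index_filtration t)"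
      by (rule value_past_measurable[OF H coupling sub control _ t, of "\<lambda>x. u x $ k"])
         (intro continuous_intros u_cont)
    with A show ?thesis unfolding g_def by (intro borel_measurable_times borel_measurable_indicator)
  qed
  have to_P: "F \<in> borel_measurable (axis_law \<Lambda> i)" if "F \<in> borel_measurable (index_filtration t)" for F :: "(real \<Rightarrow> 'm) \<Rightarrow> real"
    using that measurable_mono[of borel borel "index_filtration t" "axis_law \<Lambda> i"] sets_index_filtration_subset[of t]
    by (auto simp: sets_axis_law[OF coupling, of i] space_axis_law[OF coupling])
  have ev: "(\<lambda>\<omega>. \<omega> t) \<in> (axis_law \<Lambda> i) \<rightarrow>\<^sub>M count_space UNIV" "(\<lambda>\<omega>. \<omega> (t + h)) \<in> (axis_law \<Lambda> i) \<rightarrow>\<^sub>M count_space UNIV"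
    using measurable_index_eval[of t] measurable_index_eval[of "t + h"] t h
    by (auto simp: measurable_cong_sets[OF sets_axis_law[OF coupling, of i] refl])
  define BL where "BL = Bu + h * (\<Sum>k\<in>UNIV. \<Sum>l\<in>UNIV. \<bar>\<Lambda> $ k $ l\<bar> * Bu)"
  have Lu: "\<bar>\<Lambda> $ l \<bullet> u x\<bar> \<le> (\<Sum>k\<in>UNIV. \<Sum>l\<in>UNIV. \<bar>\<Lambda> $ k $ l\<bar> * Bu)" for l x
  proof -
    have "\<bar>\<Lambda> $ l \<bullet> u x\<bar> \<le> (\<Sum>m\<in>UNIV. \<bar>\<Lambda> $ l $ m\<bar> * Bu)"
      unfolding inner_vec_def
      by (rule order_trans[OF sum_abs], rule sum_mono) (auto simp: abs_mult intro!: mult_left_mono Bu)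
    also have "\<dots> \<le> (\<Sum>k\<in>UNIV. \<Sum>l\<in>UNIV. \<bar>\<Lambda> $ k $ l\<bar> * Bu)"
      by (rule member_le_sum[where f = "\<lambda>k. \<Sum>l\<in>UNIV. \<bar>\<Lambda> $ k $ l\<bar> * Bu"])
         (auto intro!: sum_nonneg mult_nonneg_nonneg Bu0)
    finally show ?thesis .
  qed
  have f_bound: "\<bar>f l \<omega>\<bar> \<le> BL" for l \<omega>
  proof -
    have "\<bar>u (X \<omega> t) $ l + h * (\<Lambda> $ l \<bullet> u (X \<omega> t))\<bar> \<le> BL"
      unfolding BL_def by (rule order_trans[OF abs_triangle_ineq], rule add_mono)
        (auto simp: abs_mult h intro!: Bu mult_left_mono Lu)
    then show ?thesis by (auto simp: f_def indicator_def intro: order_trans[OF abs_ge_zero])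
  qed
  have g_bound: "\<bar>g k \<omega>\<bar> \<le> Bu" for k \<omega> using Bu Bu0 by (simp add: g_def indicator_def)
  have BL0: "0 \<le> BL" using f_bound[of undefined undefined] by (rule order_trans[OF abs_ge_zero])
  have i1: "integrable (axis_law \<Lambda> i) (\<lambda>\<omega>. of_bool (\<omega> t = k \<and> \<omega> (t + h) = l) * f l \<omega>)" for k l
  proof (rule P.integrable_const_bound[of _ BL])
    note [measurable] = ev to_P[OF f_past]
    show "(\<lambda>\<omega>. of_bool (\<omega> t = k \<and> \<omega> (t + h) = l) * f l \<omega>) \<in> borel_measurable (axis_law \<Lambda> i)" by measurable
  qed (use f_bound BL0 in \<open>auto simp: of_bool_def\<close>)
  have i2: "integrable (axis_law \<Lambda> i) (\<lambda>\<omega>. of_bool (\<omega> t = k) * f l \<omega>)" for k l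
  proof (rule P.integrable_const_bound[of _ BL])
    note [measurable] = ev to_P[OF f_past]
    show "(\<lambda>\<omega>. of_bool (\<omega> t = k) * f l \<omega>) \<in> borel_measurable (axis_law \<Lambda> i)" by measurable
  qed (use f_bound BL0 in \<open>auto simp: of_bool_def\<close>)
  have i3: "integrable (axis_law \<Lambda> i) (\<lambda>\<omega>. of_bool (\<omega> t = k) * g k \<omega>)" for k
  proof (rule P.integrable_const_bound[of _ Bu])
    note [measurable] = ev to_P[OF g_past]
    show "(\<lambda>\<omega>. of_bool (\<omega> t = k) * g k \<omega>) \<in> borel_measurable (axis_law \<Lambda> i)" by measurable
  qed (use g_bound Bu0 in \<open>auto simp: of_bool_def\<close>)
  have delta: "(\<Sum>k\<in>UNIV. of_bool (a = k) * F k) = F a" for a :: 'm and F :: "'m \<Rightarrow> real"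
  proof -
    have "(\<Sum>k\<in>UNIV. of_bool (a = k) * F k) = (\<Sum>k\<in>UNIV. if k = a then F k else 0)" by (intro sum.cong) auto
    then show ?thesis by simp
  qed
  have expand: "indicator A \<omega> * M \<omega> =
     (\<Sum>k\<in>UNIV. \<Sum>l\<in>UNIV. of_bool (\<omega> t = k \<and> \<omega> (t + h) = l) * f l \<omega>) - (\<Sum>k\<in>UNIV. of_bool (\<omega> t = k) * g k \<omega>)" for \<omega>
  proof -
    have "(\<Sum>k\<in>UNIV. \<Sum>l\<in>UNIV. of_bool (\<omega> t = k \<and> \<omega> (t + h) = l) * f l \<omega>) =
       (\<Sum>k\<in>UNIV. of_bool (\<omega> t = k) * (\<Sum>l\<in>UNIV. of_bool (\<omega> (t + h) = l) * f l \<omega>))"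
      by (simp only: of_bool_conj mult.assoc sum_distrib_left)
    also have "\<dots> = f (\<omega> (t + h)) \<omega>" by (simp only: delta)
    finally show ?thesis by (simp only: delta) (simp add: f_def g_def M_def algebra_simps)
  qed
  show "integrable (axis_law \<Lambda> i) (\<lambda>\<omega>. indicator A \<omega> * M \<omega>)"
    unfolding expand by (intro Bochner_Integration.integrable_diff Bochner_Integration.integrable_sum i1 i3)
  have "(\<integral>\<omega>. indicator A \<omega> * M \<omega> \<partial>(axis_law \<Lambda> i)) =
     (\<Sum>k\<in>UNIV. \<Sum>l\<in>UNIV. \<integral>\<omega>. of_bool (\<omega> t = k \<and> \<omega> (t + h) = l) * f l \<omega> \<partial>(axis_law \<Lambda> i)) - (\<Sum>k\<in>UNIV. \<integral>\<omega>. of_bool (\<omega> t = k) * g k \<omega> \<partial>(axis_law \<Lambda> i))"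
    unfolding expand
    by (simp only: Bochner_Integration.integral_diff Bochner_Integration.integral_sum Bochner_Integration.integrable_sum i1 i3)
  also have "(\<Sum>k\<in>UNIV. \<Sum>l\<in>UNIV. \<integral>\<omega>. of_bool (\<omega> t = k \<and> \<omega> (t + h) = l) * f l \<omega> \<partial>(axis_law \<Lambda> i)) =
     (\<Sum>k\<in>UNIV. \<Sum>l\<in>UNIV. transition \<Lambda> h k l * (\<integral>\<omega>. of_bool (\<omega> t = k) * f l \<omega> \<partial>(axis_law \<Lambda> i)))"
    by (simp only: markov_property[OF coupling axis_prob_vector t h f_past])
  also have "\<dots> - (\<Sum>k\<in>UNIV. \<integral>\<omega>. of_bool (\<omega> t = k) * g k \<omega> \<partial>(axis_law \<Lambda> i)) =
     (\<integral>\<omega>. (\<Sum>k\<in>UNIV. \<Sum>l\<in>UNIV. transition \<Lambda> h k l * (of_bool (\<omega> t = k) * f l \<omega>)) - (\<Sum>k\<in>UNIV. of_bool (\<omega> t = k) * g k \<omega>) \<partial>(axis_law \<Lambda> i))"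
    by (simp only: Bochner_Integration.integral_diff Bochner_Integration.integral_sum Bochner_Integration.integrable_sum
        i2 i3 integrable_mult_right Bochner_Integration.integral_mult_right)
  also have "\<dots> \<ge> (\<integral>\<omega>. - (e * Bu) \<partial>(axis_law \<Lambda> i))"
  proof (rule integral_mono)
    show "integrable (axis_law \<Lambda> i) (\<lambda>\<omega>. (\<Sum>k\<in>UNIV. \<Sum>l\<in>UNIV. transition \<Lambda> h k l * (of_bool (\<omega> t = k) * f l \<omega>)) - (\<Sum>k\<in>UNIV. of_bool (\<omega> t = k) * g k \<omega>))"
      by (intro Bochner_Integration.integrable_diff Bochner_Integration.integrable_sum i2 i3 integrable_mult_right)
    fix \<omega> :: "real \<Rightarrow> 'm"
    define c where "c k m = transition \<Lambda> h k m + h * (\<Sum>l\<in>UNIV. transition \<Lambda> h k l * \<Lambda> $ l $ m) - of_bool (k = m)" for k m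
    define v where "v = u (X \<omega> t)"
    define k where "k = \<omega> t"
    have "(\<Sum>k\<in>UNIV. \<Sum>l\<in>UNIV. transition \<Lambda> h k l * (of_bool (\<omega> t = k) * f l \<omega>)) =
        (\<Sum>k\<in>UNIV. of_bool (\<omega> t = k) * (\<Sum>l\<in>UNIV. transition \<Lambda> h k l * f l \<omega>))"
      by (simp only: sum_distrib_left mult.left_commute)
    then have "(\<Sum>k\<in>UNIV. \<Sum>l\<in>UNIV. transition \<Lambda> h k l * (of_bool (\<omega> t = k) * f l \<omega>)) - (\<Sum>k\<in>UNIV. of_bool (\<omega> t = k) * g k \<omega>)
       = (\<Sum>l\<in>UNIV. transition \<Lambda> h k l * f l \<omega>) - g k \<omega>"
      by (simp only: delta k_def)
    also have "\<dots> = indicator A \<omega> * ((\<Sum>l\<in>UNIV. transition \<Lambda> h k l * (v $ l + h * (\<Lambda> $ l \<bullet> v))) - v $ k)"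
      by (simp add: f_def g_def v_def right_diff_distrib sum_distrib_left mult.left_commute)
    also have "(\<Sum>l\<in>UNIV. transition \<Lambda> h k l * (v $ l + h * (\<Lambda> $ l \<bullet> v))) - v $ k = (\<Sum>m\<in>UNIV. c k m * v $ m)"
    proof -
      have "(\<Sum>l\<in>UNIV. transition \<Lambda> h k l * (h * (\<Lambda> $ l \<bullet> v))) = (\<Sum>l\<in>UNIV. \<Sum>m\<in>UNIV. h * (transition \<Lambda> h k l * \<Lambda> $ l $ m) * v $ m)"
        by (simp add: inner_vec_def sum_distrib_left mult_ac)
      also have "\<dots> = (\<Sum>m\<in>UNIV. h * (\<Sum>l\<in>UNIV. transition \<Lambda> h k l * \<Lambda> $ l $ m) * v $ m)"
        by (subst sum.swap) (simp add: sum_distrib_left sum_distrib_right)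
      finally have 1: "(\<Sum>l\<in>UNIV. transition \<Lambda> h k l * (h * (\<Lambda> $ l \<bullet> v))) = (\<Sum>m\<in>UNIV. h * (\<Sum>l\<in>UNIV. transition \<Lambda> h k l * \<Lambda> $ l $ m) * v $ m)" .
      have 2: "v $ k = (\<Sum>m\<in>UNIV. of_bool (k = m) * v $ m)" by (simp only: delta)
      show ?thesis
        by (subst 2) (simp only: c_def left_diff_distrib distrib_right distrib_left sum_subtractf sum.distrib 1)
    qed
    also have "- (e * Bu) \<le> indicator A \<omega> * (\<Sum>m\<in>UNIV. c k m * v $ m)"
    proof -
      have "\<bar>\<Sum>m\<in>UNIV. c k m * v $ m\<bar> \<le> (\<Sum>m\<in>UNIV. \<bar>c k m\<bar> * Bu)"
        by (rule order_trans[OF sum_abs], rule sum_mono) (auto simp: abs_mult v_def intro!: mult_left_mono Bu)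
      also have "\<dots> = (\<Sum>m\<in>UNIV. \<bar>c k m\<bar>) * Bu" by (simp only: sum_distrib_right)
      also have "\<dots> \<le> e * Bu"
      proof (rule mult_right_mono[OF _ Bu0])
        have "(\<Sum>m\<in>UNIV. \<bar>c k m\<bar>) \<le> (\<Sum>k\<in>UNIV. \<Sum>m\<in>UNIV. \<bar>c k m\<bar>)"
          by (rule member_le_sum[where f = "\<lambda>k. \<Sum>m\<in>UNIV. \<bar>c k m\<bar>"]) (auto intro: sum_nonneg)
        then show "(\<Sum>m\<in>UNIV. \<bar>c k m\<bar>) \<le> e" using first_order unfolding c_def by linarith
      qed
      finally have "\<bar>\<Sum>m\<in>UNIV. c k m * v $ m\<bar> \<le> e * Bu" .
      moreover have "0 \<le> e * Bu" using e Bu0 by simp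
      ultimately show ?thesis by (auto simp: indicator_def abs_le_iff)
    qed
    finally show "- (e * Bu) \<le> (\<Sum>k\<in>UNIV. \<Sum>l\<in>UNIV. transition \<Lambda> h k l * (of_bool (\<omega> t = k) * f l \<omega>)) - (\<Sum>k\<in>UNIV. of_bool (\<omega> t = k) * g k \<omega>)" .
  qed simp
  finally show "- (e * Bu) \<le> (\<integral>\<omega>. indicator A \<omega> * M \<omega> \<partial>(axis_law \<Lambda> i))" using P.prob_space by simp
qed

text \<open>The set A is meant as the event that stopping has not occurred by t. The step size h0 is
  uniform in t and A, so that errors along a grid add up to at most \<epsilon> times its
  length.\<close>

lemma expected_step:
  assumes "0 < \<epsilon>"
  shows "\<exists>h0>0. \<forall>h t A. 0 < h \<and> h \<le> h0 \<and> 0 \<le> t \<and> t + h \<le> T \<and> A \<in> sets (index_filtration t) \<longrightarrow>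
    - (\<epsilon> * h) \<le> (\<integral>\<omega>. indicator A \<omega> * (W \<omega> (t + h) - W \<omega> t) \<partial>(axis_law \<Lambda> i))"
proof -
  interpret P: prob_space "axis_law \<Lambda> i" by (rule prob_space_axis_law[OF coupling])
  note [measurable_cong] = sets_axis_law[OF coupling, of i]
  have u_cont: "continuous_on UNIV u" by (rule u_continuous[OF H coupling sub])
  obtain R where R: "R > 0" "AE \<omega> in axis_law \<Lambda> i. \<forall>s\<in>{0..T}. norm (\<Xi> \<omega> s) \<le> R"
    using control_AE_bounded[OF H coupling sub control, where i = i and T = T] by blast
  obtain BL where BL: "BL > 0" "\<And>j x q. norm q \<le> R \<Longrightarrow> \<bar>lagrangian H j x q\<bar> \<le> BL"
    using lagrangian_bounded[OF H, of R] by blast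
  obtain Bu where Bu: "Bu > 0" "\<And>x j. \<bar>u x $ j\<bar> \<le> Bu" using value_bounded[OF H coupling sub] by blast
  define G where "G x = (\<chi> j. \<Lambda> $ j \<bullet> u x)" for x
  have "continuous_on (cball y (R * T)) G"
    unfolding G_def by (intro continuous_intros continuous_on_subset[OF u_cont]) auto
  then have "uniformly_continuous_on (cball y (R * T)) G" by (intro compact_uniformly_continuous compact_cball)
  then obtain \<delta> where \<delta>: "\<delta> > 0"
    "\<And>x x'. x \<in> cball y (R * T) \<Longrightarrow> x' \<in> cball y (R * T) \<Longrightarrow> dist x' x < \<delta> \<Longrightarrow> dist (G x') (G x) < \<epsilon> / 3"
    unfolding uniformly_continuous_on_def using assms by (metis zero_less_divide_iff zero_less_numeral)
  \<comment> \<open>Three errors of size \<epsilon> h / 3: the first-order error is multiplied by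
    the bound Bu of u, the expected index mismatch by 2 BL, and the speed bound R keeps the
    displacement during a step below the modulus \<delta> of the coupling term.\<close>
  have "0 < \<epsilon> / (3 * Bu)" using assms Bu by simp
  from transition_first_order[OF this, of \<Lambda>] obtain h1 where h1: "h1 > 0" "\<And>h. 0 < h \<Longrightarrow> h \<le> h1 \<Longrightarrow>
      (\<Sum>k\<in>UNIV. \<Sum>m\<in>UNIV. \<bar>transition \<Lambda> h k m + h * (\<Sum>l\<in>UNIV. transition \<Lambda> h k l * \<Lambda> $ l $ m) - of_bool (k = m)\<bar>) \<le> \<epsilon> / (3 * Bu) * h"
    by blast
  have "0 < \<epsilon> / (6 * BL)" using assms BL by simp
  from transition_near_identity[OF this, of \<Lambda>] obtain h2 where h2: "h2 > 0"
    "\<And>h k l. 0 \<le> h \<Longrightarrow> h \<le> h2 \<Longrightarrow> \<bar>transition \<Lambda> h k l - of_bool (k = l)\<bar> \<le> \<epsilon> / (6 * BL)"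
    by blast
  define h0 where "h0 = min (min h1 h2) (\<delta> / (2 * R))"
  have h0: "0 < h0" "h0 \<le> h1" "h0 \<le> h2" "h0 \<le> \<delta> / (2 * R)" using h1 h2 \<delta> R by (auto simp: h0_def)
  have "- (\<epsilon> * h) \<le> (\<integral>\<omega>. indicator A \<omega> * (W \<omega> (t + h) - W \<omega> t) \<partial>(axis_law \<Lambda> i))"
    if h: "0 < h" "h \<le> h0" and t: "0 \<le> t" "t + h \<le> T" and A: "A \<in> sets (index_filtration t)" for h t A
  proof -
    have A': "A \<in> sets index_path_space" using A sets_index_filtration_subset by blast
    let ?M = "\<lambda>\<omega>. u (X \<omega> t) $ \<omega> (t + h) + h * (\<Lambda> $ \<omega> (t + h) \<bullet> u (X \<omega> t)) - u (X \<omega> t) $ \<omega> t"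
    let ?J = "\<lambda>\<omega>::real \<Rightarrow> 'm. LINT s:{t..t + h}|lborel. of_bool (\<omega> s \<noteq> \<omega> (t + h)) :: real"
    have near: "1 - \<epsilon> / (6 * BL) \<le> transition \<Lambda> r k k" if "0 \<le> r" "r \<le> h" for k r
      using h2(2)[of r k k] that h h0 by (auto simp: abs_le_iff)
    note M = markov_step_expectation[OF A t(1) _ _ Bu(2) h1(2)[OF h(1)]]
    have EM: "- (\<epsilon> / (3 * Bu) * h * Bu) \<le> (\<integral>\<omega>. indicator A \<omega> * ?M \<omega> \<partial>(axis_law \<Lambda> i))" and iM: "integrable (axis_law \<Lambda> i) (\<lambda>\<omega>. indicator A \<omega> * ?M \<omega>)"
      by (rule M; use h h0 assms Bu in simp)+
    have hn: "0 \<le> h" using h by simp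
    have EJ: "(\<integral>\<omega>. ?J \<omega> \<partial>(axis_law \<Lambda> i)) \<le> h * (\<epsilon> / (6 * BL))"
      by (rule expected_index_change(1)[OF H coupling sub t(1) hn]) (rule near)
    have J_meas: "?J \<in> borel_measurable index_path_space"
      by (rule expected_index_change(2)[OF H coupling sub t(1) hn]) (rule near)
    have J01: "0 \<le> ?J \<omega>" "?J \<omega> \<le> h" if "\<omega> \<in> index_paths" for \<omega>
    proof -
      have J: "set_integrable lborel {t..t + h} (\<lambda>s. of_bool (\<omega> s \<noteq> \<omega> (t + h)) :: real)"
        by (rule set_integrable_right_continuous[where B = 1], rule index_change_right[OF H coupling sub that]) (auto simp: t)
      show "0 \<le> ?J \<omega>" unfolding set_lebesgue_integral_def by (intro integral_nonneg_AE) (auto simp: indicator_def)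
      have "?J \<omega> \<le> (LINT s:{t..t + h}|lborel. 1)"
        by (rule set_integral_mono[OF J]) (auto simp: set_integrable_def h less_imp_le)
      also have "\<dots> = h" using h by (simp add: set_lebesgue_integral_def)
      finally show "?J \<omega> \<le> h" .
    qed
    have iJ: "integrable (axis_law \<Lambda> i) (\<lambda>\<omega>. ?J \<omega>)"
      by (rule P.integrable_const_bound[of _ h])
         (use J01 J_meas in \<open>auto simp: space_axis_law[OF coupling] intro!: AE_I2 cong: measurable_cong_sets\<close>)
    have iW: "integrable (axis_law \<Lambda> i) (\<lambda>\<omega>. indicator A \<omega> * (W \<omega> (t + h) - W \<omega> t))"
      using Bochner_Integration.integrable_diff[OF W_integrable[OF A', of "t + h"] W_integrable[OF A', of t]] t h
      by (simp add: right_diff_distrib)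
    have "(\<integral>\<omega>. indicator A \<omega> * ?M \<omega> - h * (\<epsilon> / 3) - 2 * BL * ?J \<omega> \<partial>(axis_law \<Lambda> i)) \<le> (\<integral>\<omega>. indicator A \<omega> * (W \<omega> (t + h) - W \<omega> t) \<partial>(axis_law \<Lambda> i))"
    proof (rule integral_mono_AE[OF _ iW])
      show "integrable (axis_law \<Lambda> i) (\<lambda>\<omega>. indicator A \<omega> * ?M \<omega> - h * (\<epsilon> / 3) - 2 * BL * ?J \<omega>)"
        by (intro Bochner_Integration.integrable_diff iM iJ integrable_mult_right P.integrable_const)
      show "AE \<omega> in axis_law \<Lambda> i. indicator A \<omega> * ?M \<omega> - h * (\<epsilon> / 3) - 2 * BL * ?J \<omega> \<le> indicator A \<omega> * (W \<omega> (t + h) - W \<omega> t)"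
        using R(2) AE_space
      proof eventually_elim
        case (elim \<omega>)
        then have \<omega>: "\<omega> \<in> index_paths" by (simp add: space_axis_law[OF coupling])
        note \<xi> = control_cadlag[OF control \<omega>]
        have "?M \<omega> - h * (\<epsilon> / 3) - 2 * BL * ?J \<omega> \<le> W \<omega> (t + h) - W \<omega> t"
        proof (rule cost_plus_value_step[OF H coupling sub control _ \<omega> t(1) _ BL(2)])
          show "\<forall>s\<in>{0..t + h}. norm (\<Xi> \<omega> s) \<le> R" using elim(1) t by auto
          fix s assume s: "s \<in> {t..t + h}"
          have ball: "X \<omega> r \<in> cball y (R * T)" if "0 \<le> r" "r \<le> T" for r
          proof -
            have "norm (displacement (\<Xi> \<omega>) r - displacement (\<Xi> \<omega>) 0) \<le> R * (r - 0)"
              by (rule displacement_lipschitz[OF \<xi>]) (use elim(1) that in auto)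
            also have "\<dots> \<le> R * T" using R(1) that by simp
            finally show ?thesis by (simp add: displacement_0 dist_norm)
          qed
          have "norm (displacement (\<Xi> \<omega>) s - displacement (\<Xi> \<omega>) t) \<le> R * (s - t)"
            by (rule displacement_lipschitz[OF \<xi>]) (use elim(1) t s in auto)
          also have "\<dots> \<le> R * (\<delta> / (2 * R))" using s h h0 R(1) by (intro mult_left_mono) auto
          also have "\<dots> < \<delta>" using R(1) \<delta>(1) by simp
          finally have "dist (X \<omega> s) (X \<omega> t) < \<delta>" by (simp add: dist_norm)
          then have "dist (G (X \<omega> s)) (G (X \<omega> t)) < \<epsilon> / 3"
            by (intro \<delta>(2) ball) (use s t h in auto)
          then have "\<bar>(G (X \<omega> s) - G (X \<omega> t)) $ \<omega> (t + h)\<bar> < \<epsilon> / 3"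
            using component_le_norm_cart[of "G (X \<omega> s) - G (X \<omega> t)" "\<omega> (t + h)"] by (simp add: dist_norm)
          then show "\<bar>\<Lambda> $ \<omega> (t + h) \<bullet> u (X \<omega> s) - \<Lambda> $ \<omega> (t + h) \<bullet> u (X \<omega> t)\<bar> \<le> \<epsilon> / 3"
            by (simp add: G_def)
        qed (use h in simp_all)
        moreover have "0 \<le> h * (\<epsilon> / 3) + 2 * BL * ?J \<omega>"
          using h assms BL(1) J01(1)[OF \<omega>] by (intro add_nonneg_nonneg mult_nonneg_nonneg) auto
        ultimately show ?case by (cases "\<omega> \<in> A") auto
      qed
    qed
    moreover have "(\<integral>\<omega>. indicator A \<omega> * ?M \<omega> - h * (\<epsilon> / 3) - 2 * BL * ?J \<omega> \<partial>(axis_law \<Lambda> i)) =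
        (\<integral>\<omega>. indicator A \<omega> * ?M \<omega> \<partial>(axis_law \<Lambda> i)) - h * (\<epsilon> / 3) - 2 * BL * (\<integral>\<omega>. ?J \<omega> \<partial>(axis_law \<Lambda> i))"
      using iM iJ P.prob_space by simp
    moreover have "2 * BL * (\<integral>\<omega>. ?J \<omega> \<partial>(axis_law \<Lambda> i)) \<le> 2 * BL * (h * (\<epsilon> / (6 * BL)))"
      using EJ BL(1) by (intro mult_left_mono) auto
    moreover have "2 * BL * (h * (\<epsilon> / (6 * BL))) = \<epsilon> * h / 3" using BL(1) by (simp add: field_simps)
    moreover have "\<epsilon> / (3 * Bu) * h * Bu = \<epsilon> * h / 3" using Bu(1) by (simp add: field_simps)
    ultimately show ?thesis using EM by (simp add: field_simps)
  qed
  then show ?thesis using h0(1) by blast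
qed

lemma tendsto_from_right:
  fixes f :: "real \<Rightarrow> real"
  assumes "(f \<longlongrightarrow> f a) (at_right a)" "\<And>n. a \<le> s n" "s \<longlonglongrightarrow> a"
  shows "(\<lambda>n. f (s n)) \<longlonglongrightarrow> f a"
proof -
  have "continuous (at a within {a..}) f"
    using assms(1) by (simp add: continuous_within at_within_Ici_at_right)
  then show ?thesis using assms(2,3) unfolding continuous_within_sequentially by (auto simp: o_def)
qed

lemma W_initial: "(\<integral>\<omega>. W \<omega> 0 \<partial>(axis_law \<Lambda> i)) = u y $ i"
proof -
  interpret P: prob_space "axis_law \<Lambda> i" by (rule prob_space_axis_law[OF coupling])
  note law = is_index_law_index_law[OF coupling axis_prob_vector, of i]
  have "measure (axis_law \<Lambda> i) {\<omega> \<in> space (axis_law \<Lambda> i). \<omega> 0 = i} = 1"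
  proof -
    have "{\<omega> \<in> space (axis_law \<Lambda> i). \<omega> 0 = i} = path_cylinder ((\<lambda>_. 0) ` {..0::nat}) (\<lambda>_. i)"
      by (auto simp: space_axis_law[OF coupling] path_cylinder_def)
    also have "measure (axis_law \<Lambda> i) \<dots> = (\<Sum>j\<in>UNIV. axis i 1 $ j * transition \<Lambda> 0 j i)"
      by (subst is_index_law_cylinder[OF law]) auto
    also have "\<dots> = 1" by (simp add: transition_0 axis_def if_distrib[of "\<lambda>x. x * _"] cong: if_cong)
    finally show ?thesis .
  qed
  then have "AE \<omega> in axis_law \<Lambda> i. \<omega> 0 = i"
  proof (subst P.prob_Collect_eq_1[symmetric])
    have "(\<lambda>\<omega>. \<omega> 0) \<in> (axis_law \<Lambda> i) \<rightarrow>\<^sub>M count_space UNIV"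
      using measurable_index_eval[of 0] by (simp add: measurable_cong_sets[OF sets_axis_law[OF coupling, of i] refl])
    from measurable_sets[OF this, of "{i}"] show "{\<omega> \<in> space (axis_law \<Lambda> i). \<omega> 0 = i} \<in> P.events"
      by (simp add: vimage_def Int_def conj_commute)
  qed
  then have "AE \<omega> in axis_law \<Lambda> i. W \<omega> 0 = u y $ i"
  proof eventually_elim
    case (elim \<omega>)
    have "accumulated_cost H \<Xi> \<alpha> y \<omega> 0 = 0"
      unfolding accumulated_cost_def[OF H control] set_lebesgue_integral_def
      by (rule integral_eq_zero_AE) (use AE_lborel_singleton[of "0::real"] in \<open>auto elim!: eventually_mono\<close>)
    then show ?case using elim by (simp add: cost_plus_value_def[OF H coupling sub control] displacement_0)
  qed
  then have "(\<integral>\<omega>. W \<omega> 0 \<partial>(axis_law \<Lambda> i)) = (\<integral>\<omega>. u y $ i \<partial>(axis_law \<Lambda> i))"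
    using cost_plus_value_measurable[OF H coupling sub control, of 0 y]
    by (intro integral_cong_AE) (auto simp: measurable_cong_sets[OF sets_axis_law[OF coupling, of i] refl])
  then show ?thesis using P.prob_space by simp
qed

text \<open>The stopping time is approximated from above by its roundings to a grid; stopping on a grid,
  the expected increments telescope.\<close>

lemma stopped_expectation:
  assumes \<tau>: "bounded_stopping_time \<tau>"
  shows "u y $ i \<le> (\<integral>\<omega>. W \<omega> (\<tau> \<omega>) \<partial>(axis_law \<Lambda> i))"
    and "(\<lambda>\<omega>. W \<omega> (\<tau> \<omega>)) \<in> borel_measurable index_path_space"
proof -
  interpret P: prob_space "axis_law \<Lambda> i" by (rule prob_space_axis_law[OF coupling])
  have \<tau>_meas: "\<tau> \<in> borel_measurable index_path_space" and \<tau>_nonneg: "\<And>\<omega>. \<omega> \<in> index_paths \<Longrightarrow> 0 \<le> \<tau> \<omega>"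
    and \<tau>_stop: "\<And>t. Measurable.pred (index_filtration t) (\<lambda>\<omega>. \<tau> \<omega> \<le> t)"
    using \<tau> by (auto simp: bounded_stopping_time_def stopping_time_def)
  obtain K0 where K0: "\<And>\<omega>. \<omega> \<in> index_paths \<Longrightarrow> \<tau> \<omega> \<le> K0"
    using \<tau> unfolding bounded_stopping_time_def by blast
  define K where "K = max K0 0"
  have K: "0 \<le> K" "\<And>\<omega>. \<omega> \<in> index_paths \<Longrightarrow> \<tau> \<omega> \<le> K"
    using K0 by (auto simp: K_def le_max_iff_disj)
  \<comment> \<open>Rounding up keeps \<sigma> on the right of \<tau>, where right continuity gives
    convergence of the stopped values.\<close>
  define \<sigma> where "\<sigma> n \<omega> = real (nat \<lceil>\<tau> \<omega> * real (Suc n)\<rceil>) / real (Suc n)" for n \<omega>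
  have \<sigma>_bounds: "\<tau> \<omega> \<le> \<sigma> n \<omega>" "\<sigma> n \<omega> \<le> \<tau> \<omega> + 1 / real (Suc n)" if "\<omega> \<in> index_paths" for n \<omega>
  proof -
    have nn: "0 \<le> \<tau> \<omega> * real (Suc n)" using \<tau>_nonneg[OF that] by simp
    have "\<tau> \<omega> * real (Suc n) \<le> real (nat \<lceil>\<tau> \<omega> * real (Suc n)\<rceil>)" by (rule real_nat_ceiling_ge)
    then show "\<tau> \<omega> \<le> \<sigma> n \<omega>" by (simp add: \<sigma>_def pos_le_divide_eq del: of_nat_Suc)
    have "real (nat \<lceil>\<tau> \<omega> * real (Suc n)\<rceil>) \<le> \<tau> \<omega> * real (Suc n) + 1" using nn by linarith
    then show "\<sigma> n \<omega> \<le> \<tau> \<omega> + 1 / real (Suc n)"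
      by (simp add: \<sigma>_def pos_divide_le_eq distrib_right del: of_nat_Suc)
  qed
  have \<sigma>_lim: "(\<lambda>n. \<sigma> n \<omega>) \<longlonglongrightarrow> \<tau> \<omega>" if "\<omega> \<in> index_paths" for \<omega>
  proof (rule tendsto_sandwich[where f = "\<lambda>_. \<tau> \<omega>" and h = "\<lambda>n. \<tau> \<omega> + 1 / real (Suc n)"])
    show "(\<lambda>n. \<tau> \<omega> + 1 / real (Suc n)) \<longlonglongrightarrow> \<tau> \<omega>"
      using tendsto_add[OF tendsto_const LIMSEQ_inverse_real_of_nat, of "\<tau> \<omega>"] by (simp add: inverse_eq_divide)
  qed (use \<sigma>_bounds[OF that] in \<open>auto intro!: always_eventually simp del: of_nat_Suc\<close>)
  have W_right: "(W \<omega> \<longlongrightarrow> W \<omega> t) (at_right t)" if "\<omega> \<in> index_paths" "0 \<le> t" for \<omega> t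
    by (rule cost_plus_value_right[OF H coupling sub control that])
  have W_meas: "0 \<le> t \<Longrightarrow> (\<lambda>\<omega>. W \<omega> t) \<in> borel_measurable index_path_space" for t
    by (rule cost_plus_value_measurable[OF H coupling sub control])
  show W\<tau>_meas: "(\<lambda>\<omega>. W \<omega> (\<tau> \<omega>)) \<in> borel_measurable index_path_space"
    by (rule measurable_at_random_time[OF W_meas _ \<tau>_meas]) (auto intro: W_right \<tau>_nonneg)
  have \<sigma>_meas: "\<sigma> n \<in> borel_measurable index_path_space" for n
    unfolding \<sigma>_def using \<tau>_meas by measurable
  have W\<sigma>_meas: "(\<lambda>\<omega>. W \<omega> (\<sigma> n \<omega>)) \<in> borel_measurable index_path_space" for n
    by (rule measurable_at_random_time[OF W_meas _ \<sigma>_meas]) (auto intro: W_right simp: \<sigma>_def)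
  \<comment> \<open>Rounding exceeds \<tau> by at most one grid step, and a grid step is at most 1:
    hence the horizon K + 1.\<close>
  obtain B where B: "AE \<omega> in axis_law \<Lambda> i. \<forall>t\<in>{0..K + 1}. \<bar>W \<omega> t\<bar> \<le> B"
    using cost_plus_value_bounded[OF H coupling sub control, of "K + 1" y i] by blast
  have \<sigma>K: "\<sigma> n \<omega> \<in> {0..K + 1}" if "\<omega> \<in> index_paths" for n \<omega>
  proof -
    have "\<sigma> n \<omega> \<le> \<tau> \<omega> + 1" by (rule order_trans[OF \<sigma>_bounds(2)[OF that]]) simp
    also have "\<dots> \<le> K + 1" using K(2)[OF that] by simp
    finally show ?thesis using order_trans[OF \<tau>_nonneg[OF that] \<sigma>_bounds(1)[OF that]] by simp
  qed
  have DCT: "(\<lambda>n. \<integral>\<omega>. W \<omega> (\<sigma> n \<omega>) \<partial>(axis_law \<Lambda> i)) \<longlonglongrightarrow> (\<integral>\<omega>. W \<omega> (\<tau> \<omega>) \<partial>(axis_law \<Lambda> i))"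
  proof (rule integral_dominated_convergence[where w = "\<lambda>_. B"])
    show "AE \<omega> in axis_law \<Lambda> i. (\<lambda>n. W \<omega> (\<sigma> n \<omega>)) \<longlonglongrightarrow> W \<omega> (\<tau> \<omega>)"
    proof (rule AE_I2)
      fix \<omega> assume "\<omega> \<in> space (axis_law \<Lambda> i)"
      then have \<omega>: "\<omega> \<in> index_paths" by (simp add: space_axis_law[OF coupling])
      show "(\<lambda>n. W \<omega> (\<sigma> n \<omega>)) \<longlonglongrightarrow> W \<omega> (\<tau> \<omega>)"
        by (rule tendsto_from_right[OF W_right[OF \<omega> \<tau>_nonneg[OF \<omega>]] \<sigma>_bounds(1)[OF \<omega>] \<sigma>_lim[OF \<omega>]])
    qed
    show "AE \<omega> in axis_law \<Lambda> i. norm (W \<omega> (\<sigma> n \<omega>)) \<le> B" for n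
      using B AE_space by eventually_elim (use \<sigma>K in \<open>auto simp: space_axis_law[OF coupling]\<close>)
  qed (use W\<tau>_meas W\<sigma>_meas in \<open>auto simp: measurable_cong_sets[OF sets_axis_law[OF coupling, of i] refl]\<close>)
  have grid: "u y $ i - \<epsilon> * (K + 1) \<le> (\<integral>\<omega>. W \<omega> (\<sigma> n \<omega>) \<partial>(axis_law \<Lambda> i))"
    if step: "\<And>h t A. 0 < h \<Longrightarrow> h \<le> h0 \<Longrightarrow> 0 \<le> t \<Longrightarrow> t + h \<le> K + 1 \<Longrightarrow> A \<in> sets (index_filtration t) \<Longrightarrow>
      - (\<epsilon> * h) \<le> (\<integral>\<omega>. indicator A \<omega> * (W \<omega> (t + h) - W \<omega> t) \<partial>(axis_law \<Lambda> i))"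
      and n: "1 / real (Suc n) \<le> h0" and \<epsilon>: "0 < \<epsilon>" for \<epsilon> h0 n
  proof -
    define h where "h = 1 / real (Suc n)"
    have h: "0 < h" "h \<le> 1" by (auto simp: h_def)
    define N where "N = nat \<lceil>K * real (Suc n)\<rceil>"
    have N: "real N * h \<le> K + 1"
    proof -
      have "0 \<le> K * real (Suc n)" using K(1) by simp
      then have "real N \<le> K * real (Suc n) + 1" unfolding N_def by linarith
      then have "real N * h \<le> (K * real (Suc n) + 1) * h" using h by (intro mult_right_mono) auto
      also have "\<dots> = K + h" by (simp add: h_def field_simps del: of_nat_Suc)
      finally show ?thesis using h by simp
    qed
    \<comment> \<open>The k-th increment counts exactly when \<tau> exceeds k h, an event known at
      time k h because its complement is \<tau> \<le> k h.\<close>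
    define A where "A k = {\<omega> \<in> index_paths. real k * h < \<tau> \<omega>}" for k :: nat
    have A: "A k \<in> sets (index_filtration (real k * h))" for k
    proof -
      have "A k = space (index_filtration (real k * h)) - {\<omega> \<in> space (index_filtration (real k * h)). \<tau> \<omega> \<le> real k * h}"
        by (auto simp: A_def)
      also have "\<dots> \<in> sets (index_filtration (real k * h))"
        using \<tau>_stop[of "real k * h"] by (intro sets.Diff sets.top) (auto simp: pred_def)
      finally show ?thesis .
    qed
    have A': "A k \<in> sets index_path_space" for k using A sets_index_filtration_subset by blast
    let ?D = "\<lambda>k \<omega>. indicator (A k) \<omega> * (W \<omega> (real k * h + h) - W \<omega> (real k * h))"
    have int_D: "integrable (axis_law \<Lambda> i) (?D k)" for k
      using Bochner_Integration.integrable_diff[OF W_integrable[OF A', of "real k * h + h" k] W_integrable[OF A', of "real k * h" k]] h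
      by (simp add: right_diff_distrib)
    have telescope: "W \<omega> (\<sigma> n \<omega>) = W \<omega> 0 + (\<Sum>k<N. ?D k \<omega>)" if \<omega>: "\<omega> \<in> index_paths" for \<omega>
    proof -
      define m where "m = nat \<lceil>\<tau> \<omega> * real (Suc n)\<rceil>"
      have "\<tau> \<omega> * real (Suc n) \<le> K * real (Suc n)" using K(2)[OF \<omega>] by (intro mult_right_mono) auto
      then have mN: "m \<le> N" unfolding m_def N_def by (intro nat_mono ceiling_mono)
      have mem: "\<omega> \<in> A k \<longleftrightarrow> k < m" for k
      proof -
        have "\<omega> \<in> A k \<longleftrightarrow> real k < \<tau> \<omega> * real (Suc n)"
          using \<omega> by (simp add: A_def h_def pos_divide_less_eq del: of_nat_Suc)
        also have "\<dots> \<longleftrightarrow> k < m" unfolding m_def by linarith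
        finally show ?thesis .
      qed
      have "(\<Sum>k<N. ?D k \<omega>) = (\<Sum>k<m. ?D k \<omega>)"
        by (rule sum.mono_neutral_right) (use mN mem in auto)
      also have "\<dots> = (\<Sum>k<m. W \<omega> (real (Suc k) * h) - W \<omega> (real k * h))"
        by (rule sum.cong) (use mem in \<open>auto simp: distrib_right add.commute\<close>)
      also have "\<dots> = W \<omega> (real m * h) - W \<omega> (real 0 * h)" by (rule sum_lessThan_telescope)
      also have "real m * h = \<sigma> n \<omega>" by (simp add: \<sigma>_def m_def h_def)
      finally show ?thesis by simp
    qed
    have iW0: "integrable (axis_law \<Lambda> i) (\<lambda>\<omega>. W \<omega> 0)"
      using W_integrable[OF sets.top, of 0] by (rule Bochner_Integration.integrable_cong[THEN iffD1, rotated 2]) (auto simp: space_axis_law[OF coupling])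
    have "(\<integral>\<omega>. W \<omega> (\<sigma> n \<omega>) \<partial>(axis_law \<Lambda> i)) = (\<integral>\<omega>. W \<omega> 0 + (\<Sum>k<N. ?D k \<omega>) \<partial>(axis_law \<Lambda> i))"
      by (rule Bochner_Integration.integral_cong) (auto simp: space_axis_law[OF coupling] telescope)
    also have "\<dots> = (\<integral>\<omega>. W \<omega> 0 \<partial>(axis_law \<Lambda> i)) + (\<Sum>k<N. \<integral>\<omega>. ?D k \<omega> \<partial>(axis_law \<Lambda> i))"
      by (simp only: Bochner_Integration.integral_add[OF iW0 Bochner_Integration.integrable_sum[OF int_D]]
            Bochner_Integration.integral_sum[OF int_D])
    also have "\<dots> \<ge> u y $ i + (\<Sum>k<N. - (\<epsilon> * h))"
    proof (rule add_mono)
      show "(\<Sum>k<N. - (\<epsilon> * h)) \<le> (\<Sum>k<N. \<integral>\<omega>. ?D k \<omega> \<partial>(axis_law \<Lambda> i))"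
      proof (rule sum_mono)
        fix k assume "k \<in> {..<N}"
        then have "real (Suc k) * h \<le> real N * h" using h by (intro mult_right_mono) auto
        then have "real k * h + h \<le> K + 1" using N by (simp add: distrib_right add.commute)
        then show "- (\<epsilon> * h) \<le> (\<integral>\<omega>. ?D k \<omega> \<partial>(axis_law \<Lambda> i))"
          using h n by (intro step A) (auto simp: h_def)
      qed
    qed (simp add: W_initial)
    also have "u y $ i + (\<Sum>k<N. - (\<epsilon> * h)) = u y $ i - \<epsilon> * (real N * h)" by simp
    also have "u y $ i - \<epsilon> * (K + 1) \<le> \<dots>" using N \<epsilon> by simp
    finally show ?thesis by simp
  qed
  have "u y $ i - \<epsilon> * (K + 1) \<le> (\<integral>\<omega>. W \<omega> (\<tau> \<omega>) \<partial>(axis_law \<Lambda> i))" if \<epsilon>: "0 < \<epsilon>" for \<epsilon>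
  proof -
    obtain h0 where h0: "h0 > 0" "\<forall>h t A. 0 < h \<and> h \<le> h0 \<and> 0 \<le> t \<and> t + h \<le> K + 1 \<and> A \<in> sets (index_filtration t) \<longrightarrow>
      - (\<epsilon> * h) \<le> (\<integral>\<omega>. indicator A \<omega> * (W \<omega> (t + h) - W \<omega> t) \<partial>(axis_law \<Lambda> i))"
      using expected_step[OF \<epsilon>, of "K + 1"] by blast
    have "\<forall>\<^sub>F n in sequentially. 1 / real (Suc n) < h0"
      using order_tendstoD(2)[OF LIMSEQ_inverse_real_of_nat h0(1)] by (simp add: inverse_eq_divide)
    then have "\<forall>\<^sub>F n in sequentially. u y $ i - \<epsilon> * (K + 1) \<le> (\<integral>\<omega>. W \<omega> (\<sigma> n \<omega>) \<partial>(axis_law \<Lambda> i))"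
      by eventually_elim (rule grid[of h0], use h0(2) \<epsilon> in auto)
    then show ?thesis by (rule tendsto_lowerbound[OF DCT]) simp
  qed
  note * = this
  show "u y $ i \<le> (\<integral>\<omega>. W \<omega> (\<tau> \<omega>) \<partial>(axis_law \<Lambda> i))"
  proof (rule field_le_epsilon)
    fix e :: real assume "0 < e"
    then show "u y $ i \<le> (\<integral>\<omega>. W \<omega> (\<tau> \<omega>) \<partial>(axis_law \<Lambda> i)) + e" using *[of "e / (K + 1)"] K(1) by simp
  qed
qed

text \<open>At \<tau> the position is y up to a lattice vector, so by periodicity the stopped
  quantity is the accumulated cost plus the component of u(y) at the current index.\<close>

lemma subsolution_cycle_inequality:
  assumes \<tau>: "bounded_stopping_time \<tau>" and cycle: "tau_cycle \<Lambda> \<tau> \<Xi>"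
  shows "0 \<le> (\<integral>\<omega>. (LINT s:{0..\<tau> \<omega>}|lborel. running_cost H \<alpha> y (\<Xi> \<omega>) \<omega> s) - u y $ i + u y $ \<omega> (\<tau> \<omega>) \<partial>(axis_law \<Lambda> i))"
proof -
  interpret P: prob_space "axis_law \<Lambda> i" by (rule prob_space_axis_law[OF coupling])
  have \<tau>_meas: "\<tau> \<in> borel_measurable index_path_space" and \<tau>_nonneg: "\<And>\<omega>. \<omega> \<in> index_paths \<Longrightarrow> 0 \<le> \<tau> \<omega>"
    using \<tau> by (auto simp: bounded_stopping_time_def)
  obtain K where K: "\<And>\<omega>. \<omega> \<in> index_paths \<Longrightarrow> \<tau> \<omega> \<le> K"
    using \<tau> unfolding bounded_stopping_time_def by blast
  have "AE \<omega> in axis_law \<Lambda> i. displacement (\<Xi> \<omega>) (\<tau> \<omega>) \<in> int_lattice"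
    using cycle unfolding tau_cycle_def by (intro almost_surely_axis[OF coupling]) auto
  then have ae: "AE \<omega> in axis_law \<Lambda> i. W \<omega> (\<tau> \<omega>) - u y $ i =
     (LINT s:{0..\<tau> \<omega>}|lborel. running_cost H \<alpha> y (\<Xi> \<omega>) \<omega> s) - u y $ i + u y $ \<omega> (\<tau> \<omega>)"
    by eventually_elim
       (simp add: cost_plus_value_def[OF H coupling sub control] accumulated_cost_def[OF H control] u_periodic[OF H coupling sub])
  have m1: "(\<lambda>\<omega>. accumulated_cost H \<Xi> \<alpha> y \<omega> (\<tau> \<omega>)) \<in> borel_measurable index_path_space"
    by (rule measurable_at_random_time[OF accumulated_cost_measurable[OF H control] _ \<tau>_meas])
       (auto intro: accumulated_cost_right[OF H control] \<tau>_nonneg)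
  have m2: "(\<lambda>\<omega>. u y $ \<omega> (\<tau> \<omega>)) \<in> borel_measurable index_path_space"
  proof (rule measurable_at_random_time[OF _ _ \<tau>_meas])
    show "(\<lambda>\<omega>. u y $ \<omega> s) \<in> borel_measurable index_path_space" if "0 \<le> s" for s
      by (rule measurable_compose[OF measurable_index_eval[OF that]]) simp
    show "((\<lambda>s. u y $ \<omega> s) \<longlongrightarrow> u y $ \<omega> s) (at_right s)" if "\<omega> \<in> space index_path_space" "0 \<le> s" for \<omega> s
      by (rule tendsto_eventually) (use index_pathsD(1)[of \<omega> s] that in \<open>auto elim: eventually_mono\<close>)
  qed (auto intro: \<tau>_nonneg)
  note W\<tau> = stopped_expectation[OF \<tau>]
  obtain B where B: "AE \<omega> in axis_law \<Lambda> i. \<forall>t\<in>{0..K}. \<bar>W \<omega> t\<bar> \<le> B"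
    using cost_plus_value_bounded[OF H coupling sub control, of K y i] by blast
  have iW: "integrable (axis_law \<Lambda> i) (\<lambda>\<omega>. W \<omega> (\<tau> \<omega>))"
  proof (rule P.integrable_const_bound[of _ B])
    show "AE \<omega> in axis_law \<Lambda> i. norm (W \<omega> (\<tau> \<omega>)) \<le> B"
      using B AE_space by eventually_elim (use \<tau>_nonneg K in \<open>auto simp: space_axis_law[OF coupling]\<close>)
  qed (use W\<tau>(2) in \<open>simp add: measurable_cong_sets[OF sets_axis_law[OF coupling, of i] refl]\<close>)
  have "0 \<le> (\<integral>\<omega>. W \<omega> (\<tau> \<omega>) \<partial>(axis_law \<Lambda> i)) - u y $ i" using W\<tau>(1) by simp
  also have "\<dots> = (\<integral>\<omega>. W \<omega> (\<tau> \<omega>) - u y $ i \<partial>(axis_law \<Lambda> i))" using iW P.prob_space by simp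
  also have "\<dots> = (\<integral>\<omega>. (LINT s:{0..\<tau> \<omega>}|lborel. running_cost H \<alpha> y (\<Xi> \<omega>) \<omega> s) - u y $ i + u y $ \<omega> (\<tau> \<omega>) \<partial>(axis_law \<Lambda> i))"
    using W\<tau>(2) m1 m2 by (intro integral_cong_AE ae)
      (auto simp: measurable_cong_sets[OF sets_axis_law[OF coupling, of i] refl] accumulated_cost_def[OF H control])
  finally show ?thesis .
qed

end

subsection \<open>Finite feedback policies\<close>

text \<open>\<open>Move h q f\<close> moves with velocity \<open>q\<close> for a time \<open>h\<close> and then continues with the policy \<open>f j\<close>,
  \<open>j\<close> being the index at that moment.\<close>

datatype ('v, 'm) policy = Stop | Move real 'v "'m \<Rightarrow> ('v, 'm) policy"

text \<open>Every branch must end at y on the torus whatever indices are observed, so that a policy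
  from y is a cycle on each single path. Positive durations order the decision times.\<close>

primrec reaches :: "real^'n \<Rightarrow> (real^'n, 'm) policy \<Rightarrow> real^'n \<Rightarrow> bool" where
  "reaches y Stop x \<longleftrightarrow> x - y \<in> int_lattice"
| "reaches y (Move h q f) x \<longleftrightarrow> 0 < h \<and> (\<forall>j. reaches y (f j) (x + h *\<^sub>R q))"

primrec policy_end :: "('v, 'm) policy \<Rightarrow> real \<Rightarrow> (real \<Rightarrow> 'm) \<Rightarrow> real" where
  "policy_end Stop t \<omega> = t"
| "policy_end (Move h q f) t \<omega> = policy_end (f (\<omega> (t + h))) (t + h) \<omega>"

text \<open>A control has to be defined at all times, so the velocity after \<open>Stop\<close> is
  0.\<close>

primrec policy_velocity :: "('v::zero, 'm) policy \<Rightarrow> real \<Rightarrow> (real \<Rightarrow> 'm) \<Rightarrow> real \<Rightarrow> 'v" where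
  "policy_velocity Stop t \<omega> s = 0"
| "policy_velocity (Move h q f) t \<omega> s = (if s < t + h then q else policy_velocity (f (\<omega> (t + h))) (t + h) \<omega> s)"

definition leg_cost ::
  "('m \<Rightarrow> real^'n \<Rightarrow> real^'n \<Rightarrow> real) \<Rightarrow> real \<Rightarrow> real^'n \<Rightarrow> real^'n \<Rightarrow> real \<Rightarrow> (real \<Rightarrow> 'm) \<Rightarrow> real \<Rightarrow> real" where
  "leg_cost H \<alpha> q x t \<omega> s = lagrangian H (\<omega> s) (x + (s - t) *\<^sub>R q) (- q) + \<alpha>"

primrec path_cost ::
  "('m \<Rightarrow> real^'n \<Rightarrow> real^'n \<Rightarrow> real) \<Rightarrow> real \<Rightarrow> real^'m \<Rightarrow> (real^'n, 'm) policy \<Rightarrow> real \<Rightarrow> real^'n \<Rightarrow> (real \<Rightarrow> 'm) \<Rightarrow> real" where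
  "path_cost H \<alpha> b Stop t x \<omega> = b $ \<omega> t"
| "path_cost H \<alpha> b (Move h q f) t x \<omega> = (LINT s:{t..t + h}|lborel. leg_cost H \<alpha> q x t \<omega> s)
     + path_cost H \<alpha> b (f (\<omega> (t + h))) (t + h) (x + h *\<^sub>R q) \<omega>"

definition expected_leg_cost ::
  "('m::finite \<Rightarrow> real^'n \<Rightarrow> real^'n \<Rightarrow> real) \<Rightarrow> real^'m^'m \<Rightarrow> real \<Rightarrow> real \<Rightarrow> real^'n \<Rightarrow> 'm \<Rightarrow> real^'n \<Rightarrow> real" where
  "expected_leg_cost H \<Lambda> \<alpha> h q i x =
     integral {0..h} (\<lambda>s. \<Sum>j\<in>UNIV. transition \<Lambda> s i j * (lagrangian H j (x + s *\<^sub>R q) (- q) + \<alpha>))"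

text \<open>Defined through transition probabilities alone, so that dynamic programming is a plain
  recursion; \<open>path_cost_expectation\<close> identifies it with an expectation.\<close>

primrec policy_cost ::
  "('m::finite \<Rightarrow> real^'n \<Rightarrow> real^'n \<Rightarrow> real) \<Rightarrow> real^'m^'m \<Rightarrow> real \<Rightarrow> real^'m \<Rightarrow> (real^'n, 'm) policy \<Rightarrow> 'm \<Rightarrow> real^'n \<Rightarrow> real" where
  "policy_cost H \<Lambda> \<alpha> b Stop i x = b $ i"
| "policy_cost H \<Lambda> \<alpha> b (Move h q f) i x = expected_leg_cost H \<Lambda> \<alpha> h q i x
     + (\<Sum>j\<in>UNIV. transition \<Lambda> h i j * policy_cost H \<Lambda> \<alpha> b (f j) j (x + h *\<^sub>R q))"

lemma policy_end_ge: "reaches y p x \<Longrightarrow> t \<le> policy_end p t \<omega>"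
proof (induction p arbitrary: t x)
  case (Move h q f)
  then have "t + h \<le> policy_end (f (\<omega> (t + h))) (t + h) \<omega>" by (intro Move.IH) auto
  then show ?case using Move.prems by simp
qed simp

lemma policy_end_bounded: "\<exists>K. \<forall>t \<omega>. policy_end (p :: ('v, 'm::finite) policy) t \<omega> \<le> t + K"
proof (induction p)
  case Stop
  then show ?case by (intro exI[of _ 0]) simp
next
  case (Move h q f)
  then have "\<exists>K. \<forall>t \<omega>. policy_end (f j) t \<omega> \<le> t + K" for j by auto
  then obtain K where K: "\<And>j t \<omega>. policy_end (f j) t \<omega> \<le> t + K j" by metis
  show ?case
  proof (intro exI[of _ "h + (\<Sum>j\<in>UNIV. \<bar>K j\<bar>)"] allI)
    fix t \<omega>
    have "\<bar>K (\<omega> (t + h))\<bar> \<le> (\<Sum>j\<in>UNIV. \<bar>K j\<bar>)" by (rule member_le_sum) auto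
    then show "policy_end (Move h q f) t \<omega> \<le> t + (h + (\<Sum>j\<in>UNIV. \<bar>K j\<bar>))"
      using K[of "\<omega> (t + h)" "t + h" \<omega>] by simp
  qed
qed

lemma policy_velocity_bounded:
  "\<exists>B. \<forall>t \<omega> s. norm (policy_velocity (p :: ('v::real_normed_vector, 'm::finite) policy) t \<omega> s) \<le> B"
proof (induction p)
  case Stop
  then show ?case by (intro exI[of _ 0]) simp
next
  case (Move h q f)
  then have "\<exists>B. \<forall>t \<omega> s. norm (policy_velocity (f j) t \<omega> s) \<le> B" for j by auto
  then obtain B where B: "\<And>j t \<omega> s. norm (policy_velocity (f j) t \<omega> s) \<le> B j" by metis
  have B0: "0 \<le> B j" for j using order_trans[OF norm_ge_zero B] .
  show ?case
  proof (intro exI[of _ "norm q + (\<Sum>j\<in>UNIV. B j)"] allI)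
    fix t \<omega> s
    have "B (\<omega> (t + h)) \<le> (\<Sum>j\<in>UNIV. B j)" by (rule member_le_sum) (auto simp: B0)
    then show "norm (policy_velocity (Move h q f) t \<omega> s) \<le> norm q + (\<Sum>j\<in>UNIV. B j)"
      using B[of "\<omega> (t + h)" "t + h" \<omega> s] norm_ge_zero[of q] sum_nonneg[of UNIV B] B0
      by (auto intro: order_trans add_increasing)
  qed
qed

lemma policy_velocity_right: "\<forall>\<^sub>F r in at_right s. policy_velocity p t \<omega> r = policy_velocity p t \<omega> s"
proof (induction p arbitrary: t)
  case (Move h q f)
  show ?case
  proof (cases "s < t + h")
    case True
    then have "\<forall>\<^sub>F r in at_right s. r < t + h" unfolding eventually_at_right_field by blast
    then show ?thesis by eventually_elim (use True in simp)
  next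
    case False
    have "\<forall>\<^sub>F r in at_right s. policy_velocity (f (\<omega> (t + h))) (t + h) \<omega> r = policy_velocity (f (\<omega> (t + h))) (t + h) \<omega> s"
      by (rule Move.IH) simp
    then show ?thesis using eventually_at_right_less[of s] by eventually_elim (use False in simp)
  qed
qed simp

lemma policy_velocity_left: "\<exists>l. \<forall>\<^sub>F r in at_left s. policy_velocity p t \<omega> r = l"
proof (induction p arbitrary: t)
  case (Move h q f)
  show ?case
  proof (cases "s \<le> t + h")
    case True
    have "\<forall>\<^sub>F r in at_left s. r < s" by (simp add: eventually_at_filter)
    then have "\<forall>\<^sub>F r in at_left s. policy_velocity (Move h q f) t \<omega> r = q"
      by eventually_elim (use True in simp)
    then show ?thesis by blast
  next
    case False
    then have ev: "\<forall>\<^sub>F r in at_left s. t + h < r" unfolding eventually_at_left_field by (intro exI[of _ "t + h"]) auto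
    obtain l where "\<forall>\<^sub>F r in at_left s. policy_velocity (f (\<omega> (t + h))) (t + h) \<omega> r = l"
      using Move.IH[of "f (\<omega> (t + h))" "t + h"] by auto
    with ev have "\<forall>\<^sub>F r in at_left s. policy_velocity (Move h q f) t \<omega> r = l"
      by eventually_elim simp
    then show ?thesis by blast
  qed
qed auto

text \<open>The velocity at time s depends on decisions taken by time s, which read the index at
  times at most s: policies are nonanticipating.\<close>

lemma policy_velocity_past:
  assumes "reaches y p x" "0 \<le> t" "\<And>r. 0 \<le> r \<Longrightarrow> r \<le> T \<Longrightarrow> \<omega>1 r = \<omega>2 r" "s \<le> T"
  shows "policy_velocity p t \<omega>1 s = policy_velocity p t \<omega>2 s"
  using assms
proof (induction p arbitrary: t x)
  case (Move h q f)
  show ?case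
  proof (cases "s < t + h")
    case False
    then have "\<omega>1 (t + h) = \<omega>2 (t + h)" using Move.prems by (intro Move.prems(3)) auto
    moreover have "policy_velocity (f (\<omega>2 (t + h))) (t + h) \<omega>1 s = policy_velocity (f (\<omega>2 (t + h))) (t + h) \<omega>2 s"
      using Move.prems by (intro Move.IH[of _ "x + h *\<^sub>R q"]) auto
    ultimately show ?thesis using False by simp
  qed simp
qed simp

lemma policy_velocity_measurable:
  fixes p :: "(real^'n, 'm::finite) policy"
  assumes "reaches y p x" "0 \<le> t"
  shows "(\<lambda>\<omega>. policy_velocity p t \<omega> s) \<in> borel_measurable index_path_space"
  using assms
proof (induction p arbitrary: t x)
  case (Move h q f)
  show ?case
  proof (cases "s < t + h")
    case False
    have "(\<lambda>\<omega>. policy_velocity (f j) (t + h) \<omega> s) \<in> borel_measurable index_path_space" for j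
      using Move.prems by (intro Move.IH[of _ "x + h *\<^sub>R q"]) auto
    then have "(\<lambda>\<omega>. policy_velocity (f (\<omega> (t + h))) (t + h) \<omega> s) \<in> borel_measurable index_path_space"
      by (rule measurable_compose_countable) (use Move.prems in \<open>auto intro: measurable_index_eval\<close>)
    then show ?thesis using False by simp
  qed simp
qed simp

text \<open>If the first leg ends after s, the event is empty; otherwise the index read at its end
  is known at s, and the remaining policy is treated for each index.\<close>

lemma policy_end_stopping:
  fixes p :: "(real^'n, 'm::finite) policy"
  assumes "reaches y p x" "0 \<le> t"
  shows "Measurable.pred (index_filtration s) (\<lambda>\<omega>. policy_end p t \<omega> \<le> s)"
  using assms
proof (induction p arbitrary: t x)
  case (Move h q f)
  show ?case
  proof (cases "s < t + h")
    case True
    have "t + h \<le> policy_end (f (\<omega> (t + h))) (t + h) \<omega>" for \<omega>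
      using Move.prems by (intro policy_end_ge[of y _ "x + h *\<^sub>R q"]) auto
    then have "\<not> policy_end (Move h q f) t \<omega> \<le> s" for \<omega>
      using True by (simp add: not_le) (meson less_le_trans)
    then show ?thesis by simp
  next
    case False
    have "Measurable.pred (index_filtration s) (\<lambda>\<omega>. policy_end (f j) (t + h) \<omega> \<le> s)" for j
      using Move.prems by (intro Move.IH[of _ "x + h *\<^sub>R q"]) auto
    then have "Measurable.pred (index_filtration s) (\<lambda>\<omega>. policy_end (f (\<omega> (t + h))) (t + h) \<omega> \<le> s)"
      by (rule measurable_compose_countable[where f = "\<lambda>j \<omega>. policy_end (f j) (t + h) \<omega> \<le> s" and g = "\<lambda>\<omega>. \<omega> (t + h)"])
         (rule measurable_index_eval_filtration, use Move.prems False in auto)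
    then show ?thesis by simp
  qed
qed simp

lemma policy_end_measurable:
  fixes p :: "(real^'n, 'm::finite) policy"
  assumes "reaches y p x" "0 \<le> t"
  shows "policy_end p t \<in> borel_measurable index_path_space"
  using assms
proof (induction p arbitrary: t x)
  case (Move h q f)
  have "policy_end (f j) (t + h) \<in> borel_measurable index_path_space" for j
    using Move.prems by (intro Move.IH[of _ "x + h *\<^sub>R q"]) auto
  then have "(\<lambda>\<omega>. policy_end (f (\<omega> (t + h))) (t + h) \<omega>) \<in> borel_measurable index_path_space"
    by (rule measurable_compose_countable[where f = "\<lambda>j \<omega>. policy_end (f j) (t + h) \<omega>" and g = "\<lambda>\<omega>. \<omega> (t + h)"])
       (rule measurable_index_eval, use Move.prems in auto)
  then show ?case by simp
next
  case Stop
  have "policy_end Stop t = (\<lambda>\<omega>. t)" by (simp add: fun_eq_iff)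
  then show ?case by simp
qed

lemma policy_bounded_stopping_time:
  fixes p :: "(real^'n, 'm::finite) policy"
  assumes "reaches y p x"
  shows "bounded_stopping_time (policy_end p 0)"
proof -
  obtain K where K: "\<And>t \<omega>. policy_end p t \<omega> \<le> t + K" using policy_end_bounded[of p] by blast
  show ?thesis
    unfolding bounded_stopping_time_def stopping_time_def
    using policy_end_measurable[OF assms, of 0] policy_end_ge[OF assms, of 0] policy_end_stopping[OF assms, of 0]
      K[of 0] by auto
qed

definition policy_control :: "(real^'n, 'm) policy \<Rightarrow> (real \<Rightarrow> 'm) \<Rightarrow> real \<Rightarrow> real^'n" where
  "policy_control p \<omega> = restrict (policy_velocity p 0 \<omega>) {0..}"

lemma policy_control_cadlag: "policy_control p \<omega> \<in> cadlag_paths euclidean"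
proof -
  have "(policy_control p \<omega> \<longlongrightarrow> policy_control p \<omega> t) (at_right t)" if "0 \<le> t" for t
  proof (rule tendsto_eventually)
    show "\<forall>\<^sub>F r in at_right t. policy_control p \<omega> r = policy_control p \<omega> t"
      using policy_velocity_right[of p 0 \<omega> t] eventually_at_right_less[of t]
      by eventually_elim (use that in \<open>simp add: policy_control_def\<close>)
  qed
  moreover have "\<exists>l. (policy_control p \<omega> \<longlongrightarrow> l) (at_left t)" if "0 < t" for t
  proof -
    obtain l where l: "\<forall>\<^sub>F r in at_left t. policy_velocity p 0 \<omega> r = l" using policy_velocity_left[of p 0 \<omega> t] by blast
    have "\<forall>\<^sub>F r in at_left t. 0 < r"
      unfolding eventually_at_left_field using that by (intro exI[of _ 0]) auto
    with l have "\<forall>\<^sub>F r in at_left t. policy_control p \<omega> r = l"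
      by eventually_elim (simp add: policy_control_def)
    then show ?thesis using tendsto_eventually by blast
  qed
  ultimately show ?thesis by (simp add: cadlag_paths_def policy_control_def)
qed

lemma control_policy_control:
  fixes p :: "(real^'n, 'm::finite) policy" and \<Lambda> :: "real^'m^'m"
  assumes coupling: "coupling_matrix \<Lambda>" and p: "reaches y p x"
  shows "control \<Lambda> (policy_control p)"
  unfolding control_def
proof (intro conjI allI impI ballI)
  show "policy_control p \<in> index_path_space \<rightarrow>\<^sub>M velocity_path_space"
    unfolding velocity_path_space_def
  proof (rule measurable_into_evaluation_algebra)
    fix s :: real assume "s \<in> {0..}"
    then show "(\<lambda>\<omega>. policy_control p \<omega> s) \<in> borel_measurable index_path_space"
      using policy_velocity_measurable[OF p, of 0 s] by (simp add: policy_control_def)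
  qed (rule policy_control_cadlag)
next
  fix t :: real assume t: "0 < t"
  obtain B where B: "\<And>t \<omega> s. norm (policy_velocity p t \<omega> s) \<le> B" using policy_velocity_bounded[of p] by blast
  show "\<exists>R>0. almost_surely \<Lambda> (\<lambda>\<omega>. (SUP s\<in>{0..t}. norm (policy_control p \<omega> s)) < R)"
  proof (intro exI[of _ "\<bar>B\<bar> + 1"] conjI almost_surelyI[OF coupling])
    fix \<omega> :: "real \<Rightarrow> 'm"
    have "(SUP s\<in>{0..t}. norm (policy_control p \<omega> s)) \<le> \<bar>B\<bar>"
      using t by (intro cSUP_least) (auto simp: policy_control_def intro: order_trans[OF B abs_ge_self])
    then show "(SUP s\<in>{0..t}. norm (policy_control p \<omega> s)) < \<bar>B\<bar> + 1" by simp
  qed simp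
next
  fix t :: real and \<omega>1 \<omega>2 :: "real \<Rightarrow> 'm" and s
  assume "0 < t" "\<forall>s\<in>{0..t}. \<omega>1 s = \<omega>2 s" "s \<in> {0..t}"
  then show "policy_control p \<omega>1 s = policy_control p \<omega>2 s"
    using policy_velocity_past[OF p, of 0 t \<omega>1 \<omega>2 s] by (simp add: policy_control_def)
qed

section \<open>Costs of a policy along a path\<close>

context
  fixes H :: "'m::finite \<Rightarrow> real^'n \<Rightarrow> real^'n \<Rightarrow> real"
  assumes H: "hamiltonians H"
begin

lemma leg_cost_right:
  assumes \<omega>: "\<omega> \<in> index_paths" and s: "0 \<le> s"
  shows "(leg_cost H \<alpha> q x t \<omega> \<longlongrightarrow> leg_cost H \<alpha> q x t \<omega> s) (at_right s)"
proof -
  have "((\<lambda>r. lagrangian H (\<omega> s) (x + (r - t) *\<^sub>R q) (- q) + \<alpha>) \<longlongrightarrow> leg_cost H \<alpha> q x t \<omega> s) (at_right s)"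
    unfolding leg_cost_def by (intro tendsto_intros lagrangian_tendsto[OF H])
  moreover have "\<forall>\<^sub>F r in at_right s. lagrangian H (\<omega> s) (x + (r - t) *\<^sub>R q) (- q) + \<alpha> = leg_cost H \<alpha> q x t \<omega> r"
    using index_pathsD(1)[OF \<omega> s] by eventually_elim (simp add: leg_cost_def)
  ultimately show ?thesis by (rule Lim_transform_eventually)
qed

lemma leg_cost_bounded: "\<exists>B>0. \<forall>x t \<omega> s. \<bar>leg_cost H \<alpha> q x t \<omega> s\<bar> \<le> B"
proof -
  obtain B where B: "B > 0" "\<And>i x p. norm p \<le> norm q \<Longrightarrow> \<bar>lagrangian H i x p\<bar> \<le> B"
    using lagrangian_bounded[OF H, of "norm q"] by blast
  have "\<bar>leg_cost H \<alpha> q x t \<omega> s\<bar> \<le> B + \<bar>\<alpha>\<bar>" for x t \<omega> s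
    using B(2)[of "- q" "\<omega> s" "x + (s - t) *\<^sub>R q"] by (simp add: leg_cost_def)
  then show ?thesis using B(1) by (intro exI[of _ "B + \<bar>\<alpha>\<bar>"]) auto
qed

lemma leg_cost_set_integrable:
  assumes "\<omega> \<in> index_paths" "0 \<le> a"
  shows "set_integrable lborel {a..c} (leg_cost H \<alpha> q x t \<omega>)"
proof -
  obtain B where "\<forall>x t \<omega> s. \<bar>leg_cost H \<alpha> q x t \<omega> s\<bar> \<le> B" using leg_cost_bounded by blast
  then show ?thesis
    by (intro set_integrable_right_continuous[where B = B] leg_cost_right assms) auto
qed

lemma leg_cost_joint_measurable:
  "(\<lambda>p. leg_cost H \<alpha> q x t (fst p) (max 0 (snd p))) \<in> borel_measurable (index_path_space \<Otimes>\<^sub>M borel)"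
proof (rule joint_measurable_right_continuous)
  show "(\<lambda>\<omega>. leg_cost H \<alpha> q x t \<omega> s) \<in> borel_measurable index_path_space" if "0 \<le> s" for s
    unfolding leg_cost_def by (rule measurable_compose[OF measurable_index_eval[OF that]]) simp
qed (auto intro: leg_cost_right)

lemma leg_cost_integral_measurable:
  "0 \<le> a \<Longrightarrow> (\<lambda>\<omega>. LINT s:{a..c}|lborel. leg_cost H \<alpha> q x t \<omega> s) \<in> borel_measurable index_path_space"
  by (rule measurable_set_lebesgue_integral_param[OF leg_cost_joint_measurable])

lemma leg_cost_integral_bounded:
  "\<exists>B. \<forall>x t. \<forall>\<omega>\<in>index_paths. 0 \<le> t \<longrightarrow> \<bar>LINT s:{t..t + h}|lborel. leg_cost H \<alpha> q x t \<omega> s\<bar> \<le> B"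
proof -
  obtain B where B: "B > 0" "\<And>x t \<omega> s. \<bar>leg_cost H \<alpha> q x t \<omega> s\<bar> \<le> B" using leg_cost_bounded by blast
  have "\<bar>LINT s:{t..t + h}|lborel. leg_cost H \<alpha> q x t \<omega> s\<bar> \<le> B * \<bar>h\<bar>" if "\<omega> \<in> index_paths" "0 \<le> t" for x t \<omega>
  proof -
    note i = set_borel_integral_eq_integral[OF leg_cost_set_integrable[OF that, of "t + h" \<alpha> q x t]]
    have "norm (integral (cbox t (t + h)) (leg_cost H \<alpha> q x t \<omega>)) \<le> B * measure lborel (cbox t (t + h))"
      using i(1) B by (intro integrable_bound) (auto simp: less_imp_le)
    also have "\<dots> \<le> B * \<bar>h\<bar>" using B(1) by (intro mult_left_mono) auto
    finally show ?thesis using i(2) by simp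
  qed
  then show ?thesis by blast
qed

lemma path_cost_measurable:
  assumes "reaches y p x" "0 \<le> t"
  shows "path_cost H \<alpha> b p t x \<in> borel_measurable index_path_space"
  using assms
proof (induction p arbitrary: t x)
  case Stop
  have "(\<lambda>\<omega>. b $ \<omega> t) \<in> borel_measurable index_path_space"
    by (rule measurable_compose[OF measurable_index_eval[OF Stop(2)]]) simp
  then show ?case by (simp cong: measurable_cong)
next
  case (Move h q f)
  have "path_cost H \<alpha> b (f j) (t + h) (x + h *\<^sub>R q) \<in> borel_measurable index_path_space" for j
    using Move.prems by (intro Move.IH) auto
  then have 1: "(\<lambda>\<omega>. path_cost H \<alpha> b (f (\<omega> (t + h))) (t + h) (x + h *\<^sub>R q) \<omega>) \<in> borel_measurable index_path_space"
    by (rule measurable_compose_countable[where f = "\<lambda>j \<omega>. path_cost H \<alpha> b (f j) (t + h) (x + h *\<^sub>R q) \<omega>" and g = "\<lambda>\<omega>. \<omega> (t + h)"])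
       (rule measurable_index_eval, use Move.prems in auto)
  have "(\<lambda>\<omega>. path_cost H \<alpha> b (Move h q f) t x \<omega>) \<in> borel_measurable index_path_space"
    unfolding path_cost.simps by (rule borel_measurable_add[OF leg_cost_integral_measurable[OF Move.prems(2)] 1])
  then show ?case .
qed

lemma path_cost_bounded:
  assumes "reaches y p x" "0 \<le> t"
  shows "\<exists>B. \<forall>\<omega>\<in>index_paths. \<bar>path_cost H \<alpha> b p t x \<omega>\<bar> \<le> B"
  using assms
proof (induction p arbitrary: t x)
  case Stop
  show ?case
    by (intro exI[of _ "\<Sum>j\<in>UNIV. \<bar>b $ j\<bar>"] ballI) (auto intro: member_le_sum)
next
  case (Move h q f)
  have "\<exists>B. \<forall>\<omega>\<in>index_paths. \<bar>path_cost H \<alpha> b (f j) (t + h) (x + h *\<^sub>R q) \<omega>\<bar> \<le> B" for j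
    using Move.prems by (intro Move.IH) auto
  then obtain B where B: "\<And>j \<omega>. \<omega> \<in> index_paths \<Longrightarrow> \<bar>path_cost H \<alpha> b (f j) (t + h) (x + h *\<^sub>R q) \<omega>\<bar> \<le> B j" by metis
  obtain B' where B': "\<And>\<omega>. \<omega> \<in> index_paths \<Longrightarrow> \<bar>LINT s:{t..t + h}|lborel. leg_cost H \<alpha> q x t \<omega> s\<bar> \<le> B'"
    using leg_cost_integral_bounded[of h \<alpha> q] Move.prems(2) by blast
  show ?case
  proof (intro exI[of _ "B' + (\<Sum>j\<in>UNIV. \<bar>B j\<bar>)"] ballI)
    fix \<omega> :: "real \<Rightarrow> 'm" assume \<omega>: "\<omega> \<in> index_paths"
    have "\<bar>B (\<omega> (t + h))\<bar> \<le> (\<Sum>j\<in>UNIV. \<bar>B j\<bar>)" by (rule member_le_sum) auto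
    then show "\<bar>path_cost H \<alpha> b (Move h q f) t x \<omega>\<bar> \<le> B' + (\<Sum>j\<in>UNIV. \<bar>B j\<bar>)"
      using B[OF \<omega>, of "\<omega> (t + h)"] B'[OF \<omega>] unfolding path_cost.simps by linarith
  qed
qed

text \<open>The velocity is prescribed from t on only: the same \<xi> then serves the remaining legs
  of the induction, its earlier part being absorbed into the current point x.\<close>

lemma policy_realisation:
  assumes "reaches y p x" "0 \<le> t" and \<omega>: "\<omega> \<in> index_paths" and \<xi>: "\<xi> \<in> cadlag_paths euclidean"
    and "\<And>s. t \<le> s \<Longrightarrow> \<xi> s = policy_velocity p t \<omega> s" "x = x0 + displacement \<xi> t"
  shows "integral {t..policy_end p t \<omega>} (running_cost H \<alpha> x0 \<xi> \<omega>) + b $ \<omega> (policy_end p t \<omega>) = path_cost H \<alpha> b p t x \<omega>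
    \<and> x0 + displacement \<xi> (policy_end p t \<omega>) - y \<in> int_lattice"
  using assms(1,2,5,6)
proof (induction p arbitrary: t x)
  case (Move h q f)
  let ?p = "f (\<omega> (t + h))"
  have h: "0 < h" and r: "reaches y ?p (x + h *\<^sub>R q)" using Move.prems by auto
  have \<xi>q: "\<xi> s = q" if "t \<le> s" "s < t + h" for s using Move.prems(3)[of s] that by simp
  have pos: "displacement \<xi> s = displacement \<xi> t + (s - t) *\<^sub>R q" if "t \<le> s" "s \<le> t + h" for s
  proof -
    have "integral {t..s} \<xi> = integral {t..s} (\<lambda>_. q)"
      by (rule integral_spike[of "{s}"]) (use \<xi>q that in auto)
    then show ?thesis using displacement_split[OF \<xi> Move.prems(2) that(1)] that by simp
  qed
  have IH: "integral {t + h..policy_end ?p (t + h) \<omega>} (running_cost H \<alpha> x0 \<xi> \<omega>) + b $ \<omega> (policy_end ?p (t + h) \<omega>)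
      = path_cost H \<alpha> b ?p (t + h) (x + h *\<^sub>R q) \<omega>
    \<and> x0 + displacement \<xi> (policy_end ?p (t + h) \<omega>) - y \<in> int_lattice"
  proof (rule Move.IH[OF _ r])
    show "\<xi> s = policy_velocity ?p (t + h) \<omega> s" if "t + h \<le> s" for s
      using Move.prems(3)[of s] that h by simp
    show "x + h *\<^sub>R q = x0 + displacement \<xi> (t + h)" using pos[of "t + h"] h Move.prems(4) by simp
  qed (use Move.prems h in auto)
  have le: "t + h \<le> policy_end ?p (t + h) \<omega>" by (rule policy_end_ge[OF r])
  have int: "running_cost H \<alpha> x0 \<xi> \<omega> integrable_on {t..policy_end ?p (t + h) \<omega>}"
    by (rule set_borel_integral_eq_integral(1)[OF running_cost_set_integrable[OF H \<omega> \<xi> Move.prems(2)]])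
  have "integral {t..policy_end ?p (t + h) \<omega>} (running_cost H \<alpha> x0 \<xi> \<omega>) =
     integral {t..t + h} (running_cost H \<alpha> x0 \<xi> \<omega>) + integral {t + h..policy_end ?p (t + h) \<omega>} (running_cost H \<alpha> x0 \<xi> \<omega>)"
    using Henstock_Kurzweil_Integration.integral_combine[OF _ le int] h by simp
  also have "integral {t..t + h} (running_cost H \<alpha> x0 \<xi> \<omega>) = integral {t..t + h} (leg_cost H \<alpha> q x t \<omega>)"
  \<comment> \<open>At the right end of the leg the velocity already belongs to what follows; one
    time is negligible.\<close>
  proof (rule integral_spike[of "{t + h}"])
    fix s assume "s \<in> {t..t + h} - {t + h}"
    then show "leg_cost H \<alpha> q x t \<omega> s = running_cost H \<alpha> x0 \<xi> \<omega> s"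
      using \<xi>q[of s] pos[of s] Move.prems(4) by (simp add: leg_cost_def running_cost_def add.assoc)
  qed simp
  also have "\<dots> = (LINT s:{t..t + h}|lborel. leg_cost H \<alpha> q x t \<omega> s)"
    by (rule set_borel_integral_eq_integral(2)[OF leg_cost_set_integrable[OF \<omega> Move.prems(2)], symmetric])
  finally show ?case using IH by simp
qed simp

end

section \<open>Expected costs of policies\<close>

context
  fixes H :: "'m::finite \<Rightarrow> real^'n \<Rightarrow> real^'n \<Rightarrow> real" and \<Lambda> :: "real^'m^'m" and i :: 'm
  assumes H: "hamiltonians H" and coupling: "coupling_matrix \<Lambda>"
begin

lemma markov_event:
  assumes A: "A \<in> sets (index_filtration t)" "\<And>\<omega>. \<omega> \<in> A \<Longrightarrow> \<omega> t = k" and t: "0 \<le> t" and h: "0 \<le> h"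
  shows "(\<integral>\<omega>. of_bool (\<omega> (t + h) = l) * indicator A \<omega> \<partial>(axis_law \<Lambda> i)) = transition \<Lambda> h k l * measure (axis_law \<Lambda> i) A"
proof -
  have A': "A \<in> sets (axis_law \<Lambda> i)" using A sets_index_filtration_subset[of t] by (auto simp: sets_axis_law[OF coupling, of i])
  then have AP: "A \<inter> space (axis_law \<Lambda> i) = A" by (rule sets.Int_space_eq2)
  have "(\<integral>\<omega>. of_bool (\<omega> (t + h) = l) * indicator A \<omega> \<partial>(axis_law \<Lambda> i) :: real) = (\<integral>\<omega>. of_bool (\<omega> t = k \<and> \<omega> (t + h) = l) * indicator A \<omega> \<partial>(axis_law \<Lambda> i))"
    by (rule Bochner_Integration.integral_cong[OF refl]) (use A(2) in \<open>auto simp: indicator_def of_bool_def split: if_splits\<close>)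
  also have "\<dots> = transition \<Lambda> h k l * (\<integral>\<omega>. of_bool (\<omega> t = k) * indicator A \<omega> \<partial>(axis_law \<Lambda> i))"
    by (rule markov_property[OF coupling axis_prob_vector t h]) (use A(1) in simp)
  also have "(\<integral>\<omega>. of_bool (\<omega> t = k) * indicator A \<omega> \<partial>(axis_law \<Lambda> i)) = (\<integral>\<omega>. indicator A \<omega> \<partial>(axis_law \<Lambda> i) :: real)"
    by (rule Bochner_Integration.integral_cong[OF refl]) (use A(2) in \<open>auto simp: indicator_def of_bool_def split: if_splits\<close>)
  finally show ?thesis by (simp add: AP)
qed

text \<open>Fubini exchanges expectation and time; at each time the Markov property averages the
  Lagrangian over the current index.\<close>

lemma leg_cost_expectation:
  assumes A: "A \<in> sets (index_filtration t)" "\<And>\<omega>. \<omega> \<in> A \<Longrightarrow> \<omega> t = k" and t: "0 \<le> t" and h: "0 \<le> h"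
  shows "(\<integral>\<omega>. indicator A \<omega> * (LINT s:{t..t + h}|lborel. leg_cost H \<alpha> q x t \<omega> s) \<partial>(axis_law \<Lambda> i)) =
    expected_leg_cost H \<Lambda> \<alpha> h q k x * measure (axis_law \<Lambda> i) A"
proof -
  interpret P: prob_space "axis_law \<Lambda> i" by (rule prob_space_axis_law[OF coupling])
  interpret PS: pair_sigma_finite "axis_law \<Lambda> i" lborel ..
  note [measurable_cong] = sets_axis_law[OF coupling, of i]
  have A': "A \<in> sets (axis_law \<Lambda> i)" using A sets_index_filtration_subset[of t] by (auto simp: sets_axis_law[OF coupling, of i])
  define l where "l j s = lagrangian H j (x + (s - t) *\<^sub>R q) (- q) + \<alpha>" for j s
  obtain B where B: "B > 0" "\<And>x t \<omega> s. \<bar>leg_cost H \<alpha> q x t \<omega> s\<bar> \<le> B" using leg_cost_bounded[OF H] by blast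
  define g where "g \<omega> s = indicator A \<omega> * (indicator {t..t + h} s * leg_cost H \<alpha> q x t \<omega> (max 0 s))" for \<omega> s
  have g_eq: "g \<omega> s = indicator A \<omega> * (indicator {t..t + h} s *\<^sub>R leg_cost H \<alpha> q x t \<omega> s)" for \<omega> s
    using t by (auto simp: g_def indicator_def max_def)
  have [measurable]: "(\<lambda>p. leg_cost H \<alpha> q x t (fst p) (max 0 (snd p))) \<in> borel_measurable ((axis_law \<Lambda> i) \<Otimes>\<^sub>M lborel)"
    using leg_cost_joint_measurable[OF H, of \<alpha> q x t] by (simp cong: measurable_cong_sets sets_pair_measure_cong add: sets_axis_law[OF coupling, of i])
  have [measurable]: "A \<in> sets (axis_law \<Lambda> i)" by (rule A')
  have g_int: "integrable ((axis_law \<Lambda> i) \<Otimes>\<^sub>M lborel) (\<lambda>(\<omega>, s). g \<omega> s)"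
  proof (rule integrableI_bounded_set[where A = "space (axis_law \<Lambda> i) \<times> {t..t + h}" and B = B])
    show "(\<lambda>(\<omega>, s). g \<omega> s) \<in> borel_measurable ((axis_law \<Lambda> i) \<Otimes>\<^sub>M lborel)"
      unfolding g_def case_prod_beta' by measurable
    show "emeasure ((axis_law \<Lambda> i) \<Otimes>\<^sub>M lborel) (space (axis_law \<Lambda> i) \<times> {t..t + h}) < \<infinity>"
      using h by (subst lborel.emeasure_pair_measure_Times) (auto simp: P.emeasure_space_1 emeasure_lborel_Icc_eq)
    show "AE p in (axis_law \<Lambda> i) \<Otimes>\<^sub>M lborel. p \<in> space (axis_law \<Lambda> i) \<times> {t..t + h} \<longrightarrow> norm (case p of (\<omega>, s) \<Rightarrow> g \<omega> s) \<le> B"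
      using B by (auto simp: g_def indicator_def less_imp_le)
  qed (auto simp: g_def indicator_def space_pair_measure)
  have "(\<integral>\<omega>. indicator A \<omega> * (LINT s:{t..t + h}|lborel. leg_cost H \<alpha> q x t \<omega> s) \<partial>(axis_law \<Lambda> i)) = (\<integral>\<omega>. (\<integral>s. g \<omega> s \<partial>lborel) \<partial>(axis_law \<Lambda> i))"
    unfolding set_lebesgue_integral_def g_eq by simp
  also have "\<dots> = (\<integral>s. (\<integral>\<omega>. g \<omega> s \<partial>(axis_law \<Lambda> i)) \<partial>lborel)"
    by (rule PS.Fubini_integral[symmetric, OF g_int])
  also have "\<dots> = (LINT s:{t..t + h}|lborel. (\<Sum>j\<in>UNIV. transition \<Lambda> (s - t) k j * l j s) * measure (axis_law \<Lambda> i) A)"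
    unfolding set_lebesgue_integral_def
  proof (rule Bochner_Integration.integral_cong[OF refl])
    fix s :: real
    show "(\<integral>\<omega>. g \<omega> s \<partial>(axis_law \<Lambda> i)) = indicator {t..t + h} s *\<^sub>R ((\<Sum>j\<in>UNIV. transition \<Lambda> (s - t) k j * l j s) * measure (axis_law \<Lambda> i) A)"
    proof (cases "s \<in> {t..t + h}")
      case True
      have [measurable]: "(\<lambda>\<omega>. \<omega> s) \<in> (axis_law \<Lambda> i) \<rightarrow>\<^sub>M count_space UNIV"
        using measurable_index_eval[of s] True t by (simp add: measurable_cong_sets[OF sets_axis_law[OF coupling, of i] refl])
      have i: "integrable (axis_law \<Lambda> i) (\<lambda>\<omega>. of_bool (\<omega> s = j) * indicator A \<omega> :: real)" for j
        by (rule P.integrable_const_bound[of _ 1]) (auto simp: indicator_def)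
      have "g \<omega> s = (\<Sum>j\<in>UNIV. l j s * (of_bool (\<omega> s = j) * indicator A \<omega>))" for \<omega>
      proof -
        have "(\<Sum>j\<in>UNIV. l j s * (of_bool (\<omega> s = j) * indicator A \<omega>)) = (\<Sum>j\<in>UNIV. if j = \<omega> s then l j s * indicator A \<omega> else 0)"
          by (intro sum.cong) auto
        then show ?thesis using True by (simp add: g_eq leg_cost_def l_def mult.commute)
      qed
      then have "(\<integral>\<omega>. g \<omega> s \<partial>(axis_law \<Lambda> i)) = (\<Sum>j\<in>UNIV. l j s * (\<integral>\<omega>. of_bool (\<omega> s = j) * indicator A \<omega> \<partial>(axis_law \<Lambda> i)))"
        by (simp only: Bochner_Integration.integral_sum integrable_mult_right i Bochner_Integration.integral_mult_right)
      also have "\<dots> = (\<Sum>j\<in>UNIV. l j s * (transition \<Lambda> (s - t) k j * measure (axis_law \<Lambda> i) A))"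
      proof (intro sum.cong refl arg_cong[of _ _ "(*) _"])
        fix j
        show "(\<integral>\<omega>. of_bool (\<omega> s = j) * indicator A \<omega> \<partial>(axis_law \<Lambda> i)) = transition \<Lambda> (s - t) k j * measure (axis_law \<Lambda> i) A"
          using markov_event[of A t k "s - t" j] A t True by simp
      qed
      finally show ?thesis using True by (simp add: sum_distrib_left mult_ac)
    qed (simp add: g_eq)
  qed
  also have "\<dots> = (LINT s:{t..t + h}|lborel. (\<Sum>j\<in>UNIV. transition \<Lambda> (s - t) k j * l j s)) * measure (axis_law \<Lambda> i) A"
    unfolding set_lebesgue_integral_def by (simp flip: mult.assoc)
  also have "(LINT s:{t..t + h}|lborel. (\<Sum>j\<in>UNIV. transition \<Lambda> (s - t) k j * l j s)) =
      integral {t..t + h} (\<lambda>s. \<Sum>j\<in>UNIV. transition \<Lambda> (s - t) k j * l j s)"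
  proof (rule set_borel_integral_eq_integral(2), rule borel_integrable_atLeastAtMost')
    show "continuous_on {t..t + h} (\<lambda>s. \<Sum>j\<in>UNIV. transition \<Lambda> (s - t) k j * l j s)"
      unfolding l_def
      by (intro continuous_intros continuous_on_lagrangian[OF H] continuous_on_compose2[OF continuous_on_transition[of UNIV]]) auto
  qed
  also have "\<dots> = integral {0..h} (\<lambda>s. \<Sum>j\<in>UNIV. transition \<Lambda> s k j * (lagrangian H j (x + s *\<^sub>R q) (- q) + \<alpha>))"
    using integral_shift_Icc_real[of 0 h "\<lambda>s. \<Sum>j\<in>UNIV. transition \<Lambda> (s - t) k j * l j s" t]
    by (simp add: l_def o_def add.commute)
  finally show ?thesis by (simp add: expected_leg_cost_def)
qed

text \<open>An event A of the past of t, on which the index is k, plays the role of conditioning;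
  the induction refines A by the index at the end of the leg.\<close>

lemma path_cost_expectation:
  assumes "reaches y p x" "0 \<le> t" "A \<in> sets (index_filtration t)" "\<And>\<omega>. \<omega> \<in> A \<Longrightarrow> \<omega> t = k"
  shows "(\<integral>\<omega>. indicator A \<omega> * path_cost H \<alpha> b p t x \<omega> \<partial>(axis_law \<Lambda> i)) = policy_cost H \<Lambda> \<alpha> b p k x * measure (axis_law \<Lambda> i) A"
  using assms
proof (induction p arbitrary: t x k A)
  case Stop
  have A': "A \<in> sets (axis_law \<Lambda> i)" using Stop(3) sets_index_filtration_subset[of t] by (auto simp: sets_axis_law[OF coupling, of i])
  have "(\<integral>\<omega>. indicator A \<omega> * path_cost H \<alpha> b Stop t x \<omega> \<partial>(axis_law \<Lambda> i)) = (\<integral>\<omega>. b $ k * indicator A \<omega> \<partial>(axis_law \<Lambda> i))"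
    by (rule Bochner_Integration.integral_cong) (use Stop(4) in \<open>auto simp: indicator_def\<close>)
  then show ?case using sets.Int_space_eq2[OF A'] by simp
next
  case (Move h q f)
  interpret P: prob_space "axis_law \<Lambda> i" by (rule prob_space_axis_law[OF coupling])
  note [measurable_cong] = sets_axis_law[OF coupling, of i]
  have h: "0 < h" and r: "\<And>j. reaches y (f j) (x + h *\<^sub>R q)" using Move.prems(1) by auto
  have t: "0 \<le> t" "0 \<le> t + h" using Move.prems(2) h by auto
  have A': "A \<in> sets (axis_law \<Lambda> i)" using Move.prems(3) sets_index_filtration_subset[of t] by (auto simp: sets_axis_law[OF coupling, of i])
  let ?leg = "\<lambda>\<omega>. LINT s:{t..t + h}|lborel. leg_cost H \<alpha> q x t \<omega> s"
  let ?rest = "\<lambda>j \<omega>. path_cost H \<alpha> b (f j) (t + h) (x + h *\<^sub>R q) \<omega>"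
  define Aj where "Aj j = {\<omega> \<in> A. \<omega> (t + h) = j}" for j
  have Aj: "Aj j \<in> sets (index_filtration (t + h))" for j
  proof -
    have "A \<in> sets (index_filtration (t + h))"
      using Move.prems(3) sets_index_filtration_mono[of t "t + h"] h by auto
    moreover have "(\<lambda>\<omega>. \<omega> (t + h)) -` {j} \<inter> space (index_filtration (t + h)) \<in> sets (index_filtration (t + h))"
      by (rule measurable_sets[OF measurable_index_eval_filtration]) (use t in auto)
    moreover have "Aj j = A \<inter> ((\<lambda>\<omega>. \<omega> (t + h)) -` {j} \<inter> space (index_filtration (t + h)))"
      using sets.sets_into_space[OF Move.prems(3)] by (auto simp: Aj_def)
    ultimately show ?thesis by simp
  qed
  have Aj': "Aj j \<in> sets (axis_law \<Lambda> i)" for j using Aj[of j] sets_index_filtration_subset[of "t + h"] by (auto simp: sets_axis_law[OF coupling, of i])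
  obtain B where B: "\<And>\<omega>. \<omega> \<in> index_paths \<Longrightarrow> \<bar>?leg \<omega>\<bar> \<le> B"
    using leg_cost_integral_bounded[OF H, of h \<alpha> q] t by blast
  have leg_int: "integrable (axis_law \<Lambda> i) (\<lambda>\<omega>. indicator A \<omega> * ?leg \<omega>)"
  proof (rule P.integrable_const_bound[of _ "\<bar>B\<bar>"])
    show "AE \<omega> in axis_law \<Lambda> i. norm (indicator A \<omega> * ?leg \<omega>) \<le> \<bar>B\<bar>"
      by (rule AE_I2) (use B in \<open>auto simp: space_axis_law[OF coupling] indicator_def intro: order_trans[OF _ abs_ge_self]\<close>)
    show "(\<lambda>\<omega>. indicator A \<omega> * ?leg \<omega>) \<in> borel_measurable (axis_law \<Lambda> i)"
      using leg_cost_integral_measurable[OF H t(1)] A' by (intro borel_measurable_times borel_measurable_indicator) (auto simp: measurable_cong_sets[OF sets_axis_law[OF coupling, of i] refl])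
  qed
  have rest_int: "integrable (axis_law \<Lambda> i) (\<lambda>\<omega>. indicator (Aj j) \<omega> * ?rest j \<omega>)" for j
  proof -
    obtain C where C: "\<And>\<omega>. \<omega> \<in> index_paths \<Longrightarrow> \<bar>?rest j \<omega>\<bar> \<le> C" using path_cost_bounded[OF H r t(2), of \<alpha> b j] by blast
    show ?thesis
    proof (rule P.integrable_const_bound[of _ "\<bar>C\<bar>"])
      show "AE \<omega> in axis_law \<Lambda> i. norm (indicator (Aj j) \<omega> * ?rest j \<omega>) \<le> \<bar>C\<bar>"
        by (rule AE_I2) (use C in \<open>auto simp: space_axis_law[OF coupling] indicator_def intro: order_trans[OF _ abs_ge_self]\<close>)
      show "(\<lambda>\<omega>. indicator (Aj j) \<omega> * ?rest j \<omega>) \<in> borel_measurable (axis_law \<Lambda> i)"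
        using path_cost_measurable[OF H r t(2)] Aj' by (intro borel_measurable_times borel_measurable_indicator) (auto simp: measurable_cong_sets[OF sets_axis_law[OF coupling, of i] refl])
    qed
  qed
  have split: "indicator A \<omega> * path_cost H \<alpha> b (Move h q f) t x \<omega> =
     indicator A \<omega> * ?leg \<omega> + (\<Sum>j\<in>UNIV. indicator (Aj j) \<omega> * ?rest j \<omega>)" for \<omega>
  proof -
    have "(\<Sum>j\<in>UNIV. indicator (Aj j) \<omega> * ?rest j \<omega>) = (\<Sum>j\<in>UNIV. if j = \<omega> (t + h) then indicator A \<omega> * ?rest j \<omega> else 0)"
      by (intro sum.cong) (auto simp: Aj_def indicator_def)
    then show ?thesis by (simp add: distrib_left)
  qed
  have "(\<integral>\<omega>. indicator A \<omega> * path_cost H \<alpha> b (Move h q f) t x \<omega> \<partial>(axis_law \<Lambda> i)) =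
     (\<integral>\<omega>. indicator A \<omega> * ?leg \<omega> \<partial>(axis_law \<Lambda> i)) + (\<Sum>j\<in>UNIV. \<integral>\<omega>. indicator (Aj j) \<omega> * ?rest j \<omega> \<partial>(axis_law \<Lambda> i))"
    unfolding split
    by (simp only: Bochner_Integration.integral_add[OF leg_int Bochner_Integration.integrable_sum[OF rest_int]]
          Bochner_Integration.integral_sum[OF rest_int])
  also have "(\<integral>\<omega>. indicator A \<omega> * ?leg \<omega> \<partial>(axis_law \<Lambda> i)) = expected_leg_cost H \<Lambda> \<alpha> h q k x * measure (axis_law \<Lambda> i) A"
    using h by (intro leg_cost_expectation Move.prems t) auto
  also have "(\<Sum>j\<in>UNIV. \<integral>\<omega>. indicator (Aj j) \<omega> * ?rest j \<omega> \<partial>(axis_law \<Lambda> i)) =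
      (\<Sum>j\<in>UNIV. transition \<Lambda> h k j * policy_cost H \<Lambda> \<alpha> b (f j) j (x + h *\<^sub>R q) * measure (axis_law \<Lambda> i) A)"
  proof (intro sum.cong refl)
    fix j
    have "(\<integral>\<omega>. indicator (Aj j) \<omega> * ?rest j \<omega> \<partial>(axis_law \<Lambda> i)) = policy_cost H \<Lambda> \<alpha> b (f j) j (x + h *\<^sub>R q) * measure (axis_law \<Lambda> i) (Aj j)"
      by (rule Move.IH[OF _ r t(2) Aj]) (auto simp: Aj_def)
    also have "measure (axis_law \<Lambda> i) (Aj j) = (\<integral>\<omega>. indicator (Aj j) \<omega> \<partial>(axis_law \<Lambda> i))"
      using sets.Int_space_eq2[OF Aj'] by simp
    also have "\<dots> = (\<integral>\<omega>. of_bool (\<omega> (t + h) = j) * indicator A \<omega> \<partial>(axis_law \<Lambda> i))"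
      by (rule Bochner_Integration.integral_cong) (auto simp: Aj_def indicator_def)
    also have "\<dots> = transition \<Lambda> h k j * measure (axis_law \<Lambda> i) A"
      using h by (intro markov_event Move.prems t) auto
    finally show "(\<integral>\<omega>. indicator (Aj j) \<omega> * ?rest j \<omega> \<partial>(axis_law \<Lambda> i)) =
      transition \<Lambda> h k j * policy_cost H \<Lambda> \<alpha> b (f j) j (x + h *\<^sub>R q) * measure (axis_law \<Lambda> i) A" by simp
  qed
  finally show ?case by (simp add: distrib_right sum_distrib_right)
qed

lemma policy_control_realisation:
  assumes p: "reaches y p y" and \<omega>: "\<omega> \<in> index_paths"
  shows "integral {0..policy_end p 0 \<omega>} (running_cost H \<alpha> y (policy_control p \<omega>) \<omega>) + b $ \<omega> (policy_end p 0 \<omega>) = path_cost H \<alpha> b p 0 y \<omega>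
    \<and> y + displacement (policy_control p \<omega>) (policy_end p 0 \<omega>) - y \<in> int_lattice"
  by (rule policy_realisation[OF H p order_refl \<omega> policy_control_cadlag])
    (auto simp: policy_control_def displacement_0)

lemma policy_cost_eq_expectation:
  assumes p: "reaches y p y"
  shows "(\<integral>\<omega>. (LINT s:{0..policy_end p 0 \<omega>}|lborel. running_cost H \<alpha> y (policy_control p \<omega>) \<omega> s) - b $ i + b $ \<omega> (policy_end p 0 \<omega>) \<partial>(axis_law \<Lambda> i))
    = policy_cost H \<Lambda> \<alpha> b p i y - b $ i"
proof -
  interpret P: prob_space "axis_law \<Lambda> i" by (rule prob_space_axis_law[OF coupling])
  have realised: "(LINT s:{0..policy_end p 0 \<omega>}|lborel. running_cost H \<alpha> y (policy_control p \<omega>) \<omega> s) + b $ \<omega> (policy_end p 0 \<omega>)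
     = path_cost H \<alpha> b p 0 y \<omega>" if \<omega>: "\<omega> \<in> index_paths" for \<omega>
  proof -
    have "(LINT s:{0..policy_end p 0 \<omega>}|lborel. running_cost H \<alpha> y (policy_control p \<omega>) \<omega> s) =
       integral {0..policy_end p 0 \<omega>} (running_cost H \<alpha> y (policy_control p \<omega>) \<omega>)"
      by (rule set_borel_integral_eq_integral(2)[OF running_cost_set_integrable[OF H \<omega> policy_control_cadlag]]) simp
    also have "\<dots> + b $ \<omega> (policy_end p 0 \<omega>) = path_cost H \<alpha> b p 0 y \<omega>"
      by (rule policy_control_realisation[OF p \<omega>, THEN conjunct1])
    finally show ?thesis .
  qed
  \<comment> \<open>Under the law started at i this event has probability 1, so
    \<open>path_cost_expectation\<close> at time 0 computes the full expectation.\<close>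
  define A where "A = {\<omega> \<in> index_paths. \<omega> 0 = i}"
  have A: "A \<in> sets (index_filtration 0)"
    using measurable_sets[OF measurable_index_eval_filtration[of 0 0], of "{i}"]
    by (simp add: A_def vimage_def Int_def conj_commute)
  have A': "A \<in> sets (axis_law \<Lambda> i)" using A sets_index_filtration_subset[of 0] by (auto simp: sets_axis_law[OF coupling, of i])
  have PA: "measure (axis_law \<Lambda> i) A = 1"
  proof -
    have "A = path_cylinder ((\<lambda>_. 0) ` {..0::nat}) (\<lambda>_. i)" by (auto simp: A_def path_cylinder_def)
    also have "measure (axis_law \<Lambda> i) \<dots> = (\<Sum>j\<in>UNIV. axis i 1 $ j * transition \<Lambda> 0 j i)"
      by (subst is_index_law_cylinder[OF is_index_law_index_law[OF coupling axis_prob_vector]]) auto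
    also have "\<dots> = 1" by (simp add: transition_0 axis_def if_distrib[of "\<lambda>x. x * _"] cong: if_cong)
    finally show ?thesis .
  qed
  then have "AE \<omega> in axis_law \<Lambda> i. \<omega> \<in> A" using P.prob_eq_1[OF A'] by simp
  then have ae: "AE \<omega> in axis_law \<Lambda> i. path_cost H \<alpha> b p 0 y \<omega> = indicator A \<omega> * path_cost H \<alpha> b p 0 y \<omega>"
    by eventually_elim simp
  have m: "path_cost H \<alpha> b p 0 y \<in> borel_measurable (axis_law \<Lambda> i)"
    using path_cost_measurable[OF H p, of 0] by (simp add: measurable_cong_sets[OF sets_axis_law[OF coupling, of i] refl])
  obtain C where C: "\<And>\<omega>. \<omega> \<in> index_paths \<Longrightarrow> \<bar>path_cost H \<alpha> b p 0 y \<omega>\<bar> \<le> C" using path_cost_bounded[OF H p, of 0] by blast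
  have int: "integrable (axis_law \<Lambda> i) (path_cost H \<alpha> b p 0 y)"
    by (rule P.integrable_const_bound[of _ C]) (use C m in \<open>auto simp: space_axis_law[OF coupling] intro!: AE_I2\<close>)
  have "(\<integral>\<omega>. (LINT s:{0..policy_end p 0 \<omega>}|lborel. running_cost H \<alpha> y (policy_control p \<omega>) \<omega> s) - b $ i + b $ \<omega> (policy_end p 0 \<omega>) \<partial>(axis_law \<Lambda> i))
     = (\<integral>\<omega>. path_cost H \<alpha> b p 0 y \<omega> - b $ i \<partial>(axis_law \<Lambda> i))"
    by (rule Bochner_Integration.integral_cong) (use realised in \<open>auto simp: space_axis_law[OF coupling] algebra_simps\<close>)
  also have "\<dots> = (\<integral>\<omega>. path_cost H \<alpha> b p 0 y \<omega> \<partial>(axis_law \<Lambda> i)) - b $ i"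
    using int P.prob_space by simp
  also have "(\<integral>\<omega>. path_cost H \<alpha> b p 0 y \<omega> \<partial>(axis_law \<Lambda> i)) = (\<integral>\<omega>. indicator A \<omega> * path_cost H \<alpha> b p 0 y \<omega> \<partial>(axis_law \<Lambda> i))"
    using m A' by (intro integral_cong_AE ae borel_measurable_times borel_measurable_indicator) auto
  also have "\<dots> = policy_cost H \<Lambda> \<alpha> b p i y * measure (axis_law \<Lambda> i) A"
    by (rule path_cost_expectation[OF p _ A]) (auto simp: A_def)
  finally show ?thesis using PA by simp
qed

lemma policy_tau_cycle:
  fixes p :: "(real^'n, 'm) policy"
  assumes p: "reaches y p y"
  shows "tau_cycle \<Lambda> (policy_end p 0) (policy_control p)"
  unfolding tau_cycle_def
proof (intro conjI control_policy_control[OF coupling p] almost_surelyI[OF coupling])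
  fix \<omega> :: "real \<Rightarrow> 'm" assume \<omega>: "\<omega> \<in> index_paths"
  have "y + displacement (policy_control p \<omega>) (policy_end p 0 \<omega>) - y \<in> int_lattice"
    by (rule policy_control_realisation[OF p \<omega>, THEN conjunct2])
  then show "displacement (policy_control p \<omega>) (policy_end p 0 \<omega>) \<in> int_lattice" by simp
qed

end

subsection \<open>The value function of the exit problem\<close>

lemma reaches_periodic:
  "z \<in> int_lattice \<Longrightarrow> reaches y p x \<Longrightarrow> reaches y p (x + z)"
proof (induction p arbitrary: x)
  case Stop
  then show ?case using int_lattice_add[of "x - y" z] by (simp add: algebra_simps)
next
  case (Move h q f)
  have "reaches y (f j) (x + z + h *\<^sub>R q)" for j
    using Move.IH[of "f j" "x + h *\<^sub>R q"] Move.prems by (simp add: add_ac)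
  then show ?case using Move.prems by simp
qed

section \<open>Estimates for expected leg costs\<close>

context
  fixes H :: "'m::finite \<Rightarrow> real^'n \<Rightarrow> real^'n \<Rightarrow> real" and \<Lambda> :: "real^'m^'m" and \<alpha> :: real
  assumes H: "hamiltonians H" and coupling: "coupling_matrix \<Lambda>"
begin

lemma continuous_on_leg_integrand:
  "continuous_on S (\<lambda>s. \<Sum>j\<in>UNIV. transition \<Lambda> s i j * (lagrangian H j (x + s *\<^sub>R q) (- q) + \<alpha>))"
  by (intro continuous_intros continuous_on_lagrangian[OF H] continuous_on_transition)

lemma expected_leg_cost_bounded:
  "\<exists>M>0. \<forall>h q i x. 0 \<le> h \<and> norm q \<le> K \<longrightarrow> \<bar>expected_leg_cost H \<Lambda> \<alpha> h q i x\<bar> \<le> M * h"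
proof -
  obtain B where B: "B > 0" "\<And>i x p. norm p \<le> K \<Longrightarrow> \<bar>lagrangian H i x p\<bar> \<le> B"
    using lagrangian_bounded[OF H, of K] by blast
  have "\<bar>expected_leg_cost H \<Lambda> \<alpha> h q i x\<bar> \<le> (B + \<bar>\<alpha>\<bar>) * h" if h: "0 \<le> h" and q: "norm q \<le> K" for h q i x
  proof -
    have pw: "norm (\<Sum>j\<in>UNIV. transition \<Lambda> s i j * (lagrangian H j (x + s *\<^sub>R q) (- q) + \<alpha>)) \<le> B + \<bar>\<alpha>\<bar>"
      if "s \<in> {0..h}" for s
    proof -
      have s: "0 \<le> s" using that by simp
      have l: "\<bar>lagrangian H j (x + s *\<^sub>R q) (- q) + \<alpha>\<bar> \<le> B + \<bar>\<alpha>\<bar>" for j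
        using B(2)[of "- q" j "x + s *\<^sub>R q"] q by simp
      have "\<bar>\<Sum>j\<in>UNIV. transition \<Lambda> s i j * (lagrangian H j (x + s *\<^sub>R q) (- q) + \<alpha>)\<bar>
        \<le> (\<Sum>j\<in>UNIV. \<bar>transition \<Lambda> s i j * (lagrangian H j (x + s *\<^sub>R q) (- q) + \<alpha>)\<bar>)"
        by (rule sum_abs)
      also have "\<dots> \<le> (\<Sum>j\<in>UNIV. transition \<Lambda> s i j * (B + \<bar>\<alpha>\<bar>))"
        using transition_nonneg[OF coupling s] l by (intro sum_mono) (auto simp: abs_mult intro!: mult_left_mono)
      also have "\<dots> = B + \<bar>\<alpha>\<bar>" by (simp add: transition_sum[OF coupling s] flip: sum_distrib_right)
      finally show ?thesis by simp
    qed
    have "norm (integral (cbox 0 h) (\<lambda>s. \<Sum>j\<in>UNIV. transition \<Lambda> s i j * (lagrangian H j (x + s *\<^sub>R q) (- q) + \<alpha>)))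
       \<le> (B + \<bar>\<alpha>\<bar>) * measure lborel (cbox 0 h)"
      using B(1) pw by (intro integrable_bound integrable_continuous continuous_on_leg_integrand) auto
    then show ?thesis using h by (simp add: expected_leg_cost_def)
  qed
  then show ?thesis using B(1) by (intro exI[of _ "B + \<bar>\<alpha>\<bar>"]) auto
qed

text \<open>At time 0 the transition matrix is the identity, so only the index i contributes to the
  initial rate.\<close>

lemma expected_leg_cost_rate:
  "((\<lambda>h. expected_leg_cost H \<Lambda> \<alpha> h q i x / h) \<longlongrightarrow> lagrangian H i x (- q) + \<alpha>) (at_right 0)"
proof -
  let ?g = "\<lambda>s. \<Sum>j\<in>UNIV. transition \<Lambda> s i j * (lagrangian H j (x + s *\<^sub>R q) (- q) + \<alpha>)"
  have "((\<lambda>h. integral {0..h} ?g) has_vector_derivative ?g 0) (at 0 within {0..1})"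
    by (rule integral_has_vector_derivative[OF continuous_on_leg_integrand]) simp
  moreover have "?g 0 = lagrangian H i x (- q) + \<alpha>"
  proof -
    have "?g 0 = (\<Sum>j\<in>UNIV. if j = i then lagrangian H i x (- q) + \<alpha> else 0)"
      by (intro sum.cong) (auto simp: transition_0)
    then show ?thesis by simp
  qed
  ultimately have "((\<lambda>h. integral {0..h} ?g) has_real_derivative (lagrangian H i x (- q) + \<alpha>)) (at 0 within {0..1})"
    by (simp add: has_real_derivative_iff_has_vector_derivative)
  then have "((\<lambda>h. (integral {0..h} ?g - integral {0..0} ?g) / (h - 0)) \<longlongrightarrow> lagrangian H i x (- q) + \<alpha>) (at 0 within {0..1})"
    by (simp add: has_field_derivative_iff)
  then show ?thesis by (simp add: expected_leg_cost_def at_within_Icc_at_right)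
qed

lemma expected_leg_cost_periodic:
  assumes "z \<in> int_lattice"
  shows "expected_leg_cost H \<Lambda> \<alpha> h q i (x + z) = expected_leg_cost H \<Lambda> \<alpha> h q i x"
proof -
  have "lagrangian H j (x + z + s *\<^sub>R q) (- q) = lagrangian H j (x + s *\<^sub>R q) (- q)" for j s
    using lagrangian_periodic[OF H assms, of j "x + s *\<^sub>R q"] by (simp add: add_ac)
  then show ?thesis by (simp add: expected_leg_cost_def)
qed

lemma policy_cost_periodic:
  "z \<in> int_lattice \<Longrightarrow> policy_cost H \<Lambda> \<alpha> b p i (x + z) = policy_cost H \<Lambda> \<alpha> b p i x"
proof (induction p arbitrary: i x)
  case (Move h q f)
  have "policy_cost H \<Lambda> \<alpha> b (f j) j (x + z + h *\<^sub>R q) = policy_cost H \<Lambda> \<alpha> b (f j) j (x + h *\<^sub>R q)" for j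
    using Move.IH[of "f j" j "x + h *\<^sub>R q"] Move.prems by (simp add: add_ac)
  then show ?case using expected_leg_cost_periodic[OF Move.prems, of h q i x] by simp
qed simp

end

section \<open>The infimum over policies and its subsolution property\<close>

context
  fixes H :: "'m::finite \<Rightarrow> real^'n \<Rightarrow> real^'n \<Rightarrow> real" and \<Lambda> :: "real^'m^'m" and \<alpha> :: real
    and b :: "real^'m" and y :: "real^'n"
  assumes H: "hamiltonians H" and coupling: "coupling_matrix \<Lambda>"
    and cycles: "\<forall>p i. reaches y p y \<longrightarrow> b $ i \<le> policy_cost H \<Lambda> \<alpha> b p i y"
begin

abbreviation (input) "C p i x \<equiv> policy_cost H \<Lambda> \<alpha> b p i x"
abbreviation (input) "E h q i x \<equiv> expected_leg_cost H \<Lambda> \<alpha> h q i x"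

text \<open>Taking unit time from every x makes the speed, and hence the cost, bounded on bounded
  sets of starting points.\<close>

definition straight_policy :: "real^'n \<Rightarrow> (real^'n, 'm) policy" where
  "straight_policy x = Move 1 (y - x) (\<lambda>_. Stop)"

lemma reaches_straight_policy: "reaches y (straight_policy x) x"
  by (simp add: straight_policy_def zero_in_int_lattice)

lemma straight_policy_cost:
  "\<exists>M>0. \<forall>x i. norm (x - y) \<le> K \<longrightarrow> \<bar>C (straight_policy x) i x\<bar> \<le> M"
proof -
  obtain M where M: "0 < M" "\<And>h q i x. 0 \<le> h \<Longrightarrow> norm q \<le> K \<Longrightarrow> \<bar>E h q i x\<bar> \<le> M * h"
    using expected_leg_cost_bounded[OF H coupling, of K \<alpha>] by blast
  have "\<bar>C (straight_policy x) i x\<bar> \<le> M + (\<Sum>j\<in>UNIV. \<bar>b $ j\<bar>)" if "norm (x - y) \<le> K" for x i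
  proof -
    have "\<bar>\<Sum>j\<in>UNIV. transition \<Lambda> 1 i j * b $ j\<bar> \<le> (\<Sum>j\<in>UNIV. \<bar>b $ j\<bar>)"
      using transition_nonneg[OF coupling, of 1 i] transition_le_1[OF coupling, of 1 i]
      by (intro order_trans[OF sum_abs] sum_mono) (auto simp: abs_mult intro!: mult_left_le_one_le)
    then show ?thesis using M(2)[of 1 "y - x" i x] that by (simp add: straight_policy_def norm_minus_commute)
  qed
  then show ?thesis using M(1) by (intro exI[of _ "M + (\<Sum>j\<in>UNIV. \<bar>b $ j\<bar>)"]) (auto intro!: add_pos_nonneg sum_nonneg)
qed

text \<open>Prefixing a policy from \<open>x\<close> by a move from \<open>y\<close> to \<open>x\<close> gives a cycle, which bounds its cost from below.\<close>

lemma policy_cost_lower_bound: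
  "\<exists>M. \<forall>p j x. reaches y p x \<and> norm (x - y) \<le> K \<longrightarrow> - M \<le> C p j x"
proof -
  obtain M where M: "0 < M" "\<And>h q i x. 0 \<le> h \<Longrightarrow> norm q \<le> K \<Longrightarrow> \<bar>E h q i x\<bar> \<le> M * h"
    using expected_leg_cost_bounded[OF H coupling, of K \<alpha>] by blast
  obtain N where N: "0 < N" "\<And>x i. norm (x - y) \<le> K \<Longrightarrow> \<bar>C (straight_policy x) i x\<bar> \<le> N"
    using straight_policy_cost[of K] by blast
  define D where "D j = (M + \<bar>b $ j\<bar> + real CARD('m) * N) / transition \<Lambda> 1 j j" for j
  have D0: "0 \<le> D j" for j
    unfolding D_def using M N transition_pos[OF coupling, of j j] by (auto intro!: divide_nonneg_pos)
  have low: "- D j \<le> C p j x" if p: "reaches y p x" and x: "norm (x - y) \<le> K" for p j x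
  proof -
    \<comment> \<open>The cycle follows p only if the index is j on arrival and goes straight back
      otherwise. Arrival with index j has positive probability, so the lower bound on the cycle can
      be divided by it to bound the cost of p; this is the origin of D.\<close>
    let ?f = "\<lambda>k. if k = j then p else straight_policy x"
    have T: "0 < transition \<Lambda> 1 j j" by (rule transition_pos[OF coupling])
    have T1: "0 \<le> transition \<Lambda> 1 j k" "transition \<Lambda> 1 j k \<le> 1" for k
      using transition_nonneg[OF coupling] transition_le_1[OF coupling] by auto
    have "reaches y (Move 1 (x - y) ?f) y" using p reaches_straight_policy[of x] by simp
    then have "b $ j \<le> C (Move 1 (x - y) ?f) j y" using cycles by blast
    also have "\<dots> = E 1 (x - y) j y + (\<Sum>k\<in>UNIV. transition \<Lambda> 1 j k * C (?f k) k x)" by simp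
    also have "(\<Sum>k\<in>UNIV. transition \<Lambda> 1 j k * C (?f k) k x) =
        transition \<Lambda> 1 j j * C p j x + (\<Sum>k\<in>UNIV - {j}. transition \<Lambda> 1 j k * C (straight_policy x) k x)"
      by (subst sum.remove[of UNIV j]) auto
    also have "(\<Sum>k\<in>UNIV - {j}. transition \<Lambda> 1 j k * C (straight_policy x) k x) \<le> (\<Sum>k\<in>UNIV - {j}. N)"
    proof (rule sum_mono)
      fix k
      have "transition \<Lambda> 1 j k * C (straight_policy x) k x \<le> transition \<Lambda> 1 j k * N"
        using N(2)[OF x, of k] T1[of k] by (intro mult_left_mono) auto
      also have "\<dots> \<le> N" using T1[of k] N(1) by (simp add: mult_left_le_one_le)
      finally show "transition \<Lambda> 1 j k * C (straight_policy x) k x \<le> N" .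
    qed
    also have "(\<Sum>k\<in>UNIV - {j}. N) \<le> real CARD('m) * N" using N(1) by (simp add: card_Diff_singleton)
    also have "E 1 (x - y) j y \<le> M" using M(2)[of 1 "x - y" j y] x by simp
    finally have "- (M + \<bar>b $ j\<bar> + real CARD('m) * N) \<le> transition \<Lambda> 1 j j * C p j x" by simp
    then have "- (M + \<bar>b $ j\<bar> + real CARD('m) * N) / transition \<Lambda> 1 j j \<le> C p j x"
      using T by (simp only: pos_divide_le_eq mult.commute)
    then show ?thesis by (simp only: D_def minus_divide_left)
  qed
  have "- (\<Sum>k\<in>UNIV. D k) \<le> C p j x" if "reaches y p x" "norm (x - y) \<le> K" for p j x
    using low[OF that, of j] member_le_sum[of j UNIV D] D0 by simp
  then show ?thesis by blast
qed

definition policy_value :: "'m \<Rightarrow> real^'n \<Rightarrow> real" where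
  "policy_value i x = (INF p\<in>{p. reaches y p x}. C p i x)"

lemma bdd_below_policy_costs: "bdd_below ((\<lambda>p. C p i x) ` {p. reaches y p x})"
proof -
  obtain M where "\<And>p j z. reaches y p z \<Longrightarrow> norm (z - y) \<le> norm (x - y) \<Longrightarrow> - M \<le> C p j z"
    using policy_cost_lower_bound[of "norm (x - y)"] by blast
  then show ?thesis by (intro bdd_belowI[of _ "- M"]) auto
qed

lemma policy_value_le: "reaches y p x \<Longrightarrow> policy_value i x \<le> C p i x"
  unfolding policy_value_def by (intro cINF_lower bdd_below_policy_costs) simp

lemma policy_value_ge:
  assumes "\<And>p. reaches y p x \<Longrightarrow> c \<le> C p i x"
  shows "c \<le> policy_value i x"
  unfolding policy_value_def using reaches_straight_policy[of x] assms by (intro cINF_greatest) auto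

lemma policy_value_approx:
  assumes "0 < \<epsilon>"
  shows "\<exists>p. reaches y p x \<and> C p i x \<le> policy_value i x + \<epsilon>"
proof (rule ccontr)
  assume "\<not> ?thesis"
  then have "policy_value i x + \<epsilon> \<le> policy_value i x" by (intro policy_value_ge) (auto simp: not_le less_imp_le)
  then show False using assms by simp
qed

text \<open>\<open>Stop\<close> gives one inequality; the other is the hypothesis on policies from y
  to y.\<close>

lemma policy_value_at_target: "policy_value i y = b $ i"
proof (rule antisym)
  show "policy_value i y \<le> b $ i"
    using policy_value_le[of Stop y i] by (simp add: zero_in_int_lattice)
  show "b $ i \<le> policy_value i y" using cycles by (intro policy_value_ge) auto
qed

lemma policy_value_periodic:
  assumes "z \<in> int_lattice"
  shows "policy_value i (x + z) = policy_value i x"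
proof -
  have le: "policy_value i (x + z) \<le> policy_value i x" if "z \<in> int_lattice" for x z
  proof (rule policy_value_ge)
    fix p :: "(real^'n, 'm) policy" assume "reaches y p x"
    then show "policy_value i (x + z) \<le> C p i x"
      using policy_value_le[OF reaches_periodic[OF that], of p x i] policy_cost_periodic[OF H coupling that, of \<alpha> b p i x] by simp
  qed
  show ?thesis using le[OF assms, of x] le[OF int_lattice_uminus[OF assms], of "x + z"] by simp
qed

lemma policy_value_bounded: "\<exists>B>0. \<forall>x i. \<bar>policy_value i x\<bar> \<le> B"
proof -
  obtain K where K: "\<forall>x\<in>unit_cube. norm (x - y) \<le> K"
  proof -
    obtain K where "\<forall>x\<in>unit_cube. norm (x :: real^'n) \<le> K"
      using compact_imp_bounded[OF compact_unit_cube] unfolding bounded_iff by blast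
    then have "\<forall>x\<in>unit_cube. norm (x - y) \<le> K + norm y"
      by (auto intro: order_trans[OF norm_triangle_ineq4] add_right_mono)
    then show ?thesis by (rule that)
  qed
  obtain M where M: "\<And>p j x. reaches y p x \<Longrightarrow> norm (x - y) \<le> K \<Longrightarrow> - M \<le> C p j x"
    using policy_cost_lower_bound[of K] by blast
  obtain N where N: "0 < N" "\<And>x i. norm (x - y) \<le> K \<Longrightarrow> \<bar>C (straight_policy x) i x\<bar> \<le> N"
    using straight_policy_cost[of K] by blast
  have "\<bar>policy_value i x\<bar> \<le> \<bar>M\<bar> + N" for x i
  proof -
    obtain z where z: "z \<in> int_lattice" "x + z \<in> unit_cube" by (rule int_lattice_translate_to_unit_cube)
    then have k: "norm (x + z - y) \<le> K" using K by blast
    have "- M \<le> policy_value i (x + z)" using M k by (intro policy_value_ge) auto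
    moreover have "policy_value i (x + z) \<le> N"
      using policy_value_le[OF reaches_straight_policy, of i "x + z"] N(2)[OF k, of i] by linarith
    ultimately show ?thesis using policy_value_periodic[OF z(1), of i x] N(1) by linarith
  qed
  then show ?thesis using N(1) by (intro exI[of _ "\<bar>M\<bar> + N"]) auto
qed

text \<open>Near-optimal continuations, one for each of the finitely many indices, are grafted onto
  a constant move; since row sums are 1, their errors average to \<epsilon>.\<close>

lemma policy_value_dynamic:
  assumes h: "0 < h"
  shows "policy_value i x \<le> E h q i x + (\<Sum>j\<in>UNIV. transition \<Lambda> h i j * policy_value j (x + h *\<^sub>R q))"
proof (rule field_le_epsilon)
  fix \<epsilon> :: real assume "0 < \<epsilon>"
  then have "\<forall>j. \<exists>p. reaches y p (x + h *\<^sub>R q) \<and> C p j (x + h *\<^sub>R q) \<le> policy_value j (x + h *\<^sub>R q) + \<epsilon>"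
    by (blast intro: policy_value_approx)
  then obtain f where f: "\<And>j. reaches y (f j) (x + h *\<^sub>R q)"
      "\<And>j. C (f j) j (x + h *\<^sub>R q) \<le> policy_value j (x + h *\<^sub>R q) + \<epsilon>" by metis
  have "policy_value i x \<le> C (Move h q f) i x" using f(1) h by (intro policy_value_le) simp
  also have "\<dots> \<le> E h q i x + (\<Sum>j\<in>UNIV. transition \<Lambda> h i j * (policy_value j (x + h *\<^sub>R q) + \<epsilon>))"
    using f(2) transition_nonneg[OF coupling, of h] h by (auto intro!: sum_mono mult_left_mono)
  also have "\<dots> = E h q i x + (\<Sum>j\<in>UNIV. transition \<Lambda> h i j * policy_value j (x + h *\<^sub>R q)) + \<epsilon>"
    using transition_sum[OF coupling, of h i] h by (simp add: distrib_left sum.distrib flip: sum_distrib_right)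
  finally show "policy_value i x \<le> E h q i x + (\<Sum>j\<in>UNIV. transition \<Lambda> h i j * policy_value j (x + h *\<^sub>R q)) + \<epsilon>" .
qed

text \<open>Moving from x to x' at unit speed takes a time equal to their distance; over such a time
  the running cost is small and the transition matrix is close to the identity. Exchanging the
  points gives the reverse estimate.\<close>

lemma policy_value_continuous: "continuous_on UNIV (policy_value i)"
proof -
  obtain B where B: "0 < B" "\<And>x i. \<bar>policy_value i x\<bar> \<le> B" using policy_value_bounded by blast
  obtain M where M: "0 < M" "\<And>h q i x. 0 \<le> h \<Longrightarrow> norm q \<le> 1 \<Longrightarrow> \<bar>E h q i x\<bar> \<le> M * h"
    using expected_leg_cost_bounded[OF H coupling, of 1 \<alpha>] by blast
  let ?N = "real CARD('m)"
  have "\<exists>d>0. \<forall>x x'. dist x x' < d \<longrightarrow> \<bar>policy_value i x - policy_value i x'\<bar> \<le> \<epsilon>" if \<epsilon>: "0 < \<epsilon>" for \<epsilon>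
  proof -
    \<comment> \<open>One half of \<epsilon> is reserved for the running cost, the other for the
      change of index: it is shared among N indices, each weighting a value of size at most
      B.\<close>
    have "0 < \<epsilon> / (2 * ?N * B)" using \<epsilon> B(1) by simp
    then obtain h0 where h0: "h0 > 0" "\<And>h k l. 0 \<le> h \<Longrightarrow> h \<le> h0 \<Longrightarrow> \<bar>transition \<Lambda> h k l - of_bool (k = l)\<bar> \<le> \<epsilon> / (2 * ?N * B)"
      using transition_near_identity[of "\<epsilon> / (2 * ?N * B)" \<Lambda>] by blast
    define d where "d = min h0 (\<epsilon> / (2 * M))"
    have d: "d > 0" using h0 \<epsilon> M by (simp add: d_def)
    have one: "policy_value i x \<le> policy_value i x' + \<epsilon>" if xx: "dist x x' < d" "x \<noteq> x'" for x x'
    proof -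
      define h where "h = dist x x'"
      define q where "q = (1 / h) *\<^sub>R (x' - x)"
      have h: "0 < h" "h \<le> h0" "h \<le> \<epsilon> / (2 * M)" using xx by (auto simp: h_def d_def)
      have q: "norm q = 1" "x + h *\<^sub>R q = x'" using h(1) by (auto simp: q_def h_def dist_norm norm_minus_commute)
      have "policy_value i x \<le> E h q i x + (\<Sum>j\<in>UNIV. transition \<Lambda> h i j * policy_value j x')"
        using policy_value_dynamic[OF h(1), of i x q] q(2) by simp
      also have "E h q i x \<le> \<epsilon> / 2"
        using M(2)[of h q i x] h(1) q(1) h(3) M(1) by (simp add: field_simps)
      also have "(\<Sum>j\<in>UNIV. transition \<Lambda> h i j * policy_value j x') =
         (\<Sum>j\<in>UNIV. (transition \<Lambda> h i j - of_bool (i = j)) * policy_value j x') + policy_value i x'"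
      proof -
        have "(\<Sum>j\<in>UNIV. of_bool (i = j) * policy_value j x') = (\<Sum>j\<in>UNIV. if i = j then policy_value j x' else 0)"
          by (intro sum.cong) auto
        then have "(\<Sum>j\<in>UNIV. of_bool (i = j) * policy_value j x') = policy_value i x'" by simp
        then show ?thesis by (simp add: left_diff_distrib sum_subtractf)
      qed
      also have "(\<Sum>j\<in>UNIV. (transition \<Lambda> h i j - of_bool (i = j)) * policy_value j x') \<le> (\<Sum>j\<in>(UNIV::'m set). \<epsilon> / (2 * ?N))"
      proof (rule sum_mono)
        fix j
        have "(transition \<Lambda> h i j - of_bool (i = j)) * policy_value j x' \<le> \<bar>transition \<Lambda> h i j - of_bool (i = j)\<bar> * \<bar>policy_value j x'\<bar>"
          by (metis abs_ge_self abs_mult)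
        also have "\<dots> \<le> \<epsilon> / (2 * ?N * B) * B" using h0(2)[of h i j] h B by (intro mult_mono) auto
        also have "\<dots> = \<epsilon> / (2 * ?N)" using B(1) by simp
        finally show "(transition \<Lambda> h i j - of_bool (i = j)) * policy_value j x' \<le> \<epsilon> / (2 * ?N)" .
      qed
      also have "(\<Sum>j\<in>(UNIV::'m set). \<epsilon> / (2 * ?N)) = \<epsilon> / 2" by simp
      finally show ?thesis by simp
    qed
    have "\<bar>policy_value i x - policy_value i x'\<bar> \<le> \<epsilon>" if "dist x x' < d" for x x'
      using one[of x x'] one[of x' x] that \<epsilon> by (cases "x = x'") (auto simp: dist_commute abs_le_iff)
    then show ?thesis using d by blast
  qed
  note * = this
  show ?thesis
    unfolding continuous_on_iff
  proof (intro ballI allI impI)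
    fix x :: "real^'n" and e :: real assume e: "0 < e"
    obtain d where d: "d > 0" "\<And>x x'. dist x x' < d \<Longrightarrow> \<bar>policy_value i x - policy_value i x'\<bar> \<le> e / 2" using *[of "e / 2"] e by auto
    have "dist (policy_value i x') (policy_value i x) < e" if "dist x' x < d" for x'
      using d(2)[OF that] e by (simp add: dist_real_def)
    then show "\<exists>d>0. \<forall>x'\<in>UNIV. dist x' x < d \<longrightarrow> dist (policy_value i x') (policy_value i x) < e" using d(1) by blast
  qed
qed

definition policy_values :: "real^'n \<Rightarrow> real^'m" where
  "policy_values x = (\<chi> i. policy_value i x)"

text \<open>The dynamic programming inequality is divided by h as h tends to 0: the leg cost tends
  to its rate, \<psi> contributes its directional derivative since it touches from above, and the
  transition probabilities contribute - \<Lambda>.\<close>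

lemma policy_value_velocity:
  assumes \<psi>: "GDERIV \<psi> x :> d" and touch: "\<And>z. policy_value i z - \<psi> z \<le> policy_value i x - \<psi> x"
  shows "0 \<le> lagrangian H i x (- q) + \<alpha> + q \<bullet> d - \<Lambda> $ i \<bullet> policy_values x"
proof -
  let ?v = "\<lambda>j h. policy_value j (x + h *\<^sub>R q)"
  let ?T = "\<lambda>h j. (transition \<Lambda> h i j - of_bool (i = j)) / h"
  have T: "((\<lambda>h. ?T h j) \<longlongrightarrow> - \<Lambda> $ i $ j) (at_right 0)" for j
  proof -
    have "(\<Sum>l\<in>UNIV. - \<Lambda> $ i $ l * transition \<Lambda> 0 l j) = (\<Sum>l\<in>UNIV. if l = j then - \<Lambda> $ i $ j else 0)"
      by (intro sum.cong) (auto simp: transition_0)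
    then have "((\<lambda>h. transition \<Lambda> h i j) has_real_derivative - \<Lambda> $ i $ j) (at 0)"
      using transition_deriv[of \<Lambda> i j 0] by simp
    then have "((\<lambda>h. (transition \<Lambda> h i j - transition \<Lambda> 0 i j) / (h - 0)) \<longlongrightarrow> - \<Lambda> $ i $ j) (at 0)"
      by (simp add: has_field_derivative_iff)
    then have "((\<lambda>h. ?T h j) \<longlongrightarrow> - \<Lambda> $ i $ j) (at 0)" by (simp add: transition_0 of_bool_def)
    then show ?thesis by (rule tendsto_mono[OF at_le[OF subset_UNIV]])
  qed
  have v: "(?v j \<longlongrightarrow> policy_value j x) (at_right 0)" for j
  proof -
    have "isCont (policy_value j) x" using policy_value_continuous by (simp add: continuous_on_eq_continuous_at)
    then have "isCont (policy_value j) (x + 0 *\<^sub>R q)" by simp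
    then have "(?v j \<longlongrightarrow> policy_value j (x + 0 *\<^sub>R q)) (at_right 0)"
      by (rule isCont_tendsto_compose) (intro tendsto_intros)
    then show ?thesis by simp
  qed
  have D: "((\<lambda>h. (\<psi> (x + h *\<^sub>R q) - \<psi> x) / h) \<longlongrightarrow> q \<bullet> d) (at_right 0)"
  proof -
    have "(\<psi> has_derivative (\<lambda>z. z \<bullet> d)) (at (x + 0 *\<^sub>R q))" using \<psi> by (simp add: gderiv_def)
    moreover have "((\<lambda>h. x + h *\<^sub>R q) has_derivative (\<lambda>h. h *\<^sub>R q)) (at 0)"
      by (auto intro!: derivative_eq_intros)
    ultimately have "((\<lambda>h. \<psi> (x + h *\<^sub>R q)) has_derivative (\<lambda>h. (h *\<^sub>R q) \<bullet> d)) (at 0)"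
      using has_derivative_compose[of "\<lambda>h. x + h *\<^sub>R q" "\<lambda>h. h *\<^sub>R q" 0 UNIV \<psi> "\<lambda>z. z \<bullet> d"] by simp
    then have "((\<lambda>h. \<psi> (x + h *\<^sub>R q)) has_real_derivative q \<bullet> d) (at 0)"
      by (simp add: has_field_derivative_def mult.commute[of _ "q \<bullet> d"])
    then have "((\<lambda>h. (\<psi> (x + h *\<^sub>R q) - \<psi> x) / h) \<longlongrightarrow> q \<bullet> d) (at 0)"
      by (simp add: has_field_derivative_iff)
    then show ?thesis by (rule tendsto_mono[OF at_le[OF subset_UNIV]])
  qed
  have "((\<lambda>h. E h q i x / h + (\<psi> (x + h *\<^sub>R q) - \<psi> x) / h + (\<Sum>j\<in>UNIV. ?T h j * ?v j h)) \<longlongrightarrow>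
     (lagrangian H i x (- q) + \<alpha>) + q \<bullet> d + (\<Sum>j\<in>UNIV. - \<Lambda> $ i $ j * policy_value j x)) (at_right 0)"
    by (intro tendsto_add tendsto_sum tendsto_mult T v D expected_leg_cost_rate[OF H coupling])
  moreover have "\<forall>\<^sub>F h in at_right 0. 0 \<le> E h q i x / h + (\<psi> (x + h *\<^sub>R q) - \<psi> x) / h + (\<Sum>j\<in>UNIV. ?T h j * ?v j h)"
    using eventually_at_right_less[of 0]
  proof eventually_elim
    fix h :: real assume h: "0 < h"
    have "(\<Sum>j\<in>UNIV. of_bool (i = j) * ?v j h) = (\<Sum>j\<in>UNIV. if i = j then ?v j h else 0)"
      by (intro sum.cong) auto
    then have "(\<Sum>j\<in>UNIV. of_bool (i = j) * ?v j h) = ?v i h" by simp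
    then have "(\<Sum>j\<in>UNIV. (transition \<Lambda> h i j - of_bool (i = j)) * ?v j h) = (\<Sum>j\<in>UNIV. transition \<Lambda> h i j * ?v j h) - ?v i h"
      by (simp add: left_diff_distrib sum_subtractf)
    moreover have "?v i h - policy_value i x \<le> \<psi> (x + h *\<^sub>R q) - \<psi> x" using touch[of "x + h *\<^sub>R q"] by simp
    ultimately have "0 \<le> E h q i x + (\<psi> (x + h *\<^sub>R q) - \<psi> x) + (\<Sum>j\<in>UNIV. (transition \<Lambda> h i j - of_bool (i = j)) * ?v j h)"
      using policy_value_dynamic[OF h, of i x q] by linarith
    then have "0 \<le> (E h q i x + (\<psi> (x + h *\<^sub>R q) - \<psi> x) + (\<Sum>j\<in>UNIV. (transition \<Lambda> h i j - of_bool (i = j)) * ?v j h)) / h"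
      using h by simp
    then show "0 \<le> E h q i x / h + (\<psi> (x + h *\<^sub>R q) - \<psi> x) / h + (\<Sum>j\<in>UNIV. ?T h j * ?v j h)"
      by (simp add: add_divide_distrib sum_divide_distrib)
  qed
  ultimately have "0 \<le> (lagrangian H i x (- q) + \<alpha>) + q \<bullet> d + (\<Sum>j\<in>UNIV. - \<Lambda> $ i $ j * policy_value j x)"
    by (rule tendsto_lowerbound) simp
  then show ?thesis by (simp add: policy_values_def inner_vec_def sum_negf)
qed

lemma policy_values_subsolution: "hj_subsolution H \<Lambda> \<alpha> policy_values"
  unfolding hj_subsolution_def
proof (intro conjI allI impI)
  show "torus_periodic policy_values"
    unfolding torus_periodic_def policy_values_def by (simp add: policy_value_periodic)
  show "continuous_on UNIV policy_values"
    unfolding policy_values_def by (intro continuous_intros policy_value_continuous)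
next
  fix x i \<psi> D\<psi>
  assume *: "torus_C1 \<psi> D\<psi> \<and> (\<forall>z. policy_values z $ i - \<psi> z \<le> policy_values x $ i - \<psi> x)"
  obtain q where q: "H i x (D\<psi> x) = D\<psi> x \<bullet> q - lagrangian H i x q" using fenchel_equality[OF H] by blast
  \<comment> \<open>The move has velocity - q because the cost evaluates the Lagrangian at minus the
    velocity; for the dual q, the inequality becomes the one for H.\<close>
  have "0 \<le> lagrangian H i x (- (- q)) + \<alpha> + (- q) \<bullet> D\<psi> x - \<Lambda> $ i \<bullet> policy_values x"
  proof (rule policy_value_velocity)
    show "GDERIV \<psi> x :> D\<psi> x" using * unfolding torus_C1_def by blast
    show "policy_value i z - \<psi> z \<le> policy_value i x - \<psi> x" for z using * unfolding policy_values_def by simp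
  qed
  then show "H i x (D\<psi> x) + \<Lambda> $ i \<bullet> policy_values x \<le> \<alpha>" using q by (simp add: inner_commute)
qed

lemma policy_values_admissible: "b \<in> admissible_values H \<Lambda> \<alpha> y"
  unfolding admissible_values_def
  using policy_values_subsolution by (auto simp: policy_values_def policy_value_at_target vec_eq_iff intro!: exI[of _ policy_values])

end

theorem theorem5p5:
  fixes H :: "'m::finite \<Rightarrow> real^'n \<Rightarrow> real^'n \<Rightarrow> real"
    and \<Lambda> :: "real^'m^'m"
    and \<alpha> :: real
    and y :: "real^'n"
    and b :: "real^'m"
  assumes "hamiltonians H"
    and "coupling_matrix \<Lambda>"
    and "critical_value H \<Lambda> \<le> \<alpha>"
  shows "b \<in> admissible_values H \<Lambda> \<alpha> y \<longleftrightarrow>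
    (\<forall>i \<tau> \<Xi>. bounded_stopping_time \<tau> \<and> tau_cycle \<Lambda> \<tau> \<Xi> \<longrightarrow>
      0 \<le> (LINT \<omega>|index_law \<Lambda> (axis i 1).
             (LINT s:{0..\<tau> \<omega>}|lborel.
                lagrangian H (\<omega> s) (y + displacement (\<Xi> \<omega>) s) (- \<Xi> \<omega> s) + \<alpha>)
             - b $ i + b $ \<omega> (\<tau> \<omega>)))"
  unfolding running_cost_def[symmetric]
proof (intro iffI allI impI)
  fix i \<tau> and \<Xi> :: "(real \<Rightarrow> 'm) \<Rightarrow> real \<Rightarrow> real^'n"
  assume "b \<in> admissible_values H \<Lambda> \<alpha> y" and cycle: "bounded_stopping_time \<tau> \<and> tau_cycle \<Lambda> \<tau> \<Xi>"
  then obtain u where u: "hj_subsolution H \<Lambda> \<alpha> u" "u y = b" unfolding admissible_values_def by blast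
  have "control \<Lambda> \<Xi>" using cycle unfolding tau_cycle_def by blast
  from subsolution_cycle_inequality[OF assms(1,2) u(1) this conjunct1[OF cycle] conjunct2[OF cycle], where y = y and i = i]
  show "0 \<le> (LINT \<omega>|index_law \<Lambda> (axis i 1). (LINT s:{0..\<tau> \<omega>}|lborel. running_cost H \<alpha> y (\<Xi> \<omega>) \<omega> s) - b $ i + b $ \<omega> (\<tau> \<omega>))"
    unfolding u(2) .
next
  assume cycles: "\<forall>i \<tau> \<Xi>. bounded_stopping_time \<tau> \<and> tau_cycle \<Lambda> \<tau> \<Xi> \<longrightarrow>
    0 \<le> (LINT \<omega>|index_law \<Lambda> (axis i 1). (LINT s:{0..\<tau> \<omega>}|lborel. running_cost H \<alpha> y (\<Xi> \<omega>) \<omega> s) - b $ i + b $ \<omega> (\<tau> \<omega>))"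
  show "b \<in> admissible_values H \<Lambda> \<alpha> y"
  proof (rule policy_values_admissible[OF assms(1,2)], intro allI impI)
    fix p :: "(real^'n, 'm) policy" and i assume p: "reaches y p y"
    have "0 \<le> policy_cost H \<Lambda> \<alpha> b p i y - b $ i"
      unfolding policy_cost_eq_expectation[OF assms(1,2) p, symmetric]
      using cycles policy_bounded_stopping_time[OF p] policy_tau_cycle[OF assms(1,2) p] by blast
    then show "b $ i \<le> policy_cost H \<Lambda> \<alpha> b p i y" by simp
  qed
qed

end
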